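(* Let $r\ge5$ and let $\alpha\in\mathcal I^r$ be an immersion such that $\mathfrak p\in M$ is an axiumbilic point of type $E^1_{34}$. Then there are a neighborhood $V$ of $\mathfrak p$ in $M$, a neighborhood $\mathcal V$ of $\alpha$ in $\mathcal I^r$ and a function $\mathcal F:\mathcal V\to\mathbb R$ of class $C^{r-3}$ such that for each $\mu\in\mathcal V$ there is a unique axiumbilic point $\mathfrak p_\mu\in V$ of $\mu$, and: (i) $d\mathcal F_\alpha\neq0$; (ii) $\mathcal F(\mu)<0$ if and only if $\mathfrak p_\mu$ is an axiumbilic point of type $E_3$; (iii) $\mathcal F(\mu)>0$ if and only if $\mathfrak p_\mu$ is an axiumbilic point of type $E_4$; (iv) $\mathcal F(\mu)=0$ if and only if $\mathfrak p_\mu$ is an axiumbilic point of type $E^1_{34}$.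
   Context: $M$ is a compact smooth oriented surface and $\mathcal I^r=\mathcal I^r(M,\mathbb R^4)$ is the space of immersions $M\to\mathbb R^4$ of class $C^r$ with the $C^r$ topology (an open subset of the Banach space of $C^r$ maps). For $\alpha\in\mathcal I^r$, let $I_\alpha=E\,dx^2+2F\,dx\,dy+G\,dy^2$ be the first fundamental form in a positive chart and $II_\alpha=\sum_{i=1,2}(e_i\,dx^2+2f_i\,dx\,dy+g_i\,dy^2)N_i$ the second fundamental form, $\{N_1,N_2\}$ being an orthonormal normal frame such that $\{\alpha_x,\alpha_y,N_1,N_2\}$ is positive. The ellipse of curvature at a point is the image of the unit circle of the tangent plane under $k_n(v)=II_\alpha(v)/I_\alpha(v)$. A point is axiumbilic if this ellipse has equal axes (is a circle). Outside axiumbilic points, the axial directions are the tangent directions mapped to the vertices of the ellipse; they are the solutions of the quartic equation $$[a_0 G(EG-4F^2)+a_1F(2F^2-EG)]dy^4+[-8a_0EFG+a_1E(4F^2-EG)]dy^3dx+[-6a_0GE^2+3a_1FE^2]dy^2dx^2+a_1E^3dy\,dx^3+a_0E^3dx^4=0,$$ where $a_1=4G(EG-4F^2)(e_1^2+e_2^2)+32EFG(e_1f_1+e_2f_2)+4E^3(g_1^2+g_2^2)-8E^2G(e_1g_1+e_2g_2)-16E^2G(f_1^2+f_2^2)$ and $a_0=4F(EG-2F^2)(e_1^2+e_2^2)-4E(EG-4F^2)(e_1f_1+e_2f_2)+4E^3(f_1g_1+f_2g_2)-4E^2F(e_1g_1+e_2g_2)-8E^2F(f_1^2+f_2^2)$;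 axiumbilic points are given by $a_0=a_1=0$. Normal form at an axiumbilic point $\mathfrak p$: a Monge chart (after a rigid motion of $\mathbb R^4$, the immersion is locally $(x,y)\mapsto(x,y,R(x,y),S(x,y))$ with $\mathfrak p$ at the origin and $R,S$ having zero value and zero first derivatives there) and a homothety of $\mathbb R^4$ are chosen so that, up to a nonzero constant factor, the equation of axial lines is $$y(dy^4-6dx^2dy^2+dx^4)+(ax+by)\,dx\,dy\,(dx^2-dy^2)+H(x,y,dx,dy)=0,$$ with $H$ containing only terms of order $\ge 2$ in $(x,y)$. Let $\Delta(a,b)=16a^5+4(b^2+68)a^4+16(b^2+144)a^3-8(b^2-80)(16+b^2)a^2+96(16+b^2)^2a+4(16+b^2)^3$. Definitions (types of an axiumbilic point admitting such a normal form): type $E_3$ if $\Delta(a,b)<0$; type $E_4$ if $\Delta(a,b)>0$, $a<0$, $a\ne-1$; type $E^1_{34}$ if $a\neq0$ and either (i) $\Delta(a,b)=0$, $(a,b)\ne(-1,0)$ and $(a,b)\neq(-\frac{27}2,\pm\frac52\sqrt5)$, or (ii) $a=-1$ and $b\ne0$. *)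

theory Defs
  imports "HOL-Analysis.Analysis" "HOL-Library.Landau_Symbols"
begin

text \<open>Only used for an open set \<open>S\<close>, where \<open>frechet_derivative f (at x)\<close> is determined
  by \<open>f\<close> on \<open>S\<close>.\<close>

fun Ck_on :: "nat \<Rightarrow> ('a::euclidean_space \<Rightarrow> 'b::real_normed_vector) \<Rightarrow> 'a set \<Rightarrow> bool" where
  "Ck_on 0 f S \<longleftrightarrow> continuous_on S f"
| "Ck_on (Suc k) f S \<longleftrightarrow>
     (\<forall>x\<in>S. f differentiable (at x)) \<and> (\<forall>v. Ck_on k (\<lambda>x. frechet_derivative f (at x) v) S)"

fun iter_deriv :: "'a::euclidean_space list \<Rightarrow> ('a \<Rightarrow> 'b::real_normed_vector) \<Rightarrow> 'a \<Rightarrow> 'b" where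
  "iter_deriv [] f = f"
| "iter_deriv (v # vs) f = (\<lambda>x. frechet_derivative (iter_deriv vs f) (at x) v)"

text \<open>The surface is the whole type \<open>'m\<close>. A chart is an open domain together with a coordinate map,
  whose values outside the domain are irrelevant.\<close>

type_synonym 'm chart = "'m set \<times> ('m \<Rightarrow> real^2)"

abbreviation dom_of :: "'m chart \<Rightarrow> 'm set" where
  "dom_of c \<equiv> fst c"

abbreviation img_of :: "'m chart \<Rightarrow> (real^2) set" where
  "img_of c \<equiv> snd c ` fst c"

definition param :: "'m chart \<Rightarrow> real^2 \<Rightarrow> 'm" where
  "param c = inv_into (fst c) (snd c)"

definition is_chart :: "'m::topological_space chart \<Rightarrow> bool" where
  "is_chart c \<longleftrightarrow> open (dom_of c) \<and> open (img_of c) \<and>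
     homeomorphism (dom_of c) (img_of c) (snd c) (param c)"

definition pos_compatible :: "nat \<Rightarrow> 'm chart \<Rightarrow> 'm chart \<Rightarrow> bool" where
  "pos_compatible k c c' \<longleftrightarrow>
     Ck_on k (snd c' \<circ> param c) (snd c ` (dom_of c \<inter> dom_of c')) \<and>
     Ck_on k (snd c \<circ> param c') (snd c' ` (dom_of c \<inter> dom_of c')) \<and>
     (\<forall>u \<in> snd c ` (dom_of c \<inter> dom_of c').
        det (matrix (frechet_derivative (snd c' \<circ> param c) (at u))) > 0)"

definition compact_oriented_surface :: "'m::t2_space chart set \<Rightarrow> bool" where
  "compact_oriented_surface A \<longleftrightarrow>
     compact (UNIV :: 'm set) \<and> (\<forall>c\<in>A. is_chart c) \<and> (\<Union>c\<in>A. dom_of c) = UNIV \<and>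
     (\<forall>c\<in>A. \<forall>c'\<in>A. \<forall>k. pos_compatible k c c')"

definition positive_chart :: "'m::t2_space chart set \<Rightarrow> nat \<Rightarrow> 'm chart \<Rightarrow> bool" where
  "positive_chart A r c \<longleftrightarrow> is_chart c \<and> (\<forall>c'\<in>A. pos_compatible r c c')"

definition Cr_maps :: "'m chart set \<Rightarrow> nat \<Rightarrow> ('m \<Rightarrow> real^4) set" where
  "Cr_maps A r = {f. \<forall>c\<in>A. Ck_on r (f \<circ> param c) (img_of c)}"

definition immersions :: "'m chart set \<Rightarrow> nat \<Rightarrow> ('m \<Rightarrow> real^4) set" where
  "immersions A r = {f \<in> Cr_maps A r.
     \<forall>c\<in>A. \<forall>u\<in>img_of c. inj (frechet_derivative (f \<circ> param c) (at u))}"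

text \<open>The $C^r$ norm is computed in a finite family of charts, each over a compact subset of its
  domain. Any two such families give equivalent norms.\<close>

definition norming_cover :: "'m::t2_space chart set \<Rightarrow> ('m chart \<times> 'm set) set \<Rightarrow> bool" where
  "norming_cover A \<K> \<longleftrightarrow>
     finite \<K> \<and> (\<forall>(c, K)\<in>\<K>. c \<in> A \<and> compact K \<and> K \<subseteq> dom_of c) \<and> (\<Union>(c, K)\<in>\<K>. K) = UNIV"

definition Cr_norm :: "('m chart \<times> 'm set) set \<Rightarrow> nat \<Rightarrow> ('m \<Rightarrow> real^4) \<Rightarrow> real" where
  "Cr_norm \<K> r f = Sup {norm (iter_deriv vs (f \<circ> param c) (snd c q)) | c K q vs.
     (c, K) \<in> \<K> \<and> q \<in> K \<and> set vs \<subseteq> Basis \<and> length vs \<le> r}"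

text \<open>The following notions refer to a linear space \<open>X\<close> of maps into $\mathbf R^4$ with norm \<open>nrm\<close>
  (a set of functions, as the space depends on the atlas and on \<open>r\<close>).\<close>

definition open_rel :: "('m \<Rightarrow> real^4) set \<Rightarrow> (('m \<Rightarrow> real^4) \<Rightarrow> real) \<Rightarrow> ('m \<Rightarrow> real^4) set \<Rightarrow> bool" where
  "open_rel X nrm W \<longleftrightarrow> W \<subseteq> X \<and>
     (\<forall>\<mu>\<in>W. \<exists>\<epsilon>>0. \<forall>\<nu>\<in>X. nrm (\<lambda>q. \<nu> q - \<mu> q) < \<epsilon> \<longrightarrow> \<nu> \<in> W)"

definition bdd_multilinear ::
  "('m \<Rightarrow> real^4) set \<Rightarrow> (('m \<Rightarrow> real^4) \<Rightarrow> real) \<Rightarrow> nat \<Rightarrow> (('m \<Rightarrow> real^4) list \<Rightarrow> real) \<Rightarrow> bool" where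
  "bdd_multilinear X nrm j T \<longleftrightarrow>
     (\<forall>vs i s t v w. length vs = j \<and> set vs \<subseteq> X \<and> i < j \<and> v \<in> X \<and> w \<in> X \<longrightarrow>
        T (vs[i := \<lambda>q. s *\<^sub>R v q + t *\<^sub>R w q]) = s * T (vs[i := v]) + t * T (vs[i := w])) \<and>
     (\<exists>B. \<forall>vs. length vs = j \<and> set vs \<subseteq> X \<longrightarrow> \<bar>T vs\<bar> \<le> B * prod_list (map nrm vs))"

text \<open>\<open>D j \<mu>\<close> is the \<open>j\<close>-th Frechet derivative of \<open>F\<close> at \<open>\<mu>\<close> as a \<open>j\<close>-linear form;
  differentiability and continuity are with respect to the operator norm of multilinear forms.\<close>

definition Ck_functional ::
  "('m \<Rightarrow> real^4) set \<Rightarrow> (('m \<Rightarrow> real^4) \<Rightarrow> real) \<Rightarrow> nat \<Rightarrow> (('m \<Rightarrow> real^4) \<Rightarrow> real) \<Rightarrow>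
   ('m \<Rightarrow> real^4) set \<Rightarrow> bool" where
  "Ck_functional X nrm k F W \<longleftrightarrow>
     (\<exists>D :: nat \<Rightarrow> ('m \<Rightarrow> real^4) \<Rightarrow> ('m \<Rightarrow> real^4) list \<Rightarrow> real.
        (\<forall>\<mu>\<in>W. D 0 \<mu> [] = F \<mu>) \<and>
        (\<forall>j\<le>k. \<forall>\<mu>\<in>W. bdd_multilinear X nrm j (D j \<mu>)) \<and>
        (\<forall>j<k. \<forall>\<mu>\<in>W. \<forall>\<epsilon>>0. \<exists>\<delta>>0. \<forall>\<nu>\<in>W. nrm (\<lambda>q. \<nu> q - \<mu> q) < \<delta> \<longrightarrow>
           (\<forall>vs. length vs = j \<and> set vs \<subseteq> X \<longrightarrow>
              \<bar>D j \<nu> vs - D j \<mu> vs - D (Suc j) \<mu> ((\<lambda>q. \<nu> q - \<mu> q) # vs)\<bar>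
                \<le> \<epsilon> * nrm (\<lambda>q. \<nu> q - \<mu> q) * prod_list (map nrm vs))) \<and>
        (\<forall>\<mu>\<in>W. \<forall>\<epsilon>>0. \<exists>\<delta>>0. \<forall>\<nu>\<in>W. nrm (\<lambda>q. \<nu> q - \<mu> q) < \<delta> \<longrightarrow>
           (\<forall>vs. length vs = k \<and> set vs \<subseteq> X \<longrightarrow>
              \<bar>D k \<nu> vs - D k \<mu> vs\<bar> \<le> \<epsilon> * prod_list (map nrm vs))))"

definition functional_has_derivative ::
  "('m \<Rightarrow> real^4) set \<Rightarrow> (('m \<Rightarrow> real^4) \<Rightarrow> real) \<Rightarrow> ('m \<Rightarrow> real^4) set \<Rightarrow>
   (('m \<Rightarrow> real^4) \<Rightarrow> real) \<Rightarrow> (('m \<Rightarrow> real^4) \<Rightarrow> real) \<Rightarrow> ('m \<Rightarrow> real^4) \<Rightarrow> bool" where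
  "functional_has_derivative X nrm W F L \<mu> \<longleftrightarrow>
     (\<forall>s t. \<forall>v\<in>X. \<forall>w\<in>X. L (\<lambda>q. s *\<^sub>R v q + t *\<^sub>R w q) = s * L v + t * L w) \<and>
     (\<exists>B. \<forall>v\<in>X. \<bar>L v\<bar> \<le> B * nrm v) \<and>
     (\<forall>\<epsilon>>0. \<exists>\<delta>>0. \<forall>\<nu>\<in>W. nrm (\<lambda>q. \<nu> q - \<mu> q) < \<delta> \<longrightarrow>
        \<bar>F \<nu> - F \<mu> - L (\<lambda>q. \<nu> q - \<mu> q)\<bar> \<le> \<epsilon> * nrm (\<lambda>q. \<nu> q - \<mu> q))"

text \<open>Here \<open>X\<close> is a local parametrization of an immersed surface.\<close>

definition pdx :: "(real^2 \<Rightarrow> real^4) \<Rightarrow> real^2 \<Rightarrow> real^4" where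
  "pdx X u = frechet_derivative X (at u) (axis 1 1)"

definition pdy :: "(real^2 \<Rightarrow> real^4) \<Rightarrow> real^2 \<Rightarrow> real^4" where
  "pdy X u = frechet_derivative X (at u) (axis 2 1)"

definition fffE :: "(real^2 \<Rightarrow> real^4) \<Rightarrow> real^2 \<Rightarrow> real" where "fffE X u = pdx X u \<bullet> pdx X u"
definition fffF :: "(real^2 \<Rightarrow> real^4) \<Rightarrow> real^2 \<Rightarrow> real" where "fffF X u = pdx X u \<bullet> pdy X u"
definition fffG :: "(real^2 \<Rightarrow> real^4) \<Rightarrow> real^2 \<Rightarrow> real" where "fffG X u = pdy X u \<bullet> pdy X u"

definition sffe :: "(real^2 \<Rightarrow> real^4) \<Rightarrow> real^4 \<Rightarrow> real^2 \<Rightarrow> real" where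
  "sffe X N u = pdx (pdx X) u \<bullet> N"
definition sfff :: "(real^2 \<Rightarrow> real^4) \<Rightarrow> real^4 \<Rightarrow> real^2 \<Rightarrow> real" where
  "sfff X N u = pdx (pdy X) u \<bullet> N"
definition sffg :: "(real^2 \<Rightarrow> real^4) \<Rightarrow> real^4 \<Rightarrow> real^2 \<Rightarrow> real" where
  "sffg X N u = pdy (pdy X) u \<bullet> N"

definition positive_normal_frame ::
  "(real^2 \<Rightarrow> real^4) \<Rightarrow> real^2 \<Rightarrow> real^4 \<Rightarrow> real^4 \<Rightarrow> bool" where
  "positive_normal_frame X u N1 N2 \<longleftrightarrow>
     norm N1 = 1 \<and> norm N2 = 1 \<and> N1 \<bullet> N2 = 0 \<and>
     pdx X u \<bullet> N1 = 0 \<and> pdy X u \<bullet> N1 = 0 \<and> pdx X u \<bullet> N2 = 0 \<and> pdy X u \<bullet> N2 = 0 \<and>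
     det (vector [pdx X u, pdy X u, N1, N2] :: real^4^4) > 0"

definition first_form :: "(real^2 \<Rightarrow> real^4) \<Rightarrow> real^2 \<Rightarrow> real^2 \<Rightarrow> real" where
  "first_form X u v = fffE X u * (v$1)^2 + 2 * fffF X u * (v$1) * (v$2) + fffG X u * (v$2)^2"

definition second_form ::
  "(real^2 \<Rightarrow> real^4) \<Rightarrow> real^4 \<Rightarrow> real^4 \<Rightarrow> real^2 \<Rightarrow> real^2 \<Rightarrow> real^4" where
  "second_form X N1 N2 u v =
     (\<Sum>N\<leftarrow>[N1, N2]. (sffe X N u * (v$1)^2 + 2 * sfff X N u * (v$1) * (v$2) + sffg X N u * (v$2)^2) *\<^sub>R N)"

definition normal_curvature ::
  "(real^2 \<Rightarrow> real^4) \<Rightarrow> real^4 \<Rightarrow> real^4 \<Rightarrow> real^2 \<Rightarrow> real^2 \<Rightarrow> real^4" where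
  "normal_curvature X N1 N2 u v = second_form X N1 N2 u v /\<^sub>R first_form X u v"

definition curvature_ellipse ::
  "(real^2 \<Rightarrow> real^4) \<Rightarrow> real^4 \<Rightarrow> real^4 \<Rightarrow> real^2 \<Rightarrow> (real^4) set" where
  "curvature_ellipse X N1 N2 u = normal_curvature X N1 N2 u ` {v. first_form X u v = 1}"

text \<open>A circle of radius \<open>0\<close> (a point) is allowed, in accordance with $a_0 = a_1 = 0$.\<close>

definition axiumbilic :: "'m chart set \<Rightarrow> ('m \<Rightarrow> real^4) \<Rightarrow> 'm \<Rightarrow> bool" where
  "axiumbilic A \<alpha> p \<longleftrightarrow>
     (\<exists>c\<in>A. \<exists>N1 N2. p \<in> dom_of c \<and>
        positive_normal_frame (\<alpha> \<circ> param c) (snd c p) N1 N2 \<and>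
        (\<exists>h\<in>span {N1, N2}. \<exists>\<rho>\<ge>0.
           curvature_ellipse (\<alpha> \<circ> param c) N1 N2 (snd c p) = sphere h \<rho> \<inter> span {N1, N2}))"

definition axial_a1 :: "(real^2 \<Rightarrow> real^4) \<Rightarrow> real^4 \<Rightarrow> real^4 \<Rightarrow> real^2 \<Rightarrow> real" where
  "axial_a1 X N1 N2 u =
    (let E = fffE X u; F = fffF X u; G = fffG X u;
         e1 = sffe X N1 u; f1 = sfff X N1 u; g1 = sffg X N1 u;
         e2 = sffe X N2 u; f2 = sfff X N2 u; g2 = sffg X N2 u
     in 4 * G * (E*G - 4*F^2) * (e1^2 + e2^2) + 32 * E * F * G * (e1*f1 + e2*f2)
        + 4 * E^3 * (g1^2 + g2^2) - 8 * E^2 * G * (e1*g1 + e2*g2) - 16 * E^2 * G * (f1^2 + f2^2))"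

definition axial_a0 :: "(real^2 \<Rightarrow> real^4) \<Rightarrow> real^4 \<Rightarrow> real^4 \<Rightarrow> real^2 \<Rightarrow> real" where
  "axial_a0 X N1 N2 u =
    (let E = fffE X u; F = fffF X u; G = fffG X u;
         e1 = sffe X N1 u; f1 = sfff X N1 u; g1 = sffg X N1 u;
         e2 = sffe X N2 u; f2 = sfff X N2 u; g2 = sffg X N2 u
     in 4 * F * (E*G - 2*F^2) * (e1^2 + e2^2) - 4 * E * (E*G - 4*F^2) * (e1*f1 + e2*f2)
        + 4 * E^3 * (f1*g1 + f2*g2) - 4 * E^2 * F * (e1*g1 + e2*g2) - 8 * E^2 * F * (f1^2 + f2^2))"

definition axial_quartic ::
  "(real^2 \<Rightarrow> real^4) \<Rightarrow> real^4 \<Rightarrow> real^4 \<Rightarrow> real^2 \<Rightarrow> real \<Rightarrow> real \<Rightarrow> real" where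
  "axial_quartic X N1 N2 u dx dy =
    (let E = fffE X u; F = fffF X u; G = fffG X u;
         a0 = axial_a0 X N1 N2 u; a1 = axial_a1 X N1 N2 u
     in (a0 * G * (E*G - 4*F^2) + a1 * F * (2*F^2 - E*G)) * dy^4
        + (- 8 * a0 * E * F * G + a1 * E * (4*F^2 - E*G)) * dy^3 * dx
        + (- 6 * a0 * G * E^2 + 3 * a1 * F * E^2) * dy^2 * dx^2
        + a1 * E^3 * dy * dx^3 + a0 * E^3 * dx^4)"

text \<open>The Monge chart is the one for which the image of \<open>\<alpha>\<close> under the rigid motion
  \<open>z \<mapsto> Q *v z + t\<close> followed by the homothety of ratio \<open>\<sigma>\<close> is a graph over the tangent plane.
  It is of class $C^r$ only, as \<open>\<alpha>\<close> is. The remainder \<open>H\<close> is the quartic form in \<open>dx, dy\<close>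
  with coefficients \<open>h i\<close>; the filter \<open>nhds 0\<close> (rather than \<open>at 0\<close>) also
  forces \<open>h i 0 = 0\<close>.\<close>

definition axial_normal_form ::
  "'m::t2_space chart set \<Rightarrow> nat \<Rightarrow> ('m \<Rightarrow> real^4) \<Rightarrow> 'm \<Rightarrow> real \<Rightarrow> real \<Rightarrow> bool" where
  "axial_normal_form A r \<alpha> p a b \<longleftrightarrow>
    (\<exists>c (Q :: real^4^4) (t :: real^4) (\<sigma> :: real) (X :: real^2 \<Rightarrow> real^4) R S N1 N2 \<kappa>
       (h :: nat \<Rightarrow> real^2 \<Rightarrow> real).
      positive_chart A r c \<and> p \<in> dom_of c \<and> snd c p = 0 \<and>
      rotation_matrix Q \<and> \<sigma> > 0 \<and>
      X = (\<lambda>u. \<sigma> *\<^sub>R (Q *v \<alpha> (param c u) + t)) \<and>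
      (\<forall>u\<in>img_of c. X u = vector [u$1, u$2, R u, S u]) \<and>
      R 0 = 0 \<and> S 0 = 0 \<and>
      (R has_derivative (\<lambda>_. 0)) (at 0) \<and> (S has_derivative (\<lambda>_. 0)) (at 0) \<and>
      (\<forall>u\<in>img_of c. positive_normal_frame X u (N1 u) (N2 u)) \<and>
      \<kappa> \<noteq> 0 \<and>
      (\<forall>i\<le>4. h i \<in> O[nhds 0](\<lambda>u. (norm u)^2)) \<and>
      (\<forall>u\<in>img_of c. \<forall>dx dy.
         axial_quartic X (N1 u) (N2 u) u dx dy =
           \<kappa> * (u$2 * (dy^4 - 6 * dx^2 * dy^2 + dx^4)
                + (a * u$1 + b * u$2) * dx * dy * (dx^2 - dy^2)
                + (\<Sum>i\<le>4. h i u * dx^i * dy^(4 - i)))))"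

definition Delta :: "real \<Rightarrow> real \<Rightarrow> real" where
  "Delta a b = 16 * a^5 + 4 * (b^2 + 68) * a^4 + 16 * (b^2 + 144) * a^3
     - 8 * (b^2 - 80) * (16 + b^2) * a^2 + 96 * (16 + b^2)^2 * a + 4 * (16 + b^2)^3"

definition type_E3 :: "'m::t2_space chart set \<Rightarrow> nat \<Rightarrow> ('m \<Rightarrow> real^4) \<Rightarrow> 'm \<Rightarrow> bool" where
  "type_E3 A r \<alpha> p \<longleftrightarrow> axiumbilic A \<alpha> p \<and>
     (\<exists>a b. axial_normal_form A r \<alpha> p a b \<and> Delta a b < 0)"

definition type_E4 :: "'m::t2_space chart set \<Rightarrow> nat \<Rightarrow> ('m \<Rightarrow> real^4) \<Rightarrow> 'm \<Rightarrow> bool" where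
  "type_E4 A r \<alpha> p \<longleftrightarrow> axiumbilic A \<alpha> p \<and>
     (\<exists>a b. axial_normal_form A r \<alpha> p a b \<and> Delta a b > 0 \<and> a < 0 \<and> a \<noteq> -1)"

definition type_E34 :: "'m::t2_space chart set \<Rightarrow> nat \<Rightarrow> ('m \<Rightarrow> real^4) \<Rightarrow> 'm \<Rightarrow> bool" where
  "type_E34 A r \<alpha> p \<longleftrightarrow> axiumbilic A \<alpha> p \<and>
     (\<exists>a b. axial_normal_form A r \<alpha> p a b \<and> a \<noteq> 0 \<and>
        ((Delta a b = 0 \<and> (a, b) \<noteq> (-1, 0) \<and>
          (a, b) \<noteq> (- 27/2, 5/2 * sqrt 5) \<and> (a, b) \<noteq> (- 27/2, - (5/2 * sqrt 5))) \<or>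
         (a = -1 \<and> b \<noteq> 0)))"

end

theory Submission
  imports Defs
begin

text \<open>The coefficients of the quartic equation form a complex function \<open>axc\<close> whose zeros are the axiumbilic
  points. At a zero its derivative, read in a conformal parameter of the tangent plane, is \<open>z \<mapsto> \<alpha> z + \<beta> cnj z\<close>,
  and a change of coordinates multiplies \<open>\<alpha>\<close> and \<open>\<beta>\<close> by \<open>l^5\<close> and \<open>l^4 * cnj l\<close>. So the sign of the discriminant
  \<open>disc5 \<alpha> \<beta>\<close> of the separatrix polynomial does not depend on the chart; in the normal form it is a positive
  multiple of \<open>(a + 1)^2 * Delta a b\<close>. At a point of type E34 the conditions \<open>|\<alpha>| < |\<beta>|\<close> and \<open>9 |\<beta>|^2 < 25 |\<alpha>|^2\<close> hold;
  they are open and exclude the triple roots, so that near such a point the sign of \<open>disc5\<close> decides the type.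
  The first condition makes the zero simple: the implicit function theorem gives the axiumbilic point of a nearby
  immersion, and \<open>F\<close> is \<open>disc5\<close> there, an expression in the 3-jet, which accounts for the class \<open>r - 3\<close>. A cubic
  perturbation in the normal direction shows that its derivative does not vanish.\<close>

text \<open>In the normal form the separatrix directions of slope p solve p * (p^4 - b p^3 - (a + 6)
  p^2 + b p + a + 1) = 0. \<open>Delta\<close> is the discriminant of the quartic factor, and the
  square of that factor's value at p = 0 supplies (a + 1)^2. So a = -1 means that the separatrix p =
  0, singled out by the choice of axes, becomes multiple; this is why E34 has a second alternative,
  while \<open>disc5\<close> treats all separatrices alike. The analytic obstacle is that evaluation
  (mu, u) |-> D^s mu(u) is only of class C^(r - |s|): a derivative in u costs one order, and at
  order r the jets of a bounded set of directions are not equicontinuous. Moreover the point of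
  evaluation moves with mu. Both difficulties are met by one class of expressions,
  \<open>jp\<close>, which records the order of the jets and is closed under differentiation. The
  derivative of the moving point is again such an expression, evaluated at that point, so the higher
  derivatives follow by iterating a single chain rule.\<close>

abbreviation "fder \<equiv> frechet_derivative"

section \<open>Calculus of maps of class $C^k$\<close>

lemma Ck_on_cong:
 assumes "open S" "\<And>x. x \<in> S ==> f x = g x" "Ck_on k f S"
 shows "Ck_on k g S"
 using assms
proof (induction k arbitrary: f g)
 case 0
 then show ?case using continuous_on_cong by fastforce
next
 case (Suc k)
 have df: "f differentiable (at x)" if "x \<in> S" for x
  using Suc.prems(3) that by simp
 have dg: "g differentiable (at x)" if "x \<in> S" for x
  using df[OF that] Suc.prems(1,2) that
  by (metis differentiable_def has_derivative_transform_within_open)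
 have eq: "fder f (at x) = fder g (at x)" if "x \<in> S" for x
  using frechet_derivative_transform_within_open[OF df[OF that] Suc.prems(1) that] Suc.prems(2) by blast
 have "Ck_on k (%x. fder g (at x) v) S" for v
  by (rule Suc.IH[OF Suc.prems(1), of "%x. fder f (at x) v"])
   (use eq Suc.prems(3) in auto)
 then show ?case using dg by simp
qed

lemma Ck_on_subset: "Ck_on k f S ==> T \<subseteq> S ==> Ck_on k f T"
 by (induction k arbitrary: f) (auto intro: continuous_on_subset)

lemma Ck_on_Suc_imp: "Ck_on (Suc k) f S ==> Ck_on k f S"
proof (induction k arbitrary: f)
 case 0
 then show ?case
  by (simp add: continuous_at_imp_continuous_on differentiable_imp_continuous_within)
next
 case (Suc k)
 show ?case using Suc.prems Suc.IH by (metis Ck_on.simps(2))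
qed

lemma Ck_on_mono:
 assumes "Ck_on k f S" "j \<le> k"
 shows "Ck_on j f S"
 using assms(2,1)
proof (induction rule: inc_induct)
 case (step n)
 show ?case by (rule Ck_on_Suc_imp[OF step.IH[OF step.prems]])
qed

lemma Ck_on_imp_continuous_on: "Ck_on k f S ==> continuous_on S f"
 using Ck_on_mono[of k f S 0] by simp

lemma Ck_on_imp_differentiable: "Ck_on k f S ==> k > 0 ==> x \<in> S ==> f differentiable (at x)"
 by (cases k) auto

lemma Ck_on_imp_has_derivative:
 "Ck_on k f S ==> k > 0 ==> x \<in> S ==> (f has_derivative fder f (at x)) (at x)"
 using Ck_on_imp_differentiable frechet_derivative_works by blast

lemma Ck_on_frechet_derivative:
 "Ck_on (Suc k) f S ==> Ck_on k (%x. fder f (at x) v) S"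
 by simp

declare Ck_on.simps(2) [simp del]

lemma Ck_on_SucI:
 assumes "open S" "\<And>x. x \<in> S ==> (f has_derivative f' x) (at x)" "\<And>v. Ck_on k (%x. f' x v) S"
 shows "Ck_on (Suc k) f S"
proof -
 have "f' x = fder f (at x)" if "x \<in> S" for x
  using assms(2)[OF that] by (rule frechet_derivative_at)
 then have "Ck_on k (%x. fder f (at x) v) S" for v
  by (intro Ck_on_cong[OF assms(1) _ assms(3)[of v]]) simp
 moreover have "f differentiable (at x)" if "x \<in> S" for x
  using assms(2)[OF that] by (rule differentiableI)
 ultimately show ?thesis unfolding Ck_on.simps by blast
qed

lemma Ck_on_const [simp, intro]: "Ck_on k (%x. c) S"
 by (induction k arbitrary: c) (simp_all add: Ck_on.simps(2))

lemma Ck_on_bounded_linear_compose: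
 assumes "bounded_linear L" "open S" "Ck_on k f S"
 shows "Ck_on k (%x. L (f x)) S"
 using assms(3)
proof (induction k arbitrary: f)
 case 0
 then show ?case using bounded_linear.continuous_on[OF assms(1)] by simp
next
 case (Suc k)
 show ?case
 proof (rule Ck_on_SucI[OF assms(2)])
  fix x assume "x \<in> S"
  then show "((%x. L (f x)) has_derivative (%v. L (fder f (at x) v))) (at x)"
   by (intro bounded_linear.has_derivative[OF assms(1)] Ck_on_imp_has_derivative[OF Suc.prems]) simp_all
 next
  show "Ck_on k (%x. L (fder f (at x) v)) S" for v
   by (intro Suc.IH Ck_on_frechet_derivative Suc.prems)
 qed
qed

lemma Ck_on_bounded_linear: "bounded_linear L ==> open S ==> Ck_on k L S"
proof (induction k)
 case 0
 then show ?case by (simp add: linear_continuous_on)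
next
 case (Suc k)
 show ?case
  by (rule Ck_on_SucI[where f' = "%_. L"]) (use Suc in \<open>auto simp: bounded_linear_imp_has_derivative\<close>)
qed

lemma Ck_on_ident: "open S ==> Ck_on k (%x. x) S"
 by (rule Ck_on_bounded_linear[OF bounded_linear_ident])

lemma Ck_on_add:
 assumes "open S" "Ck_on k f S" "Ck_on k g S"
 shows "Ck_on k (%x. f x + g x) S"
 using assms(2,3)
proof (induction k arbitrary: f g)
 case 0
 then show ?case by (simp add: continuous_on_add)
next
 case (Suc k)
 show ?case
 proof (rule Ck_on_SucI[OF assms(1)])
  show "((%x. f x + g x) has_derivative
    (%v. fder f (at x) v + fder g (at x) v)) (at x)" if "x \<in> S" for x
   by (intro has_derivative_add Ck_on_imp_has_derivative[OF Suc.prems(1)]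
     Ck_on_imp_has_derivative[OF Suc.prems(2)] that) simp_all
 next
  show "Ck_on k (%x. fder f (at x) v + fder g (at x) v) S" for v
   by (intro Suc.IH Ck_on_frechet_derivative Suc.prems)
 qed
qed

lemma Ck_on_minus: "open S ==> Ck_on k f S ==> Ck_on k (%x. - f x) S"
 by (rule Ck_on_bounded_linear_compose[OF bounded_linear_minus[OF bounded_linear_ident]])

lemma Ck_on_diff:
 assumes "open S" "Ck_on k f S" "Ck_on k g S"
 shows "Ck_on k (%x. f x - g x) S"
 unfolding diff_conv_add_uminus by (intro Ck_on_add Ck_on_minus assms)

lemma Ck_on_sum:
 assumes "open S" "\<And>i. i \<in> I ==> Ck_on k (f i) S"
 shows "Ck_on k (%x. \<Sum>i\<in>I. f i x) S"
 using assms(2)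
proof (induction I rule: infinite_finite_induct)
 case (insert i I)
 have "Ck_on k (%x. f i x + (\<Sum>i\<in>I. f i x)) S"
  by (intro Ck_on_add assms(1) insert) simp_all
 then show ?case using insert.hyps by simp
qed simp_all

lemma Ck_on_bilinear:
 assumes "bounded_bilinear B" "open S" "Ck_on k f S" "Ck_on k g S"
 shows "Ck_on k (%x. B (f x) (g x)) S"
 using assms(3,4)
proof (induction k arbitrary: f g)
 case 0
 then show ?case using bounded_bilinear.continuous_on[OF assms(1)] by simp
next
 case (Suc k)
 show ?case
 proof (rule Ck_on_SucI[OF assms(2)])
  fix x assume "x \<in> S"
  then show "((%x. B (f x) (g x)) has_derivative
   (%v. B (f x) (fder g (at x) v) + B (fder f (at x) v) (g x))) (at x)"
   by (intro bounded_bilinear.FDERIV[OF assms(1)] Ck_on_imp_has_derivative[OF Suc.prems(1)]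
     Ck_on_imp_has_derivative[OF Suc.prems(2)]) simp_all
 next
  show "Ck_on k (%x. B (f x) (fder g (at x) v) + B (fder f (at x) v) (g x)) S" for v
   by (intro Ck_on_add assms(2) Suc.IH Ck_on_frechet_derivative Suc.prems
     Ck_on_Suc_imp[OF Suc.prems(1)] Ck_on_Suc_imp[OF Suc.prems(2)])
 qed
qed

lemmas Ck_on_mult = Ck_on_bilinear[OF bounded_bilinear_mult]
lemmas Ck_on_scaleR = Ck_on_bilinear[OF bounded_bilinear_scaleR]
lemmas Ck_on_inner = Ck_on_bilinear[OF bounded_bilinear_inner]

lemma Ck_on_power:
 fixes f :: "'a::euclidean_space => real"
 assumes "open S" "Ck_on k f S"
 shows "Ck_on k (%x. f x ^ n) S"
proof (induction n)
 case (Suc n)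
 have "Ck_on k (%x. f x * f x ^ n) S"
  by (intro Ck_on_mult assms Suc.IH)
 then show ?case by simp
qed simp

text \<open>The derivative - f' / f^2 is written with the factor 1 / f itself, so in the induction
  step it is a product of maps already known to be of class C^k.\<close>

lemma Ck_on_inverse:
 fixes f :: "'a::euclidean_space => real"
 assumes "open S" "Ck_on k f S" "\<And>x. x \<in> S ==> f x \<noteq> 0"
 shows "Ck_on k (%x. inverse (f x)) S"
 using assms(2)
proof (induction k)
 case 0
 then show ?case using continuous_on_inverse[of S f] assms(3) by auto
next
 case (Suc k)
 show ?case
 proof (rule Ck_on_SucI[OF assms(1)])
  fix x assume "x \<in> S"
  then show "((%x. inverse (f x)) has_derivative
    (%v. - (inverse (f x) * fder f (at x) v * inverse (f x)))) (at x)"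
   using assms(3) by (intro Deriv.has_derivative_inverse Ck_on_imp_has_derivative[OF Suc.prems]) simp_all
 next
  show "Ck_on k (%x. - (inverse (f x) * fder f (at x) v * inverse (f x))) S" for v
   by (intro Ck_on_minus Ck_on_mult assms(1) Suc.IH Ck_on_Suc_imp[OF Suc.prems]
     Ck_on_frechet_derivative[OF Suc.prems])
 qed
qed

lemma frechet_derivative_Basis_expand:
 fixes g :: "'a::euclidean_space => 'b::real_normed_vector"
 assumes "g differentiable (at x)"
 shows "fder g (at x) w = (\<Sum>b\<in>Basis. (w \<bullet> b) *\<^sub>R fder g (at x) b)"
proof -
 interpret linear "fder g (at x)"
  by (rule linear_frechet_derivative[OF assms])
 have "fder g (at x) (\<Sum>b\<in>Basis. (w \<bullet> b) *\<^sub>R b) =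
   (\<Sum>b\<in>Basis. (w \<bullet> b) *\<^sub>R fder g (at x) b)"
  by (subst sum, subst scale) (rule refl)
 then show ?thesis by (subst (asm) euclidean_representation)
qed

text \<open>\<open>Ck_on\<close> differentiates in a fixed direction, whereas here Dg is applied to
  the moving direction Df(x) v. Expanding that direction in the basis leaves scalar coefficients
  times partial derivatives of g composed with f, which the induction hypothesis covers because it
  is stated for every g.\<close>

lemma Ck_on_compose:
 fixes f :: "'a::euclidean_space => 'b::euclidean_space" and g :: "'b => 'c::real_normed_vector"
 assumes "open S" "f ` S \<subseteq> T" "Ck_on k f S" "Ck_on k g T"
 shows "Ck_on k (%x. g (f x)) S"
 using assms(3,4)
proof (induction k arbitrary: g)
 case 0
 then show ?case using continuous_on_compose2[of T g S f] assms(2) by simp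
next
 case (Suc k)
 let ?D = "%x v. \<Sum>b\<in>Basis. (fder f (at x) v \<bullet> b) *\<^sub>R fder g (at (f x)) b"
 show ?case
 proof (rule Ck_on_SucI[OF assms(1)])
  fix x assume x: "x \<in> S"
  then have fx: "f x \<in> T" using assms(2) by auto
  have "((%x. g (f x)) has_derivative (%v. fder g (at (f x)) (fder f (at x) v))) (at x)"
   by (intro has_derivative_compose[of f _ x UNIV g] Ck_on_imp_has_derivative[OF Suc.prems(1)]
     Ck_on_imp_has_derivative[OF Suc.prems(2)] x fx) simp_all
  also have "(%v. fder g (at (f x)) (fder f (at x) v)) = ?D x"
   by (rule ext, rule frechet_derivative_Basis_expand, rule Ck_on_imp_differentiable[OF Suc.prems(2) _ fx]) simp
  finally show "((%x. g (f x)) has_derivative ?D x) (at x)" .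
 next
  fix v
  have f: "Ck_on k f S" by (rule Ck_on_Suc_imp[OF Suc.prems(1)])
  have i: "Ck_on k (%x. fder f (at x) v \<bullet> b) S" for b
   by (intro Ck_on_inner assms(1) Ck_on_frechet_derivative[OF Suc.prems(1)] Ck_on_const)
  show "Ck_on k (%x. ?D x v) S"
   by (intro Ck_on_sum Ck_on_scaleR assms(1) i Suc.IH[OF f] Ck_on_frechet_derivative[OF Suc.prems(2)])
 qed
qed

lemma Ck_on_compose':
 fixes f :: "'a::euclidean_space => 'b::euclidean_space" and g :: "'b => 'c::real_normed_vector"
 assumes "open S" "f ` S \<subseteq> T" "Ck_on k f S" "Ck_on k g T"
 shows "Ck_on k (g \<circ> f) S"
 using Ck_on_compose[OF assms] by (simp add: o_def)

lemma has_derivative_plane_expand: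
 fixes g :: "real^2 => 'b::real_normed_vector"
 assumes "g differentiable (at x)"
 shows "fder g (at x) w =
  (w $ 1) *\<^sub>R fder g (at x) (axis 1 1) + (w $ 2) *\<^sub>R fder g (at x) (axis 2 1)"
proof -
 interpret linear "fder g (at x)"
  by (rule linear_frechet_derivative[OF assms])
 have "(w $ 1) *\<^sub>R axis 1 1 + (w $ 2) *\<^sub>R axis 2 1 = w"
  by (simp add: vec_eq_iff axis_def forall_2)
 moreover have "fder g (at x) ((w $ 1) *\<^sub>R axis 1 1 + (w $ 2) *\<^sub>R axis 2 1) =
   (w $ 1) *\<^sub>R fder g (at x) (axis 1 1) + (w $ 2) *\<^sub>R fder g (at x) (axis 2 1)"
  by (subst add, subst scale, subst scale) (rule refl)
 ultimately show ?thesis by simp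
qed

lemma Ck_on_vec_nth: "open S ==> Ck_on k f S ==> Ck_on k (%x. f x $ i) S"
 by (rule Ck_on_bounded_linear_compose[OF bounded_linear_vec_nth])

text \<open>Bootstrapping: by Cramer's rule the derivative of g is a rational expression in the
  first derivatives of f at g y. So if g is of class C^j with j < k, its derivative is of class C^j
  too.\<close>

lemma Ck_on_inverse_function:
 fixes f g :: "real^2 => real^2"
 assumes S: "open S" and T: "open T" and hom: "homeomorphism S T f g"
  and f: "Ck_on k f S" and k: "k > 0"
  and det: "\<And>x. x \<in> S ==> det (matrix (fder f (at x))) \<noteq> 0"
 shows "Ck_on k g T"
proof -
 define J where "J i j x = fder f (at x) (axis j 1) $ i" for i j :: 2 and x
 define d where "d x = J 1 1 x * J 2 2 x - J 1 2 x * J 2 1 x" for x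
 \<comment> \<open>The adjugate of the Jacobian matrix of f at g y, divided by its
   determinant.\<close>
 define G where "G y v = inverse (d (g y)) *\<^sub>R ((J 2 2 (g y) * v $ 1 - J 1 2 (g y) * v $ 2) *\<^sub>R (axis 1 1 :: real^2) +
   (J 1 1 (g y) * v $ 2 - J 2 1 (g y) * v $ 1) *\<^sub>R axis 2 1)" for y and v :: "real^2"
 have d: "d x \<noteq> 0" if "x \<in> S" for x
  using det[OF that] by (simp add: det_2 matrix_def d_def J_def)
 have gS: "g ` T \<subseteq> S" using hom by (auto simp: homeomorphism_def)
 have J: "Ck_on j (%x. J i i' x) S" if "j < k" for i i' j
 proof -
  have "Ck_on (Suc j) f S" using that by (intro Ck_on_mono[OF f]) simp
  then show ?thesis unfolding J_def
   by (intro Ck_on_vec_nth S Ck_on_frechet_derivative)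
 qed
 have der: "(g has_derivative G y) (at y)" if y: "y \<in> T" for y
 proof (rule has_derivative_inverse_basic)
  have gy: "g y \<in> S" using gS y by auto
  show "(f has_derivative fder f (at (g y))) (at (g y))"
   by (rule Ck_on_imp_has_derivative[OF f k gy])
  show "bounded_linear (G y)"
   unfolding linear_conv_bounded_linear[symmetric]
   by (rule linearI) (simp_all add: G_def vec_eq_iff forall_2 axis_def algebra_simps)
  show "G y \<circ> fder f (at (g y)) = id"
  proof
   fix v :: "real^2"
   have 1: "fder f (at (g y)) v $ i = v $ 1 * J i 1 (g y) + v $ 2 * J i 2 (g y)" for i
    using has_derivative_plane_expand[of f "g y" v] Ck_on_imp_differentiable[OF f k gy] by (simp add: J_def)
   have e1: "d (g y) * v $ 1 = J 2 2 (g y) * (v $ 1 * J 1 1 (g y) + v $ 2 * J 1 2 (g y))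
     - J 1 2 (g y) * (v $ 1 * J 2 1 (g y) + v $ 2 * J 2 2 (g y))"
    and e2: "d (g y) * v $ 2 = J 1 1 (g y) * (v $ 1 * J 2 1 (g y) + v $ 2 * J 2 2 (g y))
     - J 2 1 (g y) * (v $ 1 * J 1 1 (g y) + v $ 2 * J 1 2 (g y))"
    by (simp_all add: d_def algebra_simps)
   show "(G y \<circ> fder f (at (g y))) v = id v"
    using d[OF gy] by (simp add: G_def 1 vec_eq_iff forall_2 axis_def flip: e1 e2)
  qed
  show "continuous (at y) g"
   using hom y T by (simp add: homeomorphism_def continuous_on_eq_continuous_at)
  show "open T" "y \<in> T" by fact+
  show "f (g z) = z" if "z \<in> T" for z using hom that by (simp add: homeomorphism_def)
 qed
 have "Ck_on j g T" if "j \<le> k" for j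
  using that
 proof (induction j)
  case 0
  then show ?case using hom by (simp add: homeomorphism_def)
 next
  case (Suc j)
  then have g: "Ck_on j g T" and jk: "j < k" by auto
  have Jg: "Ck_on j (%y. J i i' (g y)) T" for i i'
   by (rule Ck_on_compose[OF T gS g J[OF jk]])
  have "Ck_on j (%y. G y v) T" for v
   unfolding G_def d_def
   using d gS by (intro Ck_on_scaleR Ck_on_inverse Ck_on_add Ck_on_diff Ck_on_mult T Jg Ck_on_const)
    (auto simp: d_def)
  then show ?case using der by (intro Ck_on_SucI[OF T])
 qed
 then show ?thesis by simp
qed

section \<open>Mean value formulas and the symmetry of second derivatives\<close>

lemma mvt_directional:
 fixes g :: "'a::real_normed_vector => real"
 assumes t: "t > 0" and g: "\<And>s. 0 \<le> s ==> s \<le> t ==> g differentiable (at (z + s *\<^sub>R v))"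
 shows "\<exists>s. 0 < s & s < t & g (z + t *\<^sub>R v) - g z = t * fder g (at (z + s *\<^sub>R v)) v"
proof -
 have "((%s. g (z + s *\<^sub>R v)) has_derivative
  (%h. fder g (at (z + s *\<^sub>R v)) (h *\<^sub>R v))) (at s within {0..t})"
  if "0 \<le> s" "s \<le> t" for s
 proof (rule has_derivative_compose[of "%s. z + s *\<^sub>R v" "%h. h *\<^sub>R v" s "{0..t}" g])
  show "((%s. z + s *\<^sub>R v) has_derivative (%h. h *\<^sub>R v)) (at s within {0..t})"
   by (auto intro!: derivative_eq_intros)
  show "(g has_derivative fder g (at (z + s *\<^sub>R v))) (at (z + s *\<^sub>R v))"
   using g[OF that] frechet_derivative_works by blast
 qed
 from mvt_simple[OF t this] obtain s where s: "0 < s" "s < t"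
  "g (z + t *\<^sub>R v) - g (z + 0 *\<^sub>R v) = fder g (at (z + s *\<^sub>R v)) ((t - 0) *\<^sub>R v)"
  by auto
 have "linear (fder g (at (z + s *\<^sub>R v)))"
  using s by (intro linear_frechet_derivative g) auto
 then have "fder g (at (z + s *\<^sub>R v)) (t *\<^sub>R v) = t * fder g (at (z + s *\<^sub>R v)) v"
  by (simp add: linear_scale)
 with s show ?thesis by auto
qed

text \<open>The mean value theorem is applied twice: to y |-> f (y + t w) - f y along v, and then to
  the v-derivative of f along w.\<close>

lemma second_difference_eq:
 fixes f :: "'a::euclidean_space => real"
 assumes t: "t > 0" and f: "Ck_on 2 f S"
  and S: "\<And>s s'. 0 \<le> s ==> s \<le> t ==> 0 \<le> s' ==> s' \<le> t ==> x + s *\<^sub>R v + s' *\<^sub>R w \<in> S"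
 shows "\<exists>s s'. 0 < s & s < t & 0 < s' & s' < t &
  f (x + t *\<^sub>R v + t *\<^sub>R w) - f (x + t *\<^sub>R v) - f (x + t *\<^sub>R w) + f x =
  t^2 * fder (%y. fder f (at y) v) (at (x + s *\<^sub>R v + s' *\<^sub>R w)) w"
proof -
 have S0: "x + s *\<^sub>R v \<in> S" if "0 \<le> s" "s \<le> t" for s
  using S[of s 0] that t by simp
 have St: "(x + t *\<^sub>R w) + s *\<^sub>R v \<in> S" if "0 \<le> s" "s \<le> t" for s
  using S[of s t] that t by (simp add: algebra_simps)
 have f1: "f differentiable (at y)" if "y \<in> S" for y
  using Ck_on_imp_differentiable[OF f] that by simp
 have f2: "(%y. fder f (at y) v) differentiable (at y)" if "y \<in> S" for y
  using Ck_on_imp_differentiable[OF Ck_on_frechet_derivative[of 1 f S v]] f that by (simp add: numeral_2_eq_2)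
 define g where "g y = f (y + t *\<^sub>R w) - f y" for y
 have shift: "((%y. f (y + t *\<^sub>R w)) has_derivative fder f (at (y + t *\<^sub>R w))) (at y)"
  if "y + t *\<^sub>R w \<in> S" for y
  by (rule has_derivative_compose[of "%y. y + t *\<^sub>R w" "%h. h" y UNIV f])
   (use f1[OF that] frechet_derivative_works in \<open>auto intro!: derivative_eq_intros\<close>)
 have g: "(g has_derivative (%h. fder f (at (y + t *\<^sub>R w)) h - fder f (at y) h)) (at y)"
  if "y + t *\<^sub>R w \<in> S" "y \<in> S" for y
  unfolding g_def
  by (intro has_derivative_diff shift that) (use f1[OF that(2)] frechet_derivative_works in blast)
 have g': "fder g (at y) h = fder f (at (y + t *\<^sub>R w)) h - fder f (at y) h"
  if "y + t *\<^sub>R w \<in> S" "y \<in> S" for y h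
  using frechet_derivative_at[OF g[OF that]] by metis
 have "\<exists>s. 0 < s & s < t & g (x + t *\<^sub>R v) - g x = t * fder g (at (x + s *\<^sub>R v)) v"
 proof (rule mvt_directional[OF t])
  show "g differentiable (at (x + s *\<^sub>R v))" if "0 \<le> s" "s \<le> t" for s
   using St[OF that] S0[OF that] by (intro differentiableI[OF g]) (simp_all add: algebra_simps)
 qed
 then obtain s where s: "0 < s" "s < t" "g (x + t *\<^sub>R v) - g x = t * fder g (at (x + s *\<^sub>R v)) v"
  by blast
 have s3: "fder g (at (x + s *\<^sub>R v)) v =
  fder f (at (x + s *\<^sub>R v + t *\<^sub>R w)) v - fder f (at (x + s *\<^sub>R v)) v"
  by (rule g') (use St[of s] S0[of s] s(1,2) in \<open>simp_all add: algebra_simps\<close>)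
 have "\<exists>s'. 0 < s' & s' < t &
  fder f (at ((x + s *\<^sub>R v) + t *\<^sub>R w)) v - fder f (at (x + s *\<^sub>R v)) v
  = t * fder (%y. fder f (at y) v) (at ((x + s *\<^sub>R v) + s' *\<^sub>R w)) w"
  by (rule mvt_directional[OF t, of "%y. fder f (at y) v"]) (use s in \<open>auto intro!: f2 S\<close>)
 then obtain s' where s': "0 < s'" "s' < t"
  "fder f (at ((x + s *\<^sub>R v) + t *\<^sub>R w)) v - fder f (at (x + s *\<^sub>R v)) v
  = t * fder (%y. fder f (at y) v) (at ((x + s *\<^sub>R v) + s' *\<^sub>R w)) w"
  by blast
 have "f (x + t *\<^sub>R v + t *\<^sub>R w) - f (x + t *\<^sub>R v) - f (x + t *\<^sub>R w) + f x = g (x + t *\<^sub>R v) - g x"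
  by (simp add: g_def)
 also have "\<dots> = t^2 * fder (%y. fder f (at y) v) (at (x + s *\<^sub>R v + s' *\<^sub>R w)) w"
  unfolding s(3) s3 s'(3) by (simp add: power2_eq_square)
 finally show ?thesis using s(1,2) s'(1,2) by blast
qed

text \<open>The second difference is symmetric in v and w, so some value of one mixed derivative
  near x equals some value of the other near x. With \<open>eps\<close> half of the supposed gap at
  x, continuity of both gives a contradiction.\<close>

lemma second_derivative_symmetric_real:
 fixes f :: "'a::euclidean_space => real"
 assumes S: "open S" and f: "Ck_on 2 f S" and x: "x \<in> S"
 shows "fder (%y. fder f (at y) v) (at x) w =
  fder (%y. fder f (at y) w) (at x) v" (is "?B v w x = ?B w v x")
proof (rule ccontr)
 assume ne: "\<not> ?thesis"
 define eps where "eps = \<bar>?B v w x - ?B w v x\<bar> / 2"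
 have eps: "eps > 0" using ne by (simp add: eps_def)
 have cont: "continuous_on S (?B a b)" for a b
 proof -
  have "Ck_on (Suc (Suc 0)) f S" using f by (simp add: numeral_2_eq_2)
  from Ck_on_frechet_derivative[OF Ck_on_frechet_derivative[OF this, of a], of b] show ?thesis by simp
 qed
 have "\<exists>d>0. \<forall>y. dist y x < d --> y \<in> S & dist (?B a b y) (?B a b x) < eps" for a b
 proof -
  have "isCont (?B a b) x" using cont[of a b] S x by (simp add: continuous_on_eq_continuous_at)
  then obtain d1 where "d1 > 0" "\<And>y. dist y x < d1 ==> dist (?B a b y) (?B a b x) < eps"
   using eps unfolding continuous_at_eps_delta by blast
  moreover obtain d2 where "d2 > 0" "\<And>y. dist y x < d2 ==> y \<in> S"
   using S x unfolding open_dist by blast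
  ultimately show ?thesis by (intro exI[of _ "min d1 d2"]) auto
 qed
 from this[of v w] this[of w v] obtain d1 d2 where d: "d1 > 0" "d2 > 0"
  "\<And>y. dist y x < d1 ==> y \<in> S & dist (?B v w y) (?B v w x) < eps"
  "\<And>y. dist y x < d2 ==> y \<in> S & dist (?B w v y) (?B w v x) < eps" by blast
 define t where "t = min d1 d2 / (norm v + norm w + 1)"
 have n0: "norm v + norm w + 1 > 0" by (smt (verit) norm_ge_zero)
 have t: "t > 0" using d n0 by (simp add: t_def)
 have near: "dist (x + s *\<^sub>R v + s' *\<^sub>R w) x < min d1 d2" if "0 \<le> s" "s \<le> t" "0 \<le> s'" "s' \<le> t" for s s'
 proof -
  have "dist (x + s *\<^sub>R v + s' *\<^sub>R w) x \<le> s * norm v + s' * norm w"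
   using norm_triangle_ineq[of "s *\<^sub>R v" "s' *\<^sub>R w"] that by (simp add: dist_norm add.assoc)
  also have "\<dots> \<le> t * norm v + t * norm w"
   using that by (intro add_mono mult_right_mono) auto
  also have "\<dots> < t * (norm v + norm w + 1)" using t by (simp add: algebra_simps)
  also have "\<dots> = min d1 d2" using n0 by (simp add: t_def)
  finally show ?thesis .
 qed
 obtain s s' where 1: "0 < s" "s < t" "0 < s'" "s' < t"
  "f (x + t *\<^sub>R v + t *\<^sub>R w) - f (x + t *\<^sub>R v) - f (x + t *\<^sub>R w) + f x = t^2 * ?B v w (x + s *\<^sub>R v + s' *\<^sub>R w)"
  using second_difference_eq[OF t f, of x v w] near d by fastforce
 have near': "dist (x + s *\<^sub>R w + s' *\<^sub>R v) x < min d1 d2" if "0 \<le> s" "s \<le> t" "0 \<le> s'" "s' \<le> t" for s s'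
  using near[of s' s] that by (simp add: algebra_simps)
 obtain r r' where 2: "0 < r" "r < t" "0 < r'" "r' < t"
  "f (x + t *\<^sub>R w + t *\<^sub>R v) - f (x + t *\<^sub>R w) - f (x + t *\<^sub>R v) + f x = t^2 * ?B w v (x + r *\<^sub>R w + r' *\<^sub>R v)"
  using second_difference_eq[OF t f, of x w v] near' d by fastforce
 have "t^2 * ?B v w (x + s *\<^sub>R v + s' *\<^sub>R w) = t^2 * ?B w v (x + r *\<^sub>R w + r' *\<^sub>R v)"
  using 1(5) 2(5) by (simp add: algebra_simps)
 then have eq: "?B v w (x + s *\<^sub>R v + s' *\<^sub>R w) = ?B w v (x + r *\<^sub>R w + r' *\<^sub>R v)" using t by simp
 have "dist (?B v w (x + s *\<^sub>R v + s' *\<^sub>R w)) (?B v w x) < eps"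
  using d(3) near[of s s'] 1 by simp
 moreover have "dist (?B w v (x + r *\<^sub>R w + r' *\<^sub>R v)) (?B w v x) < eps"
  using d(4) near'[of r r'] 2 by simp
 ultimately have "2 * eps < 2 * eps"
  using abs_triangle_ineq4[of "?B v w x - ?B w v (x + r *\<^sub>R w + r' *\<^sub>R v)"
    "?B w v x - ?B w v (x + r *\<^sub>R w + r' *\<^sub>R v)"]
  unfolding eq dist_real_def by (simp add: eps_def abs_minus_commute)
 then show False by simp
qed

lemma frechet_derivative_inner_left:
 assumes "f differentiable (at x)"
 shows "fder (%y. f y \<bullet> b) (at x) v = fder f (at x) v \<bullet> b"
proof -
 have "((%y. f y \<bullet> b) has_derivative (%v. fder f (at x) v \<bullet> b)) (at x)"
  using assms frechet_derivative_works by (intro has_derivative_inner_left) blast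
 then show ?thesis by (metis frechet_derivative_at)
qed

lemma second_derivative_symmetric:
 fixes f :: "'a::euclidean_space => 'b::euclidean_space"
 assumes S: "open S" and f: "Ck_on 2 f S" and x: "x \<in> S"
 shows "fder (%y. fder f (at y) v) (at x) w =
  fder (%y. fder f (at y) w) (at x) v"
proof (rule euclidean_eqI)
 fix b :: 'b assume "b \<in> Basis"
 have f1: "f differentiable (at y)" if "y \<in> S" for y
  using Ck_on_imp_differentiable[OF f] that by simp
 have f2: "(%y. fder f (at y) v) differentiable (at x)" for v
  using Ck_on_imp_differentiable[OF Ck_on_frechet_derivative[of 1 f S v]] f x by (simp add: numeral_2_eq_2)
 have eq: "fder (%y. fder f (at y) v \<bullet> b) (at x) w =
   fder (%y. fder (%y. f y \<bullet> b) (at y) v) (at x) w" for v w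
  by (rule frechet_derivative_transform_within_open[OF _ S x, THEN fun_cong])
   (auto intro!: differentiable_inner f2 simp: frechet_derivative_inner_left[OF f1])
 have "Ck_on 2 (%y. f y \<bullet> b) S"
  by (intro Ck_on_inner S f Ck_on_const)
 from second_derivative_symmetric_real[OF S this x, of v w]
 show "fder (%y. fder f (at y) v) (at x) w \<bullet> b =
   fder (%y. fder f (at y) w) (at x) v \<bullet> b"
  by (simp add: eq flip: frechet_derivative_inner_left[OF f2])
qed

section \<open>Iterated directional derivatives and the quadratic Taylor remainder\<close>

lemma Ck_on_iter_deriv: "Ck_on (k + length vs) f S ==> Ck_on k (iter_deriv vs f) S"
proof (induction vs arbitrary: k)
 case (Cons v vs)
 have "Ck_on (Suc k) (iter_deriv vs f) S" using Cons.prems by (intro Cons.IH) simp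
 then show ?case by (simp add: Ck_on_frechet_derivative)
qed simp

lemma Ck_on_iter_deriv': "Ck_on r f S ==> k + length vs \<le> r ==> Ck_on k (iter_deriv vs f) S"
 by (rule Ck_on_iter_deriv, rule Ck_on_mono)

lemma iter_deriv_differentiable:
 "Ck_on r f S ==> length vs < r ==> x \<in> S ==> iter_deriv vs f differentiable (at x)"
 using Ck_on_imp_differentiable[OF Ck_on_iter_deriv'[of r f S 1 vs]] by simp

lemma iter_deriv_cong:
 assumes "open S" "\<And>x. x \<in> S ==> f x = g x" "Ck_on (length vs) f S" "x \<in> S"
 shows "iter_deriv vs f x = iter_deriv vs g x"
 using assms(3,4)
proof (induction vs arbitrary: x)
 case (Cons v vs)
 have C: "Ck_on (length vs) f S" using Cons.prems(1) by (intro Ck_on_mono[OF Cons.prems(1)]) simp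
 show ?case
  using iter_deriv_differentiable[OF Cons.prems(1) _ Cons.prems(2)] Cons.IH[OF C]
   frechet_derivative_transform_within_open[OF _ assms(1) Cons.prems(2), of "iter_deriv vs f" "iter_deriv vs g"]
  by simp
qed (use assms in auto)

lemma iter_deriv_lincomb:
 assumes S: "open S" and "Ck_on (length vs) f S" "Ck_on (length vs) g S" "x \<in> S"
 shows "iter_deriv vs (%x. s *\<^sub>R f x + t *\<^sub>R g x) x = s *\<^sub>R iter_deriv vs f x + t *\<^sub>R iter_deriv vs g x"
 using assms(2-)
proof (induction vs arbitrary: x)
 case (Cons v vs)
 have C: "Ck_on (length vs) f S" "Ck_on (length vs) g S"
  using Ck_on_mono[OF Cons.prems(1)] Ck_on_mono[OF Cons.prems(2)] by simp_all
 have d: "iter_deriv vs f differentiable (at x)" "iter_deriv vs g differentiable (at x)"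
  using Cons.prems by (auto intro!: iter_deriv_differentiable)
 have D: "((%x. s *\<^sub>R iter_deriv vs f x + t *\<^sub>R iter_deriv vs g x) has_derivative
  (%v. s *\<^sub>R fder (iter_deriv vs f) (at x) v + t *\<^sub>R fder (iter_deriv vs g) (at x) v)) (at x)"
  using d unfolding frechet_derivative_works by (intro has_derivative_add has_derivative_scaleR_right)
 have "fder (%x. s *\<^sub>R iter_deriv vs f x + t *\<^sub>R iter_deriv vs g x) (at x) =
  fder (iter_deriv vs (%x. s *\<^sub>R f x + t *\<^sub>R g x)) (at x)"
  by (rule frechet_derivative_transform_within_open[OF differentiableI[OF D] S Cons.prems(3)])
   (use Cons.IH[OF C] in simp)
 then show ?case using frechet_derivative_at[OF D] by (simp add: fun_eq_iff)
qed simp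

text \<open>This bounds the remainders H of the normal form. The derivatives in the basis directions
  are differentiable at x, hence f' differs from f' at x by at most K |y - x|. The mean value
  inequality for f minus its linear part, on the closed ball of radius |y - x|, then gives the
  quadratic bound.\<close>

lemma Ck_2_taylor_bound:
 fixes f :: "'a::euclidean_space => 'b::real_normed_vector"
 assumes S: "open S" "x \<in> S" and f: "Ck_on 2 f S"
 shows "\<exists>M dlt. dlt > 0 & (\<forall>y. dist y x < dlt --> norm (f y - f x - fder f (at x) (y - x)) \<le> M * (norm (y - x))^2)"
proof -
 let ?D = "%y. fder f (at y)"
 have f2: "(%y. ?D y b) differentiable (at x)" for b
  using Ck_on_imp_differentiable[OF Ck_on_frechet_derivative[of 1 f S b]] f S by (simp add: numeral_2_eq_2)
 have f1: "f differentiable (at y)" if "y \<in> S" for y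
  using Ck_on_imp_differentiable[OF f] that by simp
 have "\<exists>d M. d > 0 & M \<ge> 0 & (\<forall>y. dist y x < d --> norm (?D y b - ?D x b) \<le> M * norm (y - x))" for b
 proof -
  obtain L where L: "((%y. ?D y b) has_derivative L) (at x)" using f2 unfolding differentiable_def by blast
  then have bl: "bounded_linear L" by (rule has_derivative_bounded_linear)
  from L obtain d where d: "d > 0" "\<And>y. norm (y - x) < d ==> norm (?D y b - ?D x b - L (y - x)) \<le> 1 * norm (y - x)"
   unfolding has_derivative_at_alt by (metis zero_less_one)
  have "norm (?D y b - ?D x b) \<le> (1 + onorm L) * norm (y - x)" if "dist y x < d" for y
  proof -
   have "norm (?D y b - ?D x b) \<le> norm (?D y b - ?D x b - L (y - x)) + norm (L (y - x))"
    using norm_triangle_ineq[of "?D y b - ?D x b - L (y - x)" "L (y - x)"] by simp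
   also have "\<dots> \<le> 1 * norm (y - x) + onorm L * norm (y - x)"
    using d(2)[of y] that onorm[OF bl] by (intro add_mono) (auto simp: dist_norm)
   finally show ?thesis by (simp add: algebra_simps)
  qed
  then show ?thesis using d(1) onorm_pos_le[OF bl] by (intro exI[of _ d] exI[of _ "1 + onorm L"]) auto
 qed
 then obtain d M where dM: "\<And>b. d b > 0" "\<And>b. M b \<ge> 0"
  "\<And>b y. dist y x < d b ==> norm (?D y b - ?D x b) \<le> M b * norm (y - x)" by metis
 obtain d0 where d0: "d0 > 0" "ball x d0 \<subseteq> S" using S open_contains_ball by blast
 define dlt where "dlt = Min (insert d0 (d ` Basis))"
 define K where "K = (\<Sum>b\<in>(Basis::'a set). M b)"
 have dlt: "dlt > 0" using dM(1) d0 by (auto simp: dlt_def)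
 have dlt'1: "dlt \<le> d0" unfolding dlt_def by (rule Min_le) simp_all
 have dlt'2: "dlt \<le> d b" if "b \<in> Basis" for b
  unfolding dlt_def by (rule Min_le) (use that in auto)
 note dlt' = dlt'1 dlt'2
 have K: "norm (?D y v - ?D x v) \<le> K * norm (y - x) * norm v" if "dist y x < dlt" for y v
 proof -
  have y: "y \<in> S" using that dlt'1 d0 by (auto simp: dist_commute)
  have "?D y v - ?D x v = (\<Sum>b\<in>Basis. (v \<bullet> b) *\<^sub>R (?D y b - ?D x b))"
   using frechet_derivative_Basis_expand[OF f1[OF y], of v] frechet_derivative_Basis_expand[OF f1[OF S(2)], of v]
   by (simp add: scaleR_diff_right sum_subtractf)
  also have "norm \<dots> \<le> (\<Sum>b\<in>Basis. norm v * (M b * norm (y - x)))"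
   unfolding norm_scaleR using that dlt'(2) Basis_le_norm[of _ v]
   by (intro sum_norm_le) (auto intro!: mult_mono dM(3) dest: dlt'(2) order.strict_trans2)
  also have "\<dots> = K * norm (y - x) * norm v"
   by (simp add: K_def sum_distrib_left sum_distrib_right mult_ac)
  finally show ?thesis .
 qed
 have "norm (f y - f x - ?D x (y - x)) \<le> K * (norm (y - x))^2" if y: "dist y x < dlt" for y
 proof -
  have "norm ((f y - ?D x y) - (f x - ?D x x)) \<le> (K * norm (y - x)) * norm (y - x)"
  proof (rule differentiable_bound)
   show "convex (cball x (norm (y - x)))" by simp
   show "y \<in> cball x (norm (y - x))" by (simp add: dist_norm norm_minus_commute)
   show "x \<in> cball x (norm (y - x))" by simp
   fix z assume z: "z \<in> cball x (norm (y - x))"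
   then have zd: "dist z x < dlt" "norm (z - x) \<le> norm (y - x)"
    using y by (auto simp: dist_norm norm_minus_commute)
   have zS: "z \<in> S" using zd dlt'1 d0 by (auto simp: dist_commute)
   have bl: "bounded_linear (?D x)" 
    by (rule has_derivative_bounded_linear[OF f1[OF S(2), unfolded frechet_derivative_works]])
   show "((%y. f y - ?D x y) has_derivative (%v. ?D z v - ?D x v)) (at z within cball x (norm (y - x)))"
    by (rule has_derivative_at_withinI, rule has_derivative_diff[OF _ bounded_linear_imp_has_derivative[OF bl]],
      rule f1[OF zS, unfolded frechet_derivative_works])
   have K0: "K \<ge> 0" unfolding K_def by (rule sum_nonneg) (rule dM(2))
   show "onorm (%v. ?D z v - ?D x v) \<le> K * norm (y - x)"
    by (rule onorm_le, rule order_trans[OF K[OF zd(1)]], rule mult_right_mono[OF mult_left_mono[OF zd(2) K0]], rule norm_ge_zero)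
  qed
  moreover have "f y - f x - ?D x (y - x) = (f y - ?D x y) - (f x - ?D x x)"
   unfolding linear_diff[OF linear_frechet_derivative[OF f1[OF S(2)]]] by (simp add: algebra_simps)
  ultimately show ?thesis by (simp only: power2_eq_square mult.assoc)
 qed
 then show ?thesis using dlt by blast
qed

section \<open>The axial quartic differential\<close>

lemma vector_4:
 "(vector [x, y, z, w] :: ('a::zero)^4) $ 1 = x"
 "(vector [x, y, z, w] :: ('a::zero)^4) $ 2 = y"
 "(vector [x, y, z, w] :: ('a::zero)^4) $ 3 = z"
 "(vector [x, y, z, w] :: ('a::zero)^4) $ 4 = w"
 unfolding vector_def by simp_all

lemma det_vector4_nonzero_iff:
 fixes a b c d :: "real^4"
 shows "det (vector [a, b, c, d] :: real^4^4) \<noteq> 0 \<longleftrightarrow>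
  (\<forall>x y z w. x *\<^sub>R a + y *\<^sub>R b + z *\<^sub>R c + w *\<^sub>R d = 0 --> x = 0 & y = 0 & z = 0 & w = 0)"
  (is "det ?M \<noteq> 0 \<longleftrightarrow> ?R")
proof -
 have "det ?M \<noteq> 0 \<longleftrightarrow> (\<exists>B. ?M ** B = mat 1)"
  using invertible_det_nz[of ?M] invertible_right_inverse[of ?M] by simp
 also have "\<dots> \<longleftrightarrow> (\<forall>c. (\<Sum>i\<in>UNIV. c i *s row i ?M) = 0 --> (\<forall>i. c i = 0))"
  by (rule matrix_right_invertible_independent_rows)
 also have "\<dots> \<longleftrightarrow> ?R"
 proof
  assume L: "\<forall>c. (\<Sum>i\<in>UNIV. c i *s row i ?M) = 0 --> (\<forall>i. c i = 0)"
  show ?R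
  proof (intro allI impI)
   fix x y z w assume 0: "x *\<^sub>R a + y *\<^sub>R b + z *\<^sub>R c + w *\<^sub>R d = 0"
   have "(\<Sum>i\<in>UNIV. (vector [x, y, z, w] :: real^4) $ i *s row i ?M) = 0"
    using 0 by (simp add: sum_4 row_def vec_eq_iff vector_4 forall_4)
   then have "\<forall>i. (vector [x, y, z, w] :: real^4) $ i = 0" using L by blast
   then show "x = 0 & y = 0 & z = 0 & w = 0" by (simp add: forall_4 vector_4)
  qed
 next
  assume R: ?R
  show "\<forall>c. (\<Sum>i\<in>UNIV. c i *s row i ?M) = 0 --> (\<forall>i. c i = 0)"
  proof (intro allI impI)
   fix k :: "4 => real" and i assume "(\<Sum>i\<in>UNIV. k i *s row i ?M) = 0"
   then have "k 1 *\<^sub>R a + k 2 *\<^sub>R b + k 3 *\<^sub>R c + k 4 *\<^sub>R d = 0"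
    by (simp add: sum_4 row_def vec_eq_iff vector_4 forall_4)
   then have "\<forall>i. k i = 0" using R by (simp add: forall_4)
   then show "k i = 0" by simp
  qed
 qed
 finally show ?thesis .
qed

lemma orthogonal_to_frame_eq_0:
 fixes a b c d r :: "real^4"
 assumes "det (vector [a, b, c, d] :: real^4^4) \<noteq> 0" "a \<bullet> r = 0" "b \<bullet> r = 0" "c \<bullet> r = 0" "d \<bullet> r = 0"
 shows "r = 0"
proof -
 let ?M = "vector [a, b, c, d] :: real^4^4"
 have "?M *v r = 0"
  using assms(2-) by (simp add: vec_eq_iff forall_4 matrix_vector_mult_def vector_4 inner_vec_def)
 moreover have "invertible ?M" using assms(1) by (simp add: invertible_det_nz)
 then have "\<forall>x. ?M *v x = 0 --> x = 0"
  unfolding matrix_left_invertible_ker[symmetric] invertible_def by blast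
 ultimately show ?thesis by blast
qed

lemma det_vector4_minus:
 fixes a b c d :: "real^4"
 shows "det (vector [a, b, - c, d] :: real^4^4) = - det (vector [a, b, c, d] :: real^4^4)"
proof -
 have 1: "(\<chi> i. if i = 3 then (-1) *s (vector [a, b, c, d] :: real^4^4) $ i else (vector [a, b, c, d] :: real^4^4) $ i) =
  (vector [a, b, - c, d] :: real^4^4)"
  by (simp add: vec_eq_iff forall_4 vector_4)
 have 2: "(\<chi> i. if i = 3 then (vector [a, b, c, d] :: real^4^4) $ i else (vector [a, b, c, d] :: real^4^4) $ i) =
  (vector [a, b, c, d] :: real^4^4)"
  by (simp add: vec_eq_iff)
 show ?thesis
  using det_row_mul[of 3 "-1" "%i. (vector [a, b, c, d] :: real^4^4) $ i" "%i. (vector [a, b, c, d] :: real^4^4) $ i"]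
  unfolding 1 2 by simp
qed

definition orthonormal_completion :: "real^4 => real^4 => real^4 => real^4 => bool" where
 "orthonormal_completion a b N1 N2 \<longleftrightarrow> norm N1 = 1 & norm N2 = 1 & N1 \<bullet> N2 = 0 &
  a \<bullet> N1 = 0 & b \<bullet> N1 = 0 & a \<bullet> N2 = 0 & b \<bullet> N2 = 0"

lemma positive_normal_frame_iff:
 "positive_normal_frame X u N1 N2 \<longleftrightarrow> orthonormal_completion (pdx X u) (pdy X u) N1 N2 &
  det (vector [pdx X u, pdy X u, N1, N2] :: real^4^4) > 0"
 by (auto simp: positive_normal_frame_def orthonormal_completion_def)

lemma unit_vector_orthogonal_ex:
 fixes S :: "'a::euclidean_space set"
 assumes "finite S" "card S < DIM('a)"
 shows "\<exists>x. norm x = 1 & (\<forall>y\<in>S. y \<bullet> x = 0)"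
proof -
 have "dim S < DIM('a)" using dim_le_card'[OF assms(1)] assms(2) by simp
 then obtain x where x: "x \<noteq> 0" "\<And>y. y \<in> span S ==> orthogonal x y"
  using orthogonal_to_subspace_exists by blast
 show ?thesis
  by (intro exI[of _ "x /\<^sub>R norm x"]) (use x in \<open>auto simp: orthogonal_def inner_commute span_base\<close>)
qed

lemma orthonormal_completion_det:
 assumes gram: "(a \<bullet> a) * (b \<bullet> b) - (a \<bullet> b)^2 > 0" and N: "orthonormal_completion a b N1 N2"
 shows "det (vector [a, b, N1, N2] :: real^4^4) \<noteq> 0"
 unfolding det_vector4_nonzero_iff
proof (intro allI impI)
 note N = N[unfolded orthonormal_completion_def]
 fix x y z w assume 0: "x *\<^sub>R a + y *\<^sub>R b + z *\<^sub>R N1 + w *\<^sub>R N2 = 0"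
 have "(x *\<^sub>R a + y *\<^sub>R b + z *\<^sub>R N1 + w *\<^sub>R N2) \<bullet> N1 = z" "(x *\<^sub>R a + y *\<^sub>R b + z *\<^sub>R N1 + w *\<^sub>R N2) \<bullet> N2 = w"
  using N by (simp_all add: inner_add_left inner_add_right inner_commute norm_eq_1)
 then have zw: "z = 0" "w = 0" using 0 by simp_all
 then have 1: "x *\<^sub>R a + y *\<^sub>R b = 0" using 0 by simp
 have e1: "x * (a \<bullet> a) + y * (a \<bullet> b) = 0" using arg_cong[OF 1, of "%v. v \<bullet> a"]
  by (simp add: inner_add_left inner_add_right inner_commute)
 have e2: "x * (a \<bullet> b) + y * (b \<bullet> b) = 0" using arg_cong[OF 1, of "%v. v \<bullet> b"]
  by (simp add: inner_add_left inner_add_right inner_commute)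
 have "x * ((a \<bullet> a) * (b \<bullet> b) - (a \<bullet> b)^2) = 0" "y * ((a \<bullet> a) * (b \<bullet> b) - (a \<bullet> b)^2) = 0"
  using e1 e2 by algebra+
 then show "x = 0 & y = 0 & z = 0 & w = 0" using gram zw by simp
qed

text \<open>The two unit vectors are chosen one after the other, orthogonal to the earlier vectors.
  The determinant is then nonzero, and changing the sign of N1 makes it positive if
  necessary.\<close>

lemma orthonormal_completion_ex:
 fixes a b :: "real^4"
 assumes gram: "(a \<bullet> a) * (b \<bullet> b) - (a \<bullet> b)^2 > 0"
 shows "\<exists>N1 N2. orthonormal_completion a b N1 N2 & det (vector [a, b, N1, N2] :: real^4^4) > 0"
proof -
 have "card {a, b} < DIM(real^4)" using card_insert_le_m1[of 2 "{b}" a] by simp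
 then obtain N1 where N1: "norm N1 = 1" "a \<bullet> N1 = 0" "b \<bullet> N1 = 0"
  using unit_vector_orthogonal_ex[of "{a, b}"] by auto
 have "card {a, b, N1} \<le> 3" by (simp add: card_insert_if)
 then have "card {a, b, N1} < DIM(real^4)" by simp
 then obtain N2 where N2: "norm N2 = 1" "a \<bullet> N2 = 0" "b \<bullet> N2 = 0" "N1 \<bullet> N2 = 0"
  using unit_vector_orthogonal_ex[of "{a, b, N1}"] by auto
 have oc: "orthonormal_completion a b N1 N2" "orthonormal_completion a b (- N1) N2"
  using N1 N2 by (simp_all add: orthonormal_completion_def)
 have "det (vector [a, b, N1, N2] :: real^4^4) \<noteq> 0"
  by (rule orthonormal_completion_det[OF gram oc(1)])
 then consider "det (vector [a, b, N1, N2] :: real^4^4) > 0" | "det (vector [a, b, - N1, N2] :: real^4^4) > 0"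
  unfolding det_vector4_minus by linarith
 then show ?thesis using oc by cases blast+
qed

text \<open>The vector (b . b) a - (a . b) b has squared length (b . b) times the Gram determinant,
  so equality in Cauchy-Schwarz would be a linear relation between a and b.\<close>

lemma gram_pos_if_det_nonzero:
 fixes a b N1 N2 :: "real^4"
 assumes "det (vector [a, b, N1, N2] :: real^4^4) \<noteq> 0"
 shows "(a \<bullet> a) * (b \<bullet> b) - (a \<bullet> b)^2 > 0"
proof -
 let ?g = "(a \<bullet> a) * (b \<bullet> b) - (a \<bullet> b)^2"
 have "?g \<ge> 0" using Cauchy_Schwarz_ineq[of a b] by simp
 moreover have "?g \<noteq> 0"
 proof
  assume g: "?g = 0"
  have ind: "\<And>x y. x *\<^sub>R a + y *\<^sub>R b + 0 *\<^sub>R N1 + 0 *\<^sub>R N2 = 0 ==> x = 0 & y = 0"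
   using assms unfolding det_vector4_nonzero_iff by metis
  let ?v = "(b \<bullet> b) *\<^sub>R a + (- (a \<bullet> b)) *\<^sub>R b"
  have "?v \<bullet> ?v = (b \<bullet> b) * ?g"
   by (simp add: inner_add_left inner_add_right inner_diff_left inner_diff_right inner_commute power2_eq_square algebra_simps)
  then have "?v = 0" using g by simp
  then have "b \<bullet> b = 0" using ind[of "b \<bullet> b" "- (a \<bullet> b)"] by simp
  then have "b = 0" by simp
  then show False using ind[of 0 1] by simp
 qed
 ultimately show ?thesis by simp
qed

lemma orthonormal_completion_expand:
 assumes N: "orthonormal_completion a b N1 N2" and gram: "(a \<bullet> a) * (b \<bullet> b) - (a \<bullet> b)^2 > 0"
 defines "g \<equiv> (a \<bullet> a) * (b \<bullet> b) - (a \<bullet> b)^2"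
 shows "v = (((b \<bullet> b) * (v \<bullet> a) - (a \<bullet> b) * (v \<bullet> b)) / g) *\<^sub>R a +
  (((a \<bullet> a) * (v \<bullet> b) - (a \<bullet> b) * (v \<bullet> a)) / g) *\<^sub>R b + (v \<bullet> N1) *\<^sub>R N1 + (v \<bullet> N2) *\<^sub>R N2"
  (is "v = ?s *\<^sub>R a + ?t *\<^sub>R b + _ + _")
proof -
 have g: "g > 0" unfolding g_def by (rule gram)
 note o = N[unfolded orthonormal_completion_def norm_eq_1]
 \<comment> \<open>The tangential coefficients solve the 2 x 2 Gram system by Cramer's rule; hence
   the remainder is orthogonal to all four vectors of the frame.\<close>
 let ?r = "v - (?s *\<^sub>R a + ?t *\<^sub>R b + (v \<bullet> N1) *\<^sub>R N1 + (v \<bullet> N2) *\<^sub>R N2)"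
 have s: "?s * (a \<bullet> a) + ?t * (a \<bullet> b) = v \<bullet> a"
 proof -
  have "?s * (a \<bullet> a) + ?t * (a \<bullet> b) = (v \<bullet> a) * g / g"
   by (simp add: g_def add_divide_distrib diff_divide_distrib power2_eq_square algebra_simps)
  then show ?thesis using g by simp
 qed
 have t: "?s * (a \<bullet> b) + ?t * (b \<bullet> b) = v \<bullet> b"
 proof -
  have "?s * (a \<bullet> b) + ?t * (b \<bullet> b) = (v \<bullet> b) * g / g"
   by (simp add: g_def add_divide_distrib diff_divide_distrib power2_eq_square algebra_simps)
  then show ?thesis using g by simp
 qed
 have "?r = 0"
 proof (rule orthogonal_to_frame_eq_0[of a b N1 N2])
  show "det (vector [a, b, N1, N2] :: real^4^4) \<noteq> 0" by (rule orthonormal_completion_det[OF gram N])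
  show "a \<bullet> ?r = 0" using o s by (simp only: inner_diff_right inner_add_right inner_scaleR_right inner_commute[of a v])
  show "b \<bullet> ?r = 0" using o t
   by (simp only: inner_diff_right inner_add_right inner_scaleR_right inner_commute[of b v] inner_commute[of b a])
  show "N1 \<bullet> ?r = 0" using o by (simp add: inner_diff_right inner_add_right inner_commute)
  show "N2 \<bullet> ?r = 0" using o by (simp add: inner_diff_right inner_add_right inner_commute)
 qed
 then show ?thesis by simp
qed

section \<open>Frame-free coefficients and the complex quartic differential\<close>

definition gram :: "(real^2 => real^4) => real^2 => real" where
 "gram X u = fffE X u * fffG X u - (fffF X u)^2"

text \<open>The inner product of the normal components; no normal frame enters, so \<open>nip\<close> is smooth in the jet.\<close>

definition nip :: "(real^2 => real^4) => real^2 => real^4 => real^4 => real" where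
 "nip X u a b = a \<bullet> b - (fffG X u * (a \<bullet> pdx X u) * (b \<bullet> pdx X u)
  - fffF X u * ((a \<bullet> pdx X u) * (b \<bullet> pdy X u) + (a \<bullet> pdy X u) * (b \<bullet> pdx X u))
  + fffE X u * (a \<bullet> pdy X u) * (b \<bullet> pdy X u)) * inverse (gram X u)"

lemma positive_normal_frame_gram: "positive_normal_frame X u N1 N2 ==> gram X u > 0"
 using gram_pos_if_det_nonzero[of "pdx X u" "pdy X u" N1 N2]
 by (simp add: positive_normal_frame_iff gram_def fffE_def fffF_def fffG_def)

lemma positive_normal_frame_ex: "gram X u > 0 ==> \<exists>N1 N2. positive_normal_frame X u N1 N2"
 using orthonormal_completion_ex[of "pdx X u" "pdy X u"]
 by (simp add: positive_normal_frame_iff gram_def fffE_def fffF_def fffG_def)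

text \<open>When a is expanded in the frame, the terms along \<open>pdx\<close> and
  \<open>pdy\<close> are exactly those which the definition of \<open>nip\<close> subtracts.\<close>

lemma nip_frame:
 assumes N: "orthonormal_completion (pdx X u) (pdy X u) N1 N2" and g: "gram X u > 0"
 shows "nip X u a b = (a \<bullet> N1) * (b \<bullet> N1) + (a \<bullet> N2) * (b \<bullet> N2)"
proof -
 have "a \<bullet> b = (((fffG X u * (a \<bullet> pdx X u) - fffF X u * (a \<bullet> pdy X u)) / gram X u) *\<^sub>R pdx X u +
  ((fffE X u * (a \<bullet> pdy X u) - fffF X u * (a \<bullet> pdx X u)) / gram X u) *\<^sub>R pdy X u + (a \<bullet> N1) *\<^sub>R N1 + (a \<bullet> N2) *\<^sub>R N2) \<bullet> b"
  using orthonormal_completion_expand[OF N, of a] g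
  unfolding gram_def fffE_def fffF_def fffG_def by simp
 then show ?thesis
  by (simp add: nip_def inner_add_left inner_commute[of _ b] divide_inverse algebra_simps)
qed

abbreviation "dxx X \<equiv> pdx (pdx X)"
abbreviation "dxy X \<equiv> pdx (pdy X)"
abbreviation "dyy X \<equiv> pdy (pdy X)"

text \<open>The sums over the two normals in \<open>axial_a1\<close> and \<open>axial_a0\<close> are
  inner products of normal components. With \<open>nip\<close> in their place, \<open>axa1\<close>
  and \<open>axa0\<close> take the same values without the choice of a frame and are smooth
  functions of the 2-jet.\<close>

definition axa1 :: "(real^2 => real^4) => real^2 => real" where
 "axa1 X u = (let E = fffE X u; F = fffF X u; G = fffG X u; n = nip X u;
   e = dxx X u; f = dxy X u; g = dyy X u
  in 4 * G * (E*G - 4*F^2) * n e e + 32 * E * F * G * n e f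
    + 4 * E^3 * n g g - 8 * E^2 * G * n e g - 16 * E^2 * G * n f f)"

definition axa0 :: "(real^2 => real^4) => real^2 => real" where
 "axa0 X u = (let E = fffE X u; F = fffF X u; G = fffG X u; n = nip X u;
   e = dxx X u; f = dxy X u; g = dyy X u
  in 4 * F * (E*G - 2*F^2) * n e e - 4 * E * (E*G - 4*F^2) * n e f
    + 4 * E^3 * n f g - 4 * E^2 * F * n e g - 8 * E^2 * F * n f f)"

lemma axial_a1_eq:
 assumes "positive_normal_frame X u N1 N2"
 shows "axial_a1 X N1 N2 u = axa1 X u"
proof -
 have oc: "orthonormal_completion (pdx X u) (pdy X u) N1 N2"
  using assms by (simp add: positive_normal_frame_iff)
 show ?thesis
  unfolding axial_a1_def axa1_def nip_frame[OF oc positive_normal_frame_gram[OF assms]] Let_def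
   sffe_def sfff_def sffg_def power2_eq_square ..
qed

lemma axial_a0_eq:
 assumes "positive_normal_frame X u N1 N2"
 shows "axial_a0 X N1 N2 u = axa0 X u"
proof -
 have oc: "orthonormal_completion (pdx X u) (pdy X u) N1 N2"
  using assms by (simp add: positive_normal_frame_iff)
 show ?thesis
  unfolding axial_a0_def axa0_def nip_frame[OF oc positive_normal_frame_gram[OF assms]] Let_def
   sffe_def sfff_def sffg_def power2_eq_square ..
qed

text \<open>\<open>zetaX, zetaY\<close> are the components of a complex isotropic tangent vector
 (a root of the first fundamental form, on the side given by the orientation), and \<open>axc\<close> is the
 complexified scalar square of the second fundamental form on it. Thus \<open>axc\<close> is a quartic
 differential: a change of the isotropic vector by a factor \<open>\<lambda>\<close> multiplies it by \<open>\<lambda>\<^sup>4\<close>.\<close>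

definition zetaX :: "(real^2 => real^4) => real^2 => complex" where
 "zetaX X u = Complex (sqrt (gram X u)) (fffF X u)"
definition zetaY :: "(real^2 => real^4) => real^2 => complex" where
 "zetaY X u = Complex 0 (- fffE X u)"

definition axc :: "(real^2 => real^4) => real^2 => complex" where
 "axc X u = Complex (fffE X u * axa1 X u / 4 - fffF X u * axa0 X u) (sqrt (gram X u) * axa0 X u)"

definition qform :: "complex => complex => real => real => real => complex" where
 "qform z w e f g = z^2 * of_real e + 2 * z * w * of_real f + w^2 * of_real g"

text \<open>With w^2 = E G - F^2 the vector (w + i F, - i E) is a root of the first fundamental
  form, and each \<open>qform\<close> is the second fundamental form at this vector in one normal
  direction. The sum of the two squares has real part E a1 / 4 - F a0 and imaginary part w a0; this
  is where the coefficients of \<open>axc\<close> come from.\<close>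

lemma axc_frame:
 assumes fr: "orthonormal_completion (pdx X u) (pdy X u) N1 N2" and g: "gram X u > 0"
 shows "axc X u = (qform (zetaX X u) (zetaY X u) (sffe X N1 u) (sfff X N1 u) (sffg X N1 u))^2 +
  (qform (zetaX X u) (zetaY X u) (sffe X N2 u) (sfff X N2 u) (sffg X N2 u))^2"
proof -
 define E F G w where "E = fffE X u" "F = fffF X u" "G = fffG X u" "w = sqrt (gram X u)"
 have w: "w^2 = E * G - F^2" using g by (simp add: E_F_G_w_def gram_def)
 have q: "qform (zetaX X u) (zetaY X u) e f g =
  Complex ((E*G - 2*F^2) * e + 2*E*F*f - E^2 * g) (w * (2*F*e - 2*E*f))" for e f g
 proof -
  have "(w^2 - F^2) * e = (E*G - 2*F^2) * e" unfolding w by (simp add: algebra_simps)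
  then show ?thesis
   unfolding qform_def zetaX_def zetaY_def E_F_G_w_def[symmetric]
   by (simp add: complex_eq_iff power2_eq_square algebra_simps)
 qed
 have sq: "(Complex p (w * q))^2 + (Complex p' (w * q'))^2 =
   Complex (p^2 + p'^2 - w^2 * (q^2 + q'^2)) (w * (2 * (p*q + p'*q')))" for p q p' q'
  by (simp add: complex_eq_iff power2_eq_square algebra_simps)
 show ?thesis
  unfolding q sq axc_def axa1_def axa0_def Let_def nip_frame[OF fr g] sffe_def[symmetric] sfff_def[symmetric]
   sffg_def[symmetric] E_F_G_w_def[symmetric] w complex.inject
  by (intro conjI) algebra+
qed

lemma axc_eq_0_iff: "gram X u > 0 ==> axc X u = 0 \<longleftrightarrow> axa0 X u = 0 & axa1 X u = 0"
proof -
 assume g: "gram X u > 0"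
 then have "fffE X u \<noteq> 0" by (auto simp: gram_def)
 then show ?thesis using g by (auto simp: axc_def complex_eq_iff)
qed

section \<open>Behaviour under coordinate changes and similarities\<close>

lemma frechet_derivative_eqI:
 "(f has_derivative f') (at x) ==> fder f (at x) v = f' v"
 by (drule frechet_derivative_at) simp

lemma frechet_derivative_compose_Ck:
 fixes f :: "'a::euclidean_space => 'b::euclidean_space" and g :: "'b => 'c::real_normed_vector"
 assumes "Ck_on k f S" "k > 0" "Ck_on j g T" "j > 0" "f ` S \<subseteq> T" "x \<in> S"
 shows "((%x. g (f x)) has_derivative (%v. fder g (at (f x)) (fder f (at x) v))) (at x)"
  and "fder (%x. g (f x)) (at x) v = fder g (at (f x)) (fder f (at x) v)"
proof -
 have "f x \<in> T" using assms by auto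
 then show 1: "((%x. g (f x)) has_derivative (%v. fder g (at (f x)) (fder f (at x) v))) (at x)"
  by (intro has_derivative_compose[of f _ x UNIV g] Ck_on_imp_has_derivative[OF assms(1,2,6)]
    Ck_on_imp_has_derivative[OF assms(3,4)])
 show "fder (%x. g (f x)) (at x) v = fder g (at (f x)) (fder f (at x) v)"
  by (rule frechet_derivative_eqI[OF 1])
qed

text \<open>The tangential part is left as unspecified k1, k2, because it disappears as soon as the
  second derivative is paired with a normal vector.\<close>

lemma second_derivative_compose:
 fixes psi :: "real^2 => real^2" and Y :: "real^2 => real^4" and v w :: "real^2"
 assumes S: "open S" and T: "open T" "psi ` S \<subseteq> T" and C: "Ck_on 2 psi S" "Ck_on 2 Y T" and u: "u \<in> S"
 defines "Z \<equiv> %x. Y (psi x)"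
 defines "a \<equiv> fder psi (at u) v" and "b \<equiv> fder psi (at u) w"
 shows "(%x. fder Z (at x) v) differentiable (at u)"
 and "\<exists>k1 k2. fder (%x. fder Z (at x) v) (at u) w =
  (a $ 1 * b $ 1) *\<^sub>R dxx Y (psi u) + (a $ 1 * b $ 2 + a $ 2 * b $ 1) *\<^sub>R dxy Y (psi u) +
  (a $ 2 * b $ 2) *\<^sub>R dyy Y (psi u) + k1 *\<^sub>R pdx Y (psi u) + k2 *\<^sub>R pdy Y (psi u)"
proof -
 have pu: "psi u \<in> T" using u T by auto
 have C2: "Ck_on (Suc 1) psi S" "Ck_on (Suc 1) Y T" using C by (simp_all add: numeral_2_eq_2)
 define c where "c x = fder psi (at x) v" for x
 have c: "Ck_on 1 c S" unfolding c_def by (rule Ck_on_frechet_derivative[OF C2(1)])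
 have Yx: "Ck_on 1 (pdx Y) T" and Yy: "Ck_on 1 (pdy Y) T"
  unfolding pdx_def[abs_def] pdy_def[abs_def] by (rule Ck_on_frechet_derivative[OF C2(2)])+
 have DZ: "fder Z (at x) v = c x $ 1 *\<^sub>R pdx Y (psi x) + c x $ 2 *\<^sub>R pdy Y (psi x)" if x: "x \<in> S" for x
 proof -
  have px: "psi x \<in> T" using x T by auto
  show ?thesis
   unfolding Z_def frechet_derivative_compose_Ck(2)[OF C(1) _ C(2) _ T(2) x, simplified]
    has_derivative_plane_expand[OF Ck_on_imp_differentiable[OF C(2) _ px, simplified], of "fder psi (at x) v"]
    c_def pdx_def pdy_def ..
 qed
 define c' where "c' = fder c (at u) w"
 have dc: "((%x. c x $ i) has_derivative (%w. fder c (at u) w $ i)) (at u)" for i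
  by (rule bounded_linear.has_derivative[OF bounded_linear_vec_nth Ck_on_imp_has_derivative[OF c _ u]]) simp
 have der: "((%x. c x $ 1 *\<^sub>R pdx Y (psi x) + c x $ 2 *\<^sub>R pdy Y (psi x)) has_derivative
  (%w. (c u $ 1 *\<^sub>R fder (pdx Y) (at (psi u)) (fder psi (at u) w)
     + fder c (at u) w $ 1 *\<^sub>R pdx Y (psi u)) +
   (c u $ 2 *\<^sub>R fder (pdy Y) (at (psi u)) (fder psi (at u) w)
     + fder c (at u) w $ 2 *\<^sub>R pdy Y (psi u)))) (at u)"
  by (intro has_derivative_add has_derivative_scaleR dc
    frechet_derivative_compose_Ck(1)[OF C(1) _ Yx _ T(2) u] frechet_derivative_compose_Ck(1)[OF C(1) _ Yy _ T(2) u]) simp_all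
 have der': "((%x. fder Z (at x) v) has_derivative
  (%w. (c u $ 1 *\<^sub>R fder (pdx Y) (at (psi u)) (fder psi (at u) w)
     + fder c (at u) w $ 1 *\<^sub>R pdx Y (psi u)) +
   (c u $ 2 *\<^sub>R fder (pdy Y) (at (psi u)) (fder psi (at u) w)
     + fder c (at u) w $ 2 *\<^sub>R pdy Y (psi u)))) (at u)"
  by (rule has_derivative_transform_within_open[OF der S u]) (simp add: DZ)
 then show "(%x. fder Z (at x) v) differentiable (at u)" by (rule differentiableI)
 have sym: "pdy (pdx Y) (psi u) = pdx (pdy Y) (psi u)"
  using second_derivative_symmetric[OF T(1) C(2) pu] unfolding pdx_def[abs_def] pdy_def[abs_def] .
 have e1: "fder (pdx Y) (at (psi u)) b = b $ 1 *\<^sub>R dxx Y (psi u) + b $ 2 *\<^sub>R dxy Y (psi u)"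
  using has_derivative_plane_expand[OF Ck_on_imp_differentiable[OF Yx _ pu], of b] sym
  by (simp add: pdx_def[of "pdx Y"] pdy_def[of "pdx Y"])
 have e2: "fder (pdy Y) (at (psi u)) b = b $ 1 *\<^sub>R dxy Y (psi u) + b $ 2 *\<^sub>R dyy Y (psi u)"
  using has_derivative_plane_expand[OF Ck_on_imp_differentiable[OF Yy _ pu], of b]
  by (simp add: pdx_def[of "pdy Y"] pdy_def[of "pdy Y"])
 have "fder (%x. fder Z (at x) v) (at u) w =
  (c u $ 1 *\<^sub>R fder (pdx Y) (at (psi u)) b + c' $ 1 *\<^sub>R pdx Y (psi u)) +
   (c u $ 2 *\<^sub>R fder (pdy Y) (at (psi u)) b + c' $ 2 *\<^sub>R pdy Y (psi u))"
  unfolding b_def c'_def by (rule frechet_derivative_eqI[OF der'])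
 also have "c u = a" by (simp add: c_def a_def)
 finally show "\<exists>k1 k2. fder (%x. fder Z (at x) v) (at u) w =
  (a $ 1 * b $ 1) *\<^sub>R dxx Y (psi u) + (a $ 1 * b $ 2 + a $ 2 * b $ 1) *\<^sub>R dxy Y (psi u) +
  (a $ 2 * b $ 2) *\<^sub>R dyy Y (psi u) + k1 *\<^sub>R pdx Y (psi u) + k2 *\<^sub>R pdy Y (psi u)"
  unfolding e1 e2 by (intro exI[of _ "c' $ 1"] exI[of _ "c' $ 2"]) (simp add: algebra_simps)
qed

lemma frechet_derivative_similarity:
 fixes g :: "'a::real_normed_vector => real^4" and Q :: "real^4^4"
 assumes "g differentiable (at u)"
 shows "((%x. sig *\<^sub>R (Q *v g x + t)) has_derivative (%v. sig *\<^sub>R (Q *v fder g (at u) v))) (at u)"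
proof -
 have "((%x. sig *\<^sub>R (Q *v g x + t)) has_derivative (%v. sig *\<^sub>R (Q *v fder g (at u) v + 0))) (at u)"
  by (intro has_derivative_scaleR_right has_derivative_add has_derivative_const
    bounded_linear.has_derivative[OF matrix_vector_mul_bounded_linear] assms[unfolded frechet_derivative_works])
 then show ?thesis by simp
qed

lemma orthogonal_matrix_inner: "orthogonal_matrix (Q :: real^4^4) ==> (Q *v a) \<bullet> (Q *v b) = a \<bullet> b"
 using orthogonal_transformation_matrix[of "(*v) Q"] by (simp add: orthogonal_transformation_def)

definition jac :: "(real^2 => real^2) => 2 => 2 => real^2 => real" where
 "jac psi i k u = fder psi (at u) (axis k 1) $ i"

lemma det_jac: "det (matrix (fder psi (at u))) = jac psi 1 1 u * jac psi 2 2 u - jac psi 1 2 u * jac psi 2 1 u"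
 by (simp add: det_2 matrix_def jac_def)

text \<open>The differential of \<open>psi\<close> carries roots of one first fundamental form to
  roots of the other, on the same side because its determinant is positive. So the isotropic vectors
  correspond up to a complex factor, and this is that factor when a similarity of ratio
  \<open>sig\<close> is applied as well.\<close>

definition axial_factor :: "(real^2 => real^4) => real => (real^2 => real^2) => real^2 => complex" where
 "axial_factor Y sig psi u = of_real (sig^2 * det (matrix (fder psi (at u))) / fffE Y (psi u)) *
  Complex (fffE Y (psi u) * jac psi 1 1 u + fffF Y (psi u) * jac psi 2 1 u) (sqrt (gram Y (psi u)) * jac psi 2 1 u)"

text \<open>The similarity multiplies the metric by sig^2, which gives sqrt (gram X) = sig^2 d w and
  from it the relation between the isotropic vectors. The exponents can then be read off:
  \<open>qform\<close> is of degree 2 in the vector, the second fundamental form gets one factor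
  \<open>sig\<close>, and squaring doubles both.\<close>

lemma axc_transform:
 fixes psi :: "real^2 => real^2" and Y X :: "real^2 => real^4" and Q :: "real^4^4"
 assumes S: "open S" and T: "open T" "psi ` S \<subseteq> T" and C: "Ck_on 2 psi S" "Ck_on 2 Y T" and u: "u \<in> S"
  and Q: "orthogonal_matrix Q" and sig: "sig > 0"
  and X: "\<And>x. x \<in> S ==> X x = sig *\<^sub>R (Q *v Y (psi x) + t)"
  and det: "det (matrix (fder psi (at u))) > 0"
  and gY: "gram Y (psi u) > 0"
 defines "lam \<equiv> axial_factor Y sig psi u"
 shows "gram X u > 0"
  and "axc X u = of_real (sig^2) * lam^4 * axc Y (psi u)"
  and "of_real (jac psi 1 1 u) * zetaX X u + of_real (jac psi 1 2 u) * zetaY X u = lam * zetaX Y (psi u)"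
  and "of_real (jac psi 2 1 u) * zetaX X u + of_real (jac psi 2 2 u) * zetaY X u = lam * zetaY Y (psi u)"
  and "lam \<noteq> 0"
  and "pdx X u = sig *\<^sub>R (Q *v (jac psi 1 1 u *\<^sub>R pdx Y (psi u) + jac psi 2 1 u *\<^sub>R pdy Y (psi u)))"
  and "pdy X u = sig *\<^sub>R (Q *v (jac psi 1 2 u *\<^sub>R pdx Y (psi u) + jac psi 2 2 u *\<^sub>R pdy Y (psi u)))"
proof -
 define Z where "Z x = Y (psi x)" for x
 define j11 j12 j21 j22 where j: "j11 = jac psi 1 1 u" "j12 = jac psi 1 2 u" "j21 = jac psi 2 1 u" "j22 = jac psi 2 2 u"
 define P R where PR: "P = pdx Y (psi u)" "R = pdy Y (psi u)"
 define E F G w where E: "E = fffE Y (psi u)" "F = fffF Y (psi u)" "G = fffG Y (psi u)" "w = sqrt (gram Y (psi u))"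
 define d where d: "d = j11 * j22 - j12 * j21"
 have d0: "d > 0" using det by (simp add: d det_jac j)
 have ww: "w^2 = E * G - F^2" "w > 0" using gY by (simp_all add: E gram_def)
 have E0: "E > 0" using gY by (auto simp: E(1) gram_def fffE_def)
 have EFG: "P \<bullet> P = E" "P \<bullet> R = F" "R \<bullet> P = F" "R \<bullet> R = G"
  by (simp_all add: PR E fffE_def fffF_def fffG_def inner_commute)
 have pu: "psi u \<in> T" using u T by auto
 have dZ: "Z differentiable (at x)" if "x \<in> S" for x
  unfolding Z_def by (rule differentiableI[OF frechet_derivative_compose_Ck(1)[OF C(1) _ C(2) _ T(2) that]]) simp_all
 have DX: "fder X (at x) v = sig *\<^sub>R (Q *v fder Z (at x) v)" if x: "x \<in> S" for x v
 proof -
  have "(X has_derivative (%v. sig *\<^sub>R (Q *v fder Z (at x) v))) (at x)"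
   by (rule has_derivative_transform_within_open[OF frechet_derivative_similarity[OF dZ[OF x], where t = t] S x])
    (simp add: X Z_def)
  then show ?thesis by (rule frechet_derivative_eqI)
 qed
 have DZ: "fder Z (at u) (axis k 1) = jac psi 1 k u *\<^sub>R P + jac psi 2 k u *\<^sub>R R" for k
  unfolding Z_def frechet_derivative_compose_Ck(2)[OF C(1) _ C(2) _ T(2) u, simplified]
    has_derivative_plane_expand[OF Ck_on_imp_differentiable[OF C(2) _ pu, simplified], of "fder psi (at u) (axis k 1)"]
    PR pdx_def pdy_def jac_def ..
 show px: "pdx X u = sig *\<^sub>R (Q *v (jac psi 1 1 u *\<^sub>R pdx Y (psi u) + jac psi 2 1 u *\<^sub>R pdy Y (psi u)))"
  and py: "pdy X u = sig *\<^sub>R (Q *v (jac psi 1 2 u *\<^sub>R pdx Y (psi u) + jac psi 2 2 u *\<^sub>R pdy Y (psi u)))"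
  by (simp_all add: pdx_def[of X] pdy_def[of X] DX[OF u] DZ PR)
 have Qi: "(sig *\<^sub>R (Q *v a)) \<bullet> (sig *\<^sub>R (Q *v b)) = sig^2 * (a \<bullet> b)" for a b
  by (simp add: orthogonal_matrix_inner[OF Q] power2_eq_square)
 have EX: "fffE X u = sig^2 * (E * j11^2 + 2 * F * j11 * j21 + G * j21^2)"
  unfolding fffE_def px Qi by (simp add: j PR[symmetric] inner_add_left inner_add_right EFG power2_eq_square algebra_simps)
 have FX: "fffF X u = sig^2 * (E * j11 * j12 + F * (j11 * j22 + j12 * j21) + G * j21 * j22)"
  unfolding fffF_def px py Qi by (simp add: j PR[symmetric] inner_add_left inner_add_right EFG power2_eq_square algebra_simps)
 have GX: "fffG X u = sig^2 * (E * j12^2 + 2 * F * j12 * j22 + G * j22^2)"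
  unfolding fffG_def py Qi by (simp add: j PR[symmetric] inner_add_left inner_add_right EFG power2_eq_square algebra_simps)
 have gX: "gram X u = (sig^2 * d * w)^2"
  unfolding gram_def EX FX GX power_mult_distrib ww d by algebra
 then show gX0: "gram X u > 0" using sig d0 ww by simp
 have wX: "sqrt (gram X u) = sig^2 * d * w" unfolding gX using sig d0 ww by simp
 have lf: "lam = of_real (sig^2 * d / E) * Complex (E * j11 + F * j21) (w * j21)"
  by (simp add: lam_def axial_factor_def det_jac d E j)
 have lw: "lam * of_real E = of_real (sig^2 * d) * Complex (E * j11 + F * j21) (w * j21)"
  unfolding lf using E0 by simp
 show "lam \<noteq> 0"
 proof
  assume "lam = 0"
  then have "Complex (E * j11 + F * j21) (w * j21) = 0" unfolding lf using sig d0 E0 by simp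
  then have "j21 = 0" "E * j11 + F * j21 = 0" using ww by (auto simp: complex_eq_iff)
  then show False using E0 d0 d by simp
 qed
 \<comment> \<open>Multiplication by E clears the denominator of \<open>axial_factor\<close>; what
   remains are polynomial identities modulo w^2 = E G - F^2.\<close>
 have z1: "of_real E * (of_real j11 * zetaX X u + of_real j12 * zetaY X u) = of_real E * (lam * zetaX Y (psi u))"
 proof -
  have r: "E * (j11 * (sig^2 * d * w)) = sig^2 * d * ((E * j11 + F * j21) * w - w * j21 * F)" by algebra
  have i: "E * (j11 * fffF X u - j12 * fffE X u) = sig^2 * d * ((E * j11 + F * j21) * F + w * j21 * w)"
   using ww(1) unfolding EX FX d by algebra
  have "of_real E * (lam * zetaX Y (psi u)) = (lam * of_real E) * zetaX Y (psi u)"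
   by (simp only: mult_ac)
  also have "\<dots> = of_real (sig^2 * d) * Complex (E * j11 + F * j21) (w * j21) * Complex w F"
   unfolding lw by (simp add: zetaX_def E)
  also have "\<dots> = Complex (E * (j11 * (sig^2 * d * w))) (E * (j11 * fffF X u - j12 * fffE X u))"
   unfolding r i by (simp add: complex_eq_iff algebra_simps)
  also have "\<dots> = of_real E * (of_real j11 * zetaX X u + of_real j12 * zetaY X u)"
   unfolding zetaX_def zetaY_def wX by (simp add: complex_eq_iff algebra_simps)
  finally show ?thesis by (rule sym)
 qed
 then show zz1: "of_real (jac psi 1 1 u) * zetaX X u + of_real (jac psi 1 2 u) * zetaY X u = lam * zetaX Y (psi u)"
  using E0 by (simp add: j)
 have z2: "of_real j21 * zetaX X u + of_real j22 * zetaY X u = lam * zetaY Y (psi u)"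
 proof -
  have i: "j21 * fffF X u - j22 * fffE X u = - (sig^2 * d * (E * j11 + F * j21))"
   unfolding EX FX d by algebra
  have "lam * zetaY Y (psi u) = (lam * of_real E) * Complex 0 (- 1)"
   unfolding zetaY_def E by (simp add: complex_eq_iff)
  also have "\<dots> = Complex (j21 * (sig^2 * d * w)) (j21 * fffF X u - j22 * fffE X u)"
   unfolding lw i by (simp add: complex_eq_iff algebra_simps)
  also have "\<dots> = of_real j21 * zetaX X u + of_real j22 * zetaY X u"
   unfolding zetaX_def zetaY_def wX by (simp add: complex_eq_iff algebra_simps)
  finally show ?thesis by (rule sym)
 qed
 then show zz2: "of_real (jac psi 2 1 u) * zetaX X u + of_real (jac psi 2 2 u) * zetaY X u = lam * zetaY Y (psi u)"
  by (simp add: j)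
 obtain N1 N2 where N: "positive_normal_frame Y (psi u) N1 N2" using positive_normal_frame_ex[OF gY] by blast
 then have oc: "orthonormal_completion P R N1 N2" by (simp add: positive_normal_frame_iff PR)
 \<comment> \<open>Q carries the normals of Y to normals of X, so the two sums of squares can be
   compared term by term.\<close>
 have ocX: "orthonormal_completion (pdx X u) (pdy X u) (Q *v N1) (Q *v N2)"
  using oc unfolding orthonormal_completion_def norm_eq_1 px py inner_scaleR_left orthogonal_matrix_inner[OF Q]
  by (simp add: PR inner_add_left)
 have second: "fder (%x. fder X (at x) (axis k 1)) (at u) (axis l 1) \<bullet> (Q *v N) =
   sig * (jac psi 1 k u * jac psi 1 l u * sffe Y N (psi u) + (jac psi 1 k u * jac psi 2 l u + jac psi 2 k u * jac psi 1 l u) * sfff Y N (psi u)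
    + jac psi 2 k u * jac psi 2 l u * sffg Y N (psi u))" if NN: "P \<bullet> N = 0" "R \<bullet> N = 0" for k l N
 proof -
  have dd: "(%x. fder Z (at x) (axis k 1)) differentiable (at u)"
   unfolding Z_def by (rule second_derivative_compose(1)[OF S T C u])
  have "((%x. fder X (at x) (axis k 1)) has_derivative
    (%v. sig *\<^sub>R (Q *v fder (%x. fder Z (at x) (axis k 1)) (at u) v))) (at u)"
   by (rule has_derivative_transform_within_open[OF frechet_derivative_similarity[OF dd, where t = 0] S u])
    (simp add: DX)
  then have "fder (%x. fder X (at x) (axis k 1)) (at u) (axis l 1) =
    sig *\<^sub>R (Q *v fder (%x. fder Z (at x) (axis k 1)) (at u) (axis l 1))"
   by (rule frechet_derivative_eqI)
  moreover obtain k1 k2 where "fder (%x. fder Z (at x) (axis k 1)) (at u) (axis l 1) =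
   (jac psi 1 k u * jac psi 1 l u) *\<^sub>R dxx Y (psi u) + (jac psi 1 k u * jac psi 2 l u + jac psi 2 k u * jac psi 1 l u) *\<^sub>R dxy Y (psi u) +
   (jac psi 2 k u * jac psi 2 l u) *\<^sub>R dyy Y (psi u) + k1 *\<^sub>R P + k2 *\<^sub>R R"
   using second_derivative_compose(2)[OF S T C u, of "axis k 1" "axis l 1"] unfolding Z_def PR jac_def by blast
  ultimately show ?thesis using NN
   by (simp add: orthogonal_matrix_inner[OF Q] inner_add_left sffe_def sfff_def sffg_def)
 qed
 have pdxX: "pdx X = (%x. fder X (at x) (axis 1 1))"
  and pdyX: "pdy X = (%x. fder X (at x) (axis 2 1))"
  by (simp_all add: fun_eq_iff pdx_def pdy_def)
 have e: "sffe X (Q *v N) u = sig * (j11^2 * sffe Y N (psi u) + 2 * j11 * j21 * sfff Y N (psi u) + j21^2 * sffg Y N (psi u))"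
  and f: "sfff X (Q *v N) u = sig * (j11 * j12 * sffe Y N (psi u) + (j11 * j22 + j12 * j21) * sfff Y N (psi u) + j21 * j22 * sffg Y N (psi u))"
  and g: "sffg X (Q *v N) u = sig * (j12^2 * sffe Y N (psi u) + 2 * j12 * j22 * sfff Y N (psi u) + j22^2 * sffg Y N (psi u))"
  if NN: "P \<bullet> N = 0" "R \<bullet> N = 0" for N
  unfolding sffe_def[of X] sfff_def[of X] sffg_def[of X] pdxX pdyX
   pdx_def[of "%u. fder X (at u) v" for v] pdy_def[of "%u. fder X (at u) v" for v]
  using second[OF NN] by (simp_all add: j power2_eq_square algebra_simps)
 \<comment> \<open>Transforming the coefficients of a binary quadratic form by the Jacobian amounts
   to applying the Jacobian to its argument.\<close>
 have qt: "qform z w' (sig * (j11^2 * e + 2 * j11 * j21 * f + j21^2 * g))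
   (sig * (j11 * j12 * e + (j11 * j22 + j12 * j21) * f + j21 * j22 * g))
   (sig * (j12^2 * e + 2 * j12 * j22 * f + j22^2 * g)) =
  of_real sig * qform (of_real j11 * z + of_real j12 * w') (of_real j21 * z + of_real j22 * w') e f g" for z w' e f g
  unfolding qform_def of_real_mult of_real_add of_real_power of_real_numeral by algebra
 have ql: "qform (l * z) (l * w') e f g = l^2 * qform z w' e f g" for l z w' e f g
  unfolding qform_def by algebra
 have N0: "P \<bullet> N1 = 0" "R \<bullet> N1 = 0" "P \<bullet> N2 = 0" "R \<bullet> N2 = 0"
  using oc by (simp_all add: orthonormal_completion_def)
 show "axc X u = of_real (sig^2) * lam^4 * axc Y (psi u)"
  unfolding axc_frame[OF ocX gX0] axc_frame[OF oc[unfolded PR] gY]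
   e[OF N0(1,2)] f[OF N0(1,2)] g[OF N0(1,2)] e[OF N0(3,4)] f[OF N0(3,4)] g[OF N0(3,4)] qt
  unfolding zz1[folded j] zz2[folded j] ql of_real_power by algebra
qed

text \<open>In terms of the double angle the image of the unit circle is centre + cos D + sin C, an
  ellipse with conjugate half-diameters D = (A - B) / 2 and C. It is a circle exactly when D and C
  are orthogonal and of equal length.\<close>

lemma circle_conic_iff:
 fixes A1 A2 B1 B2 C1 C2 :: real
 defines "f \<equiv> %x y. x^2 * A1 + 2 * x * y * C1 + y^2 * B1" and "g \<equiv> %x y. x^2 * A2 + 2 * x * y * C2 + y^2 * B2"
 shows "(\<exists>h1 h2 rho. rho \<ge> 0 & (\<forall>z1 z2. (\<exists>x y. x^2 + y^2 = 1 & z1 = f x y & z2 = g x y) \<longleftrightarrow> (z1 - h1)^2 + (z2 - h2)^2 = rho^2))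
  \<longleftrightarrow> (A1 - B1)^2 + (A2 - B2)^2 = 4 * (C1^2 + C2^2) & (A1 - B1) * C1 + (A2 - B2) * C2 = 0"
  (is "?L \<longleftrightarrow> ?R")
proof
 assume ?L
 then obtain h1 h2 rho where h: "\<And>x y. x^2 + y^2 = 1 ==> (f x y - h1)^2 + (g x y - h2)^2 = rho^2" by blast
 \<comment> \<open>The point (2 r, r) of the unit circle has a double angle with cosine 3/5 and sine
   4/5. It serves to detect the product D . C.\<close>
 define r where "r = sqrt (1/5)"
 have r: "r^2 = 1/5" by (simp add: r_def)
 define s where "s = sqrt (1/2)"
 have s: "s^2 = 1/2" by (simp add: s_def)
 define K1 K2 D1 D2 where K: "K1 = (A1 + B1) / 2 - h1" "K2 = (A2 + B2) / 2 - h2" "D1 = (A1 - B1) / 2" "D2 = (A2 - B2) / 2"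
 have pt: "(K1 + (x^2 - y^2) * D1 + 2 * x * y * C1)^2 + (K2 + (x^2 - y^2) * D2 + 2 * x * y * C2)^2 = rho^2"
  if xy: "x^2 + y^2 = 1" for x y
 proof -
  have "f x y - h1 = K1 + (x^2 - y^2) * D1 + 2 * x * y * C1"
  proof -
   have "x^2 = (1 + (x^2 - y^2)) / 2" "y^2 = (1 - (x^2 - y^2)) / 2" using xy by simp_all
   then show ?thesis unfolding f_def K by (simp add: field_simps) (use xy in algebra)
  qed
  moreover have "g x y - h2 = K2 + (x^2 - y^2) * D2 + 2 * x * y * C2"
  proof -
   show ?thesis unfolding g_def K by (simp add: field_simps) (use xy in algebra)
  qed
  ultimately show ?thesis using h[OF xy] by simp
 qed
 \<comment> \<open>K is the unknown offset from the supposed centre (h1, h2). Opposite points of the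
   ellipse eliminate it: adding their equations gives |K|^2 + |D|^2 = rho^2, and likewise for C and
   for 3/5 D + 4/5 C. Comparison yields |D| = |C| and then D . C = 0.\<close>
 have 1: "(K1 + D1)^2 + (K2 + D2)^2 = rho^2" using pt[of 1 0] by simp
 have 2: "(K1 - D1)^2 + (K2 - D2)^2 = rho^2" using pt[of 0 1] by simp
 have ss: "2 * s * s = 1" using s by (simp add: power2_eq_square)
 have 3: "(K1 + C1)^2 + (K2 + C2)^2 = rho^2" using pt[of s s] s ss by simp
 have 4: "(K1 - C1)^2 + (K2 - C2)^2 = rho^2" using pt[of s "-s"] s ss by simp
 have r5: "(2 * r)^2 + r^2 = 1" "r^2 + (- 2 * r)^2 = 1" "(2 * r)^2 - r^2 = 3/5" "r^2 - (-2 * r)^2 = - 3/5"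
  "2 * (2 * r) * r = 4/5" "2 * r * (- 2 * r) = - 4/5"
  using r by (simp_all add: power_mult_distrib) (simp_all add: power2_eq_square)
 have 5: "(K1 + 3/5 * D1 + 4/5 * C1)^2 + (K2 + 3/5 * D2 + 4/5 * C2)^2 = rho^2"
  using pt[OF r5(1)] unfolding r5 by simp
 have 6: "(K1 - 3/5 * D1 - 4/5 * C1)^2 + (K2 - 3/5 * D2 - 4/5 * C2)^2 = rho^2"
  using pt[OF r5(2)] unfolding r5 by simp
 have DC: "D1^2 + D2^2 = C1^2 + C2^2" using 1 2 3 4 by algebra
 have "D1 * C1 + D2 * C2 = 0" using 1 2 3 4 5 6 by algebra
 with DC show ?R unfolding K by (simp add: field_simps power2_eq_square)
next
 assume R: ?R
 define D1 D2 where D: "D1 = (A1 - B1) / 2" "D2 = (A2 - B2) / 2"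
 have R1: "D1^2 + D2^2 = C1^2 + C2^2" and R2: "D1 * C1 + D2 * C2 = 0"
  using R unfolding D by (simp_all add: field_simps power2_eq_square)
 define rho where "rho = sqrt (C1^2 + C2^2)"
 have rho: "rho \<ge> 0" "rho^2 = C1^2 + C2^2" by (simp_all add: rho_def)
 have fg: "f x y - (A1 + B1) / 2 = (x^2 - y^2) * D1 + 2 * x * y * C1"
  "g x y - (A2 + B2) / 2 = (x^2 - y^2) * D2 + 2 * x * y * C2" if xy: "x^2 + y^2 = 1" for x y
  unfolding f_def g_def D by (simp_all add: field_simps) (use xy in algebra)+
 have "(\<exists>x y. x^2 + y^2 = 1 & z1 = f x y & z2 = g x y) \<longleftrightarrow> (z1 - (A1 + B1) / 2)^2 + (z2 - (A2 + B2) / 2)^2 = rho^2" for z1 z2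
 proof
  assume "\<exists>x y. x^2 + y^2 = 1 & z1 = f x y & z2 = g x y"
  then obtain x y where xy: "x^2 + y^2 = 1" and z: "z1 = f x y" "z2 = g x y" by blast
  show "(z1 - (A1 + B1) / 2)^2 + (z2 - (A2 + B2) / 2)^2 = rho^2"
   unfolding z fg[OF xy] rho using R1 R2 xy by algebra
 next
  assume z: "(z1 - (A1 + B1) / 2)^2 + (z2 - (A2 + B2) / 2)^2 = rho^2"
  define y1 y2 where y: "y1 = z1 - (A1 + B1) / 2" "y2 = z2 - (A2 + B2) / 2"
  have yrho: "y1^2 + y2^2 = rho^2" using z by (simp add: y)
  have "\<exists>x y. x^2 + y^2 = 1 & y1 = (x^2 - y^2) * D1 + 2 * x * y * C1 & y2 = (x^2 - y^2) * D2 + 2 * x * y * C2"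
  proof (cases "rho = 0")
   \<comment> \<open>The ellipse has shrunk to a point.\<close>
   case True
   then have "C1 = 0" "C2 = 0" using rho(2) by (simp_all add: sum_power2_eq_zero_iff)
   then have "D1 = 0" "D2 = 0" using R1 by (simp_all add: sum_power2_eq_zero_iff)
   have "y1 = 0" "y2 = 0" using yrho True by (simp_all add: sum_power2_eq_zero_iff)
   then show ?thesis using \<open>C1 = 0\<close> \<open>C2 = 0\<close> \<open>D1 = 0\<close> \<open>D2 = 0\<close> by (intro exI[of _ 1] exI[of _ 0]) simp
  next
   case False
   define c s where cs: "c = (y1 * D1 + y2 * D2) / rho^2" "s = (y1 * C1 + y2 * C2) / rho^2"
   have r0: "rho^2 \<noteq> 0" using False by simp
   have c': "c * rho^2 = y1 * D1 + y2 * D2" "s * rho^2 = y1 * C1 + y2 * C2" using r0 by (simp_all add: cs)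
   have y1: "y1 * rho^2 = (c * D1 + s * C1) * rho^2"
   proof -
    have "y1 * rho^2 * rho^2 = ((y1 * D1 + y2 * D2) * D1 + (y1 * C1 + y2 * C2) * C1) * rho^2"
     unfolding rho using R1 R2 by algebra
    then have "y1 * rho^2 = (y1 * D1 + y2 * D2) * D1 + (y1 * C1 + y2 * C2) * C1"
     unfolding mult_right_cancel[OF r0] .
    then show ?thesis unfolding c'[symmetric] by algebra
   qed
   have y2: "y2 * rho^2 = (c * D2 + s * C2) * rho^2"
   proof -
    have "y2 * rho^2 * rho^2 = ((y1 * D1 + y2 * D2) * D2 + (y1 * C1 + y2 * C2) * C2) * rho^2"
     unfolding rho using R1 R2 by algebra
    then have "y2 * rho^2 = (y1 * D1 + y2 * D2) * D2 + (y1 * C1 + y2 * C2) * C2"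
     unfolding mult_right_cancel[OF r0] .
    then show ?thesis unfolding c'[symmetric] by algebra
   qed
   have yy: "y1 = c * D1 + s * C1" "y2 = c * D2 + s * C2" using y1 y2 r0 by simp_all
   have "rho^2 * (c^2 + s^2) = rho^2 * 1"
    using yrho R1 R2 rho(2) unfolding yy by algebra
   then have cs1: "c^2 + s^2 = 1" using r0 by simp
   \<comment> \<open>The complex square root halves the angle: it leads from (c, s), which lives on
     the circle of double angles, to a preimage (x, y) on the unit circle.\<close>
   define v where "v = csqrt (Complex c s)"
   have v2: "v^2 = Complex c s" by (simp add: v_def)
   have "(cmod v)^2 = cmod (v^2)" by (simp add: norm_power)
   also have "\<dots> = 1" unfolding v2 by (simp add: cmod_def cs1)
   finally have "(Re v)^2 + (Im v)^2 = 1" by (simp add: cmod_def)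
   moreover have "c = (Re v)^2 - (Im v)^2" "s = 2 * Re v * Im v"
    using arg_cong[OF v2, of Re] arg_cong[OF v2, of Im] by (simp_all add: power2_eq_square algebra_simps)
   ultimately show ?thesis using yy by (intro exI[of _ "Re v"] exI[of _ "Im v"]) simp
  qed
  then obtain x y where xy: "x^2 + y^2 = 1" "y1 = (x^2 - y^2) * D1 + 2 * x * y * C1" "y2 = (x^2 - y^2) * D2 + 2 * x * y * C2"
   by blast
  then show "\<exists>x y. x^2 + y^2 = 1 & z1 = f x y & z2 = g x y"
   using fg[OF xy(1)] unfolding y by (intro exI[of _ x] exI[of _ y]) auto
 qed
 then show ?L using rho(1) by blast
qed

lemma qform_zeta:
 assumes "gram X u > 0"
 shows "qform (zetaX X u) (zetaY X u) e f g =
  Complex ((sqrt (gram X u))^2 * e - ((fffF X u)^2 * e - 2 * fffE X u * fffF X u * f + (fffE X u)^2 * g))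
   (2 * (sqrt (gram X u) * (fffF X u * e - fffE X u * f)))"
 unfolding qform_def zetaX_def zetaY_def by (simp add: complex_eq_iff power2_eq_square algebra_simps)

lemma span_pair: "span {a, b} = {x *\<^sub>R a + y *\<^sub>R b | x y. True}"
proof -
 have "v \<in> span {a, b} \<longleftrightarrow> (\<exists>x y. v = x *\<^sub>R a + y *\<^sub>R b)" for v
 proof
  assume "v \<in> span {a, b}"
  then obtain k l where "v - k *\<^sub>R a = l *\<^sub>R b"
   unfolding span_insert[of a "{b}"] span_singleton by blast
  then have "v = k *\<^sub>R a + l *\<^sub>R b" by (simp add: algebra_simps)
  then show "\<exists>x y. v = x *\<^sub>R a + y *\<^sub>R b" by blast
 next
  assume "\<exists>x y. v = x *\<^sub>R a + y *\<^sub>R b"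
  then obtain x y where v: "v = x *\<^sub>R a + y *\<^sub>R b" by blast
  show "v \<in> span {a, b}" unfolding v by (intro span_add span_scale span_base) simp_all
 qed
 then show ?thesis by auto
qed

text \<open>In the orthonormal tangent basis formed from the real and imaginary parts of the
  isotropic vector, the value of \<open>qform\<close> in a normal direction is A - B + 2 i C up to a
  positive factor. The two real conditions of \<open>circle_conic_iff\<close> are thus the real and
  the imaginary part of one equation: the sum of the squares of these numbers is zero.\<close>

lemma curvature_ellipse_circle_iff:
 assumes fr: "positive_normal_frame X u N1 N2"
 shows "(\<exists>h\<in>span {N1, N2}. \<exists>rho\<ge>0. curvature_ellipse X N1 N2 u = sphere h rho \<inter> span {N1, N2}) \<longleftrightarrow> axc X u = 0"
proof -
 define E F G w where E: "E = fffE X u" "F = fffF X u" "G = fffG X u" "w = sqrt (gram X u)"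
 have g: "gram X u > 0" by (rule positive_normal_frame_gram[OF fr])
 have oc: "orthonormal_completion (pdx X u) (pdy X u) N1 N2" using fr by (simp add: positive_normal_frame_iff)
 have E0: "E > 0" using g by (auto simp: E(1) gram_def fffE_def)
 have w: "w^2 = E * G - F^2" "w > 0" using g by (simp_all add: E gram_def)
 \<comment> \<open>The real part (w, 0) and the imaginary part (F, - E) of the isotropic vector are
   orthogonal and both of length w sqrt E. The number k normalizes them, and V x y below is k times
   the combination of the two with coefficients x and y.\<close>
 define k where "k = 1 / (w * sqrt E)"
 have k: "k^2 * (w^2 * E) = 1" "k > 0" using w(2) E0 by (simp_all add: k_def power_divide power_mult_distrib)
 define \<iota> where "\<iota> z1 z2 = z1 *\<^sub>R N1 + z2 *\<^sub>R N2" for z1 z2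
 have N: "N1 \<bullet> N1 = 1" "N2 \<bullet> N2 = 1" "N1 \<bullet> N2 = 0" "N2 \<bullet> N1 = 0"
  using oc by (simp_all add: orthonormal_completion_def norm_eq_1 inner_commute)
 have \<iota>_in: "\<iota> z1 z2 \<bullet> N1 = z1" "\<iota> z1 z2 \<bullet> N2 = z2" for z1 z2
  using N by (simp_all add: \<iota>_def inner_add_left)
 have \<iota>_inj: "\<iota> z1 z2 = \<iota> h1 h2 \<longleftrightarrow> z1 = h1 & z2 = h2" for z1 z2 h1 h2
  using \<iota>_in by metis
 have \<iota>_dist: "(dist (\<iota> h1 h2) (\<iota> z1 z2))^2 = (z1 - h1)^2 + (z2 - h2)^2" for z1 z2 h1 h2
 proof -
  have "\<iota> h1 h2 - \<iota> z1 z2 = \<iota> (h1 - z1) (h2 - z2)" by (simp add: \<iota>_def algebra_simps)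
  then show ?thesis using N
   unfolding dist_norm power2_norm_eq_inner
   by (simp add: \<iota>_def inner_add_left inner_add_right power2_eq_square algebra_simps)
 qed
 have span: "v \<in> span {N1, N2} \<longleftrightarrow> (\<exists>z1 z2. v = \<iota> z1 z2)" for v
  unfolding span_pair \<iota>_def by auto
 define A B C where A: "A N = k^2 * (w^2 * sffe X N u)"
  and B: "B N = k^2 * (F^2 * sffe X N u - 2 * E * F * sfff X N u + E^2 * sffg X N u)"
  and C: "C N = k^2 * (w * (F * sffe X N u - E * sfff X N u))" for N
 define V where "V x y = (vector [k * (w * x + F * y), - (k * E * y)] :: real^2)" for x y
 have V1: "first_form X u (V x y) = x^2 + y^2" for x y
 proof -
  have "first_form X u (V x y) = k^2 * (E * (w * x + F * y)^2 - 2 * F * E * y * (w * x + F * y) + G * E^2 * y^2)"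
   by (simp add: first_form_def V_def E[symmetric] power2_eq_square algebra_simps)
  also have "\<dots> = (k^2 * (w^2 * E)) * (x^2 + y^2)" using w(1) by algebra
  finally show ?thesis using k by simp
 qed
 have Vsurj: "\<exists>x y. v = V x y" for v
 proof -
  have "v = V ((v $ 1 + v $ 2 / E * F) / (k * w)) (- v $ 2 / (k * E))"
   using k(2) w(2) E0 by (simp add: V_def vec_eq_iff forall_2 field_simps)
  then show ?thesis by blast
 qed
 have val: "sffe X N u * (V x y $ 1)^2 + 2 * sfff X N u * V x y $ 1 * V x y $ 2 + sffg X N u * (V x y $ 2)^2 =
  x^2 * A N + 2 * x * y * C N + y^2 * B N" for N x y
  unfolding V_def vector_2 A B C by algebra
 have sec: "second_form X N1 N2 u (V x y) = \<iota> (x^2 * A N1 + 2 * x * y * C N1 + y^2 * B N1) (x^2 * A N2 + 2 * x * y * C N2 + y^2 * B N2)" for x y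
  unfolding second_form_def by (simp add: \<iota>_def val)
 have ell: "v \<in> curvature_ellipse X N1 N2 u \<longleftrightarrow> (\<exists>x y. x^2 + y^2 = 1 &
   v = \<iota> (x^2 * A N1 + 2 * x * y * C N1 + y^2 * B N1) (x^2 * A N2 + 2 * x * y * C N2 + y^2 * B N2))" for v
 proof
  assume "v \<in> curvature_ellipse X N1 N2 u"
  then obtain s where s: "first_form X u s = 1" "v = second_form X N1 N2 u s"
   by (auto simp: curvature_ellipse_def normal_curvature_def)
  obtain x y where "s = V x y" using Vsurj by blast
  then show "\<exists>x y. x^2 + y^2 = 1 &
   v = \<iota> (x^2 * A N1 + 2 * x * y * C N1 + y^2 * B N1) (x^2 * A N2 + 2 * x * y * C N2 + y^2 * B N2)"
   using s V1 sec by auto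
 next
  assume "\<exists>x y. x^2 + y^2 = 1 &
   v = \<iota> (x^2 * A N1 + 2 * x * y * C N1 + y^2 * B N1) (x^2 * A N2 + 2 * x * y * C N2 + y^2 * B N2)"
  then obtain x y where xy: "x^2 + y^2 = 1" "v = second_form X N1 N2 u (V x y)" using sec by auto
  then have "first_form X u (V x y) = 1" using V1 by simp
  then show "v \<in> curvature_ellipse X N1 N2 u"
   unfolding curvature_ellipse_def using xy(2)
   by (intro image_eqI[of _ _ "V x y"]) (simp_all add: normal_curvature_def)
 qed
 have "(\<exists>h\<in>span {N1, N2}. \<exists>rho\<ge>0. curvature_ellipse X N1 N2 u = sphere h rho \<inter> span {N1, N2}) \<longleftrightarrow>
  (\<exists>h1 h2 rho. rho \<ge> 0 & (\<forall>z1 z2. (\<exists>x y. x^2 + y^2 = 1 &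
   z1 = x^2 * A N1 + 2 * x * y * C N1 + y^2 * B N1 & z2 = x^2 * A N2 + 2 * x * y * C N2 + y^2 * B N2) \<longleftrightarrow>
   (z1 - h1)^2 + (z2 - h2)^2 = rho^2))" (is "?L = ?M")
 proof
  assume ?L
  then obtain v rho where v: "v \<in> span {N1, N2}" "rho \<ge> 0" "curvature_ellipse X N1 N2 u = sphere v rho \<inter> span {N1, N2}"
   by blast
  then obtain h1 h2 where "v = \<iota> h1 h2" using span by blast
  with v have h: "rho \<ge> 0" "curvature_ellipse X N1 N2 u = sphere (\<iota> h1 h2) rho \<inter> span {N1, N2}" by simp_all
  have "(\<exists>x y. x^2 + y^2 = 1 &
   z1 = x^2 * A N1 + 2 * x * y * C N1 + y^2 * B N1 & z2 = x^2 * A N2 + 2 * x * y * C N2 + y^2 * B N2) \<longleftrightarrow>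
   (z1 - h1)^2 + (z2 - h2)^2 = rho^2" for z1 z2
  proof -
   have "(\<exists>x y. x^2 + y^2 = 1 &
    z1 = x^2 * A N1 + 2 * x * y * C N1 + y^2 * B N1 & z2 = x^2 * A N2 + 2 * x * y * C N2 + y^2 * B N2)
    \<longleftrightarrow> \<iota> z1 z2 \<in> curvature_ellipse X N1 N2 u"
    unfolding ell \<iota>_inj ..
   also have "\<dots> \<longleftrightarrow> dist (\<iota> h1 h2) (\<iota> z1 z2) = rho" using h(2) span by auto
   also have "\<dots> \<longleftrightarrow> (dist (\<iota> h1 h2) (\<iota> z1 z2))^2 = rho^2" using h(1) by (simp add: power2_eq_iff_nonneg)
   finally show ?thesis unfolding \<iota>_dist .
  qed
  then show ?M using h(1) by blast
 next
  assume ?M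
  then obtain h1 h2 rho where h: "rho \<ge> 0" "\<And>z1 z2. (\<exists>x y. x^2 + y^2 = 1 &
   z1 = x^2 * A N1 + 2 * x * y * C N1 + y^2 * B N1 & z2 = x^2 * A N2 + 2 * x * y * C N2 + y^2 * B N2) \<longleftrightarrow>
   (z1 - h1)^2 + (z2 - h2)^2 = rho^2" by blast
  have sph: "(z1 - h1)^2 + (z2 - h2)^2 = rho^2 \<longleftrightarrow> \<iota> z1 z2 \<in> sphere (\<iota> h1 h2) rho" for z1 z2
   unfolding \<iota>_dist[symmetric] using h(1) by (simp add: power2_eq_iff_nonneg)
  have "v \<in> curvature_ellipse X N1 N2 u \<longleftrightarrow> v \<in> sphere (\<iota> h1 h2) rho \<inter> span {N1, N2}" for v
  proof
   assume "v \<in> curvature_ellipse X N1 N2 u"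
   then obtain x y where xy: "x^2 + y^2 = 1"
    "v = \<iota> (x^2 * A N1 + 2 * x * y * C N1 + y^2 * B N1) (x^2 * A N2 + 2 * x * y * C N2 + y^2 * B N2)"
    unfolding ell by blast
   then have "v \<in> sphere (\<iota> h1 h2) rho" unfolding xy(2) sph[symmetric] h(2)[symmetric] by blast
   then show "v \<in> sphere (\<iota> h1 h2) rho \<inter> span {N1, N2}" using span xy(2) by blast
  next
   assume "v \<in> sphere (\<iota> h1 h2) rho \<inter> span {N1, N2}"
   moreover from this obtain z1 z2 where zv: "v = \<iota> z1 z2" using span by (metis IntD2)
   ultimately have z: "v = \<iota> z1 z2" "(z1 - h1)^2 + (z2 - h2)^2 = rho^2" using sph by (metis IntD1)+
   then obtain x y where "x^2 + y^2 = 1" "z1 = x^2 * A N1 + 2 * x * y * C N1 + y^2 * B N1"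
     "z2 = x^2 * A N2 + 2 * x * y * C N2 + y^2 * B N2"
    unfolding h(2)[symmetric] by blast
   then show "v \<in> curvature_ellipse X N1 N2 u" unfolding ell z(1) by blast
  qed
  then have "curvature_ellipse X N1 N2 u = sphere (\<iota> h1 h2) rho \<inter> span {N1, N2}" by blast
  moreover have "\<iota> h1 h2 \<in> span {N1, N2}" using span by blast
  ultimately show ?L using h(1) by blast
 qed
 also have "\<dots> \<longleftrightarrow> (A N1 - B N1)^2 + (A N2 - B N2)^2 = 4 * ((C N1)^2 + (C N2)^2) &
   (A N1 - B N1) * C N1 + (A N2 - B N2) * C N2 = 0"
  by (rule circle_conic_iff)
 also have "\<dots> \<longleftrightarrow> axc X u = 0"
 proof -
  have q: "of_real (k^2) * qform (zetaX X u) (zetaY X u) (sffe X N u) (sfff X N u) (sffg X N u) = Complex (A N - B N) (2 * C N)" for N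
   unfolding qform_zeta[OF g] E[symmetric] A B C by (simp add: complex_eq_iff algebra_simps)
  have "of_real (k^2)^2 * axc X u = (Complex (A N1 - B N1) (2 * C N1))^2 + (Complex (A N2 - B N2) (2 * C N2))^2"
   unfolding axc_frame[OF oc g] q[symmetric] by (simp add: power_mult_distrib distrib_left)
  also have "\<dots> = Complex ((A N1 - B N1)^2 + (A N2 - B N2)^2 - 4 * ((C N1)^2 + (C N2)^2))
    (4 * ((A N1 - B N1) * C N1 + (A N2 - B N2) * C N2))"
   by (simp add: complex_eq_iff power2_eq_square algebra_simps)
  finally have "of_real (k^2)^2 * axc X u = Complex ((A N1 - B N1)^2 + (A N2 - B N2)^2 - 4 * ((C N1)^2 + (C N2)^2))
    (4 * ((A N1 - B N1) * C N1 + (A N2 - B N2) * C N2))" .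
  moreover have "axc X u = 0 \<longleftrightarrow> of_real (k^2)^2 * axc X u = 0" using k(2) by simp
  ultimately have "axc X u = 0 \<longleftrightarrow> Complex ((A N1 - B N1)^2 + (A N2 - B N2)^2 - 4 * ((C N1)^2 + (C N2)^2))
    (4 * ((A N1 - B N1) * C N1 + (A N2 - B N2) * C N2)) = 0" by (simp only:)
  moreover have "Complex (p - q) (4 * r) = 0 \<longleftrightarrow> p = q & r = 0" for p q r
   by (simp add: complex_eq_iff)
  ultimately show ?thesis by (simp only:)
 qed
 finally show ?thesis .
qed

lemma axiumbilic_iff:
 "axiumbilic A \<alpha> p \<longleftrightarrow> (\<exists>c\<in>A. p \<in> dom_of c & gram (\<alpha> \<circ> param c) (snd c p) > 0 & axc (\<alpha> \<circ> param c) (snd c p) = 0)"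
 unfolding axiumbilic_def
 using curvature_ellipse_circle_iff positive_normal_frame_gram positive_normal_frame_ex by meson

section \<open>The discriminant of the separatrix quintic\<close>

text \<open>Near a zero \<open>q\<close> of the quartic differential, its linear part along \<open>Re (z \<zeta>)\<close> is \<open>\<alpha> z + \<beta> cnj z\<close>,
 and the separatrix directions are the zeros of \<open>Im (\<alpha> z\<^sup>5 + \<beta> z\<^sup>4 cnj z)\<close> on the unit circle. A double
 zero means, after a rotation, \<open>\<alpha> = 3 s + i t\<close> and \<open>\<beta> = - 5 s - i t\<close>; then
 \<open>\<bar>\<alpha>\<bar>\<^sup>2 = 9 s\<^sup>2 + t\<^sup>2\<close> and \<open>\<bar>\<beta>\<bar>\<^sup>2 = 25 s\<^sup>2 + t\<^sup>2\<close>, and \<open>quintic_P\<close> expresses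
 \<open>Re (\<alpha>\<^sup>3 cnj \<beta>\<^sup>5)\<close> through them. A triple zero has \<open>t = 0\<close>.\<close>

definition quintic_P :: "real => real => real" where
 "quintic_P A B = 3125/512 * A^4 - 625/128 * A^3 * B - 25/256 * A^2 * B^2 - 9/128 * A * B^3 - 27/512 * B^4"

definition disc5 :: "complex => complex => real" where
 "disc5 \<alpha> \<beta> = quintic_P ((cmod \<alpha>)^2) ((cmod \<beta>)^2) - Re (\<alpha>^3 * cnj \<beta>^5)"

text \<open>S and T are the s^2 and t^2 of the parametrization by a double zero. The identity is
  |Z|^2 = (Re Z)^2 + (Im Z)^2 for Z = (3 s + i t)^3 (- 5 s + i t)^5, whose imaginary part is 16 s
  t^3 (t^4 + 22 s^2 t^2 + 125 s^4).\<close>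

lemma quintic_P_identity:
 defines "S A B \<equiv> (B - A) / 16" and "T A B \<equiv> (25 * A - 9 * B) / (16::real)"
 shows "A^3 * B^5 = (quintic_P A B)^2 +
  256 * S A B * T A B^3 * (T A B^2 + 22 * S A B * T A B + 125 * S A B^2)^2"
 unfolding quintic_P_def S_def T_def by (simp add: field_simps) algebra

lemma quintic_P_scale: "quintic_P (c * A) (c * B) = c^4 * quintic_P A B"
 unfolding quintic_P_def by algebra

text \<open>Both terms of \<open>disc5\<close> are homogeneous of degree 8. The three hypotheses are
  those satisfied by the multipliers of a coordinate change, see
  \<open>axial_factor_scale\<close>.\<close>

lemma disc5_scale:
 assumes "(cmod l1)^2 = r" "(cmod l2)^2 = r" "l1^3 * cnj l2^5 = of_real (r^4)"
 shows "disc5 (l1 * \<alpha>) (l2 * \<beta>) = r^4 * disc5 \<alpha> \<beta>"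
proof -
 have "(l1 * \<alpha>)^3 * cnj (l2 * \<beta>)^5 = (l1^3 * cnj l2^5) * (\<alpha>^3 * cnj \<beta>^5)"
  by (simp add: power_mult_distrib)
 then have "Re ((l1 * \<alpha>)^3 * cnj (l2 * \<beta>)^5) = r^4 * Re (\<alpha>^3 * cnj \<beta>^5)"
  unfolding assms(3) by simp
 then show ?thesis
  unfolding disc5_def norm_mult power_mult_distrib[of _ _ 2] assms quintic_P_scale by (simp only: right_diff_distrib)
qed

text \<open>The values of \<open>\<alpha>\<close> and \<open>\<beta>\<close> are those that
  \<open>monge_quartic_alpha_beta\<close> finds in a normal form. The eight factors k / 8 produce
  8^8 = 16777216, and the polynomial identity contributes one factor 8, which leaves 8^7 =
  2097152.\<close>

lemma disc5_normal_form:
 assumes "\<alpha> = of_real k * Complex ((a + 4) / 8) (- b / 8)" "\<beta> = of_real k * Complex ((a - 4) / 8) (b / 8)"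
 shows "disc5 \<alpha> \<beta> = k^8 / 2097152 * ((a + 1)^2 * Delta a b)"
  and "(cmod \<beta>)^2 - (cmod \<alpha>)^2 = - (k^2 * a / 4)"
  and "25 * (cmod \<alpha>)^2 - 9 * (cmod \<beta>)^2 = k^2 / 4 * (a^2 + b^2 + 17 * a + 16)"
proof -
 have A: "(cmod \<alpha>)^2 = k^2 / 64 * ((a + 4)^2 + b^2)" "(cmod \<beta>)^2 = k^2 / 64 * ((a - 4)^2 + b^2)"
  unfolding assms norm_mult power_mult_distrib cmod_power2 by (simp_all add: field_simps power2_eq_square)
 have p5: "z^5 = z * (z^2)^2" for z :: complex by algebra
 have p3: "z^3 = z * z^2" for z :: complex by algebra
 have z2: "(Complex x y)^2 = Complex (x^2 - y^2) (2 * x * y)" for x y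
  by (simp add: complex_eq_iff power2_eq_square)
 have Z: "\<alpha>^3 * cnj \<beta>^5 = of_real (k^8 / 16777216) * ((Complex (a + 4) (- b))^3 * (Complex (a - 4) (- b))^5)"
 proof -
  have "\<alpha> = of_real (k / 8) * Complex (a + 4) (- b)" "cnj \<beta> = of_real (k / 8) * Complex (a - 4) (- b)"
   unfolding assms by (simp_all add: complex_eq_iff)
  then have "\<alpha>^3 * cnj \<beta>^5 = of_real ((k / 8)^3 * (k / 8)^5) * ((Complex (a + 4) (- b))^3 * (Complex (a - 4) (- b))^5)"
   by (simp only: power_mult_distrib of_real_mult of_real_power mult_ac)
  moreover have "(k / 8)^3 * (k / 8)^5 = k^8 / 16777216" by (simp add: power_divide flip: power_add)
  ultimately show ?thesis by (simp only:)
 qed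
 have "Re (of_real c * z) = c * Re z" for c z by simp
 then have R: "Re (\<alpha>^3 * cnj \<beta>^5) = k^8 / 16777216 * Re ((Complex (a + 4) (- b))^3 * (Complex (a - 4) (- b))^5)"
  unfolding Z by blast
 have "disc5 \<alpha> \<beta> = k^8 / 16777216 * (quintic_P ((a + 4)^2 + b^2) ((a - 4)^2 + b^2)
   - Re ((Complex (a + 4) (- b))^3 * (Complex (a - 4) (- b))^5))"
  unfolding disc5_def R A quintic_P_scale right_diff_distrib by (simp add: power_divide flip: power_mult)
 also have "Re ((Complex (a + 4) (- b))^3 * (Complex (a - 4) (- b))^5) =
   quintic_P ((a + 4)^2 + b^2) ((a - 4)^2 + b^2) - 8 * ((a + 1)^2 * Delta a b)"
  unfolding p5 p3 z2 quintic_P_def Delta_def by (simp add: field_simps) algebra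
 finally show "disc5 \<alpha> \<beta> = k^8 / 2097152 * ((a + 1)^2 * Delta a b)" by simp
 show "(cmod \<beta>)^2 - (cmod \<alpha>)^2 = - (k^2 * a / 4)"
  "25 * (cmod \<alpha>)^2 - 9 * (cmod \<beta>)^2 = k^2 / 4 * (a^2 + b^2 + 17 * a + 16)"
  unfolding A by (simp_all add: field_simps power2_eq_square)
qed

text \<open>At a zero of \<open>disc5\<close> the real part of Z is \<open>quintic_P\<close>, so
  \<open>quintic_P_identity\<close> shows (Im Z)^2 to be a positive multiple of s t, where s and t
  now denote the squares S and T. Hence s and t have the same sign. They cannot both be negative,
  since B < A and 25 A < 9 B contradict A, B >= 0.\<close>

lemma disc5_zero_imp_strict:
 assumes D: "disc5 \<alpha> \<beta> = 0" and AB: "(cmod \<alpha>)^2 \<noteq> (cmod \<beta>)^2" and T: "25 * (cmod \<alpha>)^2 \<noteq> 9 * (cmod \<beta>)^2"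
 shows "(cmod \<alpha>)^2 < (cmod \<beta>)^2" "25 * (cmod \<alpha>)^2 > 9 * (cmod \<beta>)^2" "Im (\<alpha>^3 * cnj \<beta>^5) \<noteq> 0"
proof -
 define A B Z where "A = (cmod \<alpha>)^2" "B = (cmod \<beta>)^2" "Z = \<alpha>^3 * cnj \<beta>^5"
 define s t where st: "s = (B - A) / 16" "t = (25 * A - 9 * B) / 16"
 have P: "quintic_P A B = Re Z" using D by (simp add: disc5_def A_B_Z_def)
 have "(cmod Z)^2 = A^3 * B^5"
  by (simp add: A_B_Z_def norm_mult norm_power power_mult_distrib flip: power_mult)
 then have "(Re Z)^2 + (Im Z)^2 = A^3 * B^5" by (simp add: cmod_power2)
 then have I: "(Im Z)^2 = 256 * s * t^3 * (t^2 + 22 * s * t + 125 * s^2)^2"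
  using quintic_P_identity[of A B] P by (simp add: st)
 have s0: "s \<noteq> 0" and t0: "t \<noteq> 0" using AB T by (simp_all add: st A_B_Z_def)
 have "t^2 + 22 * s * t + 125 * s^2 = (t + 11 * s)^2 + 4 * s^2" by algebra
 moreover have "4 * s^2 > 0" using s0 by simp
 ultimately have q: "t^2 + 22 * s * t + 125 * s^2 > 0" using zero_le_power2[of "t + 11 * s"] by linarith
 have I': "(Im Z)^2 = s * t * (256 * t^2 * (t^2 + 22 * s * t + 125 * s^2)^2)" unfolding I by algebra
 have pos: "256 * t^2 * (t^2 + 22 * s * t + 125 * s^2)^2 > 0" using t0 q by simp
 have "s * t * (256 * t^2 * (t^2 + 22 * s * t + 125 * s^2)^2) \<ge> 0" unfolding I'[symmetric] by simp
 then have "s * t \<ge> 0" using pos by (simp add: zero_le_mult_iff)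
 then have st0: "s * t > 0" using s0 t0 by (simp add: less_le)
 then have "(Im Z)^2 > 0" unfolding I' using pos by (rule mult_pos_pos)
 then show "Im (\<alpha>^3 * cnj \<beta>^5) \<noteq> 0" by (simp add: A_B_Z_def)
 have "A \<ge> 0" "B \<ge> 0" by (simp_all add: A_B_Z_def)
 then have "\<not> (s < 0 & t < 0)" by (simp add: st)
 then have "s > 0" "t > 0" using st0 by (auto simp: zero_less_mult_iff)
 then show "(cmod \<alpha>)^2 < (cmod \<beta>)^2" "25 * (cmod \<alpha>)^2 > 9 * (cmod \<beta>)^2"
  by (simp_all add: st A_B_Z_def)
qed

text \<open>The factor (a + 1)^2 makes \<open>disc5\<close> vanish at a = -1. That
  \<open>Delta\<close> is nonnegative there guarantees that \<open>Delta\<close> < 0 still implies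
  \<open>disc5\<close> < 0.\<close>

lemma Delta_minus_one: "Delta (-1) b \<ge> 0"
proof -
 have "Delta (-1) b = 4 * b^6 + 88 * b^4 + 500 * b^2"
  unfolding Delta_def by (simp add: field_simps) algebra
 then show ?thesis by simp
qed

text \<open>The conic is the zero set of 25 |alpha|^2 - 9 |beta|^2, where a double separatrix
  becomes triple. With b^2 taken from its equation, \<open>Delta\<close> factors as - 4 a^3 (a + 1)
  (2 a + 27)^2. The root a = 0 would make b^2 negative, and the other roots give the points excluded
  in the first alternative of E34.\<close>

lemma triple_root_parameters:
 assumes "a^2 + b^2 + 17 * a + 16 = (0::real)" "(a + 1)^2 * Delta a b = 0"
 shows "(a, b) = (-1, 0) \<or> (a, b) = (- 27/2, 5/2 * sqrt 5) \<or> (a, b) = (- 27/2, - (5/2 * sqrt 5))"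
proof -
 have b2: "b^2 = - (a^2 + 17 * a + 16)" using assms(1) by simp
 have "Delta a b = 16 * a^5 + 4 * (b^2 + 68) * a^4 + 16 * (b^2 + 144) * a^3
  - 8 * (b^2 - 80) * (16 + b^2) * a^2 + 96 * (16 + b^2)^2 * a + 4 * (16 + b^2)^3"
  by (simp add: Delta_def)
 also have "\<dots> = - 4 * a^3 * (a + 1) * (2 * a + 27)^2"
  unfolding b2 by algebra
 finally have "(a + 1)^2 * (- 4 * a^3 * (a + 1) * (2 * a + 27)^2) = 0" using assms(2) by simp
 then have "a = -1 \<or> a = 0 \<or> a = - 27/2" by (auto simp: add_eq_0_iff)
 moreover have "a \<noteq> 0"
 proof
  assume "a = 0"
  then have "b^2 = - 16" using b2 by simp
  then show False using zero_le_power2[of b] by linarith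
 qed
 moreover have "b = 0" if "a = -1" using b2 that by simp
 moreover have "b = 5/2 * sqrt 5 \<or> b = - (5/2 * sqrt 5)" if "a = - 27/2"
 proof -
  have "b^2 = (5/2 * sqrt 5)^2" using b2 that by (simp add: power_mult_distrib power_divide)
  then show ?thesis by (simp only: power2_eq_iff)
 qed
 ultimately show ?thesis by auto
qed

section \<open>The linear part of the quartic differential at a zero\<close>

lemma Ck_on_pdx: "Ck_on (Suc k) X S ==> Ck_on k (pdx X) S"
 and Ck_on_pdy: "Ck_on (Suc k) X S ==> Ck_on k (pdy X) S"
 unfolding pdx_def[abs_def] pdy_def[abs_def] by (rule Ck_on_frechet_derivative, assumption)+

lemma Ck_on_first_form:
 assumes "open S" "Ck_on (Suc k) X S"
 shows "Ck_on k (fffE X) S" "Ck_on k (fffF X) S" "Ck_on k (fffG X) S" "Ck_on k (gram X) S"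
proof -
 show *: "Ck_on k (fffE X) S" "Ck_on k (fffF X) S" "Ck_on k (fffG X) S"
  unfolding fffE_def[abs_def] fffF_def[abs_def] fffG_def[abs_def]
  by (intro Ck_on_inner assms(1) Ck_on_pdx[OF assms(2)] Ck_on_pdy[OF assms(2)])+
 show "Ck_on k (gram X) S"
  unfolding gram_def[abs_def] by (intro Ck_on_diff Ck_on_mult Ck_on_power assms(1) *)
qed

lemma Ck_on_axa:
 assumes S: "open S" and X: "Ck_on (Suc (Suc k)) X S" and g: "\<And>x. x \<in> S ==> gram X x \<noteq> 0"
 shows "Ck_on k (axa0 X) S" "Ck_on k (axa1 X) S"
proof -
 note X1 = Ck_on_mono[OF X, of "Suc k", simplified]
 note fff = Ck_on_first_form[OF S X1]
 note p = Ck_on_pdx[OF X1] Ck_on_pdy[OF X1]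
 have s: "Ck_on k (dxx X) S" "Ck_on k (dxy X) S" "Ck_on k (dyy X) S"
  by (rule Ck_on_pdx Ck_on_pdy, rule Ck_on_pdx Ck_on_pdy, rule X)+
 have n: "Ck_on k (%u. nip X u (a u) (b u)) S" if "Ck_on k a S" "Ck_on k b S" for a b
  unfolding nip_def
  by (intro Ck_on_diff Ck_on_add Ck_on_mult Ck_on_inner Ck_on_inverse S fff p that g)
 show "Ck_on k (axa0 X) S"
  unfolding axa0_def[abs_def] Let_def
  by (intro Ck_on_diff Ck_on_add Ck_on_mult Ck_on_power Ck_on_const S fff n s)
 show "Ck_on k (axa1 X) S"
  unfolding axa1_def[abs_def] Let_def
  by (intro Ck_on_diff Ck_on_add Ck_on_mult Ck_on_power Ck_on_const S fff n s)
qed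

text \<open>At a zero of f mere continuity of g is enough: the error splits into g times the
  remainder of f, and the increment of g times the linear part of f. So the roots and coordinate
  factors that multiply \<open>axc\<close> never have to be differentiated.\<close>

lemma has_derivative_zero_mult:
 fixes f :: "'a::real_normed_vector => 'b::real_normed_algebra"
 assumes f: "(f has_derivative f') (at x)" "f x = 0" and g: "continuous (at x) g"
 shows "((%y. g y * f y) has_derivative (%v. g x * f' v)) (at x)"
proof -
 have bl: "bounded_linear f'" by (rule has_derivative_bounded_linear[OF f(1)])
 have lf: "((%h. norm (f (x + h) - f' h) / norm h) \<longlongrightarrow> 0) (at 0)"
  using f unfolding has_derivative_at by simp
 have gl: "((%h. g (x + h)) \<longlongrightarrow> g x) (at 0)" using g by (simp add: continuous_at LIM_offset_zero_iff)
 have lim: "((%h. norm (g (x + h)) * (norm (f (x + h) - f' h) / norm h) + norm (g (x + h) - g x) * onorm f') \<longlongrightarrow>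
   norm (g x) * 0 + norm (g x - g x) * onorm f') (at 0)"
  by (intro tendsto_intros gl lf)
 have bound: "norm (norm (g (x + h) * f (x + h) - g x * f' h) / norm h) \<le>
   norm (g (x + h)) * (norm (f (x + h) - f' h) / norm h) + norm (g (x + h) - g x) * onorm f'" if "h \<noteq> 0" for h
 proof -
  have "g (x + h) * f (x + h) - g x * f' h = g (x + h) * (f (x + h) - f' h) + (g (x + h) - g x) * f' h"
   by (simp add: algebra_simps)
  then have "norm (g (x + h) * f (x + h) - g x * f' h) \<le>
    norm (g (x + h)) * norm (f (x + h) - f' h) + norm (g (x + h) - g x) * norm (f' h)"
   by (metis norm_triangle_le add_mono norm_mult_ineq)
  also have "\<dots> \<le> norm (g (x + h)) * norm (f (x + h) - f' h) + norm (g (x + h) - g x) * (onorm f' * norm h)"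
   by (intro add_left_mono mult_left_mono onorm[OF bl]) simp
  finally have "norm (g (x + h) * f (x + h) - g x * f' h) / norm h \<le>
    (norm (g (x + h)) * norm (f (x + h) - f' h) + norm (g (x + h) - g x) * (onorm f' * norm h)) / norm h"
   by (intro divide_right_mono) simp_all
  then show ?thesis using that by (simp add: add_divide_distrib)
 qed
 have "((%h. norm (g (x + h) * f (x + h) - g x * f' h) / norm h) \<longlongrightarrow> 0) (at 0)"
  by (rule Lim_null_comparison[OF _ lim[simplified]])
   (use bound in \<open>auto simp: eventually_at_filter\<close>)
 then show ?thesis
  unfolding has_derivative_at using f(2)
  by (simp add: bounded_linear_const_mult[OF bl])
qed

text \<open>The real part of \<open>z\<close> times the isotropic vector: an identification of the tangent plane with
 the complex numbers.\<close>

definition zvec :: "(real^2 => real^4) => real^2 => complex => real^2" where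
 "zvec X u z = vector [Re (z * zetaX X u), Re (z * zetaY X u)]"

text \<open>\<open>axial_alpha\<close> and \<open>axial_beta\<close> are the Wirtinger derivatives
  of \<open>axc\<close> in the parameter z of \<open>zvec\<close>, that is, the coefficients of z
  and of cnj z in the differential.\<close>

definition axial_alpha :: "(real^2 => real^4) => real^2 => complex" where
 "axial_alpha X u = (fder (axc X) (at u) (zvec X u 1) - \<i> * fder (axc X) (at u) (zvec X u \<i>)) / 2"

definition axial_beta :: "(real^2 => real^4) => real^2 => complex" where
 "axial_beta X u = (fder (axc X) (at u) (zvec X u 1) + \<i> * fder (axc X) (at u) (zvec X u \<i>)) / 2"

lemma axc_zvec_derivative:
 assumes "axc X differentiable (at u)"
 shows "fder (axc X) (at u) (zvec X u z) = axial_alpha X u * z + axial_beta X u * cnj z"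
proof -
 interpret linear "fder (axc X) (at u)" by (rule linear_frechet_derivative[OF assms])
 have z: "zvec X u z = Re z *\<^sub>R zvec X u 1 + Im z *\<^sub>R zvec X u \<i>"
  by (simp add: zvec_def vec_eq_iff forall_2 algebra_simps)
 have "fder (axc X) (at u) (zvec X u z) = of_real (Re z) * fder (axc X) (at u) (zvec X u 1)
   + of_real (Im z) * fder (axc X) (at u) (zvec X u \<i>)"
  unfolding z add scale by (simp add: scaleR_conv_of_real)
 moreover have "axial_alpha X u * z + axial_beta X u * cnj z = of_real (Re z) * fder (axc X) (at u) (zvec X u 1)
   + of_real (Im z) * fder (axc X) (at u) (zvec X u \<i>)"
  unfolding axial_alpha_def axial_beta_def by (simp add: complex_eq_iff field_simps)
 ultimately show ?thesis by simp
qed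

lemma axial_alpha_beta_eqI:
 assumes d: "axc X differentiable (at u)"
  and eq: "\<And>z. fder (axc X) (at u) (zvec X u z) = a * z + b * cnj z"
 shows "axial_alpha X u = a" "axial_beta X u = b"
 unfolding axial_alpha_def axial_beta_def eq by (simp_all add: complex_eq_iff field_simps)

text \<open>Both \<open>axa0\<close> and \<open>axa1\<close> vanish at a zero of \<open>axc\<close>,
  so no derivative of E, F or the Gram determinant contributes.\<close>

lemma axc_has_derivative:
 assumes S: "open S" "u \<in> S" and X: "Ck_on 3 X S" and g: "\<And>x. x \<in> S ==> gram X x > 0" and 0: "axc X u = 0"
 shows "(axc X has_derivative (%v. Complex (fffE X u * fder (axa1 X) (at u) v / 4 - fffF X u * fder (axa0 X) (at u) v)
   (sqrt (gram X u) * fder (axa0 X) (at u) v))) (at u)"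
proof -
 have X3: "Ck_on (Suc (Suc 1)) X S" "Ck_on (Suc 1) X S" using X Ck_on_mono[OF X] by (simp_all add: numeral_3_eq_3)
 have g0: "gram X x \<noteq> 0" if "x \<in> S" for x using g[OF that] by simp
 note a = Ck_on_axa[OF S(1) X3(1) g0]
 note f = Ck_on_first_form[OF S(1) X3(2)]
 have a0: "axa0 X u = 0" "axa1 X u = 0" using axc_eq_0_iff[OF g[OF S(2)]] 0 by auto
 have cont: "continuous (at u) h" if "Ck_on 1 h S" for h :: "real^2 => real"
  using Ck_on_imp_differentiable[OF that _ S(2)] differentiable_imp_continuous_within by auto
 have d0: "(axa0 X has_derivative fder (axa0 X) (at u)) (at u)"
  and d1: "(axa1 X has_derivative fder (axa1 X) (at u)) (at u)"
  by (intro Ck_on_imp_has_derivative[OF a(1) _ S(2)] Ck_on_imp_has_derivative[OF a(2) _ S(2)]; simp)+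
 have 1: "((%x. fffE X x * axa1 X x) has_derivative (%v. fffE X u * fder (axa1 X) (at u) v)) (at u)"
  and 2: "((%x. fffF X x * axa0 X x) has_derivative (%v. fffF X u * fder (axa0 X) (at u) v)) (at u)"
  and 3: "((%x. sqrt (gram X x) * axa0 X x) has_derivative (%v. sqrt (gram X u) * fder (axa0 X) (at u) v)) (at u)"
  by (intro has_derivative_zero_mult d0 d1 a0 cont f continuous_intros)+
 have 4: "((%x. fffE X x * axa1 X x / 4 - fffF X x * axa0 X x) has_derivative
   (%v. fffE X u * fder (axa1 X) (at u) v / 4 - fffF X u * fder (axa0 X) (at u) v)) (at u)"
  by (intro has_derivative_diff 2 bounded_linear.has_derivative[OF bounded_linear_divide 1])
 have "((%x. of_real (fffE X x * axa1 X x / 4 - fffF X x * axa0 X x) + \<i> * of_real (sqrt (gram X x) * axa0 X x)) has_derivative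
   (%v. of_real (fffE X u * fder (axa1 X) (at u) v / 4 - fffF X u * fder (axa0 X) (at u) v)
     + \<i> * of_real (sqrt (gram X u) * fder (axa0 X) (at u) v))) (at u)"
  by (intro has_derivative_add has_derivative_mult_right has_derivative_of_real 4 3)
 then show ?thesis
  by (simp add: axc_def[abs_def] Complex_eq)
qed

lemma zvec_transform:
 assumes "fder psi (at u) = (%v. vector [jac psi 1 1 u * v $ 1 + jac psi 1 2 u * v $ 2, jac psi 2 1 u * v $ 1 + jac psi 2 2 u * v $ 2])"
  and "of_real (jac psi 1 1 u) * zetaX X u + of_real (jac psi 1 2 u) * zetaY X u = lam * zetaX Y y"
  and "of_real (jac psi 2 1 u) * zetaX X u + of_real (jac psi 2 2 u) * zetaY X u = lam * zetaY Y y"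
 shows "fder psi (at u) (zvec X u z) = zvec Y y (lam * z)"
proof -
 have "Re (z * (of_real (jac psi 1 1 u) * zetaX X u + of_real (jac psi 1 2 u) * zetaY X u)) = Re (lam * z * zetaX Y y)"
  "Re (z * (of_real (jac psi 2 1 u) * zetaX X u + of_real (jac psi 2 2 u) * zetaY X u)) = Re (lam * z * zetaY Y y)"
  unfolding assms(2,3) by (simp_all only: mult_ac)
 then show ?thesis unfolding assms(1) by (simp add: zvec_def vec_eq_iff forall_2 algebra_simps)
qed

text \<open>Four factors l come from the quartic differential, the fifth from the change of
  parameter z |-> l z; in the coefficient of cnj z only this last one is conjugated. The variation
  of the factor itself is invisible because it multiplies a zero.\<close>

lemma axial_alpha_beta_transform:
 fixes psi :: "real^2 => real^2" and Y X :: "real^2 => real^4" and Q :: "real^4^4"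
 assumes S: "open S" and T: "open T" "psi ` S \<subseteq> T" and C: "Ck_on 2 psi S" "Ck_on 3 Y T" and u: "u \<in> S"
  and Q: "orthogonal_matrix Q" and sig: "sig > 0"
  and X: "\<And>x. x \<in> S ==> X x = sig *\<^sub>R (Q *v Y (psi x) + t)"
  and det: "\<And>x. x \<in> S ==> det (matrix (fder psi (at x))) > 0"
  and gY: "\<And>y. y \<in> T ==> gram Y y > 0"
  and 0: "axc Y (psi u) = 0"
 defines "l \<equiv> axial_factor Y sig psi u"
 shows "axc X u = 0" "axc X differentiable (at u)" "l \<noteq> 0"
  "axial_alpha X u = of_real (sig^2) * l^5 * axial_alpha Y (psi u)"
  "axial_beta X u = of_real (sig^2) * l^4 * cnj l * axial_beta Y (psi u)"
  "fder psi (at u) (zvec X u z) = zvec Y (psi u) (l * z)"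
proof -
 have C2: "Ck_on 2 Y T" "Ck_on (Suc 1) Y T" "Ck_on (Suc 1) psi S"
  using Ck_on_mono[OF C(2)] C(1) by (simp_all add: numeral_2_eq_2 numeral_3_eq_3)
 have pu: "psi u \<in> T" using u T by auto
 have gy: "gram Y (psi x) > 0" if "x \<in> S" for x using gY T that by auto
 have L: "axc X x = of_real (sig^2) * axial_factor Y sig psi x^4 * axc Y (psi x)" if "x \<in> S" for x
  by (rule axc_transform(2)[OF S T C(1) C2(1) that Q sig _ det[OF that] gy[OF that]]) (erule X)
 show "axc X u = 0" using L[OF u] 0 by simp
 show "l \<noteq> 0" unfolding l_def
  by (rule axc_transform(5)[OF S T C(1) C2(1) u Q sig _ det[OF u] gy[OF u]]) (erule X)
 show z: "fder psi (at u) (zvec X u z) = zvec Y (psi u) (l * z)" for z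
 proof (rule zvec_transform)
  show "fder psi (at u) = (%v. vector [jac psi 1 1 u * v $ 1 + jac psi 1 2 u * v $ 2, jac psi 2 1 u * v $ 1 + jac psi 2 2 u * v $ 2])"
  proof
   fix v
   show "fder psi (at u) v = vector [jac psi 1 1 u * v $ 1 + jac psi 1 2 u * v $ 2, jac psi 2 1 u * v $ 1 + jac psi 2 2 u * v $ 2]"
    using has_derivative_plane_expand[OF Ck_on_imp_differentiable[OF C(1) _ u], of v]
    by (simp add: vec_eq_iff forall_2 jac_def mult.commute)
  qed
  show "of_real (jac psi 1 1 u) * zetaX X u + of_real (jac psi 1 2 u) * zetaY X u = l * zetaX Y (psi u)"
   unfolding l_def by (rule axc_transform(3)[OF S T C(1) C2(1) u Q sig _ det[OF u] gy[OF u]]) (erule X)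
  show "of_real (jac psi 2 1 u) * zetaX X u + of_real (jac psi 2 2 u) * zetaY X u = l * zetaY Y (psi u)"
   unfolding l_def by (rule axc_transform(4)[OF S T C(1) C2(1) u Q sig _ det[OF u] gy[OF u]]) (erule X)
 qed
 have dY: "(axc Y has_derivative fder (axc Y) (at (psi u))) (at (psi u))"
  by (rule differentiableI[OF axc_has_derivative[OF T(1) pu C(2) gY 0], unfolded frechet_derivative_works])
 have dpsi: "(psi has_derivative fder psi (at u)) (at u)"
  by (rule Ck_on_imp_has_derivative[OF C(1) _ u]) simp
 have comp: "((%x. axc Y (psi x)) has_derivative (%v. fder (axc Y) (at (psi u)) (fder psi (at u) v))) (at u)"
  by (rule has_derivative_compose[of psi _ u UNIV "axc Y", OF dpsi dY])
 have cpsi: "continuous (at u) psi" by (rule has_derivative_continuous[OF dpsi])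
 have cj: "continuous (at u) (jac psi i k)" for i k
 proof -
  have "Ck_on 1 (%x. fder psi (at x) (axis k 1) $ i) S"
   by (intro Ck_on_vec_nth S Ck_on_frechet_derivative C2(3))
  then have "continuous_on S (jac psi i k)" unfolding jac_def[abs_def] by (rule Ck_on_imp_continuous_on)
  then show ?thesis using S u by (simp add: continuous_on_eq_continuous_at)
 qed
 note f = Ck_on_first_form[OF T(1) C2(2)]
 have cf: "continuous (at u) (%x. h (psi x))" if "Ck_on 1 h T" for h :: "real^2 => real"
 proof -
  have "isCont h (psi u)" using Ck_on_imp_continuous_on[OF that] T(1) pu by (simp add: continuous_on_eq_continuous_at)
  then show ?thesis using cpsi by (simp add: isCont_o2)
 qed
 have E0: "fffE Y (psi u) \<noteq> 0" using gy[OF u] by (auto simp: gram_def)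
 have cl: "continuous (at u) (%x. of_real (sig^2) * axial_factor Y sig psi x^4)"
  unfolding axial_factor_def det_jac Complex_eq
  by (intro continuous_intros cf f cj E0)
 have "((%x. of_real (sig^2) * axial_factor Y sig psi x^4 * axc Y (psi x)) has_derivative
  (%v. of_real (sig^2) * axial_factor Y sig psi u^4 * fder (axc Y) (at (psi u)) (fder psi (at u) v))) (at u)"
  by (rule has_derivative_zero_mult[OF comp 0 cl])
 then have dX: "(axc X has_derivative
  (%v. of_real (sig^2) * l^4 * fder (axc Y) (at (psi u)) (fder psi (at u) v))) (at u)"
  unfolding l_def
  by (rule has_derivative_transform_within_open[OF _ S u]) (simp add: L)
 then show dd: "axc X differentiable (at u)" by (rule differentiableI)
 have "fder (axc X) (at u) (zvec X u z) = of_real (sig^2) * l^5 * axial_alpha Y (psi u) * z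
   + of_real (sig^2) * l^4 * cnj l * axial_beta Y (psi u) * cnj z" for z
 proof -
  have "fder (axc X) (at u) (zvec X u z) = of_real (sig^2) * l^4 * fder (axc Y) (at (psi u)) (zvec Y (psi u) (l * z))"
   unfolding frechet_derivative_eqI[OF dX] z ..
  also have "\<dots> = of_real (sig^2) * l^4 * (axial_alpha Y (psi u) * (l * z) + axial_beta Y (psi u) * cnj (l * z))"
   unfolding axc_zvec_derivative[OF differentiableI[OF dY]] ..
  also have "\<dots> = of_real (sig^2) * l^5 * axial_alpha Y (psi u) * z + of_real (sig^2) * l^4 * cnj l * axial_beta Y (psi u) * cnj z"
   unfolding complex_cnj_mult by algebra
  finally show ?thesis .
 qed
 from axial_alpha_beta_eqI[OF dd this]
 show "axial_alpha X u = of_real (sig^2) * l^5 * axial_alpha Y (psi u)"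
  "axial_beta X u = of_real (sig^2) * l^4 * cnj l * axial_beta Y (psi u)" by blast+
qed

section \<open>Charts of the surface\<close>

lemma is_chart_param:
 assumes "is_chart c"
 shows "q \<in> dom_of c ==> param c (snd c q) = q" "u \<in> img_of c ==> snd c (param c u) = u"
  "u \<in> img_of c ==> param c u \<in> dom_of c"
 using assms by (auto simp: is_chart_def homeomorphism_def)

lemma is_chart_open_overlap:
 assumes c: "is_chart c" and c': "is_chart c'"
 shows "open (snd c ` (dom_of c \<inter> dom_of c'))"
proof -
 have "snd c ` (dom_of c \<inter> dom_of c') = img_of c \<inter> param c -` dom_of c'"
 proof (intro subset_antisym subsetI)
  fix u assume "u \<in> snd c ` (dom_of c \<inter> dom_of c')"
  then show "u \<in> img_of c \<inter> param c -` dom_of c'" using is_chart_param(1)[OF c] by auto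
 next
  fix u assume u: "u \<in> img_of c \<inter> param c -` dom_of c'"
  then have "snd c (param c u) = u" "param c u \<in> dom_of c \<inter> dom_of c'" using is_chart_param(2,3)[OF c] by auto
  then show "u \<in> snd c ` (dom_of c \<inter> dom_of c')" by (metis imageI)
 qed
 moreover have "open (img_of c \<inter> param c -` dom_of c')"
  using c c' by (intro continuous_open_preimage) (auto simp: is_chart_def homeomorphism_def)
 ultimately show ?thesis by simp
qed

lemma positive_chart_atlas:
 "compact_oriented_surface A ==> c \<in> A ==> positive_chart A r c"
 by (simp add: compact_oriented_surface_def positive_chart_def)

lemma atlas_is_chart: "compact_oriented_surface A ==> c \<in> A ==> is_chart c"
 by (simp add: compact_oriented_surface_def)

text \<open>If the Gram determinant vanishes, the differential kills (G, - F); and if that vector is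
  zero, then G = 0 and the second basis vector is killed.\<close>

lemma gram_pos_iff_inj:
 assumes "X differentiable (at u)"
 shows "gram X u > 0 \<longleftrightarrow> inj (fder X (at u))"
proof -
 let ?D = "fder X (at u)"
 have lin: "linear ?D" by (rule linear_frechet_derivative[OF assms])
 have D: "?D v = v $ 1 *\<^sub>R pdx X u + v $ 2 *\<^sub>R pdy X u" for v
  unfolding pdx_def pdy_def by (rule has_derivative_plane_expand[OF assms])
 have gg: "gram X u \<ge> 0"
  using Cauchy_Schwarz_ineq[of "pdx X u" "pdy X u"] by (simp add: gram_def fffE_def fffF_def fffG_def)
 show ?thesis
 proof
  assume g: "gram X u > 0"
  have "v = 0" if "?D v = 0" for v
  proof -
   have 0: "v $ 1 *\<^sub>R pdx X u + v $ 2 *\<^sub>R pdy X u = 0" using that D by simp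
   have e1: "v $ 1 * fffE X u + v $ 2 * fffF X u = 0" using arg_cong[OF 0, of "%x. x \<bullet> pdx X u"]
    by (simp add: inner_add_left inner_add_right fffE_def fffF_def inner_commute)
   have e2: "v $ 1 * fffF X u + v $ 2 * fffG X u = 0" using arg_cong[OF 0, of "%x. x \<bullet> pdy X u"]
    by (simp add: inner_add_left inner_add_right fffG_def fffF_def inner_commute)
   have "v $ 1 * gram X u = 0" "v $ 2 * gram X u = 0" using e1 e2 unfolding gram_def by algebra+
   then show ?thesis using g by (simp add: vec_eq_iff forall_2)
  qed
  then show "inj ?D" using linear_injective_0[OF lin] by blast
 next
  assume i: "inj ?D"
  have "gram X u \<noteq> 0"
  proof
   assume g: "gram X u = 0"
   let ?v = "vector [fffG X u, - fffF X u] :: real^2"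
   have "?D ?v \<bullet> ?D ?v = fffG X u * gram X u"
    by (simp add: D inner_add_left inner_add_right inner_diff_left inner_diff_right fffE_def fffF_def fffG_def gram_def
      inner_commute power2_eq_square algebra_simps)
   then have "?D ?v = 0" using g by simp
   then have "?v = 0" using i linear_injective_0[OF lin] by blast
   then have "fffG X u = 0" by (simp add: vec_eq_iff forall_2)
   then have "?D (axis 2 1) = 0" by (simp add: fffG_def pdy_def)
   then have "axis 2 1 = (0 :: real^2)" using i linear_injective_0[OF lin] by blast
   then show False by (simp add: axis_eq_0_iff)
  qed
  then show "gram X u > 0" using gg by simp
 qed
qed

lemma immersion_gram:
 assumes "mu \<in> immersions A r" "r > 0" "c \<in> A" "u \<in> img_of c"
 shows "gram (mu \<circ> param c) u > 0"
proof -
 have "Ck_on r (mu \<circ> param c) (img_of c)" using assms by (auto simp: immersions_def Cr_maps_def)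
 then have "(mu \<circ> param c) differentiable (at u)" using assms Ck_on_imp_differentiable by blast
 then show ?thesis using gram_pos_iff_inj assms by (auto simp: immersions_def)
qed

lemma chart_transition:
 assumes A: "compact_oriented_surface A" and c0: "c0 \<in> A" and c: "positive_chart A r c"
 defines "S \<equiv> snd c ` (dom_of c \<inter> dom_of c0)" and "psi \<equiv> snd c0 \<circ> param c"
 shows "open S" "S \<subseteq> img_of c" "open (img_of c0)" "psi ` S \<subseteq> img_of c0" "Ck_on r psi S"
  "x \<in> S ==> det (matrix (fder psi (at x))) > 0"
  "x \<in> S ==> param c0 (psi x) = param c x"
proof -
 have ch: "is_chart c" "is_chart c0" using c atlas_is_chart[OF A c0] by (auto simp: positive_chart_def)
 show "open S" unfolding S_def by (rule is_chart_open_overlap[OF ch])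
 show "S \<subseteq> img_of c" by (auto simp: S_def)
 show "open (img_of c0)" using ch by (auto simp: is_chart_def)
 have *: "param c x \<in> dom_of c0" if "x \<in> S" for x
  using that is_chart_param[OF ch(1)] by (auto simp: S_def)
 then show "psi ` S \<subseteq> img_of c0" by (auto simp: psi_def)
 have "pos_compatible r c c0" using c c0 by (auto simp: positive_chart_def)
 then show "Ck_on r psi S" "x \<in> S ==> det (matrix (fder psi (at x))) > 0"
  by (auto simp: pos_compatible_def S_def psi_def)
 show "x \<in> S ==> param c0 (psi x) = param c x"
  using * is_chart_param[OF ch(2)] by (simp add: psi_def)
qed

text \<open>One statement for two comparisons: with trivial Q, t and \<open>sig\<close> it relates
  two charts of the surface, and with those of a normal form it relates the Monge chart to the atlas
  chart c0.\<close>

lemma axc_chart_transform: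
 fixes Q :: "real^4^4" and t :: "real^4"
 assumes A: "compact_oriented_surface A" and c0: "c0 \<in> A" and c: "positive_chart A r c" and r: "r \<ge> 3"
  and q: "q \<in> dom_of c" "q \<in> dom_of c0"
  and mu: "mu \<in> Cr_maps A r" "\<forall>y\<in>img_of c0. gram (mu \<circ> param c0) y > 0"
  and Q: "orthogonal_matrix Q" and sig: "sig > 0"
 defines "psi \<equiv> snd c0 \<circ> param c" and "Y \<equiv> mu \<circ> param c0" and "X \<equiv> %u. sig *\<^sub>R (Q *v mu (param c u) + t)"
 defines "l \<equiv> axial_factor Y sig psi (snd c q)"
 shows "gram X (snd c q) > 0" "l \<noteq> 0" "axc X (snd c q) = 0 \<longleftrightarrow> axc Y (snd c0 q) = 0"
  "axc Y (snd c0 q) = 0 ==> axc X differentiable (at (snd c q))"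
  "axc Y (snd c0 q) = 0 ==> axial_alpha X (snd c q) = of_real (sig^2) * l^5 * axial_alpha Y (snd c0 q)"
  "axc Y (snd c0 q) = 0 ==> axial_beta X (snd c q) = of_real (sig^2) * l^4 * cnj l * axial_beta Y (snd c0 q)"
  "axc Y (snd c0 q) = 0 ==> fder psi (at (snd c q)) (zvec X (snd c q) z) = zvec Y (snd c0 q) (l * z)"
proof -
 let ?S = "snd c ` (dom_of c \<inter> dom_of c0)"
 note tr = chart_transition[OF A c0 c, folded psi_def]
 have u: "snd c q \<in> ?S" using q by auto
 have ch: "is_chart c" "is_chart c0" using c atlas_is_chart[OF A c0] by (auto simp: positive_chart_def)
 have pu: "psi (snd c q) = snd c0 q" using is_chart_param(1)[OF ch(1) q(1)] by (simp add: psi_def)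
 have pu': "snd c0 q \<in> img_of c0" using q by auto
 have C: "Ck_on 2 psi ?S" "Ck_on 3 Y (img_of c0)" "Ck_on 2 Y (img_of c0)"
  using Ck_on_mono[OF tr(5)] mu(1) c0 r Ck_on_mono[of r Y "img_of c0"] by (auto simp: Cr_maps_def Y_def)
 have X: "X x = sig *\<^sub>R (Q *v Y (psi x) + t)" if "x \<in> ?S" for x
  using tr(7)[OF that] by (simp add: X_def Y_def)
 have gY: "gram Y y > 0" if "y \<in> img_of c0" for y unfolding Y_def by (rule mu(2)[rule_format, OF that])
 have gy: "gram Y (psi (snd c q)) > 0" using gY[OF pu'] by (simp add: pu)
 show "gram X (snd c q) > 0"
  by (rule axc_transform(1)[OF tr(1,3,4) C(1,3) u Q sig _ tr(6)[OF u] gy]) (erule X)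
 show l0: "l \<noteq> 0" unfolding l_def
  by (rule axc_transform(5)[OF tr(1,3,4) C(1,3) u Q sig _ tr(6)[OF u] gy]) (erule X)
 have "axc X (snd c q) = of_real (sig^2) * l^4 * axc Y (psi (snd c q))" unfolding l_def
  by (rule axc_transform(2)[OF tr(1,3,4) C(1,3) u Q sig _ tr(6)[OF u] gy]) (erule X)
 then show "axc X (snd c q) = 0 \<longleftrightarrow> axc Y (snd c0 q) = 0" using l0 sig pu by simp
 assume "axc Y (snd c0 q) = 0"
 then have 0: "axc Y (psi (snd c q)) = 0" by (simp add: pu)
 show "axc X differentiable (at (snd c q))"
  by (rule axial_alpha_beta_transform(2)[OF tr(1,3,4) C(1,2) u Q sig _ tr(6) gY 0]) (erule X)
 show "axial_alpha X (snd c q) = of_real (sig^2) * l^5 * axial_alpha Y (snd c0 q)"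
  unfolding l_def pu[symmetric]
  by (rule axial_alpha_beta_transform(4)[OF tr(1,3,4) C(1,2) u Q sig _ tr(6) gY 0]) (erule X)
 show "axial_beta X (snd c q) = of_real (sig^2) * l^4 * cnj l * axial_beta Y (snd c0 q)"
  unfolding l_def pu[symmetric]
  by (rule axial_alpha_beta_transform(5)[OF tr(1,3,4) C(1,2) u Q sig _ tr(6) gY 0]) (erule X)
 show "fder psi (at (snd c q)) (zvec X (snd c q) z) = zvec Y (snd c0 q) (l * z)"
  unfolding l_def pu[symmetric]
  by (rule axial_alpha_beta_transform(6)[OF tr(1,3,4) C(1,2) u Q sig _ tr(6) gY 0]) (erule X)
qed

lemma orthogonal_matrix_mat_1: "orthogonal_matrix (mat 1 :: real^4^4)"
 by (simp add: orthogonal_matrix_def transpose_mat)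

text \<open>The definition asks for some chart of the atlas. Since \<open>axc\<close> changes by a
  nonzero factor between charts, one fixed chart can be used throughout.\<close>

lemma axiumbilic_chart_iff:
 assumes A: "compact_oriented_surface A" and c0: "c0 \<in> A" "q \<in> dom_of c0" and r: "r \<ge> 3" and mu: "mu \<in> immersions A r"
 shows "axiumbilic A mu q \<longleftrightarrow> axc (mu \<circ> param c0) (snd c0 q) = 0"
proof -
 have eq: "axc (mu \<circ> param c) (snd c q) = 0 \<longleftrightarrow> axc (mu \<circ> param c0) (snd c0 q) = 0" if c: "c \<in> A" "q \<in> dom_of c" for c
 proof -
  have "(%u. 1 *\<^sub>R (mat 1 *v mu (param c u) + 0)) = mu \<circ> param c" by (simp add: fun_eq_iff)
  moreover have "axc (%u. 1 *\<^sub>R (mat 1 *v mu (param c u) + 0)) (snd c q) = 0 \<longleftrightarrow> axc (mu \<circ> param c0) (snd c0 q) = 0"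
  proof (rule axc_chart_transform(3)[OF A c0(1) positive_chart_atlas[OF A c(1)] r c(2) c0(2) _ _ orthogonal_matrix_mat_1])
   show "mu \<in> Cr_maps A r" using mu by (simp add: immersions_def)
   show "\<forall>y\<in>img_of c0. gram (mu \<circ> param c0) y > 0"
    using immersion_gram[OF mu _ c0(1)] r by simp
  qed simp
  ultimately show ?thesis by simp
 qed
 have gram: "gram (mu \<circ> param c) (snd c q) > 0" if "c \<in> A" "q \<in> dom_of c" for c
  using immersion_gram[OF mu _ that(1)] that(2) r by simp
 show ?thesis unfolding axiumbilic_iff using eq gram c0 by blast
qed

section \<open>Monge charts\<close>

text \<open>\<open>monge_jet X\<close> collects what is used of a Monge chart at the origin: to second order \<open>X\<close> is the inclusion
 of the coordinate plane plus normal terms.\<close>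

definition monge_jet :: "(real^2 => real^4) => (real^2) set => bool" where
 "monge_jet X S \<longleftrightarrow> open S & 0 \<in> S & Ck_on 3 X S & pdx X 0 = axis 1 1 & pdy X 0 = axis 2 1 &
  (\<forall>n \<in> {dxx X 0, dxy X 0, dyy X 0}. n $ 1 = 0 & n $ 2 = 0)"

lemma inner_axis_1: "(v :: real^'n) \<bullet> axis i 1 = v $ i" "axis i 1 \<bullet> v = v $ i"
 by (simp_all add: inner_axis inner_axis')

lemma monge_jet_values:
 assumes m: "monge_jet X S"
 shows "fffE X 0 = 1" "fffF X 0 = 0" "fffG X 0 = 1" "gram X 0 = 1" "zetaX X 0 = 1" "zetaY X 0 = - \<i>"
  "zvec X 0 z = vector [Re z, Im z]"
proof -
 have p: "pdx X 0 = axis 1 1" "pdy X 0 = axis 2 1" using m by (simp_all add: monge_jet_def)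
 show *: "fffE X 0 = 1" "fffF X 0 = 0" "fffG X 0 = 1"
  by (simp_all add: fffE_def fffF_def fffG_def p inner_axis_axis)
 then show **: "gram X 0 = 1" by (simp add: gram_def)
 show "zetaX X 0 = 1" "zetaY X 0 = - \<i>" "zvec X 0 z = vector [Re z, Im z]"
  by (simp_all add: zetaX_def zetaY_def zvec_def * ** complex_eq_iff)
qed

text \<open>At the origin of a Monge chart E, F, G and the Gram determinant are stationary and the
  second derivatives of X are normal. Hence \<open>nip\<close> differentiates there like the plain
  inner product, and only derivatives of dxx, dxy, dyy survive.\<close>

lemma monge_axa_derivative:
 assumes m: "monge_jet X S"
 defines "e \<equiv> dxx X" and "f \<equiv> dxy X" and "g \<equiv> dyy X"
 defines "D \<equiv> %h v. fder h (at 0) v"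
 shows "(axa1 X has_derivative (%v. 8 * ((e 0 - g 0) \<bullet> (D e v - D g v) - 4 * (f 0 \<bullet> D f v)))) (at 0)"
  "(axa0 X has_derivative (%v. 4 * (f 0 \<bullet> (D g v - D e v) + (g 0 - e 0) \<bullet> D f v))) (at 0)"
  "axa1 X 0 = 4 * ((e 0 - g 0) \<bullet> (e 0 - g 0) - 4 * (f 0 \<bullet> f 0))"
  "axa0 X 0 = - 4 * ((e 0 - g 0) \<bullet> f 0)"
proof -
 note m' = m[unfolded monge_jet_def]
 have X: "Ck_on 3 X S" and S: "open S" "0 \<in> S" using m' by auto
 have X3: "Ck_on (Suc (Suc (Suc 0))) X S" "Ck_on (Suc (Suc 0)) X S" using X Ck_on_mono[OF X] by (simp_all add: numeral_3_eq_3)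
 have xy: "Ck_on (Suc (Suc 0)) (pdx X) S" "Ck_on (Suc (Suc 0)) (pdy X) S" by (rule Ck_on_pdx Ck_on_pdy, rule X3)+
 have efg: "Ck_on (Suc 0) e S" "Ck_on (Suc 0) f S" "Ck_on (Suc 0) g S" unfolding e_def f_def g_def
  by (rule Ck_on_pdx Ck_on_pdy, rule xy)+
 have d: "(h has_derivative D h) (at 0)" if "Ck_on (Suc k) h S" for h :: "real^2 => real^4" and k
  unfolding D_def using Ck_on_imp_has_derivative[OF that _ S(2)] by simp
 have dx: "(pdx X has_derivative (%v. v $ 1 *\<^sub>R e 0 + v $ 2 *\<^sub>R f 0)) (at 0)"
  and dy: "(pdy X has_derivative (%v. v $ 1 *\<^sub>R f 0 + v $ 2 *\<^sub>R g 0)) (at 0)"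
 proof -
  have "Ck_on 2 X S" using X3(2) by (simp add: numeral_2_eq_2)
  then have sym: "pdy (pdx X) 0 = pdx (pdy X) 0"
   using second_derivative_symmetric[OF S(1) _ S(2)] unfolding pdx_def[abs_def] pdy_def[abs_def] by blast
  have "D (pdx X) v = v $ 1 *\<^sub>R e 0 + v $ 2 *\<^sub>R f 0" for v
   unfolding D_def has_derivative_plane_expand[OF Ck_on_imp_differentiable[OF xy(1) _ S(2), simplified], of v]
   using sym by (simp add: e_def f_def pdx_def[of "pdx X"] pdy_def[of "pdx X"])
  then have "D (pdx X) = (%v. v $ 1 *\<^sub>R e 0 + v $ 2 *\<^sub>R f 0)" by (rule ext)
  then show "(pdx X has_derivative (%v. v $ 1 *\<^sub>R e 0 + v $ 2 *\<^sub>R f 0)) (at 0)" using d[OF xy(1)] by simp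
  have "D (pdy X) v = v $ 1 *\<^sub>R f 0 + v $ 2 *\<^sub>R g 0" for v
   unfolding D_def has_derivative_plane_expand[OF Ck_on_imp_differentiable[OF xy(2) _ S(2), simplified], of v]
   by (simp add: g_def f_def pdx_def[of "pdy X"] pdy_def[of "pdy X"])
  then have "D (pdy X) = (%v. v $ 1 *\<^sub>R f 0 + v $ 2 *\<^sub>R g 0)" by (rule ext)
  then show "(pdy X has_derivative (%v. v $ 1 *\<^sub>R f 0 + v $ 2 *\<^sub>R g 0)) (at 0)" using d[OF xy(2)] by simp
 qed
 have n: "n \<bullet> pdx X 0 = 0" "n \<bullet> pdy X 0 = 0" "pdx X 0 \<bullet> n = 0" "pdy X 0 \<bullet> n = 0" if "n \<in> {e 0, f 0, g 0}" for n
  using m' that by (auto simp: e_def f_def g_def inner_axis_1)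
 note v0 = monge_jet_values[OF m]
 have E: "(fffE X has_derivative (%v. 0)) (at 0)" and F: "(fffF X has_derivative (%v. 0)) (at 0)"
  and G: "(fffG X has_derivative (%v. 0)) (at 0)"
  unfolding fffE_def[abs_def] fffF_def[abs_def] fffG_def[abs_def]
  by (rule has_derivative_eq_rhs[OF has_derivative_inner[OF dx dx]] has_derivative_eq_rhs[OF has_derivative_inner[OF dx dy]]
    has_derivative_eq_rhs[OF has_derivative_inner[OF dy dy]],
    simp add: n inner_add_left inner_add_right)+
 have gr: "(gram X has_derivative (%v. 0)) (at 0)"
  unfolding gram_def[abs_def] by (rule derivative_eq_intros E F G refl)+ simp
 have nip: "((%u. nip X u (a u) (b u)) has_derivative (%v. a 0 \<bullet> D b v + D a v \<bullet> b 0)) (at 0)"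
  and nip0: "nip X 0 (a 0) (b 0) = a 0 \<bullet> b 0"
  if ab: "Ck_on (Suc 0) a S" "Ck_on (Suc 0) b S" "a 0 \<in> {e 0, f 0, g 0}" "b 0 \<in> {e 0, f 0, g 0}" for a b
 proof -
  note da = d[OF ab(1)] and db = d[OF ab(2)]
  have g00: "gram X 0 \<noteq> 0" by (simp add: v0)
  show "((%u. nip X u (a u) (b u)) has_derivative (%v. a 0 \<bullet> D b v + D a v \<bullet> b 0)) (at 0)"
   unfolding nip_def
   by (rule has_derivative_eq_rhs,
     (rule has_derivative_diff has_derivative_add has_derivative_mult has_derivative_inner Deriv.has_derivative_inverse da db dx dy E F G gr g00)+)
    (simp_all add: v0 n[OF ab(3)] n[OF ab(4)])
  show "nip X 0 (a 0) (b 0) = a 0 \<bullet> b 0" unfolding nip_def by (simp add: n[OF ab(3)] n[OF ab(4)])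
 qed
 note nn = nip[OF efg(1) efg(1)] nip[OF efg(1) efg(2)] nip[OF efg(3) efg(3)] nip[OF efg(1) efg(3)] nip[OF efg(2) efg(2)] nip[OF efg(2) efg(3)]
 note nn0 = nip0[OF efg(1) efg(1)] nip0[OF efg(1) efg(2)] nip0[OF efg(3) efg(3)] nip0[OF efg(1) efg(3)] nip0[OF efg(2) efg(2)] nip0[OF efg(2) efg(3)]
 show "(axa1 X has_derivative (%v. 8 * ((e 0 - g 0) \<bullet> (D e v - D g v) - 4 * (f 0 \<bullet> D f v)))) (at 0)"
  unfolding axa1_def[abs_def] Let_def e_def[symmetric] f_def[symmetric] g_def[symmetric]
  by (rule has_derivative_eq_rhs,
    (rule has_derivative_diff has_derivative_add has_derivative_mult has_derivative_power has_derivative_const nn E F G insertI1 insertI2)+)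
   (simp_all add: v0 nn0 fun_eq_iff inner_diff_left inner_diff_right inner_commute algebra_simps)
 show "(axa0 X has_derivative (%v. 4 * (f 0 \<bullet> (D g v - D e v) + (g 0 - e 0) \<bullet> D f v))) (at 0)"
  unfolding axa0_def[abs_def] Let_def e_def[symmetric] f_def[symmetric] g_def[symmetric]
  by (rule has_derivative_eq_rhs,
    (rule has_derivative_diff has_derivative_add has_derivative_mult has_derivative_power has_derivative_const nn E F G insertI1 insertI2)+)
   (simp_all add: v0 nn0 fun_eq_iff inner_diff_left inner_diff_right inner_commute algebra_simps)
 show "axa1 X 0 = 4 * ((e 0 - g 0) \<bullet> (e 0 - g 0) - 4 * (f 0 \<bullet> f 0))"
  "axa0 X 0 = - 4 * ((e 0 - g 0) \<bullet> f 0)"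
  unfolding axa1_def axa0_def Let_def e_def[symmetric] f_def[symmetric] g_def[symmetric]
  by (simp_all add: v0 nn0 inner_diff_left inner_diff_right inner_commute algebra_simps)
qed

lemma monge_jet_graph:
 assumes S: "open S" "0 \<in> S" and X: "Ck_on 3 X S" and g: "\<And>u i. u \<in> S ==> X u $ 1 = u $ 1 & X u $ 2 = u $ 2"
  and R: "((%u. X u $ 3) has_derivative (%_. 0)) (at 0)" "((%u. X u $ 4) has_derivative (%_. 0)) (at 0)"
 shows "monge_jet X S"
proof -
 have X3: "Ck_on (Suc (Suc (Suc 0))) X S" "Ck_on (Suc (Suc 0)) X S" using X Ck_on_mono[OF X] by (simp_all add: numeral_3_eq_3)
 have D: "fder X (at u) v $ i = fder (%u. X u $ i) (at u) v" if "u \<in> S" for u v i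
  by (rule frechet_derivative_eqI[symmetric], rule bounded_linear.has_derivative[OF bounded_linear_vec_nth])
   (rule Ck_on_imp_has_derivative[OF X _ that], simp)
 have D12: "fder X (at u) v $ i = v $ i'" if u: "u \<in> S" and i: "i = 1 & i' = 1 \<or> i = 2 & i' = 2" for u v i i'
  unfolding D[OF u]
 proof (rule frechet_derivative_eqI)
  have "((%u :: real^2. u $ i') has_derivative (%v. v $ i')) (at u)"
   by (rule bounded_linear_imp_has_derivative[OF bounded_linear_vec_nth])
  then show "((%u. X u $ i) has_derivative (%v. v $ i')) (at u)"
   by (rule has_derivative_transform_within_open[OF _ S(1) u]) (use g i in auto)
 qed
 have D34: "fder X (at 0) v $ 3 = 0" "fder X (at 0) v $ 4 = 0" for v
  unfolding D[OF S(2)] by (rule frechet_derivative_eqI[OF R(1)] frechet_derivative_eqI[OF R(2)])+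
 have p: "pdx X 0 = axis 1 1" "pdy X 0 = axis 2 1"
  by (simp_all add: vec_eq_iff forall_4 pdx_def pdy_def D34 D12[OF S(2)] axis_def)
 have xy: "Ck_on (Suc (Suc 0)) (pdx X) S" "Ck_on (Suc (Suc 0)) (pdy X) S" by (rule Ck_on_pdx Ck_on_pdy, rule X3)+
 have z: "fder Z (at 0) v $ i = 0" if Z: "Ck_on (Suc (Suc 0)) Z S" and c: "\<And>u. u \<in> S ==> Z u $ i = c"
  for Z :: "real^2 => real^4" and i c v
 proof -
  have "((%u. Z u $ i) has_derivative (%v. fder Z (at 0) v $ i)) (at 0)"
   by (rule bounded_linear.has_derivative[OF bounded_linear_vec_nth Ck_on_imp_has_derivative[OF Z _ S(2)]]) simp
  moreover have "((%u. Z u $ i) has_derivative (%v. 0)) (at 0)"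
   by (rule has_derivative_transform_within_open[OF has_derivative_const S]) (simp add: c)
  ultimately show ?thesis using has_derivative_unique by metis
 qed
 have "dxx X 0 $ i = 0 & dxy X 0 $ i = 0 & dyy X 0 $ i = 0" if i: "i = 1 \<or> i = 2" for i
  unfolding pdx_def[of "pdx X"] pdx_def[of "pdy X"] pdy_def[of "pdy X"]
 proof (intro conjI)
  have 1: "pdx X u $ i = (if i = 1 then 1 else 0)" "pdy X u $ i = (if i = 2 then 1 else 0)" if "u \<in> S" for u
   using i D12[OF that, of i "if i = 1 then 1 else 2"] by (auto simp: pdx_def pdy_def axis_def)
  show "fder (pdx X) (at 0) (axis 1 1) $ i = 0" by (rule z[OF xy(1) 1(1)])
  show "fder (pdy X) (at 0) (axis 1 1) $ i = 0" by (rule z[OF xy(2) 1(2)])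
  show "fder (pdy X) (at 0) (axis 2 1) $ i = 0" by (rule z[OF xy(2) 1(2)])
 qed
 then show ?thesis unfolding monge_jet_def using S X p by simp
qed

lemma bigo_square_derivative:
 fixes h :: "'a::real_normed_vector => real"
 assumes "h \<in> O[nhds 0](%u. (norm u)^2)"
 shows "h 0 = 0" "(h has_derivative (%_. 0)) (at 0)"
proof -
 obtain c where c: "c > 0" "eventually (%u. norm (h u) \<le> c * norm ((norm u)^2)) (nhds 0)"
  using assms by (elim landau_o.bigE)
 have "norm (h 0) \<le> c * norm ((norm (0::'a))^2)" by (rule eventually_nhds_x_imp_x[OF c(2)])
 then show h0: "h 0 = 0" by simp
 have lim: "((%u::'a. c * norm u) \<longlongrightarrow> c * norm (0::'a)) (at 0)"
  by (intro tendsto_intros)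
 have "eventually (%u. norm (norm (h u) / norm u) \<le> c * norm u) (at 0)"
  using c(2) unfolding eventually_at_filter
 proof eventually_elim
  case (elim u)
  show ?case
  proof (intro impI)
   assume "u \<noteq> 0"
   moreover have "\<bar>h u\<bar> \<le> (c * norm u) * norm u" using elim by (simp add: power2_eq_square)
   ultimately show "norm (norm (h u) / norm u) \<le> c * norm u" by (simp add: pos_divide_le_eq)
  qed
 qed
 then have "((%u. norm (h u) / norm u) \<longlongrightarrow> 0) (at 0)"
  by (rule Lim_null_comparison) (use lim in simp)
 then show "(h has_derivative (%_. 0)) (at 0)" by (simp add: has_derivative_at h0)
qed

lemma sum_atMost_4: "(\<Sum>i\<le>4. f i) = f 0 + f 1 + f 2 + f 3 + (f 4 :: real)" for f :: "nat => real"
 by (simp add: numeral_eq_Suc)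

lemma monge_axc_derivative:
 assumes m: "monge_jet X S" and g: "\<forall>u\<in>S. gram X u > 0" and 0: "axc X 0 = 0"
  and D: "(axa0 X has_derivative d0) (at 0)" "(axa1 X has_derivative d1) (at 0)"
 shows "(axc X has_derivative (%v. Complex (d1 v / 4) (d0 v))) (at 0)"
proof -
 have S: "open S" "0 \<in> S" "Ck_on 3 X S" using m by (auto simp: monge_jet_def)
 show ?thesis
  using axc_has_derivative[OF S g[rule_format] 0] frechet_derivative_eqI[OF D(1)] frechet_derivative_eqI[OF D(2)]
  by (simp add: monge_jet_values[OF m])
qed

lemma monge_alpha_beta:
 assumes m: "monge_jet X S" and d: "(axc X has_derivative d) (at 0)"
  and eq: "\<And>z. d (vector [Re z, Im z]) = a * z + b * cnj z"
 shows "axial_alpha X 0 = a" "axial_beta X 0 = b"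
 by (rule axial_alpha_beta_eqI[OF differentiableI[OF d]], unfold frechet_derivative_eqI[OF d] monge_jet_values[OF m], rule eq)+

text \<open>The coefficients of dx^4 and dx^3 dy in the quartic equation are a0 E^3 and a1 E^3. They
  alone determine the linear parts of a0 and a1, here kappa y and kappa (a x + b y), and therefore
  the linear part (kappa (a x + b y) / 4, kappa y) of \<open>axc\<close>.\<close>

lemma monge_quartic_alpha_beta:
 assumes m: "monge_jet X S" and fr: "\<And>u. u \<in> S ==> positive_normal_frame X u (N1 u) (N2 u)"
  and h: "\<And>i. i \<le> 4 ==> h i \<in> O[nhds 0](%u. (norm u)^2)"
  and q: "\<And>u dx dy. u \<in> S ==> axial_quartic X (N1 u) (N2 u) u dx dy =
     \<kappa> * (u$2 * (dy^4 - 6 * dx^2 * dy^2 + dx^4)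
        + (a * u$1 + b * u$2) * dx * dy * (dx^2 - dy^2)
        + (\<Sum>i\<le>4. h i u * dx^i * dy^(4 - i)))"
 shows "axc X 0 = 0" "axial_alpha X 0 = of_real \<kappa> * Complex ((a + 4) / 8) (- b / 8)"
  "axial_beta X 0 = of_real \<kappa> * Complex ((a - 4) / 8) (b / 8)"
proof -
 have S: "open S" "0 \<in> S" "Ck_on 3 X S" using m by (auto simp: monge_jet_def)
 have g: "gram X u > 0" if "u \<in> S" for u by (rule positive_normal_frame_gram[OF fr[OF that]])
 have X3: "Ck_on (Suc (Suc 1)) X S" "Ck_on (Suc 1) X S" using S(3) Ck_on_mono[OF S(3)] by (simp_all add: numeral_3_eq_3)
 have g0: "gram X x \<noteq> 0" if "x \<in> S" for x using g[OF that] by simp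
 note a = Ck_on_axa[OF S(1) X3(1) g0]
 note f = Ck_on_first_form[OF S(1) X3(2)]
 have c0: "axa0 X u * fffE X u^3 = \<kappa> * (u $ 2 + h 4 u)"
  and c1: "axa1 X u * fffE X u^3 = \<kappa> * (a * u $ 1 + b * u $ 2 + h 3 u)" if u: "u \<in> S" for u
 proof -
  define A4 A3 A2 where A: "A4 = axa0 X u * fffG X u * (fffE X u * fffG X u - 4 * (fffF X u)^2) + axa1 X u * fffF X u * (2 * (fffF X u)^2 - fffE X u * fffG X u)"
   "A3 = - 8 * axa0 X u * fffE X u * fffF X u * fffG X u + axa1 X u * fffE X u * (4 * (fffF X u)^2 - fffE X u * fffG X u)"
   "A2 = - 6 * axa0 X u * fffG X u * (fffE X u)^2 + 3 * axa1 X u * fffF X u * (fffE X u)^2"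
  have Q: "A4 * t^4 + A3 * t^3 + A2 * t^2 + axa1 X u * fffE X u^3 * t + axa0 X u * fffE X u^3 =
   \<kappa> * (u$2 * (t^4 - 6 * t^2 + 1) + (a * u$1 + b * u$2) * t * (1 - t^2)
     + (h 0 u * t^4 + h 1 u * t^3 + h 2 u * t^2 + h 3 u * t + h 4 u))" for t
   using q[OF u, of 1 t]
   unfolding axial_quartic_def Let_def axial_a0_eq[OF fr[OF u]] axial_a1_eq[OF fr[OF u]] sum_atMost_4
   by (simp add: A)
  show "axa0 X u * fffE X u^3 = \<kappa> * (u $ 2 + h 4 u)" using Q[of 0] by simp
  \<comment> \<open>The values at t and - t give the odd part of the polynomial; doing this for t =
    1 and t = 2 separates the coefficient of t from that of t^3.\<close>
  show "axa1 X u * fffE X u^3 = \<kappa> * (a * u $ 1 + b * u $ 2 + h 3 u)"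
   using Q[of 1] Q[of "-1"] Q[of 2] Q[of "-2"] by (simp add: algebra_simps)
 qed
 note v0 = monge_jet_values[OF m]
 note h4 = bigo_square_derivative[OF h[of 4, simplified]] and h3 = bigo_square_derivative[OF h[of 3, simplified]]
 have z: "axa0 X 0 = 0" "axa1 X 0 = 0" using c0[OF S(2)] c1[OF S(2)] v0 h4 h3 by simp_all
 show 0: "axc X 0 = 0" using axc_eq_0_iff[OF g[OF S(2)]] z by simp
 have cE: "continuous (at 0) (%u. fffE X u^3)"
  using Ck_on_imp_continuous_on[OF f(1)] S by (intro continuous_intros) (simp add: continuous_on_eq_continuous_at)
 \<comment> \<open>The derivative of H is recovered from that of H E^3, because H vanishes at the
   origin and E = 1 there.\<close>
 have D: "(H has_derivative (%v. \<kappa> * L v)) (at 0)"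
  if H: "Ck_on 1 H S" "H 0 = 0" "\<And>u. u \<in> S ==> H u * fffE X u^3 = \<kappa> * (L u + hh u)"
   and L: "bounded_linear L" and hh: "(hh has_derivative (%_. 0)) (at 0)" for H L hh
 proof -
  have d: "(H has_derivative fder H (at 0)) (at 0)"
   by (rule Ck_on_imp_has_derivative[OF H(1) _ S(2)]) simp
  have "((%u. fffE X u^3 * H u) has_derivative (%v. fffE X 0^3 * fder H (at 0) v)) (at 0)"
   by (rule has_derivative_zero_mult[OF d H(2) cE])
  moreover have "((%u. \<kappa> * (L u + hh u)) has_derivative (%v. \<kappa> * (L v + 0))) (at 0)"
   by (intro has_derivative_mult_right has_derivative_add bounded_linear_imp_has_derivative L hh)
  then have "((%u. fffE X u^3 * H u) has_derivative (%v. \<kappa> * (L v + 0))) (at 0)"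
   by (rule has_derivative_transform_within_open[OF _ S(1,2)]) (use H(3) in \<open>simp add: mult.commute\<close>)
  ultimately have "(%v. fffE X 0^3 * fder H (at 0) v) = (%v. \<kappa> * (L v + 0))"
   by (rule has_derivative_unique)
  then have "fder H (at 0) = (%v. \<kappa> * L v)" using v0 by simp
  then show ?thesis using d by simp
 qed
 have d0: "(axa0 X has_derivative (%v. \<kappa> * v $ 2)) (at 0)"
  by (rule D[OF a(1) z(1) c0 bounded_linear_vec_nth h4(2)])
 have d1: "(axa1 X has_derivative (%v. \<kappa> * (a * v $ 1 + b * v $ 2))) (at 0)"
  by (rule D[OF a(2) z(2) _ _ h3(2)])
   (auto simp: c1 intro!: bounded_linear_add bounded_linear_const_mult bounded_linear_vec_nth)
 have "(axc X has_derivative (%v. Complex (\<kappa> * (a * v $ 1 + b * v $ 2) / 4) (\<kappa> * v $ 2))) (at 0)"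
  using g by (intro monge_axc_derivative[OF m _ 0 d0 d1]) blast
 from monge_alpha_beta[OF m this, of "of_real \<kappa> * Complex ((a + 4) / 8) (- b / 8)" "of_real \<kappa> * Complex ((a - 4) / 8) (b / 8)"]
 show "axial_alpha X 0 = of_real \<kappa> * Complex ((a + 4) / 8) (- b / 8)"
  "axial_beta X 0 = of_real \<kappa> * Complex ((a - 4) / 8) (b / 8)"
  by (simp_all add: complex_eq_iff field_simps)
qed

text \<open>The content of a normal form, for an atlas chart \<open>c0\<close>: in the Monge chart the linear part of
 the quartic differential is given by \<open>k, a, b\<close>, and the chart change multiplies it as below.\<close>

lemma axial_normal_formE:
 assumes nf: "axial_normal_form A r mu p a b"
  and A: "compact_oriented_surface A" and c0: "c0 \<in> A" "p \<in> dom_of c0" and r: "r \<ge> 3" and mu: "mu \<in> immersions A r"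
 obtains c Q t sig \<kappa> where "positive_chart A r c" "p \<in> dom_of c" "snd c p = 0" "orthogonal_matrix Q" "sig > 0" "\<kappa> \<noteq> 0"
  "\<forall>u \<in> img_of c. (sig *\<^sub>R (Q *v mu (param c u) + t)) $ 1 = u $ 1 & (sig *\<^sub>R (Q *v mu (param c u) + t)) $ 2 = u $ 2"
  "sig *\<^sub>R (Q *v mu p + t) = 0"
  "monge_jet (%u. sig *\<^sub>R (Q *v mu (param c u) + t)) (snd c ` (dom_of c \<inter> dom_of c0))"
  "axc (%u. sig *\<^sub>R (Q *v mu (param c u) + t)) 0 = 0"
  "axial_alpha (%u. sig *\<^sub>R (Q *v mu (param c u) + t)) 0 = of_real \<kappa> * Complex ((a + 4) / 8) (- b / 8)"
  "axial_beta (%u. sig *\<^sub>R (Q *v mu (param c u) + t)) 0 = of_real \<kappa> * Complex ((a - 4) / 8) (b / 8)"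
proof -
 from nf obtain c Q t sig X R S N1 N2 \<kappa> and h :: "nat => real^2 => real" where
  c: "positive_chart A r c" "p \<in> dom_of c" "snd c p = 0" and Q: "rotation_matrix Q" and sig: "sig > 0"
  and X: "X = (%u. sig *\<^sub>R (Q *v mu (param c u) + t))" "\<forall>u\<in>img_of c. X u = vector [u$1, u$2, R u, S u]"
  and RS: "R 0 = 0" "S 0 = 0" "(R has_derivative (%_. 0)) (at 0)" "(S has_derivative (%_. 0)) (at 0)"
  and N: "\<forall>u\<in>img_of c. positive_normal_frame X u (N1 u) (N2 u)" and \<kappa>: "\<kappa> \<noteq> 0"
  and h: "\<forall>i\<le>4. h i \<in> O[nhds 0](%u. (norm u)^2)"
  and q: "\<forall>u\<in>img_of c. \<forall>dx dy.
    axial_quartic X (N1 u) (N2 u) u dx dy =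
     \<kappa> * (u$2 * (dy^4 - 6 * dx^2 * dy^2 + dx^4)
        + (a * u$1 + b * u$2) * dx * dy * (dx^2 - dy^2)
        + (\<Sum>i\<le>4. h i u * dx^i * dy^(4 - i)))"
  unfolding axial_normal_form_def by (elim exE conjE) (rule that)
 let ?S = "snd c ` (dom_of c \<inter> dom_of c0)"
 note tr = chart_transition[OF A c0(1) c(1)]
 have ch: "is_chart c" using c by (simp add: positive_chart_def)
 have S0: "0 \<in> ?S" using c c0 by (metis IntI imageI)
 have 0: "0 \<in> img_of c" using S0 tr(2) by blast
 have p0: "param c 0 = p" using is_chart_param(1)[OF ch c(2)] c(3) by simp
 have oQ: "orthogonal_matrix Q" using Q by (simp add: rotation_matrix_def)
 have "Ck_on r (mu \<circ> param c0) (img_of c0)" using mu c0 by (auto simp: immersions_def Cr_maps_def)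
 then have "Ck_on 3 (mu \<circ> param c0) (img_of c0)" using r by (rule Ck_on_mono)
 from Ck_on_compose'[OF tr(1,4) Ck_on_mono[OF tr(5) r] this]
 have "Ck_on 3 (mu \<circ> param c) ?S"
  by (rule Ck_on_cong[OF tr(1), rotated]) (use tr(7) in auto)
 then have "Ck_on 3 (%u. sig *\<^sub>R (Q *v (mu \<circ> param c) u + t)) ?S"
  by (intro Ck_on_scaleR Ck_on_add tr(1) Ck_on_const Ck_on_bounded_linear_compose[OF matrix_vector_mul_bounded_linear])
 then have CX: "Ck_on 3 X ?S" by (simp add: X(1))
 have comp: "X u $ 1 = u $ 1" "X u $ 2 = u $ 2" "X u $ 3 = R u" "X u $ 4 = S u" if "u \<in> img_of c" for u
  by (simp_all add: X(2)[rule_format, OF that] vector_4)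
 have oi: "open (img_of c)" using ch by (simp add: is_chart_def)
 have m: "monge_jet X ?S"
 proof (rule monge_jet_graph[OF tr(1) S0 CX])
  show "X u $ 1 = u $ 1 & X u $ 2 = u $ 2" if "u \<in> ?S" for u using comp tr(2) that by blast
  show "((%u. X u $ 3) has_derivative (%_. 0)) (at 0)"
   by (rule has_derivative_transform_within_open[OF RS(3) oi 0]) (simp add: comp)
  show "((%u. X u $ 4) has_derivative (%_. 0)) (at 0)"
   by (rule has_derivative_transform_within_open[OF RS(4) oi 0]) (simp add: comp)
 qed
 have mm: "axc X 0 = 0 & axial_alpha X 0 = of_real \<kappa> * Complex ((a + 4) / 8) (- b / 8) &
  axial_beta X 0 = of_real \<kappa> * Complex ((a - 4) / 8) (b / 8)"
  using monge_quartic_alpha_beta[OF m, of N1 N2 h \<kappa> a b] N h q tr(2) by blast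
 have X0: "X 0 = 0" by (simp add: vec_eq_iff forall_4 comp[OF 0] RS(1,2))
 show thesis
 proof (rule that[OF c oQ sig \<kappa>])
  show "\<forall>u \<in> img_of c. (sig *\<^sub>R (Q *v mu (param c u) + t)) $ 1 = u $ 1 & (sig *\<^sub>R (Q *v mu (param c u) + t)) $ 2 = u $ 2"
   using comp unfolding X(1) by blast
  show "sig *\<^sub>R (Q *v mu p + t) = 0" using X0 unfolding X(1) p0 .
 qed (use m mm in \<open>simp_all only: X(1) simp_thms\<close>)
qed

text \<open>These are the hypotheses of \<open>disc5_scale\<close> with r = sig^4 |l|^10. The
  exponents 3 and 5 in \<open>disc5\<close> balance the two multipliers: up to a real factor the
  third expression is l^15 times (cnj l)^20 l^5, which is |l|^40.\<close>

lemma axial_factor_scale: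
 fixes l :: complex and sig :: real
 shows "(cmod (of_real (sig^2) * l^5))^2 = sig^4 * cmod l^10"
  "(cmod (of_real (sig^2) * l^4 * cnj l))^2 = sig^4 * cmod l^10"
  "(of_real (sig^2) * l^5)^3 * cnj (of_real (sig^2) * l^4 * cnj l)^5 = of_real ((sig^4 * cmod l^10)^4)"
proof -
 show "(cmod (of_real (sig^2) * l^5))^2 = sig^4 * cmod l^10"
  by (simp add: norm_mult norm_power power_mult_distrib flip: power_mult)
 show "(cmod (of_real (sig^2) * l^4 * cnj l))^2 = sig^4 * cmod l^10"
  by (simp add: norm_mult norm_power power_mult_distrib flip: power_mult power_Suc2 power_add)
 have "(of_real (sig^2) * l^5)^3 * cnj (of_real (sig^2) * l^4 * cnj l)^5 = of_real (sig^2)^8 * (l * cnj l)^20"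
 proof -
  have "(s * l^5)^3 * (s * m^4 * l)^5 = s^8 * (l * m)^20" for s m :: complex
  proof -
   have "s^8 = s^3 * s^5" "l^20 = l^15 * l^5" by (simp_all flip: power_add)
   moreover have "(l^5)^3 = l^15" "(m^4)^5 = m^20" by (simp_all flip: power_mult)
   ultimately show ?thesis by (simp only: power_mult_distrib mult_ac)
  qed
  then show ?thesis unfolding complex_cnj_mult complex_cnj_power complex_cnj_cnj complex_cnj_complex_of_real .
 qed
 also have "l * cnj l = of_real (cmod l^2)" by (metis complex_norm_square)
 finally show "(of_real (sig^2) * l^5)^3 * cnj (of_real (sig^2) * l^4 * cnj l)^5 = of_real ((sig^4 * cmod l^10)^4)"
  by (simp add: power_mult_distrib flip: power_mult)
qed

text \<open>The Monge chart of any normal form is compared with c0. Passing between them multiplies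
  the squared moduli by rho and \<open>disc5\<close> by rho^4, and \<open>\<kappa>\<close> enters
  only in even powers; so the signs computed in an arbitrary normal form are those of intrinsic
  quantities at p.\<close>

lemma normal_form_invariants:
 assumes nf: "axial_normal_form A r mu p a b"
  and A: "compact_oriented_surface A" and c0: "c0 \<in> A" "p \<in> dom_of c0" and r: "r \<ge> 3" and mu: "mu \<in> immersions A r"
 defines "\<alpha> \<equiv> axial_alpha (mu \<circ> param c0) (snd c0 p)" and "\<beta> \<equiv> axial_beta (mu \<circ> param c0) (snd c0 p)"
 shows "axc (mu \<circ> param c0) (snd c0 p) = 0"
  "\<exists>K>0. disc5 \<alpha> \<beta> = K * ((a + 1)^2 * Delta a b)"
  "\<exists>K>0. (cmod \<beta>)^2 - (cmod \<alpha>)^2 = - (K * a)"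
  "\<exists>K>0. 25 * (cmod \<alpha>)^2 - 9 * (cmod \<beta>)^2 = K * (a^2 + b^2 + 17 * a + 16)"
proof -
 have mu': "mu \<in> Cr_maps A r" "\<forall>y\<in>img_of c0. gram (mu \<circ> param c0) y > 0"
  using mu immersion_gram[OF mu _ c0(1)] r by (auto simp: immersions_def)
 obtain c Q t sig \<kappa> where c: "positive_chart A r c" "p \<in> dom_of c" "snd c p = 0" and Q: "orthogonal_matrix Q" and sig: "sig > 0" and \<kappa>: "\<kappa> \<noteq> 0"
  and z: "axc (%u. sig *\<^sub>R (Q *v mu (param c u) + t)) 0 = 0"
  and al: "axial_alpha (%u. sig *\<^sub>R (Q *v mu (param c u) + t)) 0 = of_real \<kappa> * Complex ((a + 4) / 8) (- b / 8)"
  and be: "axial_beta (%u. sig *\<^sub>R (Q *v mu (param c u) + t)) 0 = of_real \<kappa> * Complex ((a - 4) / 8) (b / 8)"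
  by (rule axial_normal_formE[OF nf A c0 r mu])
 note tr = axc_chart_transform(3,5,6)[OF A c0(1) c(1) r c(2) c0(2) mu' Q sig, of t, unfolded c(3)]
 show z0: "axc (mu \<circ> param c0) (snd c0 p) = 0" using tr(1) z by blast
 define l where "l = axial_factor (mu \<circ> param c0) sig (snd c0 \<circ> param c) 0"
 have l0: "l \<noteq> 0" unfolding l_def
  by (rule axc_chart_transform(2)[OF A c0(1) c(1) r c(2) c0(2) mu' Q sig, unfolded c(3)])
 have a1: "of_real (sig^2) * l^5 * \<alpha> = of_real \<kappa> * Complex ((a + 4) / 8) (- b / 8)"
  using tr(2)[OF z0] unfolding al l_def \<alpha>_def by simp
 have b1: "of_real (sig^2) * l^4 * cnj l * \<beta> = of_real \<kappa> * Complex ((a - 4) / 8) (b / 8)"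
  using tr(3)[OF z0] unfolding be l_def \<beta>_def by simp
 define rho where "rho = sig^4 * cmod l^10"
 have rho: "rho > 0" using sig l0 by (simp add: rho_def)
 note n = disc5_normal_form[OF a1 b1]
 have d: "disc5 (of_real (sig^2) * l^5 * \<alpha>) (of_real (sig^2) * l^4 * cnj l * \<beta>) = rho^4 * disc5 \<alpha> \<beta>"
  unfolding rho_def by (rule disc5_scale[OF axial_factor_scale])
 have k0: "\<kappa>^8 / 2097152 > 0" "\<kappa>^2 > 0" using \<kappa> by simp_all
 show "\<exists>K>0. disc5 \<alpha> \<beta> = K * ((a + 1)^2 * Delta a b)"
  using n(1) k0 rho unfolding d by (intro exI[of _ "\<kappa>^8 / 2097152 / rho^4"]) (simp add: field_simps)
 have nn: "(cmod (of_real (sig^2) * l^5 * \<alpha>))^2 = rho * (cmod \<alpha>)^2" "(cmod (of_real (sig^2) * l^4 * cnj l * \<beta>))^2 = rho * (cmod \<beta>)^2"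
  unfolding rho_def by (simp_all only: norm_mult[of _ \<alpha>] norm_mult[of _ \<beta>] power_mult_distrib[of _ _ 2] axial_factor_scale)
 show "\<exists>K>0. (cmod \<beta>)^2 - (cmod \<alpha>)^2 = - (K * a)"
  using n(2) k0 rho unfolding nn by (intro exI[of _ "\<kappa>^2 / 4 / rho"]) (simp add: field_simps)
 show "\<exists>K>0. 25 * (cmod \<alpha>)^2 - 9 * (cmod \<beta>)^2 = K * (a^2 + b^2 + 17 * a + 16)"
  using n(3) k0 rho unfolding nn by (intro exI[of _ "\<kappa>^2 / 4 / rho"]) (simp add: field_simps)
qed

section \<open>Perturbing the quintic\<close>

text \<open>\<open>disc5_grad\<close> and \<open>disc5_grad'\<close> are the coefficients p, q for
  which the derivative of \<open>disc5\<close> in the direction (u, v) is Re (p u + q v). The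
  rational numbers are those of the partial derivatives of \<open>quintic_P\<close> in A and in
  B.\<close>

definition disc5_grad :: "complex => complex => complex" where
 "disc5_grad \<alpha> \<beta> = (let A = (cmod \<alpha>)^2; B = (cmod \<beta>)^2 in
  2 * of_real (3125/128 * A^3 - 1875/128 * A^2 * B - 25/128 * A * B^2 - 9/128 * B^3) * cnj \<alpha> - 3 * \<alpha>^2 * cnj \<beta>^5)"

definition disc5_grad' :: "complex => complex => complex" where
 "disc5_grad' \<alpha> \<beta> = (let A = (cmod \<alpha>)^2; B = (cmod \<beta>)^2 in
  2 * of_real (- 625/128 * A^3 - 25/128 * A^2 * B - 27/128 * A * B^2 - 27/128 * B^3) * cnj \<beta> - 5 * cnj \<alpha>^3 * \<beta>^4)"

lemma disc5_has_derivative: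
 "((%eps::real. disc5 (\<alpha> + of_real eps * u) (\<beta> + of_real eps * v)) has_real_derivative
  Re (disc5_grad \<alpha> \<beta> * u + disc5_grad' \<alpha> \<beta> * v)) (at 0)"
proof -
 have N: "((%eps::real. (cmod (\<alpha> + of_real eps * u))^2) has_real_derivative 2 * Re (cnj \<alpha> * u)) (at 0)" for \<alpha> u
 proof -
  have "(%eps::real. (cmod (\<alpha> + of_real eps * u))^2) = (%eps. (cmod \<alpha>)^2 + 2 * Re (cnj \<alpha> * u) * eps + (cmod u)^2 * eps^2)"
   unfolding cmod_power2 by (simp add: fun_eq_iff power2_eq_square algebra_simps)
  then show ?thesis by (auto intro!: derivative_eq_intros)
 qed
 have l: "((%eps::real. \<alpha> + of_real eps * u) has_derivative (%h. of_real h * u)) (at 0)" for \<alpha> u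
 proof -
  have "((%eps::real. \<alpha> + eps *\<^sub>R u) has_derivative (%h. 0 + h *\<^sub>R u)) (at 0)"
   by (intro has_derivative_add has_derivative_const bounded_linear_imp_has_derivative bounded_linear_scaleR_left)
  then show ?thesis by (simp add: scaleR_conv_of_real)
 qed
 have "((%eps::real. Re ((\<alpha> + of_real eps * u)^3 * (cnj \<beta> + of_real eps * cnj v)^5)) has_derivative
   (%h. h * Re (3 * \<alpha>^2 * cnj \<beta>^5 * u + 5 * \<alpha>^3 * cnj \<beta>^4 * cnj v))) (at 0)"
 proof (rule has_derivative_eq_rhs)
  show "((%eps::real. Re ((\<alpha> + of_real eps * u)^3 * (cnj \<beta> + of_real eps * cnj v)^5)) has_derivative
   (%h. Re ((\<alpha> + of_real 0 * u)^3 * (of_nat 5 * (of_real h * cnj v) * (cnj \<beta> + of_real 0 * cnj v)^(5 - 1))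
    + (of_nat 3 * (of_real h * u) * (\<alpha> + of_real 0 * u)^(3 - 1)) * (cnj \<beta> + of_real 0 * cnj v)^5))) (at 0)"
   by (intro bounded_linear.has_derivative[OF bounded_linear_Re] has_derivative_mult has_derivative_power l)
  have "Re (\<alpha>^3 * (5 * (of_real h * cnj v) * cnj \<beta>^4) + (3 * (of_real h * u) * \<alpha>^2) * cnj \<beta>^5) =
   Re (of_real h * (3 * \<alpha>^2 * cnj \<beta>^5 * u + 5 * \<alpha>^3 * cnj \<beta>^4 * cnj v))" for h
   by (rule arg_cong[of _ _ Re]) algebra
  then show "(%h. Re ((\<alpha> + of_real 0 * u)^3 * (of_nat 5 * (of_real h * cnj v) * (cnj \<beta> + of_real 0 * cnj v)^(5 - 1))
    + (of_nat 3 * (of_real h * u) * (\<alpha> + of_real 0 * u)^(3 - 1)) * (cnj \<beta> + of_real 0 * cnj v)^5)) =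
   (%h. h * Re (3 * \<alpha>^2 * cnj \<beta>^5 * u + 5 * \<alpha>^3 * cnj \<beta>^4 * cnj v))" by (simp add: fun_eq_iff del: of_real_mult)
 qed
 then have R: "((%eps::real. Re ((\<alpha> + of_real eps * u)^3 * cnj (\<beta> + of_real eps * v)^5)) has_real_derivative
   Re (3 * \<alpha>^2 * cnj \<beta>^5 * u + 5 * \<alpha>^3 * cnj \<beta>^4 * cnj v)) (at 0)"
  by (intro has_derivative_imp_has_field_derivative) (simp_all add: mult.commute)
 let ?A = "(cmod \<alpha>)^2" and ?B = "(cmod \<beta>)^2"
 have P: "((%eps::real. quintic_P ((cmod (\<alpha> + of_real eps * u))^2) ((cmod (\<beta> + of_real eps * v))^2)) has_real_derivative
   (3125/128 * ?A^3 - 1875/128 * ?A^2 * ?B - 25/128 * ?A * ?B^2 - 9/128 * ?B^3) * (2 * Re (cnj \<alpha> * u)) +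
   (- 625/128 * ?A^3 - 25/128 * ?A^2 * ?B - 27/128 * ?A * ?B^2 - 27/128 * ?B^3) * (2 * Re (cnj \<beta> * v))) (at 0)"
  unfolding quintic_P_def
  by (rule derivative_eq_intros N refl)+ (simp add: field_simps power_numeral_reduce)
 have "Re (disc5_grad \<alpha> \<beta> * u + disc5_grad' \<alpha> \<beta> * v) =
   (3125/128 * ?A^3 - 1875/128 * ?A^2 * ?B - 25/128 * ?A * ?B^2 - 9/128 * ?B^3) * (2 * Re (cnj \<alpha> * u)) +
   (- 625/128 * ?A^3 - 25/128 * ?A^2 * ?B - 27/128 * ?A * ?B^2 - 27/128 * ?B^3) * (2 * Re (cnj \<beta> * v))
   - Re (3 * \<alpha>^2 * cnj \<beta>^5 * u + 5 * \<alpha>^3 * cnj \<beta>^4 * cnj v)"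
 proof -
  \<comment> \<open>Conjugation does not change the real part; it turns the term in cnj v into one
    that is complex linear in v.\<close>
  have c: "Re (5 * \<alpha>^3 * cnj \<beta>^4 * cnj v) = Re (5 * cnj \<alpha>^3 * \<beta>^4 * v)"
   using complex_cnj(1) by (metis (no_types) cnj.simps(1) complex_cnj_mult complex_cnj_power complex_cnj_numeral complex_cnj_cnj)
  have r: "Re (2 * of_real k * w * z) = k * (2 * Re (w * z))" for k w z by (simp add: algebra_simps)
  show ?thesis
   unfolding disc5_grad_def disc5_grad'_def Let_def left_diff_distrib plus_complex.sel minus_complex.sel r c by simp
 qed
 then show ?thesis unfolding disc5_def using DERIV_diff[OF P R] by (simp add: o_def)
qed

text \<open>The product of alpha with \<open>disc5_grad\<close> is a real number minus 3 alpha^3 cnj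
  beta^5, and at such a zero the latter is not real by \<open>disc5_zero_imp_strict\<close>.\<close>

lemma disc5_grad_nonzero:
 assumes "disc5 \<alpha> \<beta> = 0" "(cmod \<alpha>)^2 \<noteq> (cmod \<beta>)^2" "25 * (cmod \<alpha>)^2 \<noteq> 9 * (cmod \<beta>)^2"
 shows "disc5_grad \<alpha> \<beta> \<noteq> 0"
proof
 assume 0: "disc5_grad \<alpha> \<beta> = 0"
 obtain P where P: "disc5_grad \<alpha> \<beta> = 2 * of_real P * cnj \<alpha> - 3 * \<alpha>^2 * cnj \<beta>^5"
  unfolding disc5_grad_def Let_def by blast
 have "\<alpha> * cnj \<alpha> = of_real ((cmod \<alpha>)^2)" by (rule complex_norm_square[symmetric])
 then have "3 * (\<alpha>^3 * cnj \<beta>^5) = of_real (2 * P * (cmod \<alpha>)^2) - \<alpha> * disc5_grad \<alpha> \<beta>"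
  unfolding P by (simp add: algebra_simps power3_eq_cube power2_eq_square)
 then have "Im (3 * (\<alpha>^3 * cnj \<beta>^5)) = 0" unfolding 0 by simp
 then show False using disc5_zero_imp_strict(3)[OF assms] by simp
qed

text \<open>The four directions (s c, cnj s c) are those which cubic perturbations can produce: s
  records which coordinate is cubed and c the normal direction. If all four real parts vanished,
  both the sum and the difference of the two gradients would be zero.\<close>

lemma disc5_direction:
 assumes "disc5 \<alpha> \<beta> = 0" "(cmod \<alpha>)^2 \<noteq> (cmod \<beta>)^2" "25 * (cmod \<alpha>)^2 \<noteq> 9 * (cmod \<beta>)^2"
 shows "\<exists>s \<in> {1, \<i>}. \<exists>c \<in> {1, \<i>}. Re (disc5_grad \<alpha> \<beta> * (s * c) + disc5_grad' \<alpha> \<beta> * (cnj s * c)) \<noteq> 0"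
proof (rule ccontr)
 let ?p = "disc5_grad \<alpha> \<beta>" and ?q = "disc5_grad' \<alpha> \<beta>"
 assume "\<not> ?thesis"
 then have z: "Re (?p * (s * c) + ?q * (cnj s * c)) = 0" if "s \<in> {1, \<i>}" "c \<in> {1, \<i>}" for s c using that by blast
 have "Re ?p = 0" "Im ?p = 0" using z[of 1 1] z[of 1 \<i>] z[of \<i> 1] z[of \<i> \<i>] by simp_all
 then have "?p = 0" by (simp add: complex_eq_iff)
 then show False using disc5_grad_nonzero[OF assms] by simp
qed

section \<open>Cubic perturbations in a normal direction\<close>

lemma frechet_derivative_add_monomial:
 fixes Z Z' :: "real^2 => real^4"
 assumes S: "open S" "u \<in> S" and Z: "Z differentiable (at u)"
  and eq: "\<And>x. x \<in> S ==> Z' x = Z x + (k * (x $ i)^m) *\<^sub>R n"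
 shows "(Z' has_derivative (%v. fder Z (at u) v + (k * (real m * (v $ i) * (u $ i)^(m - 1))) *\<^sub>R n)) (at u)"
proof -
 have "((%x. Z x + (k * (x $ i)^m) *\<^sub>R n) has_derivative
  (%v. fder Z (at u) v + (k * (of_nat m * (v $ i) * (u $ i)^(m - 1))) *\<^sub>R n)) (at u)"
  by (intro has_derivative_add has_derivative_scaleR_left has_derivative_mult_right has_derivative_power
    bounded_linear_imp_has_derivative bounded_linear_vec_nth Z[unfolded frechet_derivative_works])
 then show ?thesis by (rule has_derivative_transform_within_open[OF _ S]) (simp add: eq)
qed

text \<open>The cubic term leaves the 2-jet at 0 unchanged, so the zero of \<open>axc\<close>
  persists, and it adds 6 eps u_i n to dxx or to dyy. Because 2 Re z = z + cnj z and - 2 Im z = i z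
  + cnj (i z), both cases change the linear part by 6 eps c (s z + cnj s cnj z), with s = 1 or s =
  i.\<close>

lemma monge_perturbation:
 assumes m: "monge_jet X S" and g: "\<forall>u\<in>S. gram X u > 0" and 0: "axc X 0 = 0"
  and X': "\<And>u. u \<in> S ==> X' u = X u + (eps * (u $ i)^3) *\<^sub>R n" and g': "\<forall>u\<in>S. gram X' u > 0"
  and s: "s = (if i = 1 then 1 else \<i>)"
 defines "c \<equiv> Complex ((dxx X 0 - dyy X 0) \<bullet> n) (- 2 * (dxy X 0 \<bullet> n))"
 shows "axc X' 0 = 0" "axial_alpha X' 0 = axial_alpha X 0 + of_real eps * (6 * (s * c))"
  "axial_beta X' 0 = axial_beta X 0 + of_real eps * (6 * (cnj s * c))"
proof -
 have S: "open S" "0 \<in> S" and X: "Ck_on 3 X S" using m by (auto simp: monge_jet_def)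
 have X3: "Ck_on (Suc (Suc (Suc 0))) X S" "Ck_on (Suc (Suc 0)) X S" using X Ck_on_mono[OF X] by (simp_all add: numeral_3_eq_3)
 have xy: "Ck_on (Suc (Suc 0)) (pdx X) S" "Ck_on (Suc (Suc 0)) (pdy X) S" by (rule Ck_on_pdx Ck_on_pdy, rule X3)+
 have efg: "Ck_on (Suc 0) (dxx X) S" "Ck_on (Suc 0) (dxy X) S" "Ck_on (Suc 0) (dyy X) S"
  by (rule Ck_on_pdx Ck_on_pdy, rule xy)+
 define x y where xy_def: "x = (axis 1 1 :: real^2) $ i" "y = (axis 2 1 :: real^2) $ i"
 have i: "i = 1 & x = 1 & y = 0 \<or> i = 2 & x = 0 & y = 1" using exhaust_2[of i] by (auto simp: xy_def axis_def)
 note D = frechet_derivative_add_monomial[OF S(1)]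
 have px: "pdx X' u = pdx X u + ((3 * eps * x) * (u $ i)^2) *\<^sub>R n" and py: "pdy X' u = pdy X u + ((3 * eps * y) * (u $ i)^2) *\<^sub>R n"
  if u: "u \<in> S" for u
  unfolding pdx_def pdy_def using frechet_derivative_eqI[OF D[OF u Ck_on_imp_differentiable[OF X _ u] X', simplified]]
  by (simp_all add: xy_def)
 have e: "dxx X' u = dxx X u + ((6 * eps * x) * (u $ i)^1) *\<^sub>R n" and f: "dxy X' u = dxy X u"
  and h: "dyy X' u = dyy X u + ((6 * eps * y) * (u $ i)^1) *\<^sub>R n" if u: "u \<in> S" for u
  unfolding pdx_def[of "pdx X"] pdx_def[of "pdy X"] pdy_def[of "pdy X"] pdx_def[of "pdx X'"] pdx_def[of "pdy X'"] pdy_def[of "pdy X'"]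
  using frechet_derivative_eqI[OF D[OF u Ck_on_imp_differentiable[OF xy(1) _ u] px, simplified]]
   frechet_derivative_eqI[OF D[OF u Ck_on_imp_differentiable[OF xy(2) _ u] py, simplified]] i
  by (auto simp: axis_def)
 have De: "fder (dxx X') (at 0) v = fder (dxx X) (at 0) v + (6 * eps * x * v $ i) *\<^sub>R n" for v
  using frechet_derivative_eqI[OF D[OF S(2) Ck_on_imp_differentiable[OF efg(1) _ S(2)] e, simplified]] by simp
 have Dh: "fder (dyy X') (at 0) v = fder (dyy X) (at 0) v + (6 * eps * y * v $ i) *\<^sub>R n" for v
  using frechet_derivative_eqI[OF D[OF S(2) Ck_on_imp_differentiable[OF efg(3) _ S(2)] h, simplified]] by simp
 have Df: "fder (dxy X') (at 0) v = fder (dxy X) (at 0) v" for v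
  by (rule frechet_derivative_transform_within_open[THEN fun_cong, symmetric, OF _ S])
   (use f Ck_on_imp_differentiable[OF efg(2) _ S(2)] in auto)
 have CX': "Ck_on 3 X' S"
 proof (rule Ck_on_cong[OF S(1) X'[symmetric]])
  show "Ck_on 3 (%u. X u + (eps * (u $ i)^3) *\<^sub>R n) S"
   by (intro Ck_on_add Ck_on_scaleR Ck_on_mult Ck_on_const Ck_on_power Ck_on_vec_nth Ck_on_ident S X)
 qed
 have m': "monge_jet X' S"
  using m unfolding monge_jet_def by (simp add: CX' px[OF S(2)] py[OF S(2)] e[OF S(2)] f[OF S(2)] h[OF S(2)])
 note d = monge_axa_derivative[OF m] and d' = monge_axa_derivative[OF m']
 have z: "axa0 X 0 = 0" "axa1 X 0 = 0" using axc_eq_0_iff[OF g[rule_format, OF S(2)]] 0 by auto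
 have "axa0 X' 0 = axa0 X 0" "axa1 X' 0 = axa1 X 0"
  unfolding d(3,4) d'(3,4) by (simp_all add: e[OF S(2)] f[OF S(2)] h[OF S(2)])
 then show zero': "axc X' 0 = 0" using axc_eq_0_iff[OF g'[rule_format, OF S(2)]] z by simp
 note a = monge_axc_derivative[OF m g 0 d(2,1)] and a' = monge_axc_derivative[OF m' g' zero' d'(2,1)]
 have eq: "fder (axc X') (at 0) v = fder (axc X) (at 0) v + of_real (12 * eps * (x - y) * v $ i) * c" for v
  unfolding frechet_derivative_eqI[OF a] frechet_derivative_eqI[OF a'] De Df Dh e[OF S(2)] f[OF S(2)] h[OF S(2)]
  by (simp add: complex_eq_iff c_def inner_diff_left inner_diff_right inner_add_right algebra_simps inner_commute
    add_divide_distrib diff_divide_distrib)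
 note dd = differentiableI[OF a] and dd' = differentiableI[OF a']
 have zz: "zvec X' 0 z = zvec X 0 z" for z by (simp add: monge_jet_values[OF m] monge_jet_values[OF m'])
 have "fder (axc X') (at 0) (zvec X' 0 z) = (axial_alpha X 0 + of_real eps * (6 * (s * c))) * z
   + (axial_beta X 0 + of_real eps * (6 * (cnj s * c))) * cnj z" for z
 proof -
  have "of_real (12 * eps * (x - y) * zvec X 0 z $ i) * c = of_real eps * 6 * c * (s * z + cnj s * cnj z)"
   using i by (auto simp: monge_jet_values[OF m] s complex_eq_iff algebra_simps)
  then show ?thesis unfolding zz eq axc_zvec_derivative[OF dd] by (simp add: algebra_simps)
 qed
 from axial_alpha_beta_eqI[OF dd' this]
 show "axial_alpha X' 0 = axial_alpha X 0 + of_real eps * (6 * (s * c))"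
  "axial_beta X' 0 = axial_beta X 0 + of_real eps * (6 * (cnj s * c))" by blast+
qed

lemma immersions_Cr_maps: "mu \<in> immersions A r ==> mu \<in> Cr_maps A r"
 by (simp add: immersions_def)

lemma chart_similarity_gram:
 fixes Q :: "real^4^4"
 assumes A: "compact_oriented_surface A" and c0: "c0 \<in> A" and c: "positive_chart A r c" and r: "r \<ge> 3"
  and mu: "mu \<in> immersions A r" and Q: "orthogonal_matrix Q" and sig: "sig > 0"
 shows "\<forall>u \<in> snd c ` (dom_of c \<inter> dom_of c0). gram (%u. sig *\<^sub>R (Q *v mu (param c u) + t)) u > 0"
proof -
 have "\<forall>y\<in>img_of c0. gram (mu \<circ> param c0) y > 0" using immersion_gram[OF mu _ c0] r by simp
 from axc_chart_transform(1)[OF A c0 c r _ _ immersions_Cr_maps[OF mu] this Q sig] show ?thesis by blast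
qed

text \<open>It provides the direction \<open>\<eta>\<close> in which F will have a nonzero
  derivative. Along it the coefficients in the Monge chart move on a straight line, so
  \<open>\<Phi>\<close> is \<open>disc5\<close> along that line divided by the constant rho^4, and
  \<open>disc5_direction\<close> gives the nonzero slope.\<close>

lemma immersion_perturbation:
 assumes nf: "axial_normal_form A r mu p a b"
  and A: "compact_oriented_surface A" and c0: "c0 \<in> A" "p \<in> dom_of c0" and r: "r \<ge> 3" and mu: "mu \<in> immersions A r"
 defines "\<alpha> \<equiv> axial_alpha (mu \<circ> param c0) (snd c0 p)" and "\<beta> \<equiv> axial_beta (mu \<circ> param c0) (snd c0 p)"
 assumes disc: "disc5 \<alpha> \<beta> = 0" "(cmod \<alpha>)^2 \<noteq> (cmod \<beta>)^2" "25 * (cmod \<alpha>)^2 \<noteq> 9 * (cmod \<beta>)^2"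
 shows "\<exists>\<eta>\<in>Cr_maps A r. \<exists>\<Phi> d. (\<Phi> has_real_derivative d) (at 0) & d \<noteq> 0 &
  (\<forall>eps. (%q. mu q + eps *\<^sub>R \<eta> q) \<in> immersions A r -->
   axc ((%q. mu q + eps *\<^sub>R \<eta> q) \<circ> param c0) (snd c0 p) = 0 &
   disc5 (axial_alpha ((%q. mu q + eps *\<^sub>R \<eta> q) \<circ> param c0) (snd c0 p))
    (axial_beta ((%q. mu q + eps *\<^sub>R \<eta> q) \<circ> param c0) (snd c0 p)) = \<Phi> eps)"
proof -
 obtain c Q t sig \<kappa> where c: "positive_chart A r c" "p \<in> dom_of c" "snd c p = 0" and Q: "orthogonal_matrix Q" and sig: "sig > 0" and \<kappa>: "\<kappa> \<noteq> 0"
  and X12: "\<forall>u \<in> img_of c. (sig *\<^sub>R (Q *v mu (param c u) + t)) $ 1 = u $ 1 & (sig *\<^sub>R (Q *v mu (param c u) + t)) $ 2 = u $ 2"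
  and Xp: "sig *\<^sub>R (Q *v mu p + t) = 0"
  and mj: "monge_jet (%u. sig *\<^sub>R (Q *v mu (param c u) + t)) (snd c ` (dom_of c \<inter> dom_of c0))"
  and z: "axc (%u. sig *\<^sub>R (Q *v mu (param c u) + t)) 0 = 0"
  and al: "axial_alpha (%u. sig *\<^sub>R (Q *v mu (param c u) + t)) 0 = of_real \<kappa> * Complex ((a + 4) / 8) (- b / 8)"
  and be: "axial_beta (%u. sig *\<^sub>R (Q *v mu (param c u) + t)) 0 = of_real \<kappa> * Complex ((a - 4) / 8) (b / 8)"
  by (rule axial_normal_formE[OF nf A c0 r mu])
 define S where "S = snd c ` (dom_of c \<inter> dom_of c0)"
 define X where "X = (%u. sig *\<^sub>R (Q *v mu (param c u) + t))"
 define l where "l = axial_factor (mu \<circ> param c0) sig (snd c0 \<circ> param c) 0"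
 define rho where "rho = sig^4 * cmod l^10"
 note z = z[folded X_def] and mj = mj[folded X_def S_def] and al = al[folded X_def] and be = be[folded X_def]
 have gr: "\<forall>y\<in>img_of c0. gram (nu \<circ> param c0) y > 0" if "nu \<in> immersions A r" for nu
  using immersion_gram[OF that _ c0(1)] r by simp
 have gX: "\<forall>u\<in>S. gram X u > 0"
  unfolding S_def X_def by (rule chart_similarity_gram[OF A c0(1) c(1) r mu Q sig])
 note trl = axc_chart_transform(2)[OF A c0(1) c(1) r c(2) c0(2) immersions_Cr_maps gr Q sig, unfolded c(3)]
 note tr = axc_chart_transform(3,5,6)[OF A c0(1) c(1) r c(2) c0(2) immersions_Cr_maps gr Q sig, where t = t, unfolded c(3)]
 have l0: "l \<noteq> 0" unfolding l_def by (rule trl[OF mu mu])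
 have rho: "rho > 0" using sig l0 by (simp add: rho_def)
 have z0: "axc (mu \<circ> param c0) (snd c0 p) = 0" using tr(1)[OF mu mu] z by (simp add: X_def)
 have a1: "axial_alpha X 0 = of_real (sig^2) * l^5 * \<alpha>" and b1: "axial_beta X 0 = of_real (sig^2) * l^4 * cnj l * \<beta>"
  using tr(2)[OF mu mu z0] tr(3)[OF mu mu z0] by (simp_all add: X_def l_def \<alpha>_def \<beta>_def)
 have scale: "disc5 (of_real (sig^2) * l^5 * u) (of_real (sig^2) * l^4 * cnj l * v) = rho^4 * disc5 u v" for u v
  unfolding rho_def by (rule disc5_scale[OF axial_factor_scale])
 have nn: "(cmod (axial_alpha X 0))^2 = rho * (cmod \<alpha>)^2" "(cmod (axial_beta X 0))^2 = rho * (cmod \<beta>)^2"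
  unfolding rho_def a1 b1
  by (simp_all only: norm_mult[of _ \<alpha>] norm_mult[of _ \<beta>] power_mult_distrib[of _ _ 2] axial_factor_scale)
 have discX: "disc5 (axial_alpha X 0) (axial_beta X 0) = 0" "(cmod (axial_alpha X 0))^2 \<noteq> (cmod (axial_beta X 0))^2"
  "25 * (cmod (axial_alpha X 0))^2 \<noteq> 9 * (cmod (axial_beta X 0))^2"
  unfolding nn using disc rho scale by (simp_all add: a1 b1)
 obtain s e where se: "s \<in> {1, \<i>}" "e \<in> {1, \<i>}" and
  ne: "Re (disc5_grad (axial_alpha X 0) (axial_beta X 0) * (s * e) + disc5_grad' (axial_alpha X 0) (axial_beta X 0) * (cnj s * e)) \<noteq> 0"
  using disc5_direction[OF discX] by blast
 define m f where "m = dxx X 0 - dyy X 0" and "f = dxy X 0"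
 have S0: "0 \<in> S" "open S" using mj by (auto simp: monge_jet_def)
 have S_sub: "S \<subseteq> img_of c" by (auto simp: S_def)
 note ax = monge_axa_derivative[OF mj]
 have ax0: "axa0 X 0 = 0" "axa1 X 0 = 0" using axc_eq_0_iff[OF gX[rule_format, OF S0(1)]] z by auto
 \<comment> \<open>The circle condition in the Monge chart: m and f are orthogonal with |m| = 2 |f|.
   If m were zero, f would be zero too and \<open>axc\<close> would have no linear part, against
   \<open>\<kappa>\<close> being nonzero. So both m and f can serve as directions of
   perturbation.\<close>
 have mf: "m \<bullet> m = 4 * (f \<bullet> f)" "m \<bullet> f = 0" using ax(3,4) ax0 by (simp_all add: m_def f_def)
 have m0: "m \<noteq> 0"
 proof
  assume m: "m = 0"
  then have f: "f = 0" using mf by simp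
  have mm: "dxx X 0 - dyy X 0 = 0" "dyy X 0 - dxx X 0 = 0" "dxy X 0 = 0" using m f by (simp_all add: m_def f_def)
  have "(axc X has_derivative (%v. 0)) (at 0)"
   using monge_axc_derivative[OF mj gX z ax(2,1)] unfolding mm by (simp add: complex_eq_iff Complex_eq)
  from monge_alpha_beta[OF mj this, of 0 0] have "axial_alpha X 0 = 0" "axial_beta X 0 = 0" by simp_all
  then show False using \<kappa> unfolding al be by (auto simp: complex_eq_iff)
 qed
 then have f0: "f \<bullet> f \<noteq> 0" using mf by auto
 have mf12: "m $ 1 = 0" "m $ 2 = 0" "f $ 1 = 0" "f $ 2 = 0" using mj by (simp_all add: monge_jet_def m_def f_def)
 define i :: 2 where "i = (if s = 1 then 1 else 2)"
 define j :: 4 where "j = (if s = 1 then 1 else 2)"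
 define n where "n = (if e = 1 then m else f)"
 define k where "k = (if e = 1 then m \<bullet> m else - 2 * (f \<bullet> f))"
 have k0: "k \<noteq> 0" using m0 f0 by (simp add: k_def)
 have ni: "1 \<noteq> \<i>" by (simp add: complex_eq_iff)
 have si: "s = (if i = 1 then 1 else \<i>)" using se ni by (auto simp: i_def)
 \<comment> \<open>Along m the complex number c of \<open>monge_perturbation\<close> is real, along
   f it is imaginary; each of the four test directions is reached up to the nonzero real factor
   k.\<close>
 have nk: "Complex ((dxx X 0 - dyy X 0) \<bullet> n) (- 2 * (dxy X 0 \<bullet> n)) = of_real k * e"
  unfolding m_def[symmetric] f_def[symmetric] using se ni mf
  by (auto simp: n_def k_def complex_eq_iff inner_commute)
 define w where "w = (1 / sig) *\<^sub>R (transpose Q *v n)"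
 \<comment> \<open>What is cubed is a coordinate of the similarity image of mu, not a coordinate of
   the chart. So \<open>\<eta>\<close> is polynomial in mu and of class C^r on the whole surface
   without any cut-off, while in the Monge chart it is the monomial required.\<close>
 define \<eta> where "\<eta> q = ((sig *\<^sub>R (Q *v mu q + t)) $ j)^3 *\<^sub>R w" for q
 define M where "M eps = (%q. mu q + eps *\<^sub>R \<eta> q)" for eps
 have Qw: "Q *v w = (1 / sig) *\<^sub>R n"
 proof -
  have "Q *v (transpose Q *v n) = n"
   unfolding matrix_vector_mul_assoc using Q by (simp add: orthogonal_matrix_def)
  then show ?thesis unfolding w_def matrix_vector_mult_scaleR by (rule arg_cong)
 qed
 have \<eta>: "\<eta> \<in> Cr_maps A r"
  unfolding Cr_maps_def
 proof (intro CollectI ballI)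
  fix c' assume c': "c' \<in> A"
  have o: "open (img_of c')" using atlas_is_chart[OF A c'] by (simp add: is_chart_def)
  have "Ck_on r (mu \<circ> param c') (img_of c')" using mu c' by (auto simp: immersions_def Cr_maps_def)
  then have "Ck_on r (%u. ((sig *\<^sub>R (Q *v (mu \<circ> param c') u + t)) $ j)^3 *\<^sub>R w) (img_of c')"
   by (intro Ck_on_scaleR Ck_on_power Ck_on_vec_nth Ck_on_add o Ck_on_const
     Ck_on_bounded_linear_compose[OF matrix_vector_mul_bounded_linear])
  then show "Ck_on r (\<eta> \<circ> param c') (img_of c')" by (simp add: \<eta>_def[abs_def] o_def)
 qed
 have main: "axc (M eps \<circ> param c0) (snd c0 p) = 0 &
   rho^4 * disc5 (axial_alpha (M eps \<circ> param c0) (snd c0 p)) (axial_beta (M eps \<circ> param c0) (snd c0 p)) =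
   disc5 (axial_alpha X 0 + of_real eps * (6 * (s * (of_real k * e)))) (axial_beta X 0 + of_real eps * (6 * (cnj s * (of_real k * e))))"
  if im: "M eps \<in> immersions A r" for eps
 proof -
  define X' where "X' = (%u. sig *\<^sub>R (Q *v M eps (param c u) + t))"
  have X': "X' u = X u + (eps * (u $ i)^3) *\<^sub>R n" if u: "u \<in> S" for u
  proof -
   have "(sig *\<^sub>R (Q *v mu (param c u) + t)) $ 1 = u $ 1" "(sig *\<^sub>R (Q *v mu (param c u) + t)) $ 2 = u $ 2"
    using X12 u S_sub by blast+
   then have xi: "(sig *\<^sub>R (Q *v mu (param c u) + t)) $ j = u $ i" by (simp add: i_def j_def)
   have "Q *v M eps (param c u) = Q *v mu (param c u) + (eps * (u $ i)^3) *\<^sub>R (Q *v w)"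
    unfolding M_def \<eta>_def xi by (simp add: matrix_vector_right_distrib matrix_vector_mult_scaleR)
   then show ?thesis using sig by (simp add: X'_def X_def Qw algebra_simps)
  qed
  have gX': "\<forall>u\<in>S. gram X' u > 0"
   unfolding S_def X'_def by (rule chart_similarity_gram[OF A c0(1) c(1) r im Q sig])
  have mp1: "axc X' 0 = 0" by (rule monge_perturbation(1)[OF mj gX z _ gX' si]) (erule X')
  have mp2: "axial_alpha X' 0 = axial_alpha X 0 + of_real eps * (6 * (s * (of_real k * e)))"
   unfolding nk[symmetric] by (rule monge_perturbation(2)[OF mj gX z _ gX' si]) (erule X')
  have mp3: "axial_beta X' 0 = axial_beta X 0 + of_real eps * (6 * (cnj s * (of_real k * e)))"
   unfolding nk[symmetric] by (rule monge_perturbation(3)[OF mj gX z _ gX' si]) (erule X')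
  have z': "axc (M eps \<circ> param c0) (snd c0 p) = 0" using tr(1)[OF im im] mp1 by (simp add: X'_def)
  \<comment> \<open>The cube vanishes at p together with its first derivatives. Hence every
    perturbed map has the first derivatives of mu there, and the factor l is the same for all
    \<open>eps\<close>.\<close>
  have pe: "pdx (M eps \<circ> param c0) (snd c0 p) = pdx (mu \<circ> param c0) (snd c0 p)"
   "pdy (M eps \<circ> param c0) (snd c0 p) = pdy (mu \<circ> param c0) (snd c0 p)"
  proof -
   let ?u = "snd c0 p" and ?Y = "mu \<circ> param c0"
   have Y: "(?Y has_derivative fder ?Y (at ?u)) (at ?u)"
    using mu c0 r by (intro Ck_on_imp_has_derivative[of r _ "img_of c0"]) (auto simp: immersions_def Cr_maps_def)
   have p0: "param c0 ?u = p" using is_chart_param(1)[OF atlas_is_chart[OF A c0(1)] c0(2)] .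
   have s: "((%y. (sig *\<^sub>R (Q *v ?Y y + t)) $ j) has_derivative (%v. (sig *\<^sub>R (Q *v fder ?Y (at ?u) v)) $ j)) (at ?u)"
    by (rule bounded_linear.has_derivative[OF bounded_linear_vec_nth frechet_derivative_similarity[OF differentiableI[OF Y]]])
   have "((%y. ?Y y + eps *\<^sub>R (((sig *\<^sub>R (Q *v ?Y y + t)) $ j)^3 *\<^sub>R w)) has_derivative
     (%v. fder ?Y (at ?u) v + eps *\<^sub>R ((of_nat 3 * (sig *\<^sub>R (Q *v fder ?Y (at ?u) v)) $ j *
      ((sig *\<^sub>R (Q *v ?Y ?u + t)) $ j)^(3 - 1)) *\<^sub>R w))) (at ?u)"
    by (intro has_derivative_add Y has_derivative_scaleR_right has_derivative_scaleR_left has_derivative_power s)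
   moreover have Yu: "?Y ?u = mu p" by (simp add: p0)
   have "(sig *\<^sub>R (Q *v ?Y ?u + t)) $ j = 0" unfolding Yu Xp by (rule zero_index)
   ultimately have "((%y. ?Y y + eps *\<^sub>R (((sig *\<^sub>R (Q *v ?Y y + t)) $ j)^3 *\<^sub>R w)) has_derivative fder ?Y (at ?u)) (at ?u)"
    by (simp only:) simp
   moreover have "(%y. ?Y y + eps *\<^sub>R (((sig *\<^sub>R (Q *v ?Y y + t)) $ j)^3 *\<^sub>R w)) = M eps \<circ> param c0"
    by (simp add: M_def \<eta>_def fun_eq_iff)
   ultimately have "(M eps \<circ> param c0 has_derivative fder ?Y (at ?u)) (at ?u)" by simp
   then show "pdx (M eps \<circ> param c0) (snd c0 p) = pdx (mu \<circ> param c0) (snd c0 p)"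
    "pdy (M eps \<circ> param c0) (snd c0 p) = pdy (mu \<circ> param c0) (snd c0 p)"
    unfolding pdx_def pdy_def by (rule frechet_derivative_eqI)+
  qed
  have "param c 0 = p" using is_chart_param(1)[of c p] c by (auto simp: positive_chart_def)
  then have l': "axial_factor (M eps \<circ> param c0) sig (snd c0 \<circ> param c) 0 = l"
   by (simp add: l_def axial_factor_def gram_def fffE_def fffF_def fffG_def pe)
  have ab: "axial_alpha X' 0 = of_real (sig^2) * l^5 * axial_alpha (M eps \<circ> param c0) (snd c0 p)"
   "axial_beta X' 0 = of_real (sig^2) * l^4 * cnj l * axial_beta (M eps \<circ> param c0) (snd c0 p)"
   using tr(2)[OF im im z'] tr(3)[OF im im z'] by (simp_all add: X'_def l')
  have "rho^4 * disc5 (axial_alpha (M eps \<circ> param c0) (snd c0 p)) (axial_beta (M eps \<circ> param c0) (snd c0 p)) =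
    disc5 (axial_alpha X' 0) (axial_beta X' 0)" unfolding ab scale ..
  then show ?thesis using z' unfolding mp2 mp3 by blast
 qed
 let ?g = "disc5_grad (axial_alpha X 0) (axial_beta X 0)" and ?g' = "disc5_grad' (axial_alpha X 0) (axial_beta X 0)"
 define \<Phi> where "\<Phi> eps = disc5 (axial_alpha X 0 + of_real eps * (6 * (s * (of_real k * e))))
   (axial_beta X 0 + of_real eps * (6 * (cnj s * (of_real k * e)))) / rho^4" for eps
 define d where "d = Re (?g * (6 * (s * (of_real k * e))) + ?g' * (6 * (cnj s * (of_real k * e)))) / rho^4"
 have "(\<Phi> has_real_derivative d) (at 0)"
  unfolding \<Phi>_def[abs_def] d_def by (rule DERIV_cdivide[OF disc5_has_derivative])
 moreover have "d \<noteq> 0"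
 proof -
  have eq: "?g * (6 * (s * (of_real k * e))) + ?g' * (6 * (cnj s * (of_real k * e))) = of_real (6 * k) * (?g * (s * e) + ?g' * (cnj s * e))"
   by (simp add: algebra_simps)
  have "Re (of_real x * y) = x * Re y" for x y by simp
  then have "d = 6 * k * Re (?g * (s * e) + ?g' * (cnj s * e)) / rho^4" unfolding d_def eq by (simp only:)
  then show ?thesis using k0 ne rho by simp
 qed
 moreover have "axc (M eps \<circ> param c0) (snd c0 p) = 0 &
   disc5 (axial_alpha (M eps \<circ> param c0) (snd c0 p)) (axial_beta (M eps \<circ> param c0) (snd c0 p)) = \<Phi> eps"
  if "M eps \<in> immersions A r" for eps
  using main[OF that] rho by (simp add: \<Phi>_def field_simps)
 ultimately show ?thesis unfolding M_def using \<eta> by blast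
qed

section \<open>Existence of normal forms\<close>

text \<open>The expression is homogeneous of degree 5, so a rotation by pi changes its sign and the
  intermediate value theorem gives an angle with vanishing imaginary part: there is always a
  separatrix direction, which becomes the x-axis of the normal form.\<close>

lemma separatrix_rotation_ex:
 fixes \<alpha> \<beta> :: complex
 assumes "R \<ge> 0"
 shows "\<exists>l. cmod l = R & Im (l^5 * \<alpha> + l^4 * cnj l * \<beta>) = 0"
proof -
 define l where "l \<theta> = of_real R * cis \<theta>" for \<theta>
 define f where "f \<theta> = Im (l \<theta>^5 * \<alpha> + l \<theta>^4 * cnj (l \<theta>) * \<beta>)" for \<theta>
 have lpi: "l pi = - l 0" by (simp add: l_def)
 have fpi: "f pi = - f 0" unfolding f_def lpi by simp
 have cont: "continuous_on {0..pi} f" unfolding f_def[abs_def] l_def[abs_def] cis_conv_exp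
  by (intro continuous_intros)
 have "\<exists>\<theta>. f \<theta> = 0"
 proof (cases "f 0 \<le> 0")
  case True
  then show ?thesis using IVT'[of f 0 0 pi] cont fpi by auto
 next
  case False
  then show ?thesis using IVT2'[of f pi 0 0] cont fpi by auto
 qed
 then obtain \<theta> where "f \<theta> = 0" by blast
 then show ?thesis using assms by (intro exI[of _ "l \<theta>"]) (simp add: f_def l_def norm_mult)
qed

lemma Ck_on_det:
 fixes m :: "real^2 => real^2"
 assumes "open S" "Ck_on (Suc k) m S"
 shows "Ck_on k (%u. det (matrix (fder m (at u)))) S"
 unfolding det_jac jac_def
 by (intro Ck_on_diff Ck_on_mult Ck_on_vec_nth Ck_on_frechet_derivative assms)

lemma frechet_det_compose:
 fixes f g :: "real^2 => real^2"
 assumes "Ck_on k f S" "k > 0" "Ck_on j g T" "j > 0" "f ` S \<subseteq> T" "x \<in> S"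
 shows "det (matrix (fder (%x. g (f x)) (at x))) =
  det (matrix (fder g (at (f x)))) * det (matrix (fder f (at x)))"
proof -
 have "f x \<in> T" using assms by auto
 then have lin: "linear (fder g (at (f x)))" "linear (fder f (at x))"
  using linear_frechet_derivative[OF Ck_on_imp_differentiable[OF assms(3,4)]]
   linear_frechet_derivative[OF Ck_on_imp_differentiable[OF assms(1,2,6)]] by blast+
 have "fder (%x. g (f x)) (at x) = fder g (at (f x)) \<circ> fder f (at x)"
  by (simp add: fun_eq_iff frechet_derivative_compose_Ck(2)[OF assms])
 then show ?thesis using matrix_compose[OF lin(2,1)] by (simp add: det_mul)
qed

text \<open>The inverse function theorem is applied on the open set where the determinant is
  positive. The new chart is m after \<open>snd c0\<close>, on a smaller domain, and its
  compatibility with the atlas is inherited from c0 by composition with m or its inverse.\<close>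

lemma positive_chart_of_local_diffeo:
 fixes m :: "real^2 => real^2"
 assumes A: "compact_oriented_surface A" and c0: "c0 \<in> A" "p \<in> dom_of c0" and r: "r \<ge> 2"
  and m: "Ck_on r m (img_of c0)" and det: "det (matrix (fder m (at (snd c0 p)))) > 0"
 shows "\<exists>c. positive_chart A r c & p \<in> dom_of c & dom_of c \<subseteq> dom_of c0 & (\<forall>q\<in>dom_of c. snd c q = m (snd c0 q))"
proof -
 let ?u0 = "snd c0 p"
 have ch0: "is_chart c0" by (rule atlas_is_chart[OF A c0(1)])
 have oi: "open (img_of c0)" and od: "open (dom_of c0)" using ch0 by (auto simp: is_chart_def)
 have c0c: "continuous_on (dom_of c0) (snd c0)" "continuous_on (img_of c0) (param c0)"
  using ch0 by (auto simp: is_chart_def homeomorphism_def)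
 note c0p = is_chart_param[OF ch0]
 define T where "T = {u \<in> img_of c0. det (matrix (fder m (at u))) > 0}"
 have m2: "Ck_on (Suc 1) m (img_of c0)" using Ck_on_mono[OF m] r by simp
 have "T = img_of c0 \<inter> (%u. det (matrix (fder m (at u)))) -` {0<..}" by (auto simp: T_def)
 then have oT: "open T"
  using continuous_open_preimage[OF Ck_on_imp_continuous_on[OF Ck_on_det[OF oi m2]] oi, of "{0<..}"] by simp
 have T: "T \<subseteq> img_of c0" "?u0 \<in> T" using det c0 by (auto simp: T_def)
 have mT: "Ck_on (Suc 1) m T" "Ck_on r m T" using Ck_on_subset[OF m2 T(1)] Ck_on_subset[OF m T(1)] .
 \<comment> \<open>The derivative as an element of the space of bounded linear maps, since the
   inverse function theorem asks for its continuity in the operator norm.\<close>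
 define m' where "m' u = Blinfun (fder m (at u))" for u
 have dm: "(m has_derivative fder m (at u)) (at u)" if "u \<in> T" for u
  by (rule Ck_on_imp_has_derivative[OF mT(1) _ that]) simp
 have m': "blinfun_apply (m' u) = fder m (at u)" if "u \<in> T" for u
  unfolding m'_def by (rule bounded_linear_Blinfun_apply[OF has_derivative_bounded_linear[OF dm[OF that]]])
 have cm': "continuous_on T m'"
 proof (rule continuous_on_blinfun_componentwise)
  fix i :: "real^2" assume "i \<in> Basis"
  have "continuous_on T (%u. fder m (at u) i)"
   by (rule Ck_on_imp_continuous_on[OF Ck_on_frechet_derivative[OF mT(1)]])
  then show "continuous_on T (%x. blinfun_apply (m' x) i)"
   by (rule continuous_on_eq) (simp add: m')
 qed
 have lin: "linear (fder m (at ?u0))" using dm[OF T(2)] has_derivative_linear by blast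
 have "inj (fder m (at ?u0))" using det_nz_iff_inj[OF lin] det by simp
 then obtain g0 where g0: "linear g0" "g0 \<circ> fder m (at ?u0) = id"
  using linear_injective_left_inverse[OF lin] by blast
 have inv: "Blinfun g0 o\<^sub>L m' ?u0 = id_blinfun"
  using g0 by (intro blinfun_eqI) (simp add: m'[OF T(2)] bounded_linear_Blinfun_apply linear_conv_bounded_linear[symmetric] fun_eq_iff)
 have dm': "(m has_derivative blinfun_apply (m' u)) (at u)" if "u \<in> T" for u
  using dm[OF that] by (simp add: m'[OF that])
 have "\<exists>U V g. open U & U \<subseteq> T & ?u0 \<in> U & open V & homeomorphism U V m g"
  by (rule inverse_function_theorem[where U = T and f = m and f' = m' and invf = "Blinfun g0" and ?x0.0 = "?u0"],
    rule oT, erule dm', rule cm', rule T(2), rule inv, intro exI conjI, assumption+)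
 then obtain U V g where U: "open U" "U \<subseteq> T" "?u0 \<in> U" and V: "open V" and hom: "homeomorphism U V m g"
  by (elim exE conjE) (rule that)
 have mg: "m ` U = V" "g ` V = U" "\<And>u. u \<in> U ==> g (m u) = u" "\<And>v. v \<in> V ==> m (g v) = v" "continuous_on U m" "continuous_on V g"
  using hom unfolding homeomorphism_def by blast+
 have UI: "U \<subseteq> img_of c0" using U T by auto
 have mU: "Ck_on r m U" by (rule Ck_on_subset[OF m UI])
 have detU: "det (matrix (fder m (at u))) > 0" if "u \<in> U" for u using U that by (auto simp: T_def)
 have g: "Ck_on r g V"
  by (rule Ck_on_inverse_function[OF U(1) V hom mU]) (use r detU in fastforce)+
 have gV: "g ` V \<subseteq> U" using mg by auto
 have detV: "det (matrix (fder g (at v))) > 0" if v: "v \<in> V" for v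
 proof -
  have "fder (%v. m (g v)) (at v) = fder (%v. v) (at v)"
   by (rule frechet_derivative_transform_within_open[OF differentiableI[OF frechet_derivative_compose_Ck(1)[OF g _ mU _ gV v]] V v])
    (use r mg in auto)
  then have "det (matrix (fder (%v. m (g v)) (at v))) = 1"
   by (simp add: matrix_id_mat_1[unfolded id_def] flip: id_def)
  then have "det (matrix (fder m (at (g v)))) * det (matrix (fder g (at v))) = 1"
   using frechet_det_compose[OF g _ mU _ gV v] r by simp
  moreover have "det (matrix (fder m (at (g v)))) > 0" using detU gV v by auto
  ultimately show ?thesis by (metis zero_less_mult_pos zero_less_one)
 qed
 define c where "c = (param c0 ` U, m \<circ> snd c0)"
 have dc: "dom_of c = param c0 ` U" and sc: "snd c q = m (snd c0 q)" for q by (simp_all add: c_def)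
 have dcU: "q \<in> dom_of c \<longleftrightarrow> q \<in> dom_of c0 & snd c0 q \<in> U" for q
  unfolding dc using c0p UI by (auto simp: image_iff) (metis subsetD)+
 have sub: "dom_of c \<subseteq> dom_of c0" using dcU by auto
 have ic: "img_of c = V"
 proof -
  have "img_of c = (%u. m (snd c0 (param c0 u))) ` U" by (simp add: dc sc image_image)
  also have "\<dots> = m ` U" using UI c0p(2) by (intro image_cong) auto
  finally show ?thesis unfolding mg(1) .
 qed
 have inj: "inj_on (snd c) (dom_of c)"
  by (rule inj_onI) (metis c0p(1) dcU mg(3) sc)
 have pc: "param c v = param c0 (g v)" if v: "v \<in> V" for v
 proof -
  have gv: "g v \<in> U" using v gV by auto
  have "param c0 (g v) \<in> dom_of c" using gv by (simp add: dc)
  moreover have "snd c (param c0 (g v)) = v" using gv UI c0p(2) mg(4)[OF v] by (auto simp: sc)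
  ultimately show ?thesis unfolding param_def[of c] using inv_into_f_f[OF inj] by metis
 qed
 have odc: "open (dom_of c)"
 proof -
  have "dom_of c = dom_of c0 \<inter> snd c0 -` U" using dcU by auto
  then show ?thesis using continuous_open_preimage[OF c0c(1) od U(1)] by simp
 qed
 have chc: "is_chart c"
  unfolding is_chart_def homeomorphism_def ic
 proof (intro conjI ballI)
  show "open (dom_of c)" "open V" by (rule odc V)+
  show "param c (snd c q) = q" if "q \<in> dom_of c" for q
   using that inj by (simp add: param_def)
  show "V = V" ..
  show "continuous_on (dom_of c) (snd c)"
  proof -
   have "continuous_on (dom_of c) (%q. m (snd c0 q))"
    by (rule continuous_on_compose2[OF mg(5) continuous_on_subset[OF c0c(1) sub]]) (use dcU in auto)
   then show ?thesis by (simp add: c_def o_def)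
  qed
  show "snd c (param c v) = v" if "v \<in> V" for v
   using that ic by (metis f_inv_into_f param_def)
  show "param c ` V = dom_of c"
  proof -
   have "param c ` V = (%v. param c0 (g v)) ` V" using pc by (intro image_cong) auto
   also have "\<dots> = param c0 ` (g ` V)" by (simp add: image_image)
   finally show ?thesis unfolding mg(2) dc .
  qed
  show "continuous_on V (param c)"
  proof -
   have "continuous_on V (%v. param c0 (g v))"
    by (rule continuous_on_compose2[OF c0c(2) mg(6)]) (use gV UI in auto)
   then show ?thesis by (rule continuous_on_eq) (simp add: pc)
  qed
 qed
 have "pos_compatible r c c'" if c': "c' \<in> A" for c'
 proof -
  have ch': "is_chart c'" by (rule atlas_is_chart[OF A c'])
  let ?P = "snd c ` (dom_of c \<inter> dom_of c')" and ?N = "snd c0 ` (dom_of c0 \<inter> dom_of c')" and ?R = "snd c' ` (dom_of c \<inter> dom_of c')"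
  have oO: "open ?P" "open ?R"
   by (rule is_chart_open_overlap[OF chc ch'], subst Int_commute, rule is_chart_open_overlap[OF ch' chc])
  have OV: "?P \<subseteq> V" using ic by blast
  have pr: "Ck_on r (snd c' \<circ> param c0) ?N" "Ck_on r (snd c0 \<circ> param c') (snd c' ` (dom_of c0 \<inter> dom_of c'))"
   "\<And>u. u \<in> ?N ==> det (matrix (fder (snd c' \<circ> param c0) (at u))) > 0"
   using A c0 c' by (auto simp: compact_oriented_surface_def pos_compatible_def)
  have gO: "g ` ?P \<subseteq> ?N"
  proof (rule image_subsetI)
   fix v assume "v \<in> ?P"
   then obtain q where q: "q \<in> dom_of c" "q \<in> dom_of c'" "v = snd c q" by blast
   then have "g v = snd c0 q" using dcU mg(3) sc by simp
   moreover have "q \<in> dom_of c0 \<inter> dom_of c'" using q dcU by blast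
   ultimately show "g v \<in> ?N" by blast
  qed
  have gOr: "Ck_on r g ?P" by (rule Ck_on_subset[OF g OV])
  have eq: "(snd c' \<circ> param c0) (g v) = (snd c' \<circ> param c) v" if "v \<in> ?P" for v
  proof -
   have "v \<in> V" using OV that by blast
   then show ?thesis by (simp add: pc)
  qed
  have C1: "Ck_on r (%v. (snd c' \<circ> param c0) (g v)) ?P" by (rule Ck_on_compose[OF oO(1) gO gOr pr(1)])
  have 1: "Ck_on r (snd c' \<circ> param c) ?P" by (rule Ck_on_cong[OF oO(1) eq C1])
  have im': "(snd c0 \<circ> param c') ` ?R \<subseteq> img_of c0"
  proof (rule image_subsetI)
   fix v assume "v \<in> ?R"
   then obtain q where "q \<in> dom_of c" "q \<in> dom_of c'" "v = snd c' q" by blast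
   then show "(snd c0 \<circ> param c') v \<in> img_of c0" using sub is_chart_param(1)[OF ch'] by auto
  qed
  have C2: "Ck_on r (%v. m ((snd c0 \<circ> param c') v)) ?R"
   by (rule Ck_on_compose[OF oO(2) im' Ck_on_subset[OF pr(2)] m]) (use sub in auto)
  have 2: "Ck_on r (snd c \<circ> param c') ?R" using C2 by (simp add: c_def o_def)
  have 3: "det (matrix (fder (snd c' \<circ> param c) (at v))) > 0" if v: "v \<in> ?P" for v
  proof -
   have "fder (%v. (snd c' \<circ> param c0) (g v)) (at v) = fder (snd c' \<circ> param c) (at v)"
    by (rule frechet_derivative_transform_within_open[OF Ck_on_imp_differentiable[OF C1 _ v] oO(1) v eq]) (use r in simp)
   moreover have "det (matrix (fder (%v. (snd c' \<circ> param c0) (g v)) (at v))) =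
     det (matrix (fder (snd c' \<circ> param c0) (at (g v)))) * det (matrix (fder g (at v)))"
    by (rule frechet_det_compose[OF gOr _ pr(1) _ gO v]) (use r in simp_all)
   moreover have "det (matrix (fder (snd c' \<circ> param c0) (at (g v)))) > 0" using pr(3) gO v by blast
   moreover have "det (matrix (fder g (at v))) > 0" using detV OV v by blast
   ultimately show ?thesis by simp
  qed
  show ?thesis unfolding pos_compatible_def using 1 2 3 by blast
 qed
 then have "positive_chart A r c" using chc by (simp add: positive_chart_def)
 moreover have "p \<in> dom_of c" using dcU c0 U by simp
 ultimately show ?thesis using sub sc by blast
qed

lemma Ck_on_chart_similarity:
 fixes Q :: "real^4^4"
 assumes A: "compact_oriented_surface A" and c0: "c0 \<in> A" and c: "positive_chart A r c" and mu: "mu \<in> Cr_maps A r"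
 shows "Ck_on r (%u. sig *\<^sub>R (Q *v mu (param c u) + t)) (snd c ` (dom_of c \<inter> dom_of c0))"
proof -
 note tr = chart_transition[OF A c0 c]
 have "Ck_on r (mu \<circ> param c0) (img_of c0)" using mu c0 by (auto simp: Cr_maps_def)
 from Ck_on_compose[OF tr(1,4,5) this]
 have "Ck_on r (%u. mu (param c u)) (snd c ` (dom_of c \<inter> dom_of c0))"
  by (rule Ck_on_cong[OF tr(1), rotated]) (simp add: tr(7)[unfolded o_def])
 then show ?thesis
  by (intro Ck_on_scaleR Ck_on_add tr(1) Ck_on_const Ck_on_bounded_linear_compose[OF matrix_vector_mul_bounded_linear])
qed

lemma bigo_taylor_2:
 fixes f :: "real^2 => real"
 assumes S: "open S" "0 \<in> S" and f: "Ck_on 2 f S" and L: "(f has_derivative L) (at 0)" and 0: "f 0 = 0"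
 shows "(%u. k * (f u - L u)) \<in> O[nhds 0](%u. (norm u)^2)"
proof -
 obtain M dlt where M: "dlt > 0" "\<forall>y. dist y 0 < dlt --> norm (f y - f 0 - fder f (at 0) (y - 0)) \<le> M * (norm (y - 0))^2"
  using Ck_2_taylor_bound[OF S f] by blast
 have "eventually (%u. norm (k * (f u - L u)) \<le> (\<bar>k\<bar> * M) * norm ((norm u)^2)) (nhds 0)"
  unfolding eventually_nhds_metric
 proof (intro exI[of _ dlt] conjI allI impI M(1))
  fix u :: "real^2" assume "dist u 0 < dlt"
  then have "\<bar>f u - L u\<bar> \<le> M * (norm u)^2" using M(2) 0 by (simp add: frechet_derivative_eqI[OF L])
  then have "\<bar>k\<bar> * \<bar>f u - L u\<bar> \<le> \<bar>k\<bar> * (M * (norm u)^2)" by (intro mult_left_mono) auto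
  then show "norm (k * (f u - L u)) \<le> (\<bar>k\<bar> * M) * norm ((norm u)^2)" by (simp add: abs_mult mult.assoc)
 qed
 then show ?thesis by (rule bigoI)
qed

text \<open>The values of k, a and b invert the formulas of \<open>monge_quartic_alpha_beta\<close>,
  and the vanishing imaginary part is what removes the x-term from a0. As X is of class C^4, all
  coefficients of the quartic are of class C^2, so subtracting their linear parts leaves the
  remainders h of order |u|^2.\<close>

lemma monge_quartic_normal_form:
 assumes m: "monge_jet X S" and X: "Ck_on 4 X S" and fr: "\<And>u. u \<in> S ==> positive_normal_frame X u (N1 u) (N2 u)"
  and 0: "axc X 0 = 0" and k: "k = Re (axial_alpha X 0 - axial_beta X 0)" "k \<noteq> 0" and im: "Im (axial_alpha X 0 + axial_beta X 0) = 0"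
  and a: "a = 4 * Re (axial_alpha X 0 + axial_beta X 0) / k" and b: "b = - 4 * Im (axial_alpha X 0 - axial_beta X 0) / k"
 shows "\<exists>h :: nat => real^2 => real. (\<forall>i\<le>4. h i \<in> O[nhds 0](%u. (norm u)^2)) &
   (\<forall>u\<in>S. \<forall>dx dy. axial_quartic X (N1 u) (N2 u) u dx dy =
     k * (u$2 * (dy^4 - 6 * dx^2 * dy^2 + dx^4)
        + (a * u$1 + b * u$2) * dx * dy * (dx^2 - dy^2)
        + (\<Sum>i\<le>4. h i u * dx^i * dy^(4 - i))))"
proof -
 have S: "open S" "0 \<in> S" using m by (auto simp: monge_jet_def)
 have g: "gram X u > 0" if "u \<in> S" for u by (rule positive_normal_frame_gram[OF fr[OF that]])
 have g0: "gram X x \<noteq> 0" if "x \<in> S" for x using g[OF that] by simp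
 have X4: "Ck_on (Suc (Suc 2)) X S" "Ck_on (Suc 2) X S" using X Ck_on_mono[OF X] by (simp_all add: eval_nat_numeral)
 note ax = Ck_on_axa[OF S(1) X4(1) g0]
 note f = Ck_on_first_form[OF S(1) X4(2)]
 have z: "axa0 X 0 = 0" "axa1 X 0 = 0" using axc_eq_0_iff[OF g[OF S(2)]] 0 by auto
 define d0 d1 where d: "d0 = fder (axa0 X) (at 0)" "d1 = fder (axa1 X) (at 0)"
 have D: "(axa0 X has_derivative d0) (at 0)" "(axa1 X has_derivative d1) (at 0)"
  unfolding d using Ck_on_imp_has_derivative[OF ax(1) _ S(2)] Ck_on_imp_has_derivative[OF ax(2) _ S(2)] by simp_all
 have gS: "\<forall>u\<in>S. gram X u > 0" using g by blast
 note dc = monge_axc_derivative[OF m gS 0 D]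
 note v0 = monge_jet_values[OF m]
 have zv: "zvec X 0 (Complex (v $ 1) (v $ 2)) = v" for v by (simp add: v0 vec_eq_iff forall_2)
 have cd: "Complex (d1 v / 4) (d0 v) = axial_alpha X 0 * Complex (v $ 1) (v $ 2) + axial_beta X 0 * cnj (Complex (v $ 1) (v $ 2))" for v
  using axc_zvec_derivative[OF differentiableI[OF dc], of "Complex (v $ 1) (v $ 2)"]
  unfolding zv frechet_derivative_eqI[OF dc] .
 have d0: "d0 v = k * v $ 2" for v
 proof -
  have "d0 v = v $ 1 * Im (axial_alpha X 0 + axial_beta X 0) + Re (axial_alpha X 0 - axial_beta X 0) * v $ 2"
   using arg_cong[OF cd[of v], of Im] by (simp add: algebra_simps)
  then show ?thesis unfolding im k by simp
 qed
 have d1: "d1 v = k * (a * v $ 1 + b * v $ 2)" for v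
 proof -
  have "d1 v = 4 * Re (axial_alpha X 0 + axial_beta X 0) * v $ 1 - 4 * Im (axial_alpha X 0 - axial_beta X 0) * v $ 2"
   using arg_cong[OF cd[of v], of Re] by (simp add: algebra_simps)
  moreover have "4 * Re (axial_alpha X 0 + axial_beta X 0) = k * a" "- 4 * Im (axial_alpha X 0 - axial_beta X 0) = k * b"
   using k(2) by (simp_all add: a b)
  ultimately show ?thesis by algebra
 qed
 \<comment> \<open>\<open>p i\<close> and \<open>q i\<close> are the weights of a0 and a1 in the
   coefficient of dx^i dy^(4 - i).\<close>
 define p q where
  "p i u = (if i = 4 then fffE X u^3 else if i = 3 then 0 else if i = 2 then - 6 * fffG X u * (fffE X u)^2
   else if i = 1 then - 8 * fffE X u * fffF X u * fffG X u else fffG X u * (fffE X u * fffG X u - 4 * (fffF X u)^2))"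
  and "q i u = (if i = 4 then 0 else if i = 3 then fffE X u^3 else if i = 2 then 3 * fffF X u * (fffE X u)^2
   else if i = 1 then fffE X u * (4 * (fffF X u)^2 - fffE X u * fffG X u) else fffF X u * (2 * (fffF X u)^2 - fffE X u * fffG X u))"
  for i :: nat and u
 have pq: "Ck_on 2 (p i) S" "Ck_on 2 (q i) S" for i
  unfolding p_def[abs_def] q_def[abs_def]
  by (cases "i = 4"; cases "i = 3"; cases "i = 2"; cases "i = 1"; simp; intro Ck_on_mult Ck_on_diff Ck_on_minus Ck_on_power Ck_on_const S f)+
 define cf where "cf i u = p i u * axa0 X u + q i u * axa1 X u" for i u
 have cfC: "Ck_on 2 (cf i) S" for i
  unfolding cf_def[abs_def] by (intro Ck_on_add Ck_on_mult S pq ax)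
 have cont: "continuous (at 0) h" if "Ck_on 2 h S" for h :: "real^2 => real"
  using Ck_on_imp_continuous_on[OF that] S by (simp add: continuous_on_eq_continuous_at)
 have cfD: "(cf i has_derivative (%v. p i 0 * d0 v + q i 0 * d1 v)) (at 0)" for i
  unfolding cf_def[abs_def] by (intro has_derivative_add has_derivative_zero_mult D z cont pq)
 have cf0: "cf i 0 = 0" for i by (simp add: cf_def z)
 define h where "h i u = 1 / k * (cf i u - (p i 0 * d0 u + q i 0 * d1 u))" for i u
 have "h i \<in> O[nhds 0](%u. (norm u)^2)" for i
  unfolding h_def[abs_def] by (rule bigo_taylor_2[OF S cfC cfD cf0])
 moreover have "axial_quartic X (N1 u) (N2 u) u dx dy =
     k * (u$2 * (dy^4 - 6 * dx^2 * dy^2 + dx^4)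
        + (a * u$1 + b * u$2) * dx * dy * (dx^2 - dy^2)
        + (\<Sum>i\<le>4. h i u * dx^i * dy^(4 - i)))" if u: "u \<in> S" for u dx dy
 proof -
  have kh: "k * h i u = cf i u - (p i 0 * d0 u + q i 0 * d1 u)" for i using k(2) by (simp add: h_def)
  have p0: "p 0 0 = 1" "p 1 0 = 0" "p 2 0 = - 6" "p 3 0 = 0" "p 4 0 = 1"
   "q 0 0 = 0" "q 1 0 = - 1" "q 2 0 = 0" "q 3 0 = 1" "q 4 0 = 0"
   by (simp_all add: p_def q_def v0)
  have "axial_quartic X (N1 u) (N2 u) u dx dy = cf 0 u * dy^4 + cf 1 u * dx * dy^3 + cf 2 u * dx^2 * dy^2 + cf 3 u * dx^3 * dy + cf 4 u * dx^4"
   unfolding axial_quartic_def Let_def axial_a0_eq[OF fr[OF u]] axial_a1_eq[OF fr[OF u]]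
   by (simp add: cf_def p_def q_def algebra_simps)
  also have "\<dots> = (k * h 0 u + k * u $ 2) * dy^4 + (k * h 1 u - k * (a * u $ 1 + b * u $ 2)) * dx * dy^3
    + (k * h 2 u - 6 * (k * u $ 2)) * dx^2 * dy^2 + (k * h 3 u + k * (a * u $ 1 + b * u $ 2)) * dx^3 * dy + (k * h 4 u + k * u $ 2) * dx^4"
   unfolding kh p0 d0 d1 by simp
  also have "\<dots> = k * (u$2 * (dy^4 - 6 * dx^2 * dy^2 + dx^4) + (a * u$1 + b * u$2) * dx * dy * (dx^2 - dy^2)
        + (h 0 u * dy^4 + h 1 u * dx * dy^3 + h 2 u * dx^2 * dy^2 + h 3 u * dx^3 * dy + h 4 u * dx^4))"
   by algebra
  finally show ?thesis unfolding sum_atMost_4 by simp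
 qed
 ultimately show ?thesis by blast
qed

text \<open>A positive orthonormal tangent basis t1, t2 whose first vector points along a
  separatrix, completed by a positive normal frame, forms the rows of the rotation Q. The two
  tangential coordinates of the moved surface are then the Monge chart, with ratio 1.\<close>

lemma axial_normal_form_ex:
 assumes A: "compact_oriented_surface A" and c0: "c0 \<in> A" "p \<in> dom_of c0" and r: "r \<ge> 4" and mu: "mu \<in> immersions A r"
 defines "\<alpha> \<equiv> axial_alpha (mu \<circ> param c0) (snd c0 p)" and "\<beta> \<equiv> axial_beta (mu \<circ> param c0) (snd c0 p)"
 assumes z: "axc (mu \<circ> param c0) (snd c0 p) = 0" and ne: "(cmod \<alpha>)^2 \<noteq> (cmod \<beta>)^2"
 shows "\<exists>a b. axial_normal_form A r mu p a b"
proof -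
 define Y where "Y = mu \<circ> param c0"
 define u0 where "u0 = snd c0 p"
 have r3: "r \<ge> 3" using r by simp
 have muC: "mu \<in> Cr_maps A r" by (rule immersions_Cr_maps[OF mu])
 have YC: "Ck_on r Y (img_of c0)" using muC c0 by (auto simp: Cr_maps_def Y_def)
 have u0: "u0 \<in> img_of c0" using c0 by (auto simp: u0_def)
 have ch0: "is_chart c0" by (rule atlas_is_chart[OF A c0(1)])
 have oi: "open (img_of c0)" using ch0 by (simp add: is_chart_def)
 have g: "gram Y u0 > 0" unfolding Y_def using immersion_gram[OF mu _ c0(1) u0] r by simp
 define E F G w where E: "E = fffE Y u0" "F = fffF Y u0" "G = fffG Y u0" "w = sqrt (gram Y u0)"
 have w: "w^2 = E * G - F^2" "w > 0" using g by (simp_all add: E gram_def)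
 have E0: "E > 0" using g by (auto simp: E(1) gram_def fffE_def)
 define P R where PR: "P = pdx Y u0" "R = pdy Y u0"
 have EFG: "P \<bullet> P = E" "P \<bullet> R = F" "R \<bullet> P = F" "R \<bullet> R = G"
  by (simp_all add: PR E fffE_def fffF_def fffG_def inner_commute)
 \<comment> \<open>The modulus is chosen so that the tangent vector T l below has unit length, the
   argument so that it points along a separatrix.\<close>
 obtain l where l: "cmod l = 1 / (w * sqrt E)" "Im (l^5 * \<alpha> + l^4 * cnj l * \<beta>) = 0"
  using separatrix_rotation_ex[of "1 / (w * sqrt E)" \<alpha> \<beta>] w E0 by auto
 define x y where "x = Re l" and "y = Im l"
 have xy: "(x^2 + y^2) * (w^2 * E) = 1"
 proof -
  have "x^2 + y^2 = 1 / (w^2 * E)"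
   using l(1) cmod_power2[of l] E0 by (simp add: x_def y_def power_divide power_mult_distrib)
  then show ?thesis using w(2) E0 by simp
 qed
 define T where "T z = Re (z * zetaX Y u0) *\<^sub>R P + Re (z * zetaY Y u0) *\<^sub>R R" for z
 define t1 t2 where "t1 = T l" and "t2 = T (\<i> * l)"
 have T: "T z = (Re z * w - Im z * F) *\<^sub>R P + (Im z * E) *\<^sub>R R" for z
  by (simp add: T_def zetaX_def zetaY_def E)
 have t: "t1 = (x * w - y * F) *\<^sub>R P + (y * E) *\<^sub>R R" "t2 = (- (y * w) - x * F) *\<^sub>R P + (x * E) *\<^sub>R R"
  by (simp_all add: t1_def t2_def T x_def y_def)
 have tP: "t1 \<bullet> P = x * w * E" "t1 \<bullet> R = x * w * F + y * w^2" "t2 \<bullet> P = - (y * w * E)" "t2 \<bullet> R = - (y * w * F) + x * w^2"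
  unfolding t inner_add_left inner_scaleR_left EFG w(1) by algebra+
 have t1T: "t1 \<bullet> T z = (x * Re z + y * Im z) * (w^2 * E)" and t2T: "t2 \<bullet> T z = (x * Im z - y * Re z) * (w^2 * E)" for z
  unfolding T inner_add_right inner_scaleR_right tP by algebra+
 have tt: "t1 \<bullet> t1 = 1" "t1 \<bullet> t2 = 0" "t2 \<bullet> t1 = 0" "t2 \<bullet> t2 = 1"
  using xy t1T[of l] t1T[of "\<i> * l"] t2T[of l] t2T[of "\<i> * l"]
  by (simp_all add: t1_def[symmetric] t2_def[symmetric] x_def[symmetric] y_def[symmetric] power2_eq_square algebra_simps)
 obtain N1 N2 where oc: "orthonormal_completion t1 t2 N1 N2" and dN: "det (vector [t1, t2, N1, N2] :: real^4^4) > 0"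
  using orthonormal_completion_ex[of t1 t2] tt by auto
 note oc' = oc[unfolded orthonormal_completion_def norm_eq_1]
 define Q where "Q = (vector [t1, t2, N1, N2] :: real^4^4)"
 have Qn: "Q $ 1 = t1" "Q $ 2 = t2" "Q $ 3 = N1" "Q $ 4 = N2" by (simp_all add: Q_def vector_4)
 have row: "row i Q = Q $ i" for i by (simp add: row_def)
 have oQ: "orthogonal_matrix Q"
  unfolding orthogonal_matrix_orthonormal_rows row
  using oc' tt by (simp add: forall_4 Qn orthogonal_def norm_eq_1 inner_commute)
 have rQ: "rotation_matrix Q"
  using det_orthogonal_matrix[OF oQ] dN oQ by (auto simp: rotation_matrix_def Q_def)
 have Qv: "(Q *v v) $ i = Q $ i \<bullet> v" for v i by (simp add: matrix_vector_mul_component)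
 \<comment> \<open>The orthogonal projection to the tangent plane at u0 in the basis t1, t2. Its
   Jacobian determinant at u0 is w, hence positive.\<close>
 define m where "m u = (t1 \<bullet> (Y u - Y u0)) *\<^sub>R (axis 1 1 :: real^2) + (t2 \<bullet> (Y u - Y u0)) *\<^sub>R axis 2 1" for u
 have mC: "Ck_on r m (img_of c0)"
  unfolding m_def[abs_def] by (intro Ck_on_add Ck_on_scaleR Ck_on_inner Ck_on_diff Ck_on_const oi YC)
 have Yd: "(Y has_derivative fder Y (at u0)) (at u0)"
  using r by (intro Ck_on_imp_has_derivative[OF YC _ u0]) simp
 have dm: "(m has_derivative (%v. (t1 \<bullet> fder Y (at u0) v) *\<^sub>R axis 1 1 + (t2 \<bullet> fder Y (at u0) v) *\<^sub>R axis 2 1)) (at u0)"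
 proof -
  have "(m has_derivative (%v. (t1 \<bullet> (fder Y (at u0) v - 0)) *\<^sub>R axis 1 1 + (t2 \<bullet> (fder Y (at u0) v - 0)) *\<^sub>R axis 2 1)) (at u0)"
   unfolding m_def[abs_def]
   by (intro has_derivative_add has_derivative_scaleR_left has_derivative_inner_right has_derivative_diff Yd has_derivative_const)
  then show ?thesis by simp
 qed
 have "det (matrix (fder m (at u0))) = (t1 \<bullet> P) * (t2 \<bullet> R) - (t1 \<bullet> R) * (t2 \<bullet> P)"
  unfolding det_jac jac_def frechet_derivative_eqI[OF dm] by (simp add: PR pdx_def pdy_def axis_def)
 also have "\<dots> = w * ((x^2 + y^2) * (w^2 * E))" unfolding tP by algebra
 finally have "det (matrix (fder m (at (snd c0 p)))) > 0" unfolding xy u0_def using w(2) by simp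
 then obtain c where c: "positive_chart A r c" "p \<in> dom_of c" "dom_of c \<subseteq> dom_of c0" "\<And>q. q \<in> dom_of c ==> snd c q = m (snd c0 q)"
  using positive_chart_of_local_diffeo[OF A c0 _ mC] r by auto
 have ch: "is_chart c" using c by (simp add: positive_chart_def)
 have cp: "snd c p = 0" using c(4)[OF c(2)] by (simp add: m_def u0_def)
 have img: "snd c ` (dom_of c \<inter> dom_of c0) = img_of c" using c(3) by blast
 have oc_img: "open (img_of c)" using ch by (simp add: is_chart_def)
 have I0: "0 \<in> img_of c" using c(2) cp by (metis imageI)
 define \<tau> where "\<tau> = - (Q *v mu p)"
 define X where "X = (%u. 1 *\<^sub>R (Q *v mu (param c u) + \<tau>))"
 have Yp: "Y u0 = mu p" using is_chart_param(1)[OF ch0 c0(2)] by (simp add: Y_def u0_def)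
 have Xi: "X u $ i = Q $ i \<bullet> (mu (param c u) - mu p)" for u i
  by (simp add: X_def \<tau>_def Qv inner_diff_right)
 have X12: "X u $ 1 = u $ 1" "X u $ 2 = u $ 2" if u: "u \<in> img_of c" for u
 proof -
  have pd: "param c u \<in> dom_of c" using is_chart_param(3)[OF ch u] .
  have "Y (snd c0 (param c u)) = mu (param c u)" using is_chart_param(1)[OF ch0] pd c(3) by (auto simp: Y_def)
  moreover have "u = m (snd c0 (param c u))" using c(4)[OF pd] is_chart_param(2)[OF ch u] by simp
  ultimately have "u = (t1 \<bullet> (mu (param c u) - mu p)) *\<^sub>R axis 1 1 + (t2 \<bullet> (mu (param c u) - mu p)) *\<^sub>R axis 2 1"
   by (simp add: m_def Yp)
  from arg_cong[OF this, of "%z. z $ 1"] arg_cong[OF this, of "%z. z $ 2"]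
  have "u $ 1 = t1 \<bullet> (mu (param c u) - mu p)" "u $ 2 = t2 \<bullet> (mu (param c u) - mu p)"
   by (simp_all only: vector_add_component vector_scaleR_component axis_def vec_lambda_beta) simp_all
  then show "X u $ 1 = u $ 1" "X u $ 2 = u $ 2" by (simp_all add: Xi Qn)
 qed
 have X0: "X 0 = 0" using is_chart_param(1)[OF ch c(2)] by (simp add: X_def \<tau>_def cp)
 note tr = chart_transition[OF A c0(1) c(1), unfolded img]
 define psi where "psi = snd c0 \<circ> param c"
 have psi0: "psi 0 = u0" using is_chart_param(1)[OF ch c(2)] by (simp add: psi_def u0_def cp)
 have dpsi: "(psi has_derivative fder psi (at 0)) (at 0)"
  unfolding psi_def using r by (intro Ck_on_imp_has_derivative[OF tr(5) _ I0]) simp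
 have XY: "X u = 1 *\<^sub>R (Q *v Y (psi u) + \<tau>)" if "u \<in> img_of c" for u
  using tr(7)[OF that] by (simp add: X_def Y_def psi_def)
 have dX: "(X has_derivative (%v. Q *v fder Y (at u0) (fder psi (at 0) v))) (at 0)"
 proof -
  have "((%u. Y (psi u)) has_derivative (%v. fder Y (at u0) (fder psi (at 0) v))) (at 0)"
   using has_derivative_compose[of psi _ 0 UNIV Y, OF dpsi] Yd psi0 by simp
  then have "((%u. 1 *\<^sub>R (Q *v Y (psi u) + \<tau>)) has_derivative (%v. 1 *\<^sub>R (Q *v fder Y (at u0) (fder psi (at 0) v) + 0))) (at 0)"
   by (intro has_derivative_scaleR_right has_derivative_add has_derivative_const
    bounded_linear.has_derivative[OF matrix_vector_mul_bounded_linear])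
  then have "((%u. 1 *\<^sub>R (Q *v Y (psi u) + \<tau>)) has_derivative (%v. Q *v fder Y (at u0) (fder psi (at 0) v))) (at 0)"
   by simp
  then show ?thesis by (rule has_derivative_transform_within_open[OF _ oc_img I0]) (use XY in simp)
 qed
 have DY: "fder Y (at u0) v = v $ 1 *\<^sub>R P + v $ 2 *\<^sub>R R" for v
  unfolding PR pdx_def pdy_def by (rule has_derivative_plane_expand[OF differentiableI[OF Yd]])
 have NPR: "N \<bullet> P = 0" "N \<bullet> R = 0" if N: "t1 \<bullet> N = 0" "t2 \<bullet> N = 0" for N
 proof -
  have e1: "(x * w - y * F) * (N \<bullet> P) + (y * E) * (N \<bullet> R) = 0" "(- (y * w) - x * F) * (N \<bullet> P) + (x * E) * (N \<bullet> R) = 0"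
   using N unfolding t by (simp_all add: inner_add_left inner_add_right inner_commute)
  have "((x^2 + y^2) * w) * (N \<bullet> P) = 0" using e1 by algebra
  moreover have x0: "x^2 + y^2 \<noteq> 0" using xy by auto
  ultimately show NP: "N \<bullet> P = 0" using w(2) by auto
  have "((x^2 + y^2) * E) * (N \<bullet> R) = 0" using e1 NP by algebra
  then show "N \<bullet> R = 0" using x0 E0 by auto
 qed
 have dX34: "((%u. X u $ i) has_derivative (%_. 0)) (at 0)" if i: "i = 3 \<or> i = 4" for i
 proof -
  have "t1 \<bullet> Q $ i = 0" "t2 \<bullet> Q $ i = 0" using i oc' by (auto simp: Qn)
  note n = NPR[OF this]
  have "((%u. X u $ i) has_derivative (%v. (Q *v fder Y (at u0) (fder psi (at 0) v)) $ i)) (at 0)"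
   by (rule bounded_linear.has_derivative[OF bounded_linear_vec_nth dX])
  then show ?thesis unfolding Qv DY by (simp add: inner_add_right n)
 qed
 have XC: "Ck_on r X (img_of c)"
  using Ck_on_chart_similarity[OF A c0(1) c(1) muC, of 1 Q \<tau>] unfolding img X_def .
 have mj: "monge_jet X (img_of c)"
  by (rule monge_jet_graph[OF oc_img I0 Ck_on_mono[OF XC r3]]) (use X12 dX34 in auto)
 have gX: "\<forall>u\<in>img_of c. gram X u > 0"
  using chart_similarity_gram[OF A c0(1) c(1) r3 mu oQ, of 1 \<tau>] unfolding img X_def by simp
 then have "\<forall>u\<in>img_of c. \<exists>n1 n2. positive_normal_frame X u n1 n2" using positive_normal_frame_ex by blast
 from bchoice[OF this] obtain M1 where "\<forall>u\<in>img_of c. \<exists>n2. positive_normal_frame X u (M1 u) n2" ..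
 from bchoice[OF this] obtain M2 where "\<forall>u\<in>img_of c. positive_normal_frame X u (M1 u) (M2 u)" ..
 then have fr: "\<And>u. u \<in> img_of c ==> positive_normal_frame X u (M1 u) (M2 u)" by (rule bspec)
 have gr: "\<forall>y\<in>img_of c0. gram (mu \<circ> param c0) y > 0" using immersion_gram[OF mu _ c0(1)] r by simp
 have o1: "(1::real) > 0" by simp
 define l' where "l' = axial_factor Y 1 psi 0"
 note tr1 = axc_chart_transform(3,5,6,7)[OF A c0(1) c(1) r3 c(2) c0(2) muC gr oQ o1, where t = \<tau>, unfolded cp, folded X_def Y_def psi_def u0_def]
 have z': "axc Y u0 = 0" using z by (simp add: Y_def u0_def)
 have X0z: "axc X 0 = 0" using tr1(1) z' by blast
 have al: "axial_alpha X 0 = l'^5 * \<alpha>" "axial_beta X 0 = l'^4 * cnj l' * \<beta>"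
  using tr1(2)[OF z'] tr1(3)[OF z'] by (simp_all add: l'_def \<alpha>_def \<beta>_def Y_def u0_def)
 \<comment> \<open>The first coordinate vector of the Monge chart corresponds to T l' by the
   transformation rule and to t1 = T l by construction. So the factor of this chart change is the
   number l chosen above, and the condition on its argument applies.\<close>
 have "l' = l"
 proof -
  have "fder psi (at 0) (zvec X 0 1) = zvec Y u0 (l' * 1)" unfolding l'_def by (rule tr1(4)[OF z'])
  moreover have "zvec X 0 1 = axis 1 1" by (simp add: monge_jet_values[OF mj] vec_eq_iff forall_2 axis_def)
  ultimately have p1: "fder psi (at 0) (axis 1 1) = zvec Y u0 l'" by simp
  have "axis 1 1 = pdx X 0" using mj by (simp add: monge_jet_def)
  also have "\<dots> = Q *v fder Y (at u0) (zvec Y u0 l')"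
   unfolding pdx_def frechet_derivative_eqI[OF dX] p1 ..
  also have "fder Y (at u0) (zvec Y u0 l') = T l'" unfolding DY by (simp add: T_def zvec_def)
  finally have e: "axis 1 1 = Q *v T l'" .
  have "t1 \<bullet> T l' = 1" "t2 \<bullet> T l' = 0"
   using arg_cong[OF e, of "%v. v $ 1"] arg_cong[OF e, of "%v. v $ 2"] by (simp_all add: Qv Qn axis_def)
  then have e1: "(x * Re l' + y * Im l') * (w^2 * E) = (x^2 + y^2) * (w^2 * E)" "(x * Im l' - y * Re l') * (w^2 * E) = 0"
   unfolding t1T t2T xy by simp_all
  have wE: "w^2 * E \<noteq> 0" using w(2) E0 by simp
  have e2: "x * Re l' + y * Im l' = x^2 + y^2" "x * Im l' - y * Re l' = 0" using e1 wE by simp_all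
  have x0: "x^2 + y^2 \<noteq> 0" using xy by auto
  have "(x^2 + y^2) * Re l' = (x^2 + y^2) * x" "(x^2 + y^2) * Im l' = (x^2 + y^2) * y" using e2 by algebra+
  then show ?thesis using x0 by (auto simp: complex_eq_iff x_def y_def)
 qed
 then have im: "Im (axial_alpha X 0 + axial_beta X 0) = 0" using l(2) unfolding al by simp
 define k where "k = Re (axial_alpha X 0 - axial_beta X 0)"
 \<comment> \<open>|alpha|^2 - |beta|^2 is the real inner product of alpha + beta and alpha - beta.
   As alpha + beta is real, k = 0 would make the two moduli equal.\<close>
 have "k \<noteq> 0"
 proof
  assume k0: "k = 0"
  have "(cmod (axial_alpha X 0))^2 - (cmod (axial_beta X 0))^2 =
    Re (axial_alpha X 0 + axial_beta X 0) * Re (axial_alpha X 0 - axial_beta X 0) + Im (axial_alpha X 0 + axial_beta X 0) * Im (axial_alpha X 0 - axial_beta X 0)"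
   unfolding cmod_power2 by (simp add: power2_eq_square algebra_simps)
  then have "(cmod (axial_alpha X 0))^2 = (cmod (axial_beta X 0))^2" using im k0 unfolding k_def by simp
  then have "cmod l'^10 * (cmod \<alpha>)^2 = cmod l'^10 * (cmod \<beta>)^2"
   unfolding al by (simp add: norm_mult norm_power power_mult_distrib flip: power_mult power_add)
  moreover have "cmod l' > 0" unfolding \<open>l' = l\<close> l(1) using w(2) E0 by simp
  ultimately show False using ne by simp
 qed
 then obtain h :: "nat => real^2 => real" where h: "\<forall>i\<le>4. h i \<in> O[nhds 0](%u. (norm u)^2)"
  "\<forall>u\<in>img_of c. \<forall>dx dy. axial_quartic X (M1 u) (M2 u) u dx dy =
     k * (u$2 * (dy^4 - 6 * dx^2 * dy^2 + dx^4)
        + (4 * Re (axial_alpha X 0 + axial_beta X 0) / k * u$1 + - 4 * Im (axial_alpha X 0 - axial_beta X 0) / k * u$2) * dx * dy * (dx^2 - dy^2)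
        + (\<Sum>i\<le>4. h i u * dx^i * dy^(4 - i)))"
  using monge_quartic_normal_form[OF mj Ck_on_mono[OF XC r] fr X0z k_def _ im refl refl] by blast
 have Xg: "\<forall>u\<in>img_of c. X u = vector [u$1, u$2, X u $ 3, X u $ 4]"
  using X12 by (simp add: vec_eq_iff forall_4 vector_4)
 have "axial_normal_form A r mu p (4 * Re (axial_alpha X 0 + axial_beta X 0) / k) (- 4 * Im (axial_alpha X 0 - axial_beta X 0) / k)"
  unfolding axial_normal_form_def
 proof (rule exI[of _ c], rule exI[of _ Q], rule exI[of _ \<tau>], rule exI[of _ 1], rule exI[of _ X], rule exI[of _ "%u. X u $ 3"], rule exI[of _ "%u. X u $ 4"],
   rule exI[of _ M1], rule exI[of _ M2], rule exI[of _ k], rule exI[of _ h], intro conjI)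
  show "positive_chart A r c" "p \<in> dom_of c" "snd c p = 0" "rotation_matrix Q" by (rule c(1), rule c(2), rule cp, rule rQ)
  show "(0::real) < 1" by simp
  show "X = (%u. 1 *\<^sub>R (Q *v mu (param c u) + \<tau>))" by (rule X_def)
  show "\<forall>u\<in>img_of c. X u = vector [u$1, u$2, X u $ 3, X u $ 4]" by (rule Xg)
  show "X 0 $ 3 = 0" "X 0 $ 4 = 0" unfolding X0 by simp_all
  show "((%u. X u $ 3) has_derivative (%_. 0)) (at 0)" "((%u. X u $ 4) has_derivative (%_. 0)) (at 0)"
   by (rule dX34, simp)+
  show "\<forall>u\<in>img_of c. positive_normal_frame X u (M1 u) (M2 u)" by (intro ballI fr)
  show "k \<noteq> 0" by fact
  show "\<forall>i\<le>4. h i \<in> O[nhds 0](%u. (norm u)^2)" by (rule h(1))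
 qed (rule h(2))
 then show ?thesis by blast
qed

section \<open>The norm of order r in a single chart\<close>

lemma Cr_maps_lincomb:
 assumes A: "compact_oriented_surface A" and "f \<in> Cr_maps A r" "g \<in> Cr_maps A r"
 shows "(%q. x *\<^sub>R f q + y *\<^sub>R g q) \<in> Cr_maps A r"
 unfolding Cr_maps_def
proof (intro CollectI ballI)
 fix c assume c: "c \<in> A"
 then have o: "open (img_of c)" using atlas_is_chart[OF A] by (auto simp: is_chart_def)
 have "Ck_on r (f \<circ> param c) (img_of c)" "Ck_on r (g \<circ> param c) (img_of c)" using assms c by (auto simp: Cr_maps_def)
 then have "Ck_on r (%u. x *\<^sub>R (f \<circ> param c) u + y *\<^sub>R (g \<circ> param c) u) (img_of c)"
  by (intro Ck_on_add Ck_on_scaleR Ck_on_const o)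
 then show "Ck_on r ((%q. x *\<^sub>R f q + y *\<^sub>R g q) \<circ> param c) (img_of c)" by (simp add: o_def)
qed

text \<open>\<open>Cr_norm\<close> is a supremum and carries information only over a bounded set.
  There are finitely many charts and finitely many words of basis vectors, and each pair gives a
  continuous function on a compact set.\<close>

lemma Cr_norm_bdd:
 assumes A: "compact_oriented_surface A" and K: "norming_cover A \<K>" and f: "f \<in> Cr_maps A r"
 shows "bdd_above {norm (iter_deriv vs (f \<circ> param c) (snd c q)) | c K q vs. (c, K) \<in> \<K> & q \<in> K & set vs \<subseteq> Basis & length vs \<le> r}"
proof -
 let ?V = "{vs :: (real^2) list. set vs \<subseteq> Basis & length vs \<le> r}"
 let ?F = "%i. (%q. norm (iter_deriv (snd i) (f \<circ> param (fst (fst i))) (snd (fst (fst i)) q))) ` snd (fst i)"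
 have fin: "finite (\<K> \<times> ?V)" using K finite_lists_length_le[of Basis r] by (auto simp: norming_cover_def)
 have b: "bdd_above (?F i)" if i: "i \<in> \<K> \<times> ?V" for i
 proof -
  obtain c L vs where i': "i = ((c, L), vs)" by (metis surj_pair)
  then have c: "c \<in> A" "compact L" "L \<subseteq> dom_of c" and vs: "length vs \<le> r" using i K by (auto simp: norming_cover_def)
  have h: "homeomorphism (dom_of c) (img_of c) (snd c) (param c)" using atlas_is_chart[OF A c(1)] by (simp add: is_chart_def)
  have "Ck_on 0 (iter_deriv vs (f \<circ> param c)) (img_of c)" using f c(1) vs by (intro Ck_on_iter_deriv'[of r]) (auto simp: Cr_maps_def)
  then have "continuous_on (img_of c) (iter_deriv vs (f \<circ> param c))" by simp
  moreover have "continuous_on L (snd c)" using continuous_on_subset[OF homeomorphism_cont1[OF h] c(3)] .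
  ultimately have "continuous_on L (%q. iter_deriv vs (f \<circ> param c) (snd c q))"
   by (rule continuous_on_compose2) (use c(3) in blast)
  then have "compact ((%q. norm (iter_deriv vs (f \<circ> param c) (snd c q))) ` L)"
   by (intro compact_continuous_image continuous_on_norm c(2))
  then show ?thesis unfolding i' by (simp add: bounded_imp_bdd_above[OF compact_imp_bounded])
 qed
 have "bdd_above (\<Union>i\<in>\<K> \<times> ?V. ?F i)" by (subst bdd_above_UN[OF fin], rule ballI, rule b)
 moreover have "{norm (iter_deriv vs (f \<circ> param c) (snd c q)) | c K q vs. (c, K) \<in> \<K> & q \<in> K & set vs \<subseteq> Basis & length vs \<le> r} \<subseteq> (\<Union>i\<in>\<K> \<times> ?V. ?F i)"
 proof
  fix x assume "x \<in> {norm (iter_deriv vs (f \<circ> param c) (snd c q)) | c K q vs. (c, K) \<in> \<K> & q \<in> K & set vs \<subseteq> Basis & length vs \<le> r}"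
  then obtain c L q vs where q: "x = norm (iter_deriv vs (f \<circ> param c) (snd c q))" "(c, L) \<in> \<K>" "q \<in> L" "set vs \<subseteq> Basis" "length vs \<le> r"
   by blast
  then have "((c, L), vs) \<in> \<K> \<times> ?V" "x \<in> ?F ((c, L), vs)" by auto
  then show "x \<in> (\<Union>i\<in>\<K> \<times> ?V. ?F i)" by (rule UN_I)
 qed
 ultimately show ?thesis by (rule bdd_above_mono)
qed

lemma Cr_norm_ge:
 assumes "compact_oriented_surface A" "norming_cover A \<K>" "f \<in> Cr_maps A r" "(c, K) \<in> \<K>" "q \<in> K" "set vs \<subseteq> Basis" "length vs \<le> r"
 shows "norm (iter_deriv vs (f \<circ> param c) (snd c q)) \<le> Cr_norm \<K> r f"
 unfolding Cr_norm_def
 by (rule cSup_upper[OF _ Cr_norm_bdd[OF assms(1-3)]]) (use assms(4-7) in blast)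

lemma Cr_norm_le:
 assumes K: "norming_cover A \<K>"
  and B: "\<And>c K q vs. (c, K) \<in> \<K> ==> q \<in> K ==> set vs \<subseteq> Basis ==> length vs \<le> r ==> norm (iter_deriv vs (f \<circ> param c) (snd c q)) \<le> B"
 shows "Cr_norm \<K> r f \<le> B"
 unfolding Cr_norm_def
proof (rule cSup_least)
 \<comment> \<open>\<open>undefined\<close> stands for some point of the surface, which is a whole
   type and therefore nonempty.\<close>
 have "undefined \<in> (\<Union>(c, K)\<in>\<K>. K)" using K by (simp add: norming_cover_def)
 then obtain c K where cK: "(c, K) \<in> \<K>" "undefined \<in> K" by auto
 have "norm (iter_deriv [] (f \<circ> param c) (snd c undefined)) \<in>
  {norm (iter_deriv vs (f \<circ> param c) (snd c q)) | c K q vs. (c, K) \<in> \<K> & q \<in> K & set vs \<subseteq> Basis & length vs \<le> r}"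
  by (intro CollectI exI[of _ c] exI[of _ K] exI[of _ undefined] exI[of _ "[]"]) (use cK in simp)
 then show "{norm (iter_deriv vs (f \<circ> param c) (snd c q)) | c K q vs. (c, K) \<in> \<K> & q \<in> K & set vs \<subseteq> Basis & length vs \<le> r} \<noteq> {}" by blast
qed (use B in blast)

lemma Cr_norm_nonneg:
 assumes "compact_oriented_surface A" "norming_cover A \<K>" "f \<in> Cr_maps A r"
 shows "Cr_norm \<K> r f \<ge> 0"
proof -
 have "undefined \<in> (\<Union>(c, K)\<in>\<K>. K)" using assms(2) by (simp add: norming_cover_def)
 then obtain c K where cK: "(c, K) \<in> \<K>" "undefined \<in> K" by auto
 have "norm (iter_deriv [] (f \<circ> param c) (snd c undefined)) \<le> Cr_norm \<K> r f" by (rule Cr_norm_ge[OF assms cK]) simp_all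
 then show ?thesis by (rule order_trans[OF norm_ge_zero])
qed

lemma Cr_norm_lincomb:
 assumes A: "compact_oriented_surface A" and K: "norming_cover A \<K>" and fg: "f \<in> Cr_maps A r" "g \<in> Cr_maps A r"
 shows "Cr_norm \<K> r (%q. x *\<^sub>R f q + y *\<^sub>R g q) \<le> \<bar>x\<bar> * Cr_norm \<K> r f + \<bar>y\<bar> * Cr_norm \<K> r g"
proof (rule Cr_norm_le[OF K])
 fix c L q and vs :: "(real^2) list" assume c: "(c, L) \<in> \<K>" "q \<in> L" and vs: "set vs \<subseteq> Basis" "length vs \<le> r"
 have cA: "c \<in> A" "q \<in> dom_of c" using c K by (auto simp: norming_cover_def)
 then have o: "open (img_of c)" using atlas_is_chart[OF A] by (auto simp: is_chart_def)
 have u: "snd c q \<in> img_of c" using cA by blast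
 have k: "Ck_on (length vs) (f \<circ> param c) (img_of c)" "Ck_on (length vs) (g \<circ> param c) (img_of c)"
  using fg cA(1) Ck_on_mono[OF _ vs(2)] by (auto simp: Cr_maps_def)
 have "iter_deriv vs ((%q. x *\<^sub>R f q + y *\<^sub>R g q) \<circ> param c) (snd c q) =
   x *\<^sub>R iter_deriv vs (f \<circ> param c) (snd c q) + y *\<^sub>R iter_deriv vs (g \<circ> param c) (snd c q)"
  using iter_deriv_lincomb[OF o k u, of x y] by (simp add: o_def)
 also have "norm \<dots> \<le> \<bar>x\<bar> * norm (iter_deriv vs (f \<circ> param c) (snd c q)) + \<bar>y\<bar> * norm (iter_deriv vs (g \<circ> param c) (snd c q))"
  by (rule order_trans[OF norm_triangle_ineq]) simp
 also have "\<dots> \<le> \<bar>x\<bar> * Cr_norm \<K> r f + \<bar>y\<bar> * Cr_norm \<K> r g"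
  by (intro add_mono mult_left_mono Cr_norm_ge[OF A K fg(1) c vs] Cr_norm_ge[OF A K fg(2) c vs] abs_ge_zero)
 finally show "norm (iter_deriv vs ((%q. x *\<^sub>R f q + y *\<^sub>R g q) \<circ> param c) (snd c q)) \<le> \<bar>x\<bar> * Cr_norm \<K> r f + \<bar>y\<bar> * Cr_norm \<K> r g" .
qed

text \<open>The chain rule of higher order: \<open>jet_sum psi S n\<close> contains the operators that map \<open>f\<close> to a
 combination of its derivatives of order at most \<open>n\<close> at \<open>psi u\<close>, with coefficients not depending on \<open>f\<close>.\<close>

inductive jet_sum :: "(real^2 => real^2) => (real^2) set => nat => ((real^2 => real^4) => real^2 => real^4) => bool"
 for psi S n where
 jet_term: "(\<forall>k. Ck_on k a S) ==> set s \<subseteq> Basis ==> length s \<le> n ==> jet_sum psi S n (%f u. a u *\<^sub>R iter_deriv s f (psi u))"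
| jet_add: "jet_sum psi S n \<Phi> ==> jet_sum psi S n \<Phi>' ==> jet_sum psi S n (%f u. \<Phi> f u + \<Phi>' f u)"

lemma jet_sum_derivative:
 assumes "jet_sum psi S n \<Phi>" and S: "open S" "psi ` S \<subseteq> T" and psi: "\<forall>k. Ck_on k psi S"
 shows "\<exists>\<Phi>'. jet_sum psi S (Suc n) \<Phi>' & (\<forall>f. Ck_on (Suc n) f T --> (\<forall>u\<in>S. \<exists>D. (\<Phi> f has_derivative D) (at u) & D b = \<Phi>' f u))"
 using assms(1)
proof (induction rule: jet_sum.induct)
 case (jet_term a s)
 let ?w = "%u. fder psi (at u) b"
 \<comment> \<open>The direction D psi b moves with u. It is expanded in the two coordinate
   directions, with its components absorbed into the coefficients, so that only words of basis
   vectors occur.\<close>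
 let ?\<Phi> = "%f u. fder a (at u) b *\<^sub>R iter_deriv s f (psi u) +
  ((a u * ?w u $ 1) *\<^sub>R iter_deriv (axis 1 1 # s) f (psi u) + (a u * ?w u $ 2) *\<^sub>R iter_deriv (axis 2 1 # s) f (psi u))"
 have w: "Ck_on k ?w S" for k by (rule Ck_on_frechet_derivative) (use psi in blast)
 have w': "Ck_on k (%u. ?w u $ i) S" for k i by (rule Ck_on_vec_nth[OF S(1) w])
 have a: "Ck_on k (%u. fder a (at u) b) S" for k by (rule Ck_on_frechet_derivative) (use jet_term in blast)
 have a': "Ck_on k (%u. a u * ?w u $ i) S" for k i by (rule Ck_on_mult[OF S(1)]) (use jet_term w' in blast)+
 have "jet_sum psi S (Suc n) ?\<Phi>"
  using jet_term a a' by (intro jet_sum.jet_add jet_sum.jet_term) (auto simp: axis_in_Basis_iff)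
 moreover have "\<exists>D. ((%u. a u *\<^sub>R iter_deriv s f (psi u)) has_derivative D) (at u) & D b = ?\<Phi> f u" if f: "Ck_on (Suc n) f T" and u: "u \<in> S" for f :: "real^2 => real^4" and u
 proof -
  have 1: "Ck_on 1 (iter_deriv s f) T" by (rule Ck_on_iter_deriv'[OF f]) (use jet_term in simp)
  have psi1: "Ck_on 1 psi S" "Ck_on 1 a S" using psi jet_term by blast+
  have uT: "psi u \<in> T" using S u by blast
  have gd: "iter_deriv s f differentiable (at (psi u))" using Ck_on_imp_differentiable[OF 1 _ uT] by simp
  have d: "((%u. iter_deriv s f (psi u)) has_derivative (%v. fder (iter_deriv s f) (at (psi u)) (fder psi (at u) v))) (at u)"
   by (rule frechet_derivative_compose_Ck(1)[OF psi1(1) _ 1 _ S(2) u]) simp_all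
  have da: "(a has_derivative fder a (at u)) (at u)" by (rule Ck_on_imp_has_derivative[OF psi1(2) _ u]) simp
  note D = has_derivative_scaleR[OF da d]
  show ?thesis
  proof (intro exI conjI)
   show "((%u. a u *\<^sub>R iter_deriv s f (psi u)) has_derivative (%h. a u *\<^sub>R fder (iter_deriv s f) (at (psi u)) (fder psi (at u) h) +
    fder a (at u) h *\<^sub>R iter_deriv s f (psi u))) (at u)" by (rule D)
   show "a u *\<^sub>R fder (iter_deriv s f) (at (psi u)) (fder psi (at u) b) + fder a (at u) b *\<^sub>R iter_deriv s f (psi u) = ?\<Phi> f u"
    unfolding has_derivative_plane_expand[OF gd, of "?w u"] by (simp add: scaleR_add_right)
  qed
 qed
 ultimately show ?case by blast
next
 case (jet_add \<Phi>1 \<Phi>2)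
 from jet_add.IH(1) obtain \<Psi>1 where p1: "jet_sum psi S (Suc n) \<Psi>1 & (\<forall>f. Ck_on (Suc n) f T --> (\<forall>u\<in>S. \<exists>D. (\<Phi>1 f has_derivative D) (at u) & D b = \<Psi>1 f u))" ..
 from jet_add.IH(2) obtain \<Psi>2 where p2: "jet_sum psi S (Suc n) \<Psi>2 & (\<forall>f. Ck_on (Suc n) f T --> (\<forall>u\<in>S. \<exists>D. (\<Phi>2 f has_derivative D) (at u) & D b = \<Psi>2 f u))" ..
 show ?case
 proof (intro exI[of _ "%f u. \<Psi>1 f u + \<Psi>2 f u"] conjI allI impI ballI)
  show "jet_sum psi S (Suc n) (%f u. \<Psi>1 f u + \<Psi>2 f u)" using p1 p2 by (intro jet_sum.jet_add) simp_all
  fix f :: "real^2 => real^4" and u assume f: "Ck_on (Suc n) f T" "u \<in> S"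
  obtain D1 where D1: "(\<Phi>1 f has_derivative D1) (at u) & D1 b = \<Psi>1 f u" using p1 f by blast
  obtain D2 where D2: "(\<Phi>2 f has_derivative D2) (at u) & D2 b = \<Psi>2 f u" using p2 f by blast
  show "\<exists>D. ((%u. \<Phi>1 f u + \<Phi>2 f u) has_derivative D) (at u) & D b = \<Psi>1 f u + \<Psi>2 f u"
   by (intro exI[of _ "%h. D1 h + D2 h"] conjI has_derivative_add) (use D1 D2 in simp_all)
 qed
qed

lemma iter_deriv_compose:
 assumes S: "open S" "psi ` S \<subseteq> T" and psi: "\<forall>k. Ck_on k psi S"
 shows "\<exists>\<Phi>. jet_sum psi S (length s) \<Phi> & (\<forall>f. Ck_on (length s) f T --> (\<forall>u\<in>S. iter_deriv s (%u. f (psi u)) u = \<Phi> f u))"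
proof (induction s)
 case Nil
 have "jet_sum psi S 0 (%f u. 1 *\<^sub>R iter_deriv [] f (psi u))" by (rule jet_sum.jet_term) (simp_all add: Ck_on_const)
 then show ?case by (intro exI[of _ "%f u. 1 *\<^sub>R iter_deriv [] f (psi u)"]) simp
next
 case (Cons b s)
 from Cons.IH obtain \<Phi> where p: "jet_sum psi S (length s) \<Phi> & (\<forall>f. Ck_on (length s) f T --> (\<forall>u\<in>S. iter_deriv s (%u. f (psi u)) u = \<Phi> f u))" ..
 from jet_sum_derivative[OF conjunct1[OF p] S psi, of b] obtain \<Psi> where q: "jet_sum psi S (Suc (length s)) \<Psi> &
  (\<forall>f. Ck_on (Suc (length s)) f T --> (\<forall>u\<in>S. \<exists>D. (\<Phi> f has_derivative D) (at u) & D b = \<Psi> f u))" ..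
 show ?case
 proof (intro exI[of _ \<Psi>] conjI allI impI ballI)
  show "jet_sum psi S (length (b # s)) \<Psi>" using q by simp
  fix f :: "real^2 => real^4" and u assume f: "Ck_on (length (b # s)) f T" and u: "u \<in> S"
  obtain D where D: "(\<Phi> f has_derivative D) (at u) & D b = \<Psi> f u" using q f u by auto
  have "Ck_on (length s) f T" using Ck_on_mono[OF f] by simp
  then have e: "\<And>x. x \<in> S ==> \<Phi> f x = iter_deriv s (%u. f (psi u)) x" using p by simp
  have "(iter_deriv s (%u. f (psi u)) has_derivative D) (at u)"
   by (rule has_derivative_transform_within_open[OF conjunct1[OF D] S(1) u e])
  from frechet_derivative_eqI[OF this, of b] show "iter_deriv (b # s) (%u. f (psi u)) u = \<Psi> f u" using D by simp
 qed
qed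

lemma jet_sum_bound:
 assumes "jet_sum psi S n \<Phi>" and B: "compact B" "B \<subseteq> S"
 shows "\<exists>C\<ge>0. \<forall>f. \<forall>u\<in>B. \<forall>M. (\<forall>s. set s \<subseteq> Basis & length s \<le> n --> norm (iter_deriv s f (psi u)) \<le> M) --> norm (\<Phi> f u) \<le> C * M"
 using assms(1)
proof (induction rule: jet_sum.induct)
 case (jet_term a s)
 have "Ck_on 0 a S" using jet_term by blast
 then have "continuous_on B a" using continuous_on_subset[OF _ B(2)] by simp
 then have "bounded (a ` B)" by (intro compact_imp_bounded compact_continuous_image B(1))
 then obtain C where C: "C > 0" "\<And>u. u \<in> B ==> norm (a u) \<le> C" unfolding bounded_pos by blast
 show ?case
 proof (intro exI[of _ C] conjI allI ballI impI)
  fix f :: "real^2 => real^4" and u M assume u: "u \<in> B" and M: "\<forall>s. set s \<subseteq> Basis & length s \<le> n --> norm (iter_deriv s f (psi u)) \<le> M"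
  have "norm (iter_deriv s f (psi u)) \<le> M" using M jet_term by blast
  then show "norm (a u *\<^sub>R iter_deriv s f (psi u)) \<le> C * M" unfolding norm_scaleR using C(2)[OF u] C(1) by (intro mult_mono) auto
 qed (use C in simp)
next
 case (jet_add \<Phi>1 \<Phi>2)
 from jet_add.IH(1) obtain C1 where C1: "C1 \<ge> 0 & (\<forall>f. \<forall>u\<in>B. \<forall>M. (\<forall>s. set s \<subseteq> Basis & length s \<le> n --> norm (iter_deriv s f (psi u)) \<le> M) --> norm (\<Phi>1 f u) \<le> C1 * M)" ..
 from jet_add.IH(2) obtain C2 where C2: "C2 \<ge> 0 & (\<forall>f. \<forall>u\<in>B. \<forall>M. (\<forall>s. set s \<subseteq> Basis & length s \<le> n --> norm (iter_deriv s f (psi u)) \<le> M) --> norm (\<Phi>2 f u) \<le> C2 * M)" ..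
 show ?case
 proof (intro exI[of _ "C1 + C2"] conjI allI ballI impI)
  fix f :: "real^2 => real^4" and u M assume u: "u \<in> B" and M: "\<forall>s. set s \<subseteq> Basis & length s \<le> n --> norm (iter_deriv s f (psi u)) \<le> M"
  have "norm (\<Phi>1 f u) \<le> C1 * M" "norm (\<Phi>2 f u) \<le> C2 * M" using C1 C2 u M by blast+
  then show "norm (\<Phi>1 f u + \<Phi>2 f u) \<le> (C1 + C2) * M" using norm_triangle_ineq[of "\<Phi>1 f u" "\<Phi>2 f u"] unfolding distrib_right by linarith
 qed (use C1 C2 in simp)
qed

text \<open>The norm controls derivatives in the chart c of the cover, and only over K, which
  explains the restriction to points of K. The coefficients of the higher chain rule are smooth and
  hence bounded on a closed ball around the image of p.\<close>

lemma transition_jet_bound: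
 assumes A: "compact_oriented_surface A" and K: "norming_cover A \<K>" and c0: "c0 \<in> A" "p \<in> dom_of c0" and c: "(c, K) \<in> \<K>" "p \<in> K"
 shows "\<exists>rho>0. \<exists>C\<ge>0. \<forall>v\<in>Cr_maps A r. \<forall>u\<in>ball (snd c0 p) rho. param c0 u \<in> K -->
  (\<forall>s. set s \<subseteq> Basis & length s \<le> r --> norm (iter_deriv s (v \<circ> param c0) u) \<le> C * Cr_norm \<K> r v)"
proof -
 have cA: "c \<in> A" "K \<subseteq> dom_of c" using K c by (auto simp: norming_cover_def)
 define S where "S = snd c0 ` (dom_of c0 \<inter> dom_of c)"
 define psi where "psi = snd c \<circ> param c0"
 note tr = chart_transition[OF A cA(1) positive_chart_atlas[OF A c0(1)], folded S_def psi_def]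
 have psi: "\<forall>k. Ck_on k psi S" using tr(5) by blast
 have "snd c0 p \<in> S" using c0 cA c unfolding S_def by blast
 then obtain rho where rho: "rho > 0" "cball (snd c0 p) rho \<subseteq> S" using tr(1) open_contains_cball by metis
 let ?V = "{s :: (real^2) list. set s \<subseteq> Basis & length s \<le> r}"
 have fin: "finite ?V" using finite_lists_length_le[of Basis r] by simp
 have "\<forall>s\<in>?V. \<exists>C\<ge>0. \<forall>v\<in>Cr_maps A r. \<forall>u\<in>ball (snd c0 p) rho. param c0 u \<in> K --> norm (iter_deriv s (v \<circ> param c0) u) \<le> C * Cr_norm \<K> r v"
 proof
  fix s assume s: "s \<in> ?V"
  from iter_deriv_compose[OF tr(1,4) psi, of s] obtain \<Phi> where p: "jet_sum psi S (length s) \<Phi> &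
   (\<forall>f. Ck_on (length s) f (img_of c) --> (\<forall>u\<in>S. iter_deriv s (%u. f (psi u)) u = \<Phi> f u))" ..
  from jet_sum_bound[OF conjunct1[OF p] compact_cball rho(2)] obtain C where C: "C \<ge> 0 & (\<forall>f. \<forall>u\<in>cball (snd c0 p) rho. \<forall>M.
   (\<forall>t. set t \<subseteq> Basis & length t \<le> length s --> norm (iter_deriv t f (psi u)) \<le> M) --> norm (\<Phi> f u) \<le> C * M)" ..
  show "\<exists>C\<ge>0. \<forall>v\<in>Cr_maps A r. \<forall>u\<in>ball (snd c0 p) rho. param c0 u \<in> K --> norm (iter_deriv s (v \<circ> param c0) u) \<le> C * Cr_norm \<K> r v"
  proof (intro exI[of _ C] conjI ballI impI)
   fix v u assume v: "v \<in> Cr_maps A r" and u: "u \<in> ball (snd c0 p) rho" and uK: "param c0 u \<in> K"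
   have uc: "u \<in> cball (snd c0 p) rho" using u by simp
   then have uS: "u \<in> S" using rho(2) by blast
   have sl: "length s \<le> r" using s by simp
   have vk: "Ck_on (length s) (v \<circ> param c) (img_of c)" "Ck_on (length s) (v \<circ> param c0) S"
   proof -
    have "Ck_on r (v \<circ> param c) (img_of c)" "Ck_on r (v \<circ> param c0) (img_of c0)" using v cA(1) c0(1) by (simp_all add: Cr_maps_def)
    then show "Ck_on (length s) (v \<circ> param c) (img_of c)" "Ck_on (length s) (v \<circ> param c0) S"
     using Ck_on_mono[OF _ sl] Ck_on_subset[OF _ tr(2)] by blast+
   qed
   have "iter_deriv s (v \<circ> param c0) u = iter_deriv s (%u. (v \<circ> param c) (psi u)) u"
    by (rule iter_deriv_cong[OF tr(1) _ vk(2) uS]) (simp add: tr(7))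
   also have "\<dots> = \<Phi> (v \<circ> param c) u" by (rule conjunct2[OF p, rule_format, OF vk(1) uS])
   finally have e: "iter_deriv s (v \<circ> param c0) u = \<Phi> (v \<circ> param c) u" .
   have "norm (iter_deriv t (v \<circ> param c) (psi u)) \<le> Cr_norm \<K> r v" if t: "set t \<subseteq> Basis & length t \<le> length s" for t
    using Cr_norm_ge[OF A K v c(1) uK conjunct1[OF t]] t sl by (simp add: psi_def)
   then show "norm (iter_deriv s (v \<circ> param c0) u) \<le> C * Cr_norm \<K> r v" unfolding e
    by (intro conjunct2[OF C, rule_format, OF uc])
  qed (use C in simp)
 qed
 from bchoice[OF this] obtain C where C: "\<forall>s\<in>?V. C s \<ge> 0 & (\<forall>v\<in>Cr_maps A r. \<forall>u\<in>ball (snd c0 p) rho. param c0 u \<in> K --> norm (iter_deriv s (v \<circ> param c0) u) \<le> C s * Cr_norm \<K> r v)" ..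
 have C0: "sum C ?V \<ge> 0" using C by (intro sum_nonneg) blast
 show ?thesis
 proof (rule exI[of _ rho], rule conjI[OF rho(1)], rule exI[of _ "sum C ?V"], rule conjI[OF C0], intro ballI allI impI)
  fix v u and s :: "(real^2) list" assume a: "v \<in> Cr_maps A r" "u \<in> ball (snd c0 p) rho" "param c0 u \<in> K" "set s \<subseteq> Basis & length s \<le> r"
  then have s: "s \<in> ?V" by simp
  have "C s \<le> sum C ?V" by (rule member_le_sum[OF s _ fin]) (use C in blast)
  then have "C s * Cr_norm \<K> r v \<le> sum C ?V * Cr_norm \<K> r v" by (rule mult_right_mono[OF _ Cr_norm_nonneg[OF A K a(1)]])
  moreover have "norm (iter_deriv s (v \<circ> param c0) u) \<le> C s * Cr_norm \<K> r v"
   by (rule conjunct2[OF bspec[OF C s], rule_format, OF a(1-3)])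
  ultimately show "norm (iter_deriv s (v \<circ> param c0) u) \<le> sum C ?V * Cr_norm \<K> r v" by linarith
 qed
qed

text \<open>The ball is shrunk until it misses every compact set of the cover that does not contain
  p; for those the constant is 0. Each point of the ball lies in one of the other sets, where
  \<open>transition_jet_bound\<close> applies, and the sum of all constants serves for every
  point.\<close>

lemma local_jet_bound:
 assumes A: "compact_oriented_surface A" and K: "norming_cover A \<K>" and c0: "c0 \<in> A" "p \<in> dom_of c0"
 shows "\<exists>rho>0. \<exists>C\<ge>0. ball (snd c0 p) rho \<subseteq> img_of c0 & (\<forall>v\<in>Cr_maps A r. \<forall>u\<in>ball (snd c0 p) rho.
  \<forall>s. set s \<subseteq> Basis & length s \<le> r --> norm (iter_deriv s (v \<circ> param c0) u) \<le> C * Cr_norm \<K> r v)"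
proof -
 note ch = atlas_is_chart[OF A c0(1)]
 have ho: "homeomorphism (dom_of c0) (img_of c0) (snd c0) (param c0)" "open (img_of c0)" using ch by (simp_all add: is_chart_def)
 have u0: "snd c0 p \<in> img_of c0" using c0 by blast
 obtain rho0 where r0: "rho0 > 0" "ball (snd c0 p) rho0 \<subseteq> img_of c0" using ho(2) u0 open_contains_ball by metis
 let ?P = "%i x. fst x > 0 & snd x \<ge> (0::real) & (\<forall>v\<in>Cr_maps A r. \<forall>u\<in>ball (snd c0 p) (fst x) \<inter> img_of c0. param c0 u \<in> snd i -->
  (\<forall>s. set s \<subseteq> Basis & length s \<le> r --> norm (iter_deriv s (v \<circ> param c0) u) \<le> snd x * Cr_norm \<K> r v))"
 have "\<forall>i\<in>\<K>. \<exists>x. ?P i x"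
 proof
  fix i assume i: "i \<in> \<K>"
  obtain c L where cL: "i = (c, L)" by (metis surj_pair)
  show "\<exists>x. ?P i x"
  proof (cases "p \<in> L")
   case True
   from transition_jet_bound[OF A K c0 i[unfolded cL] True, of r] obtain rho where r: "rho > 0 & (\<exists>C\<ge>0. \<forall>v\<in>Cr_maps A r. \<forall>u\<in>ball (snd c0 p) rho. param c0 u \<in> L -->
    (\<forall>s. set s \<subseteq> Basis & length s \<le> r --> norm (iter_deriv s (v \<circ> param c0) u) \<le> C * Cr_norm \<K> r v))" ..
   from conjunct2[OF r] obtain C where C: "C \<ge> 0 & (\<forall>v\<in>Cr_maps A r. \<forall>u\<in>ball (snd c0 p) rho. param c0 u \<in> L -->
    (\<forall>s. set s \<subseteq> Basis & length s \<le> r --> norm (iter_deriv s (v \<circ> param c0) u) \<le> C * Cr_norm \<K> r v))" ..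
   show ?thesis by (intro exI[of _ "(rho, C)"]) (use r C cL in auto)
  next
   case False
   have "closed L" using K i cL compact_imp_closed by (auto simp: norming_cover_def)
   then have "open (img_of c0 \<inter> param c0 -` (- L))"
    by (intro continuous_open_preimage[OF homeomorphism_cont2[OF ho(1)] ho(2)] open_Compl)
   moreover have "snd c0 p \<in> img_of c0 \<inter> param c0 -` (- L)" using u0 False is_chart_param(1)[OF ch c0(2)] by simp
   ultimately obtain rho where "rho > 0" "ball (snd c0 p) rho \<subseteq> img_of c0 \<inter> param c0 -` (- L)" using open_contains_ball by metis
   then show ?thesis by (intro exI[of _ "(rho, 0)"]) (use cL in auto)
  qed
 qed
 from bchoice[OF this] obtain x where x: "\<forall>i\<in>\<K>. ?P i (x i)" ..
 have fK: "finite \<K>" using K by (simp add: norming_cover_def)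
 define rho where "rho = Min (insert rho0 ((fst \<circ> x) ` \<K>))"
 have rho: "rho > 0" "rho \<le> rho0" "\<And>i. i \<in> \<K> ==> rho \<le> fst (x i)" unfolding rho_def using fK r0 x by (auto simp: Min_gr_iff)
 have C0: "sum (snd \<circ> x) \<K> \<ge> 0" using x by (intro sum_nonneg) simp
 show ?thesis
 proof (rule exI[of _ rho], rule conjI[OF rho(1)], rule exI[of _ "sum (snd \<circ> x) \<K>"], rule conjI[OF C0], intro conjI ballI allI impI)
  show "ball (snd c0 p) rho \<subseteq> img_of c0" by (rule order_trans[OF subset_ball[OF rho(2)] r0(2)])
  fix v u and s :: "(real^2) list" assume a: "v \<in> Cr_maps A r" "u \<in> ball (snd c0 p) rho" "set s \<subseteq> Basis & length s \<le> r"
  have "param c0 u \<in> (\<Union>(c, K)\<in>\<K>. K)" using K by (simp add: norming_cover_def)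
  then obtain i where i: "i \<in> \<K>" "param c0 u \<in> (case i of (c, K) => K)" by blast
  have iL: "param c0 u \<in> snd i" using i(2) by (simp add: case_prod_beta)
  have "u \<in> ball (snd c0 p) (fst (x i))" using subsetD[OF subset_ball[OF rho(3)[OF i(1)]] a(2)] .
  moreover have "u \<in> img_of c0" using subsetD[OF r0(2) subsetD[OF subset_ball[OF rho(2)] a(2)]] .
  ultimately have u: "u \<in> ball (snd c0 p) (fst (x i)) \<inter> img_of c0" by (rule IntI)
  have "snd (x i) \<le> sum (snd \<circ> x) \<K>" using member_le_sum[OF i(1), of "snd \<circ> x"] x fK by simp
  then have "snd (x i) * Cr_norm \<K> r v \<le> sum (snd \<circ> x) \<K> * Cr_norm \<K> r v" by (rule mult_right_mono[OF _ Cr_norm_nonneg[OF A K a(1)]])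
  moreover have "norm (iter_deriv s (v \<circ> param c0) u) \<le> snd (x i) * Cr_norm \<K> r v"
   by (rule conjunct2[OF conjunct2[OF bspec[OF x i(1)]], rule_format, OF a(1) u iL a(3)])
  ultimately show "norm (iter_deriv s (v \<circ> param c0) u) \<le> sum (snd \<circ> x) \<K> * Cr_norm \<K> r v" by linarith
 qed
qed

section \<open>Immersions remain immersions under small perturbations\<close>

lemma gram_stable:
 assumes A: "compact_oriented_surface A" and K: "norming_cover A \<K>" and r: "r > 0" and \<alpha>: "\<alpha> \<in> immersions A r" and c: "(c, L) \<in> \<K>"
 shows "\<exists>eps>0. \<forall>mu\<in>Cr_maps A r. Cr_norm \<K> r (%q. mu q - \<alpha> q) < eps --> (\<forall>q\<in>L. gram (mu \<circ> param c) (snd c q) > 0)"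
proof -
 have cA: "c \<in> A" "compact L" "L \<subseteq> dom_of c" using K c by (auto simp: norming_cover_def)
 have h: "homeomorphism (dom_of c) (img_of c) (snd c) (param c)" "open (img_of c)" using atlas_is_chart[OF A cA(1)] by (simp_all add: is_chart_def)
 let ?j = "%mu q. (pdx (mu \<circ> param c) (snd c q), pdy (mu \<circ> param c) (snd c q)) :: (real^4) \<times> (real^4)"
 let ?O = "{z :: (real^4) \<times> (real^4). (fst z \<bullet> fst z) * (snd z \<bullet> snd z) - (fst z \<bullet> snd z)^2 > 0}"
 have jg: "gram (mu \<circ> param c) (snd c q) > 0 \<longleftrightarrow> ?j mu q \<in> ?O" for mu q by (simp add: gram_def fffE_def fffF_def fffG_def)
 have \<alpha>C: "\<alpha> \<in> Cr_maps A r" by (rule immersions_Cr_maps[OF \<alpha>])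
 have "Ck_on (Suc 0) (\<alpha> \<circ> param c) (img_of c)" using \<alpha>C cA(1) Ck_on_mono[of r _ _ "Suc 0"] r by (auto simp: Cr_maps_def)
 then have pc: "continuous_on (img_of c) (pdx (\<alpha> \<circ> param c))" "continuous_on (img_of c) (pdy (\<alpha> \<circ> param c))"
  using Ck_on_pdx[of 0] Ck_on_pdy[of 0] by simp_all
 have sL: "continuous_on L (snd c)" "snd c ` L \<subseteq> img_of c"
  by (rule continuous_on_subset[OF homeomorphism_cont1[OF h(1)] cA(3)], rule image_mono[OF cA(3)])
 have "continuous_on L (%q. pdx (\<alpha> \<circ> param c) (snd c q))" "continuous_on L (%q. pdy (\<alpha> \<circ> param c) (snd c q))"
  by (rule continuous_on_compose2[OF pc(1) sL], rule continuous_on_compose2[OF pc(2) sL])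
 then have "compact (?j \<alpha> ` L)" by (intro compact_continuous_image continuous_on_Pair cA(2))
 moreover have "open ?O" by (intro open_Collect_less continuous_intros)
 moreover have "?j \<alpha> ` L \<subseteq> ?O"
 proof (rule image_subsetI)
  fix q assume "q \<in> L"
  then have "snd c q \<in> img_of c" using cA(3) by blast
  from immersion_gram[OF \<alpha> r cA(1) this] show "?j \<alpha> q \<in> ?O" by (rule iffD1[OF jg])
 qed
 \<comment> \<open>A compact subset of an open set has a uniform neighbourhood inside it. This turns
   the open condition on pairs of tangent vectors into one radius for all points of L.\<close>
 ultimately obtain e where e: "e > 0" "(\<Union>x\<in>?j \<alpha> ` L. ball x e) \<subseteq> ?O"
  by (rule compact_subset_open_imp_ball_epsilon_subset)
 show ?thesis
 proof (intro exI[of _ "e / 2"] conjI ballI impI)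
  fix mu q assume mu: "mu \<in> Cr_maps A r" "Cr_norm \<K> r (%q. mu q - \<alpha> q) < e / 2" and q: "q \<in> L"
  have u: "snd c q \<in> img_of c" using q cA(3) by blast
  have d: "(%q. mu q - \<alpha> q) \<in> Cr_maps A r" using Cr_maps_lincomb[OF A mu(1) \<alpha>C, of 1 "-1"] by simp
  have k: "Ck_on (length [axis i 1]) (mu \<circ> param c) (img_of c)" "Ck_on (length [axis i 1]) (\<alpha> \<circ> param c) (img_of c)" for i :: 2
   using mu(1) \<alpha>C cA(1) Ck_on_mono[of r _ _ "Suc 0"] r by (auto simp: Cr_maps_def)
  have di: "norm (fder (mu \<circ> param c) (at (snd c q)) (axis i 1) - fder (\<alpha> \<circ> param c) (at (snd c q)) (axis i 1)) < e / 2" for i :: 2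
  proof -
   have "norm (iter_deriv [axis i 1] ((%q. mu q - \<alpha> q) \<circ> param c) (snd c q)) \<le> Cr_norm \<K> r (%q. mu q - \<alpha> q)"
    by (rule Cr_norm_ge[OF A K d c q]) (use r in \<open>auto simp: axis_in_Basis_iff\<close>)
   moreover have "iter_deriv [axis i 1] ((%q. mu q - \<alpha> q) \<circ> param c) (snd c q) =
     iter_deriv [axis i 1] (mu \<circ> param c) (snd c q) - iter_deriv [axis i 1] (\<alpha> \<circ> param c) (snd c q)"
    using iter_deriv_lincomb[OF h(2) k[of i] u, of 1 "-1"] by (simp add: o_def)
   ultimately show ?thesis using mu(2) by simp
  qed
  have "norm (?j mu q - ?j \<alpha> q) \<le> norm (pdx (mu \<circ> param c) (snd c q) - pdx (\<alpha> \<circ> param c) (snd c q)) + norm (pdy (mu \<circ> param c) (snd c q) - pdy (\<alpha> \<circ> param c) (snd c q))"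
   by (simp add: norm_Pair_le)
  also have "\<dots> < e" using di[of 1] di[of 2] unfolding pdx_def pdy_def by linarith
  finally have "?j mu q \<in> ball (?j \<alpha> q) e" by (simp only: mem_ball dist_norm norm_minus_commute[of "?j mu q"])
  with imageI[OF q, of "?j \<alpha>"] have "?j mu q \<in> (\<Union>x\<in>?j \<alpha> ` L. ball x e)" by (rule UN_I)
  then have "?j mu q \<in> ?O" by (rule subsetD[OF e(2)])
  then show "gram (mu \<circ> param c) (snd c q) > 0" by (rule iffD2[OF jg])
 qed (use e in simp)
qed

lemma immersions_stable:
 assumes A: "compact_oriented_surface A" and K: "norming_cover A \<K>" and r: "r > 0" and \<alpha>: "\<alpha> \<in> immersions A r"
 shows "\<exists>eps>0. \<forall>mu\<in>Cr_maps A r. Cr_norm \<K> r (%q. mu q - \<alpha> q) < eps --> mu \<in> immersions A r"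
proof -
 have "\<forall>i\<in>\<K>. \<exists>eps>0. \<forall>mu\<in>Cr_maps A r. Cr_norm \<K> r (%q. mu q - \<alpha> q) < eps --> (\<forall>q\<in>snd i. gram (mu \<circ> param (fst i)) (snd (fst i) q) > 0)"
  using gram_stable[OF A K r \<alpha>] by simp
 from bchoice[OF this] obtain e where e: "\<forall>i\<in>\<K>. e i > 0 & (\<forall>mu\<in>Cr_maps A r. Cr_norm \<K> r (%q. mu q - \<alpha> q) < e i --> (\<forall>q\<in>snd i. gram (mu \<circ> param (fst i)) (snd (fst i) q) > 0))" ..
 have fK: "finite \<K>" using K by (simp add: norming_cover_def)
 show ?thesis
 proof (intro exI[of _ "Min (insert 1 (e ` \<K>))"] conjI ballI impI)
  show "Min (insert 1 (e ` \<K>)) > 0" using fK e by (auto simp: Min_gr_iff)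
  fix mu assume mu: "mu \<in> Cr_maps A r" "Cr_norm \<K> r (%q. mu q - \<alpha> q) < Min (insert 1 (e ` \<K>))"
  show "mu \<in> immersions A r" unfolding immersions_def
  proof (intro CollectI conjI mu(1) ballI)
   fix c u assume c: "c \<in> A" "u \<in> img_of c"
   note ch = atlas_is_chart[OF A c(1)]
   have "param c u \<in> (\<Union>(c, K)\<in>\<K>. K)" using K by (simp add: norming_cover_def)
   then obtain c' L where cL: "(c', L) \<in> \<K>" "param c u \<in> L" by auto
   then have c': "c' \<in> A" "L \<subseteq> dom_of c'" using K by (auto simp: norming_cover_def)
   have "Min (insert 1 (e ` \<K>)) \<le> e (c', L)" using fK cL by (intro Min_le) auto
   then have lt: "Cr_norm \<K> r (%q. mu q - \<alpha> q) < e (c', L)" using mu(2) by linarith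
   have "param c u \<in> snd (c', L)" using cL(2) by simp
   from conjunct2[OF bspec[OF e cL(1)], rule_format, OF mu(1) lt this]
   have g: "gram (mu \<circ> param c') (snd c' (param c u)) > 0" by simp
   define S where "S = snd c ` (dom_of c \<inter> dom_of c')"
   define psi where "psi = snd c' \<circ> param c"
   note tr = chart_transition[OF A c'(1) positive_chart_atlas[OF A c(1), of r], folded S_def psi_def]
   have q: "param c u \<in> dom_of c \<inter> dom_of c'" using is_chart_param(3)[OF ch c(2)] cL(2) c'(2) by blast
   have uS: "u \<in> S" using imageI[OF q, of "snd c"] unfolding S_def is_chart_param(2)[OF ch c(2)] .
   have k: "Ck_on r (mu \<circ> param c') (img_of c')" using mu(1) c'(1) by (simp add: Cr_maps_def)
   have psiu: "psi u \<in> img_of c'" by (rule subsetD[OF tr(4) imageI[OF uS]])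
   have "gram (mu \<circ> param c') (psi u) > 0" using g by (simp add: psi_def)
   then have inj1: "inj (fder (mu \<circ> param c') (at (psi u)))"
    by (rule iffD1[OF gram_pos_iff_inj[OF Ck_on_imp_differentiable[OF k r psiu]]])
   have lin: "linear (fder psi (at u))"
    by (rule linear_frechet_derivative[OF Ck_on_imp_differentiable[OF tr(5) r uS]])
   have inj2: "inj (fder psi (at u))" using det_nz_iff_inj[OF lin] tr(6)[OF uS] by simp
   have "((%x. (mu \<circ> param c') (psi x)) has_derivative (%v. fder (mu \<circ> param c') (at (psi u)) (fder psi (at u) v))) (at u)"
    by (rule frechet_derivative_compose_Ck(1)[OF tr(5) r k r tr(4) uS])
   then have "((mu \<circ> param c) has_derivative (%v. fder (mu \<circ> param c') (at (psi u)) (fder psi (at u) v))) (at u)"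
    by (rule has_derivative_transform_within_open[OF _ tr(1) uS]) (simp add: tr(7))
   then have "fder (mu \<circ> param c) (at u) = fder (mu \<circ> param c') (at (psi u)) \<circ> fder psi (at u)"
    by (intro ext) (simp add: frechet_derivative_eqI)
   then show "inj (fder (mu \<circ> param c) (at u))" using inj_compose[OF inj1 inj2] by simp
  qed
 qed
qed

section \<open>Functionals of the jet at a moving point\<close>

text \<open>What the calculus below uses of the C^r maps: linear combinations, and a norm that
  bounds all derivatives of order at most r over an open set U of one chart. As the maps form a set
  and not a type, differentiability is expressed by explicit O and o estimates.\<close>

locale jet_space =
 fixes Xs :: "('m => real^4) set" and nrm :: "('m => real^4) => real" and pc :: "real^2 => 'm"
  and U :: "(real^2) set" and r :: nat and C :: real
 assumes open_U: "open U"
  and lincomb: "v \<in> Xs ==> w \<in> Xs ==> (%q. x *\<^sub>R v q + y *\<^sub>R w q) \<in> Xs"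
  and Ck: "v \<in> Xs ==> Ck_on r (v \<circ> pc) U"
  and jet_bound: "v \<in> Xs ==> u \<in> U ==> set s \<subseteq> Basis ==> length s \<le> r ==> norm (iter_deriv s (v \<circ> pc) u) \<le> C * nrm v"
  and nrm_nonneg: "v \<in> Xs ==> nrm v \<ge> 0" and nrm_zero: "nrm (%q. 0) = 0" and C_nonneg: "C \<ge> 0"
begin

abbreviation mdf :: "('m => real^4) => ('m => real^4) => 'm => real^4" where
 "mdf nu mu \<equiv> %q. nu q - mu q"

lemma mdf_in: "nu \<in> Xs ==> mu \<in> Xs ==> mdf nu mu \<in> Xs"
 using lincomb[of nu mu 1 "-1"] by simp

definition jet :: "(real^2) list => real^4 => ('m => real^4) => real^2 => real" where
 "jet s b v u = iter_deriv s (v \<circ> pc) u \<bullet> b"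

lemma jet_lincomb:
 assumes "v \<in> Xs" "w \<in> Xs" "u \<in> U" "length s \<le> r"
 shows "jet s b (%q. x *\<^sub>R v q + y *\<^sub>R w q) u = x * jet s b v u + y * jet s b w u"
proof -
 have "iter_deriv s (%z. x *\<^sub>R (v \<circ> pc) z + y *\<^sub>R (w \<circ> pc) z) u = x *\<^sub>R iter_deriv s (v \<circ> pc) u + y *\<^sub>R iter_deriv s (w \<circ> pc) u"
  using assms by (intro iter_deriv_lincomb[OF open_U] Ck_on_mono[OF Ck]) auto
 then show ?thesis by (simp add: jet_def o_def inner_add_left)
qed

lemma jet_minus:
 "nu \<in> Xs ==> mu \<in> Xs ==> u \<in> U ==> length s \<le> r ==> jet s b (mdf nu mu) u = jet s b nu u - jet s b mu u"
 using jet_lincomb[of nu mu u s b 1 "-1"] by simp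

lemma jet_le:
 assumes "v \<in> Xs" "u \<in> U" "set s \<subseteq> Basis" "length s \<le> r" "b \<in> Basis"
 shows "\<bar>jet s b v u\<bar> \<le> C * nrm v"
 using jet_bound[OF assms(1-4)] Basis_le_norm[OF assms(5), of "iter_deriv s (v \<circ> pc) u"] by (simp add: jet_def)

lemma jet_has_derivative:
 assumes v: "v \<in> Xs" and u: "u \<in> U" and s: "length s < r"
 shows "(jet s b v has_derivative (%h. jet (axis 1 1 # s) b v u * h $ 1 + jet (axis 2 1 # s) b v u * h $ 2)) (at u)"
proof -
 have d: "iter_deriv s (v \<circ> pc) differentiable (at u)"
  by (rule iter_deriv_differentiable[OF Ck[OF v] s u])
 have "((%u. iter_deriv s (v \<circ> pc) u \<bullet> b) has_derivative (%h. fder (iter_deriv s (v \<circ> pc)) (at u) h \<bullet> b)) (at u)"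
  using d unfolding frechet_derivative_works by (rule has_derivative_inner_left)
 then show ?thesis
  unfolding jet_def[abs_def] by (rule has_derivative_eq_rhs)
   (subst has_derivative_plane_expand[OF d, abs_def], simp add: fun_eq_iff inner_add_left mult.commute)
qed

lemma axis_Basis: "axis i 1 \<in> (Basis :: (real^2) set)"
 by (simp add: axis_in_Basis_iff)

lemma ball_in_U: "u \<in> U ==> \<exists>dlt>0. ball u dlt \<subseteq> U"
 using open_U open_contains_ball by blast

text \<open>The estimate is uniform in v at the price of one order: the next derivatives are bounded
  by C \<open>nrm v\<close>, once for each coordinate.\<close>

lemma jet_lipschitz:
 assumes v: "v \<in> Xs" and u: "u \<in> U" and s: "length s < r" "set s \<subseteq> Basis" "b \<in> Basis"
  and B: "ball u dlt \<subseteq> U" "u' \<in> ball u dlt"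
 shows "\<bar>jet s b v u' - jet s b v u\<bar> \<le> 2 * C * nrm v * norm (u' - u)"
proof -
 have "norm (jet s b v u' - jet s b v u) \<le> (2 * C * nrm v) * norm (u' - u)"
 proof (rule differentiable_bound)
  show "convex (ball u dlt)" by simp
  show "u' \<in> ball u dlt" by fact
  show "u \<in> ball u dlt" using B(2) by (metis centre_in_ball ball_empty empty_iff not_le)
  fix y assume y: "y \<in> ball u dlt"
  then have yU: "y \<in> U" using B by auto
  show "(jet s b v has_derivative (%h. jet (axis 1 1 # s) b v y * h $ 1 + jet (axis 2 1 # s) b v y * h $ 2)) (at y within ball u dlt)"
   by (rule has_derivative_at_withinI[OF jet_has_derivative[OF v yU s(1)]])
  have j: "\<bar>jet (axis i 1 # s) b v y\<bar> \<le> C * nrm v" for i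
   using s axis_Basis by (intro jet_le[OF v yU]) auto
  show "onorm (%h::real^2. jet (axis 1 1 # s) b v y * h $ 1 + jet (axis 2 1 # s) b v y * h $ 2) \<le> 2 * C * nrm v"
  proof (rule onorm_le)
   fix h :: "real^2"
   have "norm (jet (axis 1 1 # s) b v y * h $ 1 + jet (axis 2 1 # s) b v y * h $ 2) \<le>
     \<bar>jet (axis 1 1 # s) b v y\<bar> * \<bar>h $ 1\<bar> + \<bar>jet (axis 2 1 # s) b v y\<bar> * \<bar>h $ 2\<bar>"
    unfolding real_norm_def abs_mult[symmetric] by (rule abs_triangle_ineq)
   also have "\<dots> \<le> (C * nrm v) * norm h + (C * nrm v) * norm h"
    by (intro add_mono mult_mono j component_le_norm_cart mult_nonneg_nonneg C_nonneg nrm_nonneg[OF v]) simp_all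
   also have "\<dots> = 2 * C * nrm v * norm h" by simp
   finally show "norm (jet (axis 1 1 # s) b v y * h $ 1 + jet (axis 2 1 # s) b v y * h $ 2) \<le> 2 * C * nrm v * norm h" .
  qed
 qed
 then show ?thesis by simp
qed

text \<open>Two orders are spent here. By \<open>jet_lipschitz\<close> each of the two partial
  derivatives changes by at most 2 C \<open>nrm v\<close> times the distance, and the mean value
  inequality is applied to the jet minus its linear part.\<close>

lemma jet_taylor:
 assumes v: "v \<in> Xs" and u: "u \<in> U" and s: "Suc (length s) < r" "set s \<subseteq> Basis" "b \<in> Basis"
  and B: "ball u dlt \<subseteq> U" "u' \<in> ball u dlt"
 shows "\<bar>jet s b v u' - jet s b v u - (jet (axis 1 1 # s) b v u * (u' - u) $ 1 + jet (axis 2 1 # s) b v u * (u' - u) $ 2)\<bar>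
  \<le> 4 * C * nrm v * norm (u' - u) * norm (u' - u)"
proof -
 let ?R = "norm (u' - u)"
 let ?L = "%h::real^2. jet (axis 1 1 # s) b v u * h $ 1 + jet (axis 2 1 # s) b v u * h $ 2"
 have R: "cball u ?R \<subseteq> ball u dlt" using B(2) by (auto simp: dist_norm norm_minus_commute)
 have blL: "bounded_linear ?L"
  by (intro bounded_linear_add bounded_linear_const_mult bounded_linear_vec_nth)
 have "norm ((jet s b v u' - ?L u') - (jet s b v u - ?L u)) \<le> (4 * C * nrm v * ?R) * norm (u' - u)"
 proof (rule differentiable_bound)
  show "convex (cball u ?R)" by simp
  show "u' \<in> cball u ?R" "u \<in> cball u ?R" by (simp_all add: dist_norm norm_minus_commute)
  fix y assume y: "y \<in> cball u ?R"
  then have yB: "y \<in> ball u dlt" using R by blast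
  then have yU: "y \<in> U" using B by auto
  have "((%u'. jet s b v u' - ?L u') has_derivative
    (%h. (jet (axis 1 1 # s) b v y * h $ 1 + jet (axis 2 1 # s) b v y * h $ 2) - ?L h)) (at y)"
   using s by (intro has_derivative_diff jet_has_derivative[OF v yU] bounded_linear_imp_has_derivative[OF blL]) simp
  then show "((%u'. jet s b v u' - ?L u') has_derivative
    (%h. (jet (axis 1 1 # s) b v y * h $ 1 + jet (axis 2 1 # s) b v y * h $ 2) - ?L h)) (at y within cball u ?R)"
   by (rule has_derivative_at_withinI)
  have yR: "norm (y - u) \<le> ?R" using y by (simp add: dist_norm norm_minus_commute)
  have j: "\<bar>jet (axis i 1 # s) b v y - jet (axis i 1 # s) b v u\<bar> \<le> 2 * C * nrm v * ?R" for i
  proof -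
   have "\<bar>jet (axis i 1 # s) b v y - jet (axis i 1 # s) b v u\<bar> \<le> 2 * C * nrm v * norm (y - u)"
    using s axis_Basis by (intro jet_lipschitz[OF v u _ _ _ B(1) yB]) auto
   also have "\<dots> \<le> 2 * C * nrm v * ?R" using yR C_nonneg nrm_nonneg[OF v] by (intro mult_left_mono) auto
   finally show ?thesis .
  qed
  show "onorm (%h::real^2. (jet (axis 1 1 # s) b v y * h $ 1 + jet (axis 2 1 # s) b v y * h $ 2) - ?L h) \<le> 4 * C * nrm v * ?R"
  proof (rule onorm_le)
   fix h :: "real^2"
   have "(jet (axis 1 1 # s) b v y * h $ 1 + jet (axis 2 1 # s) b v y * h $ 2) - ?L h =
    (jet (axis 1 1 # s) b v y - jet (axis 1 1 # s) b v u) * h $ 1 + (jet (axis 2 1 # s) b v y - jet (axis 2 1 # s) b v u) * h $ 2"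
    by (simp add: algebra_simps)
   also have "norm \<dots> \<le> \<bar>jet (axis 1 1 # s) b v y - jet (axis 1 1 # s) b v u\<bar> * \<bar>h $ 1\<bar> + \<bar>jet (axis 2 1 # s) b v y - jet (axis 2 1 # s) b v u\<bar> * \<bar>h $ 2\<bar>"
    unfolding real_norm_def abs_mult[symmetric] by (rule abs_triangle_ineq)
   also have "\<dots> \<le> (2 * C * nrm v * ?R) * norm h + (2 * C * nrm v * ?R) * norm h"
    by (intro add_mono mult_mono j component_le_norm_cart mult_nonneg_nonneg C_nonneg nrm_nonneg[OF v]) simp_all
   finally show "norm ((jet (axis 1 1 # s) b v y * h $ 1 + jet (axis 2 1 # s) b v y * h $ 2) - ?L h) \<le> 4 * C * nrm v * ?R * norm h"
    by (simp add: algebra_simps)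
  qed
 qed
 moreover have "?L (u' - u) = ?L u' - ?L u" by (simp add: algebra_simps)
 ultimately show ?thesis by (simp add: algebra_simps)
qed

text \<open>\<open>at_big k S\<close> and \<open>at_small k S\<close> are the symbols \<open>O\<close> and \<open>o\<close> of the \<open>k\<close>-th power of the distance to \<open>(mu, u)\<close>,
 uniformly over directions \<open>v\<close>.\<close>

definition dst :: "('m => real^4) => real^2 => ('m => real^4) => real^2 => real" where
 "dst mu u nu u' = nrm (mdf nu mu) + norm (u' - u)"

definition at_le :: "('m => real^4) => real^2 => nat => nat set => (('m => real^4) => real^2 => (nat => 'm => real^4) => real) => real => bool" where
 "at_le mu u k S R B \<longleftrightarrow> (\<exists>dlt>0. \<forall>nu\<in>Xs. \<forall>u'\<in>U. dst mu u nu u' < dlt -->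
  (\<forall>v. (\<forall>n\<in>S. v n \<in> Xs) --> \<bar>R nu u' v\<bar> \<le> B * dst mu u nu u'^k * (\<Prod>n\<in>S. nrm (v n))))"

definition at_big where "at_big mu u k S R \<longleftrightarrow> (\<exists>B\<ge>0. at_le mu u k S R B)"
definition at_small where "at_small mu u k S R \<longleftrightarrow> (\<forall>eps>0. at_le mu u k S R eps)"

lemma at_leD:
 assumes "at_le mu u k S R B"
 obtains dlt where "dlt > 0" "\<And>nu u' v. nu \<in> Xs ==> u' \<in> U ==> dst mu u nu u' < dlt ==> (\<forall>n\<in>S. v n \<in> Xs) ==>
  \<bar>R nu u' v\<bar> \<le> B * dst mu u nu u'^k * (\<Prod>n\<in>S. nrm (v n))"
 using assms unfolding at_le_def by blast

lemma dst_nonneg: "mu \<in> Xs ==> nu \<in> Xs ==> dst mu u nu u' \<ge> 0"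
 using nrm_nonneg[OF mdf_in] by (simp add: dst_def)

lemma prod_nrm_nonneg: "\<forall>n\<in>S. v n \<in> Xs ==> (\<Prod>n\<in>S. nrm (v n)) \<ge> 0"
 by (intro prod_nonneg ballI nrm_nonneg) blast

lemma at_le_add:
 assumes "at_le mu u k S R B" "at_le mu u k S R' B'"
 shows "at_le mu u k S (%nu u' v. R nu u' v + R' nu u' v) (B + B')"
proof -
 obtain dlt where d: "dlt > 0" "\<And>nu u' v. nu \<in> Xs ==> u' \<in> U ==> dst mu u nu u' < dlt ==> (\<forall>n\<in>S. v n \<in> Xs) ==>
  \<bar>R nu u' v\<bar> \<le> B * dst mu u nu u'^k * (\<Prod>n\<in>S. nrm (v n))" by (rule at_leD[OF assms(1)]) blast
 obtain dlt' where d': "dlt' > 0" "\<And>nu u' v. nu \<in> Xs ==> u' \<in> U ==> dst mu u nu u' < dlt' ==> (\<forall>n\<in>S. v n \<in> Xs) ==>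
  \<bar>R' nu u' v\<bar> \<le> B' * dst mu u nu u'^k * (\<Prod>n\<in>S. nrm (v n))" by (rule at_leD[OF assms(2)]) blast
 show ?thesis unfolding at_le_def
 proof (intro exI[of _ "min dlt dlt'"] conjI ballI impI allI)
  fix nu u' v assume a: "nu \<in> Xs" "u' \<in> U" "dst mu u nu u' < min dlt dlt'" "\<forall>n\<in>S. v n \<in> Xs"
  have "\<bar>R nu u' v + R' nu u' v\<bar> \<le> \<bar>R nu u' v\<bar> + \<bar>R' nu u' v\<bar>" by (rule abs_triangle_ineq)
  also have "\<dots> \<le> B * dst mu u nu u'^k * (\<Prod>n\<in>S. nrm (v n)) + B' * dst mu u nu u'^k * (\<Prod>n\<in>S. nrm (v n))"
   using d(2)[of nu u' v] d'(2)[of nu u' v] a by (intro add_mono) auto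
  finally show "\<bar>R nu u' v + R' nu u' v\<bar> \<le> (B + B') * dst mu u nu u'^k * (\<Prod>n\<in>S. nrm (v n))" by (simp add: algebra_simps)
 qed (use d d' in auto)
qed

lemma at_le_mult:
 assumes "at_le mu u k S R B" "at_le mu u k' S' R' B'" "B \<ge> 0" "B' \<ge> 0" "S \<inter> S' = {}" "finite S" "finite S'" "mu \<in> Xs"
 shows "at_le mu u (k + k') (S \<union> S') (%nu u' v. R nu u' v * R' nu u' v) (B * B')"
proof -
 obtain dlt where d: "dlt > 0" "\<And>nu u' v. nu \<in> Xs ==> u' \<in> U ==> dst mu u nu u' < dlt ==> (\<forall>n\<in>S. v n \<in> Xs) ==>
  \<bar>R nu u' v\<bar> \<le> B * dst mu u nu u'^k * (\<Prod>n\<in>S. nrm (v n))" by (rule at_leD[OF assms(1)]) blast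
 obtain dlt' where d': "dlt' > 0" "\<And>nu u' v. nu \<in> Xs ==> u' \<in> U ==> dst mu u nu u' < dlt' ==> (\<forall>n\<in>S'. v n \<in> Xs) ==>
  \<bar>R' nu u' v\<bar> \<le> B' * dst mu u nu u'^k' * (\<Prod>n\<in>S'. nrm (v n))" by (rule at_leD[OF assms(2)]) blast
 show ?thesis unfolding at_le_def
 proof (intro exI[of _ "min dlt dlt'"] conjI ballI impI allI)
  fix nu u' v assume a: "nu \<in> Xs" "u' \<in> U" "dst mu u nu u' < min dlt dlt'" "\<forall>n\<in>S \<union> S'. v n \<in> Xs"
  have "\<bar>R nu u' v * R' nu u' v\<bar> = \<bar>R nu u' v\<bar> * \<bar>R' nu u' v\<bar>" by (rule abs_mult)
  also have "\<dots> \<le> (B * dst mu u nu u'^k * (\<Prod>n\<in>S. nrm (v n))) * (B' * dst mu u nu u'^k' * (\<Prod>n\<in>S'. nrm (v n)))"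
   using d(2)[of nu u' v] d'(2)[of nu u' v] a assms(3) dst_nonneg[OF assms(8) a(1)]
   by (intro mult_mono mult_nonneg_nonneg zero_le_power prod_nrm_nonneg) auto
  also have "\<dots> = B * B' * dst mu u nu u'^(k + k') * (\<Prod>n\<in>S \<union> S'. nrm (v n))"
   using assms by (simp add: prod.union_disjoint power_add mult_ac)
  finally show "\<bar>R nu u' v * R' nu u' v\<bar> \<le> B * B' * dst mu u nu u'^(k + k') * (\<Prod>n\<in>S \<union> S'. nrm (v n))" .
 qed (use d d' in auto)
qed

lemma at_le_mono:
 assumes "at_le mu u k S R B" "B \<le> B'" "mu \<in> Xs"
 shows "at_le mu u k S R B'"
proof -
 obtain dlt where d: "dlt > 0" "\<And>nu u' v. nu \<in> Xs ==> u' \<in> U ==> dst mu u nu u' < dlt ==> (\<forall>n\<in>S. v n \<in> Xs) ==>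
  \<bar>R nu u' v\<bar> \<le> B * dst mu u nu u'^k * (\<Prod>n\<in>S. nrm (v n))" by (rule at_leD[OF assms(1)]) blast
 show ?thesis unfolding at_le_def
 proof (intro exI[of _ dlt] conjI ballI impI allI)
  fix nu u' v assume a: "nu \<in> Xs" "u' \<in> U" "dst mu u nu u' < dlt" "\<forall>n\<in>S. v n \<in> Xs"
  have "\<bar>R nu u' v\<bar> \<le> B * (dst mu u nu u'^k * (\<Prod>n\<in>S. nrm (v n)))" using d(2)[OF a] by (simp add: mult.assoc)
  also have "\<dots> \<le> B' * (dst mu u nu u'^k * (\<Prod>n\<in>S. nrm (v n)))"
   by (rule mult_right_mono[OF assms(2) mult_nonneg_nonneg[OF zero_le_power[OF dst_nonneg[OF assms(3) a(1)]] prod_nrm_nonneg[OF a(4)]]])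
  finally show "\<bar>R nu u' v\<bar> \<le> B' * dst mu u nu u'^k * (\<Prod>n\<in>S. nrm (v n))" by (simp add: mult.assoc)
 qed (rule d(1))
qed

lemma at_small_imp_big: "at_small mu u k S R ==> at_big mu u k S R"
 unfolding at_small_def at_big_def by (intro exI[of _ 1]) auto

lemma at_small_add: "at_small mu u k S R ==> at_small mu u k S R' ==> at_small mu u k S (%nu u' v. R nu u' v + R' nu u' v)"
 unfolding at_small_def
proof (intro allI impI)
 fix eps :: real assume "\<forall>eps>0. at_le mu u k S R eps" "\<forall>eps>0. at_le mu u k S R' eps" "eps > 0"
 then show "at_le mu u k S (%nu u' v. R nu u' v + R' nu u' v) eps"
  using at_le_add[of mu u k S R "eps / 2" R' "eps / 2"] by simp
qed

lemma at_big_add: "at_big mu u k S R ==> at_big mu u k S R' ==> at_big mu u k S (%nu u' v. R nu u' v + R' nu u' v)"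
 unfolding at_big_def
proof (elim exE conjE)
 fix B B' :: real assume "B \<ge> 0" "B' \<ge> 0" "at_le mu u k S R B" "at_le mu u k S R' B'"
 then show "\<exists>B\<ge>0. at_le mu u k S (%nu u' v. R nu u' v + R' nu u' v) B"
  using at_le_add[of mu u k S R B R' B'] by (intro exI[of _ "B + B'"]) simp
qed

lemma at_big_mult:
 assumes "at_big mu u k S R" "at_big mu u k' S' R'" "S \<inter> S' = {}" "finite S" "finite S'" "mu \<in> Xs"
 shows "at_big mu u (k + k') (S \<union> S') (%nu u' v. R nu u' v * R' nu u' v)"
proof -
 obtain B B' where "B \<ge> 0" "at_le mu u k S R B" "B' \<ge> 0" "at_le mu u k' S' R' B'" using assms(1,2) unfolding at_big_def by blast
 then show ?thesis unfolding at_big_def using at_le_mult[OF _ _ _ _ assms(3-6)]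
  by (intro exI[of _ "B * B'"]) simp
qed

lemma at_small_mult:
 assumes "at_small mu u k S R" "at_big mu u k' S' R'" "S \<inter> S' = {}" "finite S" "finite S'" "mu \<in> Xs"
 shows "at_small mu u (k + k') (S \<union> S') (%nu u' v. R nu u' v * R' nu u' v)"
 unfolding at_small_def
proof (intro allI impI)
 fix eps :: real assume e: "eps > 0"
 obtain B where B: "B \<ge> 0" "at_le mu u k' S' R' B" using assms(2) unfolding at_big_def by blast
 have "at_le mu u k S R (eps / (B + 1))" using assms(1) e B unfolding at_small_def by simp
 then have "at_le mu u (k + k') (S \<union> S') (%nu u' v. R nu u' v * R' nu u' v) (eps / (B + 1) * B)"
  using e B by (intro at_le_mult assms) auto
 then show "at_le mu u (k + k') (S \<union> S') (%nu u' v. R nu u' v * R' nu u' v) eps"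
  by (rule at_le_mono) (use e B assms(6) in \<open>auto simp: field_simps\<close>)
qed

lemma at_big_Suc_imp_small:
 assumes "at_big mu u (Suc k) S R" "mu \<in> Xs"
 shows "at_small mu u k S R"
 unfolding at_small_def
proof (intro allI impI)
 fix eps :: real assume e: "eps > 0"
 obtain B where B: "B \<ge> 0" "at_le mu u (Suc k) S R B" using assms(1) unfolding at_big_def by blast
 obtain dlt where d: "dlt > 0" "\<And>nu u' v. nu \<in> Xs ==> u' \<in> U ==> dst mu u nu u' < dlt ==> (\<forall>n\<in>S. v n \<in> Xs) ==>
  \<bar>R nu u' v\<bar> \<le> B * dst mu u nu u'^Suc k * (\<Prod>n\<in>S. nrm (v n))" by (rule at_leD[OF B(2)]) blast
 show "at_le mu u k S R eps" unfolding at_le_def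
 proof (intro exI[of _ "min dlt (eps / (B + 1))"] conjI ballI impI allI)
  fix nu u' v assume a: "nu \<in> Xs" "u' \<in> U" "dst mu u nu u' < min dlt (eps / (B + 1))" "\<forall>n\<in>S. v n \<in> Xs"
  have D: "dst mu u nu u' \<ge> 0" by (rule dst_nonneg[OF assms(2) a(1)])
  have "B * dst mu u nu u' \<le> (B + 1) * (eps / (B + 1))" using a(3) B(1) D by (intro mult_mono) auto
  then have "B * dst mu u nu u' \<le> eps" using B(1) by simp
  then have "B * dst mu u nu u' * (dst mu u nu u'^k * (\<Prod>n\<in>S. nrm (v n))) \<le> eps * (dst mu u nu u'^k * (\<Prod>n\<in>S. nrm (v n)))"
   using D a(4) by (intro mult_right_mono mult_nonneg_nonneg zero_le_power prod_nrm_nonneg)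
  moreover have "\<bar>R nu u' v\<bar> \<le> B * dst mu u nu u'^Suc k * (\<Prod>n\<in>S. nrm (v n))" using a by (intro d(2)) auto
  ultimately show "\<bar>R nu u' v\<bar> \<le> eps * dst mu u nu u'^k * (\<Prod>n\<in>S. nrm (v n))" by (simp add: mult_ac)
 qed (use d e B in auto)
qed

lemma at_small_zero: "mu \<in> Xs ==> at_small mu u k S (%nu u' v. 0)"
 unfolding at_small_def at_le_def
 by (intro allI impI exI[of _ 1] conjI ballI)
  (auto intro!: mult_nonneg_nonneg zero_le_power dst_nonneg prod_nrm_nonneg)

lemma at_small_cong:
 "at_small mu u k S R ==> (\<And>nu u' v. nu \<in> Xs ==> u' \<in> U ==> (\<forall>n\<in>S. v n \<in> Xs) ==> R' nu u' v = R nu u' v) ==> at_small mu u k S R'"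
proof -
 assume s: "at_small mu u k S R" and e: "\<And>nu u' v. nu \<in> Xs ==> u' \<in> U ==> (\<forall>n\<in>S. v n \<in> Xs) ==> R' nu u' v = R nu u' v"
 have "at_le mu u k S R' eps" if "at_le mu u k S R eps" for eps using that e unfolding at_le_def by simp
 then show "at_small mu u k S R'" using s unfolding at_small_def by simp
qed

text \<open>Expressions in the jet of \<open>mu\<close> at \<open>u\<close>, of order at most \<open>L\<close>, that are linear in the jets, of order
 less than \<open>L\<close>, of direction maps \<open>v n\<close> for \<open>n \<in> S\<close>. The two bounds reflect that a derivative in \<open>u\<close>
 raises the order of all jets, while a derivative in \<open>mu\<close> only replaces \<open>mu\<close> by a new direction. The base of
 a real power has to be positive on \<open>G\<close>.\<close>

inductive jp :: "(('m => real^4) \<times> (real^2)) set => nat => nat set => (('m => real^4) => real^2 => (nat => 'm => real^4) => real) => bool"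
 for G :: "(('m => real^4) \<times> (real^2)) set" and L :: nat where
 jp_zero: "finite S ==> jp G L S (%mu u v. 0)"
| jp_const: "jp G L {} (%mu u v. c)"
| jp_jet: "set s \<subseteq> Basis ==> length s \<le> L ==> b \<in> Basis ==> jp G L {} (%mu u v. jet s b mu u)"
| jp_dir: "set s \<subseteq> Basis ==> length s < L ==> b \<in> Basis ==> jp G L {n} (%mu u v. jet s b (v n) u)"
| jp_add: "jp G L S T ==> jp G L S T' ==> jp G L S (%mu u v. T mu u v + T' mu u v)"
| jp_mult: "jp G L S T ==> jp G L S' T' ==> S \<inter> S' = {} ==> jp G L (S \<union> S') (%mu u v. T mu u v * T' mu u v)"
| jp_powr: "jp G L {} T ==> (\<forall>(mu, u)\<in>G. \<forall>v. T mu u v > 0) ==> jp G L {} (%mu u v. T mu u v powr c)"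

lemma jp_finite: "jp G L S T ==> finite S"
 by (induction rule: jp.induct) auto

lemma jp_mono:
 assumes "jp G L S T" "L \<le> L'" "H \<subseteq> G"
 shows "jp H L' S T"
 using assms(1)
proof (induction rule: jp.induct)
 case (jp_powr T c)
 then show ?case using assms(3) by (intro jp.jp_powr) auto
qed (use assms(2) in \<open>auto intro: jp.intros\<close>)

text \<open>Index 0 becomes free for the direction that the next derivative introduces.\<close>

lemma jp_shift: "jp G L S T ==> jp G L (Suc ` S) (%mu u v. T mu u (%n. v (Suc n)))"
proof (induction rule: jp.induct)
 case (jp_zero S)
 then show ?case by (intro jp.jp_zero) simp
next
 case (jp_dir s b n)
 then show ?case using jp.jp_dir[of s L b G "Suc n"] by simp
next
 case (jp_mult S T S' T')
 then have "Suc ` S \<inter> Suc ` S' = {}" by auto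
 from jp.jp_mult[OF jp_mult.IH this] show ?case by (simp add: image_Un)
next
 case (jp_powr T c)
 then have "jp G L {} (%mu u v. T mu u (%n. v (Suc n)))" by simp
 moreover have "\<forall>(mu, u)\<in>G. \<forall>v. T mu u (%n. v (Suc n)) > 0" using jp_powr.hyps(2) by blast
 ultimately show ?case unfolding image_empty by (rule jp.jp_powr)
qed (auto intro: jp.intros)

lemma jp_cong:
 "jp G L S T ==> \<forall>n\<in>S. v n = w n ==> T mu u v = T mu u w"
 by (induction rule: jp.induct) auto

text \<open>Jets of directions have order less than L, so the bound L <= Suc r keeps them at order
  at most r, where linearity of the derivatives is available.\<close>

lemma jp_linear:
 assumes "jp G L S T" "L \<le> Suc r" "u \<in> U" "n \<in> S" "x \<in> Xs" "y \<in> Xs"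
 shows "T mu u (v(n := %q. a *\<^sub>R x q + b *\<^sub>R y q)) = a * T mu u (v(n := x)) + b * T mu u (v(n := y))"
 using assms(1,4)
proof (induction rule: jp.induct)
 case (jp_dir s b' m)
 then show ?case using assms by (simp add: jet_lincomb)
next
 case (jp_mult S T S' T')
 have "n \<in> S & n \<notin> S' \<or> n \<notin> S & n \<in> S'" using jp_mult.prems jp_mult.hyps(3) by blast
 then show ?case
 proof (elim disjE conjE)
  assume n: "n \<in> S" "n \<notin> S'"
  have "T' mu u (v(n := z)) = T' mu u v" for z by (rule jp_cong[OF jp_mult.hyps(2)]) (use n in auto)
  then show ?thesis unfolding jp_mult.IH(1)[OF n(1)] by (simp only: distrib_right mult.assoc)
 next
  assume n: "n \<notin> S" "n \<in> S'"
  have "T mu u (v(n := z)) = T mu u v" for z by (rule jp_cong[OF jp_mult.hyps(1)]) (use n in auto)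
  then show ?thesis unfolding jp_mult.IH(2)[OF n(2)] by (simp only: distrib_left mult.left_commute)
 qed
qed (auto simp: algebra_simps)

lemma jp_bounded:
 assumes "jp G L S T" "L \<le> r" "mu \<in> Xs" "u \<in> U"
 shows "\<exists>B\<ge>0. \<forall>v. (\<forall>n\<in>S. v n \<in> Xs) --> \<bar>T mu u v\<bar> \<le> B * (\<Prod>n\<in>S. nrm (v n))"
 using assms(1)
proof (induction rule: jp.induct)
 case (jp_zero S)
 then show ?case by (intro exI[of _ 0]) auto
next
 case (jp_const c)
 then show ?case by (intro exI[of _ "\<bar>c\<bar>"]) auto
next
 case (jp_jet s b)
 then show ?case by (intro exI[of _ "\<bar>jet s b mu u\<bar>"]) auto
next
 case (jp_dir s b n)
 then show ?case using assms jet_le[OF _ assms(4), of _ s b] C_nonneg by (intro exI[of _ C]) auto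
next
 case (jp_add S T T')
 from jp_add.IH obtain B B' where B: "B \<ge> 0" "B' \<ge> 0" "\<And>v. (\<forall>n\<in>S. v n \<in> Xs) ==> \<bar>T mu u v\<bar> \<le> B * (\<Prod>n\<in>S. nrm (v n))"
  "\<And>v. (\<forall>n\<in>S. v n \<in> Xs) ==> \<bar>T' mu u v\<bar> \<le> B' * (\<Prod>n\<in>S. nrm (v n))" by blast
 have "\<bar>T mu u v + T' mu u v\<bar> \<le> (B + B') * (\<Prod>n\<in>S. nrm (v n))" if "\<forall>n\<in>S. v n \<in> Xs" for v
  using B(3,4)[OF that] abs_triangle_ineq[of "T mu u v" "T' mu u v"] unfolding distrib_right by linarith
 then show ?case using B(1,2) by (intro exI[of _ "B + B'"]) auto
next
 case (jp_mult S T S' T')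
 from jp_mult.IH obtain B B' where B: "B \<ge> 0" "B' \<ge> 0" "\<And>v. (\<forall>n\<in>S. v n \<in> Xs) ==> \<bar>T mu u v\<bar> \<le> B * (\<Prod>n\<in>S. nrm (v n))"
  "\<And>v. (\<forall>n\<in>S'. v n \<in> Xs) ==> \<bar>T' mu u v\<bar> \<le> B' * (\<Prod>n\<in>S'. nrm (v n))" by blast
 have "\<bar>T mu u v * T' mu u v\<bar> \<le> (B * B') * (\<Prod>n\<in>S \<union> S'. nrm (v n))" if v: "\<forall>n\<in>S \<union> S'. v n \<in> Xs" for v
 proof -
  have v': "\<forall>n\<in>S. v n \<in> Xs" "\<forall>n\<in>S'. v n \<in> Xs" using v by auto
  have "\<bar>T mu u v\<bar> * \<bar>T' mu u v\<bar> \<le> (B * (\<Prod>n\<in>S. nrm (v n))) * (B' * (\<Prod>n\<in>S'. nrm (v n)))"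
   by (rule mult_mono[OF B(3)[OF v'(1)] B(4)[OF v'(2)] mult_nonneg_nonneg[OF B(1) prod_nrm_nonneg[OF v'(1)]]]) simp
  then show ?thesis
   unfolding prod.union_disjoint[OF jp_finite[OF jp_mult.hyps(1)] jp_finite[OF jp_mult.hyps(2)] jp_mult.hyps(3)]
   by (simp add: abs_mult mult_ac)
 qed
 then show ?case using B(1,2) by (intro exI[of _ "B * B'"]) auto
next
 case (jp_powr T c)
 have "T mu u v = T mu u (%_. undefined)" for v by (rule jp_cong[OF jp_powr.hyps(1)]) simp
 then have "\<bar>T mu u v powr c\<bar> \<le> \<bar>T mu u (%_. undefined) powr c\<bar> * (\<Prod>n\<in>{}. nrm (v n))" for v by (metis abs_ge_zero mult.right_neutral order_refl prod.empty)
 then show ?case by (intro exI[of _ "\<bar>T mu u (%_. undefined) powr c\<bar>"]) simp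
qed

lemma at_big_0I:
 assumes "B \<ge> 0" "\<And>v. (\<forall>n\<in>S. v n \<in> Xs) ==> \<bar>T v\<bar> \<le> B * (\<Prod>n\<in>S. nrm (v n))"
 shows "at_big mu u 0 S (%nu u' v. T v)"
 unfolding at_big_def at_le_def using assms by (intro exI[of _ B] conjI exI[of _ 1]) auto

lemma jp_at_big_0:
 assumes "jp G L S T" "L \<le> r" "mu \<in> Xs" "u \<in> U"
 shows "at_big mu u 0 S (%nu u' v. T mu u v)"
 using jp_bounded[OF assms] by (elim exE conjE) (rule at_big_0I, auto)

lemma at_small_0I:
 assumes "mu \<in> Xs" "\<And>eps. eps > 0 ==> \<exists>dlt>0. \<forall>nu\<in>Xs. \<forall>u'\<in>U. dst mu u nu u' < dlt --> (\<forall>v. \<bar>R nu u' v\<bar> \<le> eps)"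
 shows "at_small mu u 0 {} R"
 unfolding at_small_def at_le_def using assms(2) by simp

lemma at_small_cont:
 assumes "mu \<in> Xs" "at_small mu u 0 {} (%nu u' v. R nu u' v - x)" "isCont \<phi> x"
 shows "at_small mu u 0 {} (%nu u' v. \<phi> (R nu u' v) - \<phi> x :: real)"
proof (rule at_small_0I[OF assms(1)])
 fix eps :: real assume e: "eps > 0"
 from assms(3) e obtain d where d: "d > 0" "\<And>y. dist y x < d ==> dist (\<phi> y) (\<phi> x) < eps"
  unfolding continuous_at_eps_delta by blast
 have "at_le mu u 0 {} (%nu u' v. R nu u' v - x) (d / 2)" using assms(2) d unfolding at_small_def by simp
 then obtain dlt where "dlt > 0" and l: "\<And>nu u' v. nu \<in> Xs ==> u' \<in> U ==> dst mu u nu u' < dlt ==> \<bar>R nu u' v - x\<bar> \<le> d / 2"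
  unfolding at_le_def by auto
 moreover have "\<bar>\<phi> (R nu u' v) - \<phi> x\<bar> \<le> eps" if "nu \<in> Xs" "u' \<in> U" "dst mu u nu u' < dlt" for nu u' v
  using l[OF that, of v] d(1) d(2)[of "R nu u' v"] by (simp add: dist_real_def)
 ultimately show "\<exists>dlt>0. \<forall>nu\<in>Xs. \<forall>u'\<in>U. dst mu u nu u' < dlt --> (\<forall>v. \<bar>\<phi> (R nu u' v) - \<phi> x\<bar> \<le> eps)" by blast
qed

text \<open>The difference quotient of phi minus D, set to 0 at x, is continuous at x. The remainder
  is its value at R times R - x, an o(1) times a first-order quantity.\<close>

lemma at_small_diff:
 assumes "mu \<in> Xs" "at_small mu u 0 {} (%nu u' v. R nu u' v - x)" "at_big mu u 1 {} (%nu u' v. R nu u' v - x)"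
  and D: "(\<phi> has_real_derivative D) (at x)"
 shows "at_small mu u 1 {} (%nu u' v. \<phi> (R nu u' v) - \<phi> x - D * (R nu u' v - x))"
proof -
 define psi where "psi y = (if y = x then 0 else (\<phi> y - \<phi> x) / (y - x) - D)" for y
 have "(psi \<longlongrightarrow> 0) (at x)"
 proof -
  have "((%y. (\<phi> y - \<phi> x) / (y - x) - D) \<longlongrightarrow> D - D) (at x)"
   using D by (intro tendsto_diff tendsto_const) (simp add: has_field_derivative_iff)
  moreover have "\<forall>\<^sub>F y in at x. (\<phi> y - \<phi> x) / (y - x) - D = psi y"
   unfolding eventually_at by (intro exI[of _ 1]) (simp add: psi_def)
  ultimately show ?thesis using Lim_transform_eventually by fastforce
 qed
 then have "isCont psi x" by (simp add: isCont_def psi_def)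
 from at_small_cont[OF assms(1,2) this] have "at_small mu u 0 {} (%nu u' v. psi (R nu u' v))" by (simp add: psi_def)
 from at_small_mult[OF this assms(3) _ _ _ assms(1)]
 have "at_small mu u 1 {} (%nu u' v. psi (R nu u' v) * (R nu u' v - x))" by simp
 then show ?thesis by (rule at_small_cong) (simp add: psi_def field_simps)
qed

lemma at_small_u:
 assumes "mu \<in> Xs" "(\<phi> \<longlongrightarrow> 0) (at u)"
 shows "at_small mu u 1 {} (%nu u' v. \<phi> u' * norm (u' - u))"
 unfolding at_small_def at_le_def
proof (intro allI impI)
 fix eps :: real assume "eps > 0"
 then obtain d where d: "d > 0" "\<And>y. y \<noteq> u ==> dist y u < d ==> \<bar>\<phi> y\<bar> < eps"
  using assms(2) unfolding tendsto_iff eventually_at by (auto simp: dist_real_def)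
 have "\<bar>\<phi> u' * norm (u' - u)\<bar> \<le> eps * dst mu u nu u'" if "nu \<in> Xs" "dst mu u nu u' < d" for nu u'
 proof (cases "u' = u")
  case True
  then show ?thesis using \<open>eps > 0\<close> dst_nonneg[OF assms(1) that(1)] by simp
 next
  case False
  have n: "nrm (mdf nu mu) \<ge> 0" by (intro nrm_nonneg mdf_in assms that)
  then have "\<bar>\<phi> u'\<bar> < eps" "norm (u' - u) \<le> dst mu u nu u'" using d(2)[OF False] that(2) by (auto simp: dst_def dist_norm)
  then show ?thesis unfolding abs_mult by (intro mult_mono) (use \<open>eps > 0\<close> in auto)
 qed
 then show "\<exists>dlt>0. \<forall>nu\<in>Xs. \<forall>u'\<in>U. dst mu u nu u' < dlt -->
  (\<forall>v. (\<forall>n\<in>{}. v n \<in> Xs) --> \<bar>\<phi> u' * norm (u' - u)\<bar> \<le> eps * dst mu u nu u'^1 * (\<Prod>n\<in>{}. nrm (v n)))"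
  using d(1) by (intro exI[of _ d]) auto
qed

lemma at_big_local:
 assumes mu: "mu \<in> Xs" "u \<in> U" and B: "B \<ge> 0"
  and R: "\<And>dlt nu u' v. ball u dlt \<subseteq> U ==> u' \<in> ball u dlt ==> nu \<in> Xs ==> u' \<in> U ==> (\<forall>n\<in>S. v n \<in> Xs) ==>
   nrm (mdf nu mu) \<ge> 0 ==> nrm (mdf nu mu) \<le> dst mu u nu u' ==> norm (u' - u) \<le> dst mu u nu u' ==> \<bar>R nu u' v\<bar> \<le> B * dst mu u nu u'^k * (\<Prod>n\<in>S. nrm (v n))"
 shows "at_big mu u k S R"
proof -
 obtain dlt where d: "dlt > 0" "ball u dlt \<subseteq> U" using ball_in_U[OF mu(2)] by blast
 have "at_le mu u k S R B" unfolding at_le_def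
 proof (intro exI[of _ dlt] conjI ballI allI impI)
  fix nu u' v assume a: "nu \<in> Xs" "u' \<in> U" "dst mu u nu u' < dlt" "\<forall>n\<in>S. v n \<in> Xs"
  have n: "nrm (mdf nu mu) \<ge> 0" by (intro nrm_nonneg mdf_in mu a)
  then have "nrm (mdf nu mu) \<le> dst mu u nu u'" "norm (u' - u) \<le> dst mu u nu u'" by (simp_all add: dst_def)
  moreover from this a(3) have "u' \<in> ball u dlt" by (simp add: dist_norm norm_minus_commute)
  ultimately show "\<bar>R nu u' v\<bar> \<le> B * dst mu u nu u'^k * (\<Prod>n\<in>S. nrm (v n))" using R d a n by blast
 qed (rule d(1))
 then show ?thesis using B unfolding at_big_def by blast
qed

lemma at_big_jet_lipschitz:
 assumes "mu \<in> Xs" "u \<in> U" "set s \<subseteq> Basis" "length s < r" "b \<in> Basis"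
 shows "at_big mu u 1 {n} (%nu u' v. jet s b (v n) u' - jet s b (v n) u)"
proof (rule at_big_local[OF assms(1,2), of "2 * C"])
 fix dlt nu u' and v :: "nat => 'm => real^4" assume a: "ball u dlt \<subseteq> U" "u' \<in> ball u dlt" "\<forall>n\<in>{n}. v n \<in> Xs" "norm (u' - u) \<le> dst mu u nu u'"
 have v: "v n \<in> Xs" using a(3) by simp
 have "\<bar>jet s b (v n) u' - jet s b (v n) u\<bar> \<le> 2 * C * nrm (v n) * norm (u' - u)"
  by (rule jet_lipschitz[OF v assms(2,4,3,5) a(1,2)])
 also have "\<dots> \<le> 2 * C * nrm (v n) * dst mu u nu u'"
  using a(4) C_nonneg nrm_nonneg[OF v] by (intro mult_left_mono) auto
 finally show "\<bar>jet s b (v n) u' - jet s b (v n) u\<bar> \<le> 2 * C * dst mu u nu u'^1 * (\<Prod>n\<in>{n}. nrm (v n))" by (simp add: mult_ac)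
qed (use C_nonneg in simp)

text \<open>For the jets of mu itself continuity suffices, even at order r, as mu is fixed. For a
  direction the estimate has to be uniform in v, and at order r bounded sets are not equicontinuous;
  direction jets of order below L are controlled by \<open>jet_lipschitz\<close>.\<close>

lemma jp_continuous:
 assumes "jp G L S T" "L \<le> r" "(mu, u) \<in> G" "mu \<in> Xs" "u \<in> U"
 shows "at_small mu u 0 S (%nu u' v. T nu u' v - T mu u v)"
 using assms(1)
proof (induction rule: jp.induct)
 case (jp_zero S)
 then show ?case using at_small_zero[OF assms(4)] by simp
next
 case (jp_const c)
 then show ?case using at_small_zero[OF assms(4)] by simp
next
 case (jp_jet s b)
 show ?case
 proof (rule at_small_0I[OF assms(4)])
  fix eps :: real assume e: "eps > 0"
  have "continuous_on U (iter_deriv s (mu \<circ> pc))"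
   using Ck_on_iter_deriv'[OF Ck[OF assms(4)], of 0 s] jp_jet assms(2) by simp
  then have "continuous_on U (jet s b mu)" unfolding jet_def[abs_def] by (intro continuous_intros)
  then obtain d where d: "d > 0" "\<And>y. y \<in> U ==> dist y u < d ==> dist (jet s b mu y) (jet s b mu u) < eps / 2"
   using e assms(5) unfolding continuous_on_iff by (metis half_gt_zero)
  have "\<bar>jet s b nu u' - jet s b mu u\<bar> \<le> eps" if a: "nu \<in> Xs" "u' \<in> U" "dst mu u nu u' < min d (eps / (2 * (C + 1)))" for nu u'
  proof -
   have n: "nrm (mdf nu mu) \<ge> 0" by (intro nrm_nonneg mdf_in assms a)
   have "dst mu u nu u' < d" "dst mu u nu u' < eps / (2 * (C + 1))" using a(3) by linarith+
   then have n2: "nrm (mdf nu mu) \<le> eps / (2 * (C + 1))" "dist u' u < d"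
    using n norm_ge_zero[of "u' - u"] unfolding dst_def dist_norm by linarith+
   have "\<bar>jet s b (mdf nu mu) u'\<bar> \<le> C * nrm (mdf nu mu)"
    using jp_jet assms a by (intro jet_le mdf_in) auto
   also have "\<dots> \<le> (C + 1) * (eps / (2 * (C + 1)))" using n n2 C_nonneg by (intro mult_mono) auto
   also have "\<dots> = eps / 2" using C_nonneg by (simp add: field_simps)
   finally have "\<bar>jet s b nu u' - jet s b mu u'\<bar> \<le> eps / 2"
    using jet_minus[OF a(1) assms(4) a(2), of s b] jp_jet assms(2) by simp
   moreover have "\<bar>jet s b mu u' - jet s b mu u\<bar> < eps / 2" using d(2)[OF a(2) n2(2)] by (simp add: dist_real_def)
   ultimately show ?thesis by linarith
  qed
  moreover have "min d (eps / (2 * (C + 1))) > 0" using d(1) e C_nonneg by simp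
  ultimately show "\<exists>dlt>0. \<forall>nu\<in>Xs. \<forall>u'\<in>U. dst mu u nu u' < dlt --> (\<forall>v::nat => 'm => real^4. \<bar>jet s b nu u' - jet s b mu u\<bar> \<le> eps)" by blast
 qed
next
 case (jp_dir s b n)
 then show ?case using assms(2) at_big_jet_lipschitz[OF assms(4,5), of s b n] at_big_Suc_imp_small[of mu u 0] assms(4) by simp
next
 case (jp_add S T T')
 from at_small_add[OF jp_add.IH] show ?case by (simp add: algebra_simps)
next
 case (jp_mult S T S' T')
 note f = jp_finite[OF jp_mult.hyps(1)] jp_finite[OF jp_mult.hyps(2)]
 note big = jp_at_big_0[OF jp_mult.hyps(1) assms(2,4,5)] jp_at_big_0[OF jp_mult.hyps(2) assms(2,4,5)]
 have d': "S' \<inter> S = {}" using jp_mult.hyps(3) by blast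
 \<comment> \<open>The increment of a product is the sum of the two mixed terms and the product of
   both increments.\<close>
 note s1 = at_small_mult[OF jp_mult.IH(1) big(2) jp_mult.hyps(3) f assms(4)]
 note s2 = at_small_mult[OF jp_mult.IH(2) big(1) d' f(2,1) assms(4), unfolded Un_commute[of S' S]]
 note s3 = at_small_mult[OF jp_mult.IH(1) at_small_imp_big[OF jp_mult.IH(2)] jp_mult.hyps(3) f assms(4)]
 from at_small_add[OF at_small_add[OF s1 s2] s3] show ?case by (simp add: algebra_simps)
next
 case (jp_powr T c)
 let ?x = "T mu u (%_. undefined)"
 have x: "T mu u v = ?x" for v by (rule jp_cong[OF jp_powr.hyps(1)]) simp
 have p: "?x > 0" using jp_powr.hyps(2) assms(3) by blast
 have "isCont (%y. y powr c) ?x" using p by (intro continuous_intros) auto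
 have "at_small mu u 0 {} (%nu u' v. T nu u' v - ?x)" by (rule at_small_cong[OF jp_powr.IH]) (rule arg_cong[OF x[symmetric]])
 from at_small_cont[OF assms(4) this \<open>isCont (%y. y powr c) ?x\<close>] show ?case by (rule at_small_cong) (rule arg_cong[OF x])
qed

text \<open>\<open>Tv\<close> is the derivative in mu: the increment enters as direction 0 and
  \<open>case_nat\<close> moves the older directions up by one. \<open>T1\<close> and
  \<open>T2\<close> are the partial derivatives in u. The remainder is o of the distance, uniformly
  in the older directions.\<close>

definition jp_deriv where
 "jp_deriv G L S T Tv T1 T2 \<longleftrightarrow> jp G (Suc L) (insert 0 (Suc ` S)) Tv & jp G (Suc L) S T1 & jp G (Suc L) S T2 &
  (\<forall>(mu, u)\<in>G. at_small mu u 1 S (%nu u' v. T nu u' v - T mu u v -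
   (Tv mu u (case_nat (mdf nu mu) v) + T1 mu u v * (u' - u) $ 1 + T2 mu u v * (u' - u) $ 2)))"

lemma at_big_dir:
 assumes "jp G L (insert 0 (Suc ` S)) Tv" "L \<le> r" "mu \<in> Xs" "u \<in> U" "finite S"
 shows "at_big mu u 1 S (%nu u' v. Tv mu u (case_nat (mdf nu mu) v))"
proof -
 obtain B where B: "B \<ge> 0" "\<And>v. (\<forall>n\<in>insert 0 (Suc ` S). v n \<in> Xs) ==> \<bar>Tv mu u v\<bar> \<le> B * (\<Prod>n\<in>insert 0 (Suc ` S). nrm (v n))"
  using jp_bounded[OF assms(1-4)] by blast
 show ?thesis
 proof (rule at_big_local[OF assms(3,4) B(1)])
  fix nu u' and v :: "nat => 'm => real^4"
  assume a: "nu \<in> Xs" "\<forall>n\<in>S. v n \<in> Xs" "nrm (mdf nu mu) \<ge> 0" "nrm (mdf nu mu) \<le> dst mu u nu u'"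
  have "\<bar>Tv mu u (case_nat (mdf nu mu) v)\<bar> \<le> B * (\<Prod>n\<in>insert 0 (Suc ` S). nrm (case_nat (mdf nu mu) v n))"
   by (rule B(2)) (use a mdf_in[OF a(1) assms(3)] in auto)
  also have "\<dots> = B * nrm (mdf nu mu) * (\<Prod>n\<in>S. nrm (v n))" using assms(5) by (simp add: prod.reindex)
  also have "\<dots> \<le> B * dst mu u nu u'^1 * (\<Prod>n\<in>S. nrm (v n))"
   using a B(1) prod_nrm_nonneg[OF a(2)] by (intro mult_right_mono mult_left_mono) auto
  finally show "\<bar>Tv mu u (case_nat (mdf nu mu) v)\<bar> \<le> B * dst mu u nu u'^1 * (\<Prod>n\<in>S. nrm (v n))" .
 qed
qed

lemma at_big_component:
 assumes "mu \<in> Xs" "u \<in> U"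
 shows "at_big mu u 1 {} (%nu u' v. (u' - u) $ i)"
proof (rule at_big_local[OF assms, of 1])
 fix nu u' and v :: "nat => 'm => real^4"
 assume "norm (u' - u) \<le> dst mu u nu u'"
 then show "\<bar>(u' - u) $ i\<bar> \<le> 1 * dst mu u nu u'^1 * (\<Prod>n\<in>{}. nrm (v n))"
  using component_le_norm_cart[of "u' - u" i] by simp
qed simp

lemma jp_deriv_at_big:
 assumes "jp_deriv G L S T Tv T1 T2" "L < r" "(mu, u) \<in> G" "mu \<in> Xs" "u \<in> U" "finite S"
 shows "at_big mu u 1 S (%nu u' v. T nu u' v - T mu u v)"
proof -
 have d: "jp G (Suc L) (insert 0 (Suc ` S)) Tv" "jp G (Suc L) S T1" "jp G (Suc L) S T2"
  "at_small mu u 1 S (%nu u' v. T nu u' v - T mu u v -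
   (Tv mu u (case_nat (mdf nu mu) v) + T1 mu u v * (u' - u) $ 1 + T2 mu u v * (u' - u) $ 2))"
  using assms(1,3) unfolding jp_deriv_def by auto
 have L: "Suc L \<le> r" using assms(2) by simp
 have b: "at_big mu u 1 S (%nu u' v. T' mu u v * (u' - u) $ i)" if "jp G (Suc L) S T'" for T' i
  using at_big_mult[OF jp_at_big_0[OF that L assms(4,5)] at_big_component[OF assms(4,5)] _ assms(6) _ assms(4)] by simp
 from at_big_add[OF at_small_imp_big[OF d(4)] at_big_add[OF at_big_dir[OF d(1) L assms(4,5,6)] at_big_add[OF b[OF d(2), of 1] b[OF d(3), of 2]]]]
 show ?thesis by (simp add: algebra_simps)
qed

lemma jp_minus: "jp G L S T ==> jp G L S (%mu u v. - T mu u v)"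
 using jp_mult[OF jp_const[of G L "-1"], of S T] by simp

lemma jp_diff: "jp G L S T ==> jp G L S T' ==> jp G L S (%mu u v. T mu u v - T' mu u v)"
 using jp_add[OF _ jp_minus] by simp

lemma jp_cmult: "jp G L {} T ==> jp G L S T' ==> jp G L S (%mu u v. T mu u v * T' mu u v)"
 using jp_mult[of G L "{}" T S T'] by simp

lemma jp_power: "jp G L {} T ==> jp G L {} (%mu u v. T mu u v ^ n)"
 by (induction n) (auto intro: jp_const jp_cmult)

lemma jp_differentiable:
 assumes "jp G L S T" "L < r" "G \<subseteq> Xs \<times> U"
 shows "\<exists>Tv T1 T2. jp_deriv G L S T Tv T1 T2"
 using assms(1)
proof (induction rule: jp.induct)
 case (jp_zero S)
 show ?case unfolding jp_deriv_def
  by (rule exI[of _ "%mu u v. 0"])+ (use assms(3) jp_zero in \<open>auto intro!: jp.jp_zero at_small_zero\<close>)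
next
 case (jp_const c)
 show ?case unfolding jp_deriv_def
  by (rule exI[of _ "%mu u v. 0"])+ (use assms(3) in \<open>auto intro!: jp.jp_zero at_small_zero\<close>)
next
 case (jp_jet s b)
 have sr: "length s < r" using jp_jet(2) assms(2) by simp
 have "at_small mu u 1 {} (%nu u' v. jet s b nu u' - jet s b mu u - (jet s b (case_nat (mdf nu mu) v 0) u
   + jet (axis 1 1 # s) b mu u * (u' - u) $ 1 + jet (axis 2 1 # s) b mu u * (u' - u) $ 2))" if G: "(mu, u) \<in> G" for mu u
 proof -
  have mu: "mu \<in> Xs" "u \<in> U" using G assms(3) by auto
  \<comment> \<open>The total increment is the jet of nu - mu at u' plus the increment of the jet of
    mu. Moving the first of these from u' to u costs a product of two small quantities, the norm of
    nu - mu and |u' - u|.\<close>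
  have "at_big mu u (Suc 1) {} (%nu u' v. jet s b (mdf nu mu) u' - jet s b (mdf nu mu) u)"
  proof (rule at_big_local[OF mu, of "2 * C"])
   fix dlt nu u' and v :: "nat => 'm => real^4"
   assume a: "ball u dlt \<subseteq> U" "u' \<in> ball u dlt" "nu \<in> Xs" "nrm (mdf nu mu) \<ge> 0" "nrm (mdf nu mu) \<le> dst mu u nu u'" "norm (u' - u) \<le> dst mu u nu u'"
   have "\<bar>jet s b (mdf nu mu) u' - jet s b (mdf nu mu) u\<bar> \<le> 2 * C * nrm (mdf nu mu) * norm (u' - u)"
    by (rule jet_lipschitz[OF mdf_in[OF a(3) mu(1)] mu(2) sr jp_jet(1,3) a(1,2)])
   also have "\<dots> \<le> 2 * C * dst mu u nu u' * dst mu u nu u'"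
    using a(4-6) C_nonneg by (intro mult_mono mult_left_mono mult_nonneg_nonneg) auto
   finally show "\<bar>jet s b (mdf nu mu) u' - jet s b (mdf nu mu) u\<bar> \<le> 2 * C * dst mu u nu u' ^ Suc 1 * (\<Prod>n\<in>{}. nrm (v n))"
    by simp
  qed (use C_nonneg in simp)
  then have s1: "at_small mu u 1 {} (%nu u' v. jet s b (mdf nu mu) u' - jet s b (mdf nu mu) u)"
   by (rule at_big_Suc_imp_small[OF _ mu(1)])
  define \<phi> where "\<phi> y = (jet s b mu y - jet s b mu u - (jet (axis 1 1 # s) b mu u * (y - u) $ 1 + jet (axis 2 1 # s) b mu u * (y - u) $ 2)) / norm (y - u)" for y
  have "(\<phi> \<longlongrightarrow> 0) (at u)"
   using jet_has_derivative[OF mu sr, of b] unfolding has_derivative_at_within \<phi>_def[abs_def]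
   by (simp add: divide_inverse mult.commute)
  from at_small_add[OF s1 at_small_u[OF mu(1) this]] show ?thesis
  proof (rule at_small_cong)
   fix nu u' and v :: "nat => 'm => real^4" assume a: "nu \<in> Xs" "u' \<in> U"
   have "\<phi> u' * norm (u' - u) = jet s b mu u' - jet s b mu u - (jet (axis 1 1 # s) b mu u * (u' - u) $ 1 + jet (axis 2 1 # s) b mu u * (u' - u) $ 2)"
    by (cases "u' = u") (simp_all add: \<phi>_def)
   moreover have "jet s b (mdf nu mu) u' = jet s b nu u' - jet s b mu u'" by (rule jet_minus[OF a(1) mu(1) a(2)]) (use sr in simp)
   ultimately show "jet s b nu u' - jet s b mu u - (jet s b (case_nat (mdf nu mu) v 0) u
    + jet (axis 1 1 # s) b mu u * (u' - u) $ 1 + jet (axis 2 1 # s) b mu u * (u' - u) $ 2) =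
    jet s b (mdf nu mu) u' - jet s b (mdf nu mu) u + \<phi> u' * norm (u' - u)" by simp
  qed
 qed
 moreover have "jp G (Suc L) {0} (%mu u v. jet s b (v 0) u)" using jp_jet by (intro jp.jp_dir) auto
 moreover have "jp G (Suc L) {} (%mu u v. jet (axis i 1 # s) b mu u)" for i using jp_jet axis_Basis by (intro jp.jp_jet) auto
 ultimately show ?case unfolding jp_deriv_def
  by (intro exI[of _ "%mu u v. jet s b (v 0) u"] exI[of _ "%mu u v. jet (axis 1 1 # s) b mu u"] exI[of _ "%mu u v. jet (axis 2 1 # s) b mu u"]) auto
next
 case (jp_dir s b n)
 \<comment> \<open>The strict bound on the order of direction jets leaves two further orders below
   r, as the Taylor estimate uniform in v requires.\<close>
 have sr: "Suc (length s) < r" using jp_dir(2) assms(2) by simp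
 have "at_small mu u 1 {n} (%nu u' v. jet s b (v n) u' - jet s b (v n) u - (0
   + jet (axis 1 1 # s) b (v n) u * (u' - u) $ 1 + jet (axis 2 1 # s) b (v n) u * (u' - u) $ 2))" if G: "(mu, u) \<in> G" for mu u
 proof -
  have mu: "mu \<in> Xs" "u \<in> U" using G assms(3) by auto
  have "at_big mu u (Suc 1) {n} (%nu u' v. jet s b (v n) u' - jet s b (v n) u - (0
   + jet (axis 1 1 # s) b (v n) u * (u' - u) $ 1 + jet (axis 2 1 # s) b (v n) u * (u' - u) $ 2))"
  proof (rule at_big_local[OF mu, of "4 * C"])
   fix dlt nu u' and v :: "nat => 'm => real^4"
   assume a: "ball u dlt \<subseteq> U" "u' \<in> ball u dlt" "\<forall>n\<in>{n}. v n \<in> Xs" "norm (u' - u) \<le> dst mu u nu u'"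
   have v: "v n \<in> Xs" using a(3) by simp
   have "\<bar>jet s b (v n) u' - jet s b (v n) u - (jet (axis 1 1 # s) b (v n) u * (u' - u) $ 1 + jet (axis 2 1 # s) b (v n) u * (u' - u) $ 2)\<bar>
     \<le> 4 * C * nrm (v n) * norm (u' - u) * norm (u' - u)"
    by (rule jet_taylor[OF v mu(2) sr jp_dir(1,3) a(1,2)])
   also have "\<dots> \<le> 4 * C * nrm (v n) * dst mu u nu u' * dst mu u nu u'"
    using a(4) C_nonneg nrm_nonneg[OF v] by (intro mult_mono mult_left_mono mult_nonneg_nonneg) (auto intro: order_trans[OF norm_ge_zero])
   finally show "\<bar>jet s b (v n) u' - jet s b (v n) u - (0 + jet (axis 1 1 # s) b (v n) u * (u' - u) $ 1 + jet (axis 2 1 # s) b (v n) u * (u' - u) $ 2)\<bar>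
     \<le> 4 * C * dst mu u nu u' ^ Suc 1 * (\<Prod>n\<in>{n}. nrm (v n))"
    by (simp add: mult_ac)
  qed (use C_nonneg in simp)
  then show ?thesis by (rule at_big_Suc_imp_small[OF _ mu(1)])
 qed
 moreover have "jp G (Suc L) (insert 0 (Suc ` {n})) (%mu u v. 0)" by (intro jp.jp_zero) auto
 moreover have "jp G (Suc L) {n} (%mu u v. jet (axis i 1 # s) b (v n) u)" for i using jp_dir axis_Basis by (intro jp.jp_dir) auto
 ultimately show ?case unfolding jp_deriv_def
  by (intro exI[of _ "%mu u v. 0"] exI[of _ "%mu u v. jet (axis 1 1 # s) b (v n) u"] exI[of _ "%mu u v. jet (axis 2 1 # s) b (v n) u"]) auto
next
 case (jp_add S T T')
 from jp_add.IH obtain Tv T1 T2 Tv' T1' T2' where d: "jp_deriv G L S T Tv T1 T2" "jp_deriv G L S T' Tv' T1' T2'" by blast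
 have "jp_deriv G L S (%mu u v. T mu u v + T' mu u v) (%mu u v. Tv mu u v + Tv' mu u v) (%mu u v. T1 mu u v + T1' mu u v) (%mu u v. T2 mu u v + T2' mu u v)"
  unfolding jp_deriv_def
 proof (intro conjI)
  show "\<forall>(mu, u)\<in>G. at_small mu u 1 S (%nu u' v. T nu u' v + T' nu u' v - (T mu u v + T' mu u v) -
   ((Tv mu u (case_nat (mdf nu mu) v) + Tv' mu u (case_nat (mdf nu mu) v)) + (T1 mu u v + T1' mu u v) * (u' - u) $ 1 + (T2 mu u v + T2' mu u v) * (u' - u) $ 2))"
  proof clarify
   fix mu u assume "(mu, u) \<in> G"
   then have "at_small mu u 1 S (%nu u' v. T nu u' v - T mu u v - (Tv mu u (case_nat (mdf nu mu) v) + T1 mu u v * (u' - u) $ 1 + T2 mu u v * (u' - u) $ 2))"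
    "at_small mu u 1 S (%nu u' v. T' nu u' v - T' mu u v - (Tv' mu u (case_nat (mdf nu mu) v) + T1' mu u v * (u' - u) $ 1 + T2' mu u v * (u' - u) $ 2))"
    using d unfolding jp_deriv_def by auto
   from at_small_add[OF this] show "at_small mu u 1 S (%nu u' v. T nu u' v + T' nu u' v - (T mu u v + T' mu u v) -
   ((Tv mu u (case_nat (mdf nu mu) v) + Tv' mu u (case_nat (mdf nu mu) v)) + (T1 mu u v + T1' mu u v) * (u' - u) $ 1 + (T2 mu u v + T2' mu u v) * (u' - u) $ 2))"
    by (rule at_small_cong) (simp add: algebra_simps)
  qed
 qed (use d in \<open>auto simp: jp_deriv_def intro: jp.jp_add\<close>)
 then show ?case by blast
next
 case (jp_mult S T S' T')
 from jp_mult.IH obtain Tv T1 T2 Tv' T1' T2' where d: "jp_deriv G L S T Tv T1 T2" "jp_deriv G L S' T' Tv' T1' T2'" by blast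
 have f: "finite S" "finite S'" by (rule jp_finite[OF jp_mult.hyps(1)], rule jp_finite[OF jp_mult.hyps(2)])
 have m: "jp G (Suc L) S T" "jp G (Suc L) S' T'"
  by (rule jp_mono[OF jp_mult.hyps(1)], simp_all) (rule jp_mono[OF jp_mult.hyps(2)], simp_all)
 have dj: "insert 0 (Suc ` S) \<inter> Suc ` S' = {}" "Suc ` S \<inter> insert 0 (Suc ` S') = {}" "S' \<inter> S = {}" using jp_mult.hyps(3) by auto
 have e: "insert 0 (Suc ` S) \<union> Suc ` S' = insert 0 (Suc ` (S \<union> S'))" "Suc ` S \<union> insert 0 (Suc ` S') = insert 0 (Suc ` (S \<union> S'))" by auto
 have j: "jp G (Suc L) (insert 0 (Suc ` S)) Tv" "jp G (Suc L) S T1" "jp G (Suc L) S T2"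
  "jp G (Suc L) (insert 0 (Suc ` S')) Tv'" "jp G (Suc L) S' T1'" "jp G (Suc L) S' T2'" using d unfolding jp_deriv_def by auto
 have "jp_deriv G L (S \<union> S') (%mu u v. T mu u v * T' mu u v)
  (%mu u v. Tv mu u v * T' mu u (%n. v (Suc n)) + T mu u (%n. v (Suc n)) * Tv' mu u v)
  (%mu u v. T1 mu u v * T' mu u v + T mu u v * T1' mu u v) (%mu u v. T2 mu u v * T' mu u v + T mu u v * T2' mu u v)"
  unfolding jp_deriv_def
 proof (intro conjI)
  show "jp G (Suc L) (insert 0 (Suc ` (S \<union> S'))) (%mu u v. Tv mu u v * T' mu u (%n. v (Suc n)) + T mu u (%n. v (Suc n)) * Tv' mu u v)"
   using jp.jp_mult[OF j(1) jp_shift[OF m(2)] dj(1)] jp.jp_mult[OF jp_shift[OF m(1)] j(4) dj(2)] unfolding e by (rule jp.jp_add)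
  show "jp G (Suc L) (S \<union> S') (%mu u v. T1 mu u v * T' mu u v + T mu u v * T1' mu u v)"
   by (intro jp.jp_add jp.jp_mult j m jp_mult.hyps(3))
  show "jp G (Suc L) (S \<union> S') (%mu u v. T2 mu u v * T' mu u v + T mu u v * T2' mu u v)"
   by (intro jp.jp_add jp.jp_mult j m jp_mult.hyps(3))
  show "\<forall>(mu, u)\<in>G. at_small mu u 1 (S \<union> S') (%nu u' v. T nu u' v * T' nu u' v - T mu u v * T' mu u v -
   ((Tv mu u (case_nat (mdf nu mu) v) * T' mu u (%n. case Suc n of 0 => mdf nu mu | Suc n => v n)
    + T mu u (%n. case Suc n of 0 => mdf nu mu | Suc n => v n) * Tv' mu u (case_nat (mdf nu mu) v))
    + (T1 mu u v * T' mu u v + T mu u v * T1' mu u v) * (u' - u) $ 1 + (T2 mu u v * T' mu u v + T mu u v * T2' mu u v) * (u' - u) $ 2))"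
  proof clarify
   fix mu u assume G: "(mu, u) \<in> G"
   then have mu: "mu \<in> Xs" "u \<in> U" using assms(3) by auto
   have L: "L \<le> r" using assms(2) by simp
   have s: "at_small mu u 1 S (%nu u' v. T nu u' v - T mu u v - (Tv mu u (case_nat (mdf nu mu) v) + T1 mu u v * (u' - u) $ 1 + T2 mu u v * (u' - u) $ 2))"
    "at_small mu u 1 S' (%nu u' v. T' nu u' v - T' mu u v - (Tv' mu u (case_nat (mdf nu mu) v) + T1' mu u v * (u' - u) $ 1 + T2' mu u v * (u' - u) $ 2))"
    using d G unfolding jp_deriv_def by auto
   \<comment> \<open>The remainder of a product consists of each factor's remainder times the other
     factor at (mu, u), and of the product of the two increments, one of which is o(1) and the other
     O of the distance.\<close>
   note s1 = at_small_mult[OF s(1) jp_at_big_0[OF jp_mult.hyps(2) L mu] jp_mult.hyps(3) f mu(1)]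
   note s2 = at_small_mult[OF s(2) jp_at_big_0[OF jp_mult.hyps(1) L mu] dj(3) f(2,1) mu(1), unfolded Un_commute[of S' S]]
   note s3 = at_small_mult[OF jp_continuous[OF jp_mult.hyps(2) L G mu] jp_deriv_at_big[OF d(1) assms(2) G mu f(1)] dj(3) f(2,1) mu(1), unfolded Un_commute[of S' S]]
   from at_small_add[OF at_small_add[OF s1 s2, simplified] s3[simplified]]
   show "at_small mu u 1 (S \<union> S') (%nu u' v. T nu u' v * T' nu u' v - T mu u v * T' mu u v -
   ((Tv mu u (case_nat (mdf nu mu) v) * T' mu u (%n. case Suc n of 0 => mdf nu mu | Suc n => v n)
    + T mu u (%n. case Suc n of 0 => mdf nu mu | Suc n => v n) * Tv' mu u (case_nat (mdf nu mu) v))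
    + (T1 mu u v * T' mu u v + T mu u v * T1' mu u v) * (u' - u) $ 1 + (T2 mu u v * T' mu u v + T mu u v * T2' mu u v) * (u' - u) $ 2))"
    unfolding One_nat_def by (rule at_small_cong) (simp add: algebra_simps)
  qed
 qed
 then show ?case by blast
next
 case (jp_powr T c)
 from jp_powr.IH obtain Tv T1 T2 where d: "jp_deriv G L {} T Tv T1 T2" by blast
 have m: "jp G (Suc L) {} T" by (rule jp_mono[OF jp_powr.hyps(1)]) simp_all
 have j: "jp G (Suc L) {0} Tv" "jp G (Suc L) {} T1" "jp G (Suc L) {} T2" using d unfolding jp_deriv_def by auto
 let ?D = "%mu u v. c * T mu u v powr (c - 1)"
 have D: "jp G (Suc L) {} ?D" by (rule jp_cmult[OF jp_const jp.jp_powr[OF m jp_powr.hyps(2)]])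
 have "jp_deriv G L {} (%mu u v. T mu u v powr c) (%mu u v. ?D mu u v * Tv mu u v) (%mu u v. ?D mu u v * T1 mu u v) (%mu u v. ?D mu u v * T2 mu u v)"
  unfolding jp_deriv_def
 proof (intro conjI)
  show "jp G (Suc L) (insert 0 (Suc ` {})) (%mu u v. ?D mu u v * Tv mu u v)" using jp_cmult[OF D j(1)] by simp
  show "jp G (Suc L) {} (%mu u v. ?D mu u v * T1 mu u v)" "jp G (Suc L) {} (%mu u v. ?D mu u v * T2 mu u v)"
   by (rule jp_cmult[OF D j(2)], rule jp_cmult[OF D j(3)])
  show "\<forall>(mu, u)\<in>G. at_small mu u 1 {} (%nu u' v. T nu u' v powr c - T mu u v powr c -
   (?D mu u (case_nat (mdf nu mu) v) * Tv mu u (case_nat (mdf nu mu) v) + ?D mu u v * T1 mu u v * (u' - u) $ 1 + ?D mu u v * T2 mu u v * (u' - u) $ 2))"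
  proof clarify
   fix mu u assume G: "(mu, u) \<in> G"
   then have mu: "mu \<in> Xs" "u \<in> U" using assms(3) by auto
   have L: "L \<le> r" using assms(2) by simp
   define x where "x = T mu u (%_. undefined)"
   have x: "T mu u v = x" for v unfolding x_def by (rule jp_cong[OF jp_powr.hyps(1)]) simp
   have x0: "x > 0" using jp_powr.hyps(2) G unfolding x_def by blast
   have "at_small mu u 1 {} (%nu u' v. T nu u' v - T mu u v - (Tv mu u (case_nat (mdf nu mu) v) + T1 mu u v * (u' - u) $ 1 + T2 mu u v * (u' - u) $ 2))"
    using d G unfolding jp_deriv_def by auto
   note s = this[unfolded x]
   have c0: "at_small mu u 0 {} (%nu u' v. T nu u' v - x)" using jp_continuous[OF jp_powr.hyps(1) L G mu] unfolding x .
   have b: "at_big mu u 1 {} (%nu u' v. T nu u' v - x)" using jp_deriv_at_big[OF d assms(2) G mu] unfolding x by simp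
   have k: "at_big mu u 0 {} (%nu u' v::nat => 'm => real^4. c * x powr (c - 1))"
    by (rule at_big_0I[of "\<bar>c * x powr (c - 1)\<bar>"]) simp_all
   note s1 = at_small_diff[OF mu(1) c0 b has_real_derivative_powr[OF x0, of c]]
   note s2 = at_small_mult[OF s k Int_empty_left finite.emptyI finite.emptyI mu(1), simplified]
   from at_small_add[OF s1[unfolded One_nat_def] s2]
   show "at_small mu u 1 {} (%nu u' v. T nu u' v powr c - T mu u v powr c -
   (?D mu u (case_nat (mdf nu mu) v) * Tv mu u (case_nat (mdf nu mu) v) + ?D mu u v * T1 mu u v * (u' - u) $ 1 + ?D mu u v * T2 mu u v * (u' - u) $ 2))"
    unfolding x One_nat_def by (rule at_small_cong) (simp add: algebra_simps)
  qed
 qed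
 then show ?case by blast
qed

text \<open>Taking nu = mu makes the new direction zero, where \<open>Tv\<close> vanishes by
  linearity, and what is left is ordinary differentiability in u.\<close>

lemma jp_deriv_has_derivative:
 assumes d: "jp_deriv G L {} T Tv T1 T2" and G: "(mu, u) \<in> G" and mu: "mu \<in> Xs" "u \<in> U" and L: "L < r"
 shows "((%u. T mu u w) has_derivative (%h. T1 mu u w * h $ 1 + T2 mu u w * h $ 2)) (at u)"
proof -
 have j: "jp G (Suc L) {0} Tv" and
  s: "at_small mu u 1 {} (%nu u' v. T nu u' v - T mu u v - (Tv mu u (case_nat (mdf nu mu) v) + T1 mu u v * (u' - u) $ 1 + T2 mu u v * (u' - u) $ 2))"
  using d G unfolding jp_deriv_def by auto
 have z: "(%q. 0) \<in> Xs" using lincomb[OF mu(1) mu(1), of 0 0] by simp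
 have Tv0: "Tv mu u (case_nat (%q. 0) w) = 0"
 proof -
  have "Tv mu u ((case_nat (%q. 0) w)(0 := %q. 0 *\<^sub>R 0 + 0 *\<^sub>R 0)) = 0"
   using jp_linear[OF j _ mu(2) _ z z, of 0 mu "case_nat (%q. 0) w" 0 0] L by simp
  moreover have "(case_nat (%q. 0) w)(0 := %q. 0) = case_nat (%q. 0) w" by (auto simp: fun_eq_iff)
  ultimately show ?thesis by simp
 qed
 obtain dlt0 where d0: "dlt0 > 0" "ball u dlt0 \<subseteq> U" using ball_in_U[OF mu(2)] by blast
 show ?thesis unfolding has_derivative_at_alt
 proof (intro conjI allI impI)
  show "bounded_linear (%h::real^2. T1 mu u w * h $ 1 + T2 mu u w * h $ 2)"
   by (intro bounded_linear_add bounded_linear_const_mult bounded_linear_vec_nth)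
  fix e :: real assume e: "e > 0"
  then have "at_le mu u 1 {} (%nu u' v. T nu u' v - T mu u v - (Tv mu u (case_nat (mdf nu mu) v) + T1 mu u v * (u' - u) $ 1 + T2 mu u v * (u' - u) $ 2)) e"
   using s unfolding at_small_def by blast
  then obtain dlt where dl: "dlt > 0" "\<And>nu u' v. nu \<in> Xs ==> u' \<in> U ==> dst mu u nu u' < dlt ==>
   \<bar>T nu u' v - T mu u v - (Tv mu u (case_nat (mdf nu mu) v) + T1 mu u v * (u' - u) $ 1 + T2 mu u v * (u' - u) $ 2)\<bar> \<le> e * dst mu u nu u'"
   unfolding at_le_def by auto
  have "norm (T mu y w - T mu u w - (T1 mu u w * (y - u) $ 1 + T2 mu u w * (y - u) $ 2)) \<le> e * norm (y - u)" if y: "norm (y - u) < min dlt dlt0" for y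
  proof -
   have yU: "y \<in> U" using y d0(2) by (auto simp: dist_norm norm_minus_commute)
   have ds: "dst mu u mu y = norm (y - u)" by (simp add: dst_def nrm_zero)
   show ?thesis using dl(2)[OF mu(1) yU, of w] y unfolding ds by (simp add: Tv0)
  qed
  then show "\<exists>d>0. \<forall>y. norm (y - u) < d --> norm (T mu y w - T mu u w - (T1 mu u w * (y - u) $ 1 + T2 mu u w * (y - u) $ 2)) \<le> e * norm (y - u)"
   using dl(1) d0(1) by (intro exI[of _ "min dlt dlt0"]) auto
 qed
qed

text \<open>\<open>U1\<close> and \<open>U2\<close> are the components of the derivative of
  \<open>up\<close>, again jet expressions evaluated at (mu, up mu). The order is 3 because the
  zeros to be followed are those of an expression in the 2-jet, and its derivative in u needs one
  order more. Higher derivatives of \<open>up\<close> never have to be constructed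
  separately.\<close>

definition moving_point where
 "moving_point G W up U1 U2 \<longleftrightarrow> W \<subseteq> Xs & (\<forall>mu\<in>W. (mu, up mu) \<in> G) & jp G 3 {0} U1 & jp G 3 {0} U2 &
  (\<forall>mu\<in>W. \<exists>M\<ge>0. \<exists>dlt>0. \<forall>nu\<in>W. nrm (mdf nu mu) < dlt --> norm (up nu - up mu) \<le> M * nrm (mdf nu mu)) &
  (\<forall>mu\<in>W. \<forall>eps>0. \<exists>dlt>0. \<forall>nu\<in>W. nrm (mdf nu mu) < dlt -->
   \<bar>(up nu - up mu) $ 1 - U1 mu (up mu) (%_. mdf nu mu)\<bar> \<le> eps * nrm (mdf nu mu) &
   \<bar>(up nu - up mu) $ 2 - U2 mu (up mu) (%_. mdf nu mu)\<bar> \<le> eps * nrm (mdf nu mu))"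

lemma moving_point_subset: "moving_point G W up U1 U2 ==> W' \<subseteq> W ==> moving_point G W' up U1 U2"
 unfolding moving_point_def
 apply (intro conjI)
   apply blast
   apply blast
  apply simp
  apply simp
 apply (elim conjE, meson subsetD)
 apply (elim conjE, meson subsetD)
 done

lemma jp_moving_continuous:
 assumes T: "jp G L S T" "L \<le> r" "G \<subseteq> Xs \<times> U" and m: "moving_point G W up U1 U2" and mu: "mu \<in> W" and e: "eps > 0"
 shows "\<exists>dlt>0. \<forall>nu\<in>W. nrm (mdf nu mu) < dlt --> (\<forall>v. (\<forall>n\<in>S. v n \<in> Xs) -->
  \<bar>T nu (up nu) v - T mu (up mu) v\<bar> \<le> eps * (\<Prod>n\<in>S. nrm (v n)))"
proof -
 have G: "(nu, up nu) \<in> G" "nu \<in> Xs" "up nu \<in> U" if "nu \<in> W" for nu using m that T(3) unfolding moving_point_def by auto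
 obtain M dlt1 where M: "M \<ge> 0" "dlt1 > 0" "\<And>nu. nu \<in> W ==> nrm (mdf nu mu) < dlt1 ==> norm (up nu - up mu) \<le> M * nrm (mdf nu mu)"
  using m mu unfolding moving_point_def by blast
 from jp_continuous[OF T(1,2) G(1)[OF mu] G(2,3)[OF mu]] have "at_le mu (up mu) 0 S (%nu u' v. T nu u' v - T mu (up mu) v) eps"
  using e unfolding at_small_def by blast
 from at_leD[OF this] obtain dlt where d: "dlt > 0" "\<And>nu u' v. nu \<in> Xs ==> u' \<in> U ==> dst mu (up mu) nu u' < dlt ==> \<forall>n\<in>S. v n \<in> Xs ==>
  \<bar>T nu u' v - T mu (up mu) v\<bar> \<le> eps * dst mu (up mu) nu u'^0 * (\<Prod>n\<in>S. nrm (v n))" by blast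
 have ds: "dst mu (up mu) nu (up nu) < dlt" if n: "nu \<in> W" "nrm (mdf nu mu) < min dlt1 (dlt / (1 + M))" for nu
 proof -
  have "nrm (mdf nu mu) < dlt1" "nrm (mdf nu mu) < dlt / (1 + M)" using n(2) by linarith+
  then have "(1 + M) * nrm (mdf nu mu) < dlt" "norm (up nu - up mu) \<le> M * nrm (mdf nu mu)"
   using M(1) M(3)[OF n(1)] by (simp_all add: field_simps)
  then show ?thesis by (simp add: dst_def algebra_simps)
 qed
 show ?thesis
 proof (intro exI[of _ "min dlt1 (dlt / (1 + M))"] conjI ballI impI allI)
  fix nu v assume "nu \<in> W" "nrm (mdf nu mu) < min dlt1 (dlt / (1 + M))" "\<forall>n\<in>S. v n \<in> Xs"
  then show "\<bar>T nu (up nu) v - T mu (up mu) v\<bar> \<le> eps * (\<Prod>n\<in>S. nrm (v n))"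
   using d(2)[OF G(2,3) ds] by simp
 qed (use M d in auto)
qed

text \<open>The chain rule: the derivative of T along the moving point is Tv + U1 T1 + U2 T2, with
  the new direction at index 0. As \<open>U1\<close> and \<open>U2\<close> are of order 3, the
  result is of order L + 1 once 3 <= L + 1.\<close>

lemma jp_moving_derivative:
 assumes T: "jp G L S T" "L < r" "3 \<le> Suc L" "G \<subseteq> Xs \<times> U" and m: "moving_point G W up U1 U2"
 shows "\<exists>T'. jp G (Suc L) (insert 0 (Suc ` S)) T' & (\<forall>mu\<in>W. \<forall>eps>0. \<exists>dlt>0. \<forall>nu\<in>W. nrm (mdf nu mu) < dlt --> (\<forall>v. (\<forall>n\<in>S. v n \<in> Xs) -->
  \<bar>T nu (up nu) v - T mu (up mu) v - T' mu (up mu) (case_nat (mdf nu mu) v)\<bar> \<le> eps * nrm (mdf nu mu) * (\<Prod>n\<in>S. nrm (v n))))"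
proof -
 obtain Tv T1 T2 where d: "jp_deriv G L S T Tv T1 T2" using jp_differentiable[OF T(1,2,4)] by blast
 have j: "jp G (Suc L) (insert 0 (Suc ` S)) Tv" "jp G (Suc L) S T1" "jp G (Suc L) S T2" using d unfolding jp_deriv_def by auto
 have U: "jp G (Suc L) {0} U1" "jp G (Suc L) {0} U2" using m jp_mono[OF _ T(3)] unfolding moving_point_def by auto
 let ?T' = "%mu u v. Tv mu u v + (U1 mu u v * T1 mu u (%n. v (Suc n)) + U2 mu u v * T2 mu u (%n. v (Suc n)))"
 have "{0} \<inter> Suc ` S = {}" by auto
 from jp.jp_mult[OF U(1) jp_shift[OF j(2)] this] jp.jp_mult[OF U(2) jp_shift[OF j(3)] this]
 have T': "jp G (Suc L) (insert 0 (Suc ` S)) ?T'" by (intro jp.jp_add j) simp_all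
 have L: "Suc L \<le> r" using T(2) by simp
 have "\<exists>dlt>0. \<forall>nu\<in>W. nrm (mdf nu mu) < dlt --> (\<forall>v. (\<forall>n\<in>S. v n \<in> Xs) -->
  \<bar>T nu (up nu) v - T mu (up mu) v - ?T' mu (up mu) (case_nat (mdf nu mu) v)\<bar> \<le> eps * nrm (mdf nu mu) * (\<Prod>n\<in>S. nrm (v n)))"
  if mu: "mu \<in> W" and e: "eps > 0" for mu eps
 proof -
  have G: "(nu, up nu) \<in> G" "nu \<in> Xs" "up nu \<in> U" if "nu \<in> W" for nu using m that T(4) unfolding moving_point_def by auto
  obtain M dlt1 where M: "M \<ge> 0" "dlt1 > 0" "\<And>nu. nu \<in> W ==> nrm (mdf nu mu) < dlt1 ==> norm (up nu - up mu) \<le> M * nrm (mdf nu mu)"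
   using m mu unfolding moving_point_def by blast
  obtain B1 where B1: "B1 \<ge> 0" "\<And>v. (\<forall>n\<in>S. v n \<in> Xs) ==> \<bar>T1 mu (up mu) v\<bar> \<le> B1 * (\<Prod>n\<in>S. nrm (v n))"
   using jp_bounded[OF j(2) L G(2,3)[OF mu]] by blast
  obtain B2 where B2: "B2 \<ge> 0" "\<And>v. (\<forall>n\<in>S. v n \<in> Xs) ==> \<bar>T2 mu (up mu) v\<bar> \<le> B2 * (\<Prod>n\<in>S. nrm (v n))"
   using jp_bounded[OF j(3) L G(2,3)[OF mu]] by blast
  have dif: "\<And>mu eps. mu \<in> W ==> eps > 0 ==> \<exists>dlt>0. \<forall>nu\<in>W. nrm (mdf nu mu) < dlt -->
    \<bar>(up nu - up mu) $ 1 - U1 mu (up mu) (%_. mdf nu mu)\<bar> \<le> eps * nrm (mdf nu mu) &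
    \<bar>(up nu - up mu) $ 2 - U2 mu (up mu) (%_. mdf nu mu)\<bar> \<le> eps * nrm (mdf nu mu)"
   using m unfolding moving_point_def by simp
  \<comment> \<open>Half of \<open>eps\<close> is reserved for the remainder of T, where the
    distance is at most 1 + M times the norm of the increment. The other half is for the error in
    the motion of \<open>up\<close>, weighted by the bounds B1, B2 of T1, T2.\<close>
  define eps1 eps2 where ee: "eps1 = eps / (2 * (1 + M))" "eps2 = eps / (2 * (B1 + B2 + 1))"
  have ep: "eps1 > 0" "eps2 > 0" using e M(1) B1(1) B2(1) unfolding ee by (auto intro!: divide_pos_pos)
  obtain dlt2 where d2: "dlt2 > 0" "\<And>nu. nu \<in> W ==> nrm (mdf nu mu) < dlt2 ==>
    \<bar>(up nu - up mu) $ 1 - U1 mu (up mu) (%_. mdf nu mu)\<bar> \<le> eps2 * nrm (mdf nu mu) &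
    \<bar>(up nu - up mu) $ 2 - U2 mu (up mu) (%_. mdf nu mu)\<bar> \<le> eps2 * nrm (mdf nu mu)"
   using dif[OF mu ep(2)] by blast
  have "at_small mu (up mu) 1 S (%nu u' v. T nu u' v - T mu (up mu) v -
   (Tv mu (up mu) (case_nat (mdf nu mu) v) + T1 mu (up mu) v * (u' - up mu) $ 1 + T2 mu (up mu) v * (u' - up mu) $ 2))"
   using d G(1)[OF mu] unfolding jp_deriv_def by auto
  then have "at_le mu (up mu) 1 S (%nu u' v. T nu u' v - T mu (up mu) v -
   (Tv mu (up mu) (case_nat (mdf nu mu) v) + T1 mu (up mu) v * (u' - up mu) $ 1 + T2 mu (up mu) v * (u' - up mu) $ 2)) eps1"
   using ep(1) unfolding at_small_def by blast
  from at_leD[OF this] obtain dlt3 where d3: "dlt3 > 0" "\<And>nu u' v. nu \<in> Xs ==> u' \<in> U ==> dst mu (up mu) nu u' < dlt3 ==> \<forall>n\<in>S. v n \<in> Xs ==>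
   \<bar>T nu u' v - T mu (up mu) v - (Tv mu (up mu) (case_nat (mdf nu mu) v) + T1 mu (up mu) v * (u' - up mu) $ 1 + T2 mu (up mu) v * (u' - up mu) $ 2)\<bar>
   \<le> eps1 * dst mu (up mu) nu u'^1 * (\<Prod>n\<in>S. nrm (v n))" by blast
  define dlt where "dlt = min (min dlt1 dlt2) (dlt3 / (1 + M))"
  show ?thesis
  proof (intro exI[of _ dlt] conjI ballI impI allI)
   show "dlt > 0" using M d2(1) d3(1) unfolding dlt_def by simp
   fix nu v assume a: "nu \<in> W" "nrm (mdf nu mu) < dlt" and v: "\<forall>n\<in>S. v n \<in> Xs"
   let ?n = "nrm (mdf nu mu)" and ?P = "\<Prod>n\<in>S. nrm (v n)"
   have n0: "?n \<ge> 0" by (intro nrm_nonneg mdf_in G a(1) mu)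
   have P0: "?P \<ge> 0" by (rule prod_nrm_nonneg[OF v])
   have l: "?n < dlt1" "?n < dlt2" "?n < dlt3 / (1 + M)" using a(2) unfolding dlt_def by linarith+
   have ds: "dst mu (up mu) nu (up nu) \<le> (1 + M) * ?n" using M(3)[OF a(1) l(1)] by (simp add: dst_def algebra_simps)
   also have "\<dots> < dlt3" using l(3) M(1) by (simp add: field_simps)
   finally have ds3: "dst mu (up mu) nu (up nu) < dlt3" .
   let ?R = "T nu (up nu) v - T mu (up mu) v - (Tv mu (up mu) (case_nat (mdf nu mu) v) + T1 mu (up mu) v * (up nu - up mu) $ 1 + T2 mu (up mu) v * (up nu - up mu) $ 2)"
   have "\<bar>?R\<bar> \<le> eps1 * dst mu (up mu) nu (up nu) * ?P" using d3(2)[OF G(2,3)[OF a(1)] ds3 v] by simp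
   also have "\<dots> \<le> eps1 * ((1 + M) * ?n) * ?P" using ds ep(1) P0 by (intro mult_right_mono mult_left_mono) auto
   also have "\<dots> = eps / 2 * ?n * ?P" using M(1) unfolding ee by (simp add: field_simps)
   finally have r1: "\<bar>?R\<bar> \<le> eps / 2 * ?n * ?P" .
   let ?D1 = "(up nu - up mu) $ 1 - U1 mu (up mu) (%_. mdf nu mu)" and ?D2 = "(up nu - up mu) $ 2 - U2 mu (up mu) (%_. mdf nu mu)"
   have "\<bar>T1 mu (up mu) v * ?D1\<bar> \<le> (B1 * ?P) * (eps2 * ?n)" "\<bar>T2 mu (up mu) v * ?D2\<bar> \<le> (B2 * ?P) * (eps2 * ?n)"
    unfolding abs_mult using d2(2)[OF a(1) l(2)] B1 B2 v P0 by (auto intro!: mult_mono)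
   then have "\<bar>T1 mu (up mu) v * ?D1 + T2 mu (up mu) v * ?D2\<bar> \<le> (B1 + B2) * eps2 * (?n * ?P)"
    by (intro order_trans[OF abs_triangle_ineq]) (simp add: algebra_simps)
   also have "\<dots> \<le> eps / 2 * (?n * ?P)"
   proof (rule mult_right_mono)
    have "(B1 + B2) * eps2 \<le> (B1 + B2 + 1) * eps2" using ep by simp
    also have "\<dots> = eps / 2" using B1(1) B2(1) unfolding ee by (simp add: field_simps)
    finally show "(B1 + B2) * eps2 \<le> eps / 2" .
   qed (use n0 P0 in simp)
   finally have r2: "\<bar>T1 mu (up mu) v * ?D1 + T2 mu (up mu) v * ?D2\<bar> \<le> eps / 2 * ?n * ?P" by (simp add: mult.assoc)
   have u: "U1 mu (up mu) (case_nat (mdf nu mu) v) = U1 mu (up mu) (%_. mdf nu mu)" "U2 mu (up mu) (case_nat (mdf nu mu) v) = U2 mu (up mu) (%_. mdf nu mu)"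
    by (rule jp_cong[OF U(1)], simp) (rule jp_cong[OF U(2)], simp)
   have "T nu (up nu) v - T mu (up mu) v - ?T' mu (up mu) (case_nat (mdf nu mu) v) = ?R + (T1 mu (up mu) v * ?D1 + T2 mu (up mu) v * ?D2)"
    unfolding u by (simp add: algebra_simps)
   then have "\<bar>T nu (up nu) v - T mu (up mu) v - ?T' mu (up mu) (case_nat (mdf nu mu) v)\<bar> = \<bar>?R + (T1 mu (up mu) v * ?D1 + T2 mu (up mu) v * ?D2)\<bar>"
    by (simp only:)
   also have "\<dots> \<le> \<bar>?R\<bar> + \<bar>T1 mu (up mu) v * ?D1 + T2 mu (up mu) v * ?D2\<bar>" by (rule abs_triangle_ineq)
   also have "\<dots> \<le> eps / 2 * ?n * ?P + eps / 2 * ?n * ?P" by (rule add_mono[OF r1 r2])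
   also have "\<dots> = eps * ?n * ?P" by (simp add: field_simps)
   finally show "\<bar>T nu (up nu) v - T mu (up mu) v - ?T' mu (up mu) (case_nat (mdf nu mu) v)\<bar> \<le> eps * ?n * ?P" .
  qed
 qed
 with T' show ?thesis by blast
qed

text \<open>The j-th derivative has j directions and jets of order at most 3 + j. So k + 3 <= r is
  what k derivatives require, and the class r - 3 appears.\<close>

lemma jp_moving_sequence:
 assumes T: "jp G 3 {} T" "G \<subseteq> Xs \<times> U" "k + 3 \<le> r" and m: "moving_point G W up U1 U2"
 shows "\<exists>D. D 0 = T & (\<forall>j\<le>k. jp G (3 + j) {..<j} (D j)) & (\<forall>j<k. \<forall>mu\<in>W. \<forall>eps>0. \<exists>dlt>0. \<forall>nu\<in>W. nrm (mdf nu mu) < dlt --> (\<forall>v. (\<forall>n\<in>{..<j}. v n \<in> Xs) -->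
  \<bar>D j nu (up nu) v - D j mu (up mu) v - D (Suc j) mu (up mu) (case_nat (mdf nu mu) v)\<bar> \<le> eps * nrm (mdf nu mu) * (\<Prod>n\<in>{..<j}. nrm (v n))))"
proof -
 let ?P = "%j T'. (j = 0 --> T' = T) & (j \<le> k --> jp G (3 + j) {..<j} T')"
 let ?Q = "%j T' T''. j < k --> (\<forall>mu\<in>W. \<forall>eps>0. \<exists>dlt>0. \<forall>nu\<in>W. nrm (mdf nu mu) < dlt --> (\<forall>v. (\<forall>n\<in>{..<j}. v n \<in> Xs) -->
  \<bar>T' nu (up nu) v - T' mu (up mu) v - T'' mu (up mu) (case_nat (mdf nu mu) v)\<bar> \<le> eps * nrm (mdf nu mu) * (\<Prod>n\<in>{..<j}. nrm (v n))))"
 have "\<exists>f. \<forall>n. ?P n (f n) & ?Q n (f n) (f (Suc n))"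
 proof (rule dependent_nat_choice)
  show "\<exists>x. ?P 0 x" using T(1) by (intro exI[of _ T]) simp
  fix x n assume x: "?P n x"
  show "\<exists>y. ?P (Suc n) y & ?Q n x y"
  proof (cases "n < k")
   case True
   then have j: "jp G (3 + n) {..<n} x" using x by simp
   have "3 + n < r" "3 \<le> Suc (3 + n)" using True T(3) by simp_all
   from jp_moving_derivative[OF j this T(2) m] show ?thesis by (auto simp: lessThan_Suc_eq_insert_0)
  next
   case False
   then show ?thesis by simp
  qed
 qed
 then obtain D where D0: "\<forall>n. ?P n (D n) & ?Q n (D n) (D (Suc n))" ..
 have D: "?P n (D n)" "?Q n (D n) (D (Suc n))" for n
  by (rule conjunct1[OF spec[OF D0]], rule conjunct2[OF spec[OF D0]])
 show ?thesis
 proof (intro exI[of _ D] conjI allI impI)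
  show "D 0 = T" using D(1)[of 0] by simp
  show "jp G (3 + j) {..<j} (D j)" if "j \<le> k" for j using D(1)[of j] that by simp
  fix j assume "j < k"
  with D(2)[of j] show "\<forall>mu\<in>W. \<forall>eps>0. \<exists>dlt>0. \<forall>nu\<in>W. nrm (mdf nu mu) < dlt --> (\<forall>v. (\<forall>n\<in>{..<j}. v n \<in> Xs) -->
  \<bar>D j nu (up nu) v - D j mu (up mu) v - D (Suc j) mu (up mu) (case_nat (mdf nu mu) v)\<bar> \<le> eps * nrm (mdf nu mu) * (\<Prod>n\<in>{..<j}. nrm (v n)))" by simp
 qed
qed

lemma jp_Ck_functional:
 assumes T: "jp G 3 {} T" "G \<subseteq> Xs \<times> U" "k + 3 \<le> r" "k > 0" and m: "moving_point G W up U1 U2" and a: "\<alpha> \<in> W"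
 shows "Ck_functional Xs nrm k (%mu. T mu (up mu) (%_. undefined)) W"
  and "\<exists>L. functional_has_derivative Xs nrm W (%mu. T mu (up mu) (%_. undefined)) L \<alpha>"
proof -
 obtain D where D0: "D 0 = T & (\<forall>j\<le>k. jp G (3 + j) {..<j} (D j)) & (\<forall>j<k. \<forall>mu\<in>W. \<forall>eps>0. \<exists>dlt>0. \<forall>nu\<in>W. nrm (mdf nu mu) < dlt --> (\<forall>v. (\<forall>n\<in>{..<j}. v n \<in> Xs) -->
  \<bar>D j nu (up nu) v - D j mu (up mu) v - D (Suc j) mu (up mu) (case_nat (mdf nu mu) v)\<bar> \<le> eps * nrm (mdf nu mu) * (\<Prod>n\<in>{..<j}. nrm (v n))))"
  using jp_moving_sequence[OF T(1-3) m] ..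
 have D: "D 0 = T" "\<And>j. j \<le> k ==> jp G (3 + j) {..<j} (D j)"
  using D0 by simp_all
 have D3: "j < k ==> mu \<in> W ==> eps > 0 ==> \<exists>dlt>0. \<forall>nu\<in>W. nrm (mdf nu mu) < dlt --> (\<forall>v. (\<forall>n\<in>{..<j}. v n \<in> Xs) -->
  \<bar>D j nu (up nu) v - D j mu (up mu) v - D (Suc j) mu (up mu) (case_nat (mdf nu mu) v)\<bar> \<le> eps * nrm (mdf nu mu) * (\<Prod>n\<in>{..<j}. nrm (v n)))" for j mu eps
  using D0 by simp
 have G: "(nu, up nu) \<in> G" "nu \<in> Xs" "up nu \<in> U" if "nu \<in> W" for nu using m that T(2) unfolding moving_point_def by auto
 have pl: "(\<Prod>n<length vs. nrm (vs ! n)) = prod_list (map nrm vs)" for vs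
  using prod.list_conv_set_nth[of "map nrm vs"] by (simp add: atLeast0LessThan)
 have nX: "\<forall>n\<in>{..<length vs}. vs ! n \<in> Xs" if "set vs \<subseteq> Xs" for vs :: "('m => real^4) list"
  using that by (auto simp: subset_iff)
 have cN: "case_nat h ((!) vs) = (!) (h # vs)" for h and vs :: "('m => real^4) list"
  by (auto simp: fun_eq_iff nth_Cons)
 have upd: "D j mu (up mu) ((!) (vs[i := w])) = D j mu (up mu) (((!) vs)(i := w))" if "j \<le> k" "length vs = j" for j mu vs i w
  by (rule jp_cong[OF D(2)[OF that(1)]]) (use that in \<open>auto simp: nth_list_update\<close>)
 let ?D = "%j mu vs. D j mu (up mu) ((!) vs)"
 show "Ck_functional Xs nrm k (%mu. T mu (up mu) (%_. undefined)) W"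
  unfolding Ck_functional_def
 proof (intro exI[of _ ?D] conjI ballI allI impI)
  fix mu assume "mu \<in> W"
  \<comment> \<open>T contains no directions, so the arbitrary argument \<open>undefined\<close> and
    the entries of the empty list give the same value.\<close>
  show "D 0 mu (up mu) ((!) []) = T mu (up mu) (%_. undefined)" unfolding D(1) by (rule jp_cong[OF T(1)]) simp
 next
  fix j mu assume j: "j \<le> k" and mu: "mu \<in> W"
  have L: "3 + j \<le> r" using j T(3) by simp
  obtain B where B: "B \<ge> 0" "\<And>v. (\<forall>n\<in>{..<j}. v n \<in> Xs) ==> \<bar>D j mu (up mu) v\<bar> \<le> B * (\<Prod>n\<in>{..<j}. nrm (v n))"
   using jp_bounded[OF D(2)[OF j] L G(2,3)[OF mu]] by blast
  show "bdd_multilinear Xs nrm j (?D j mu)"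
   unfolding bdd_multilinear_def
  proof (intro conjI allI impI exI[of _ B])
   fix vs i s t v w assume "length vs = j & set vs \<subseteq> Xs & i < j & v \<in> Xs & w \<in> Xs"
   then have h: "length vs = j" "i \<in> {..<j}" "v \<in> Xs" "w \<in> Xs" by auto
   have L': "3 + j \<le> Suc r" using L by simp
   show "D j mu (up mu) ((!) (vs[i := %q. s *\<^sub>R v q + t *\<^sub>R w q])) = s * D j mu (up mu) ((!) (vs[i := v])) + t * D j mu (up mu) ((!) (vs[i := w]))"
    unfolding upd[OF j h(1)] by (rule jp_linear[OF D(2)[OF j] L' G(3)[OF mu] h(2-4)])
  next
   fix vs assume "length vs = j & set vs \<subseteq> Xs"
   then show "\<bar>D j mu (up mu) ((!) vs)\<bar> \<le> B * prod_list (map nrm vs)" using B(2)[of "(!) vs"] nX[of vs] pl[of vs] by auto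
  qed
 next
  fix j mu and eps :: real assume j: "j < k" "mu \<in> W" "eps > 0"
  from D3[OF j] obtain dlt where d0: "dlt > 0 & (\<forall>nu\<in>W. nrm (mdf nu mu) < dlt --> (\<forall>v. (\<forall>n\<in>{..<j}. v n \<in> Xs) -->
   \<bar>D j nu (up nu) v - D j mu (up mu) v - D (Suc j) mu (up mu) (case_nat (mdf nu mu) v)\<bar> \<le> eps * nrm (mdf nu mu) * (\<Prod>n\<in>{..<j}. nrm (v n))))" ..
  note d = conjunct1[OF d0] conjunct2[OF d0, rule_format]
  show "\<exists>dlt>0. \<forall>nu\<in>W. nrm (mdf nu mu) < dlt --> (\<forall>vs. length vs = j & set vs \<subseteq> Xs -->
   \<bar>?D j nu vs - ?D j mu vs - ?D (Suc j) mu (mdf nu mu # vs)\<bar> \<le> eps * nrm (mdf nu mu) * prod_list (map nrm vs))"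
  proof (intro exI[of _ dlt] conjI ballI impI allI d(1))
   fix nu vs assume "nu \<in> W" "nrm (mdf nu mu) < dlt" "length vs = j & set vs \<subseteq> Xs"
   then show "\<bar>?D j nu vs - ?D j mu vs - ?D (Suc j) mu (mdf nu mu # vs)\<bar> \<le> eps * nrm (mdf nu mu) * prod_list (map nrm vs)"
    using d(2)[of nu "(!) vs"] nX[of vs] pl[of vs] unfolding cN by auto
  qed
 next
  fix mu and eps :: real assume j: "mu \<in> W" "eps > 0"
  have "3 + k \<le> r" using T(3) by simp
  from jp_moving_continuous[OF D(2)[OF order_refl] this T(2) m j] obtain dlt where d0: "dlt > 0 & (\<forall>nu\<in>W. nrm (mdf nu mu) < dlt --> (\<forall>v. (\<forall>n\<in>{..<k}. v n \<in> Xs) -->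
   \<bar>D k nu (up nu) v - D k mu (up mu) v\<bar> \<le> eps * (\<Prod>n\<in>{..<k}. nrm (v n))))" ..
  note d = conjunct1[OF d0] conjunct2[OF d0, rule_format]
  show "\<exists>dlt>0. \<forall>nu\<in>W. nrm (mdf nu mu) < dlt --> (\<forall>vs. length vs = k & set vs \<subseteq> Xs -->
   \<bar>?D k nu vs - ?D k mu vs\<bar> \<le> eps * prod_list (map nrm vs))"
  proof (intro exI[of _ dlt] conjI ballI impI allI d(1))
   fix nu vs assume "nu \<in> W" "nrm (mdf nu mu) < dlt" "length vs = k & set vs \<subseteq> Xs"
   then show "\<bar>?D k nu vs - ?D k mu vs\<bar> \<le> eps * prod_list (map nrm vs)"
    using d(2)[of nu "(!) vs"] nX[of vs] pl[of vs] by auto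
  qed
 qed
 have D1: "jp G 4 {0} (D 1)" using D(2)[of 1] T(4) by (simp add: lessThan_Suc)
 have L: "4 \<le> r" "4 \<le> Suc r" using T(3,4) by simp_all
 have c0: "D 1 \<alpha> (up \<alpha>) ((%_. undefined)(0 := h)) = D 1 \<alpha> (up \<alpha>) (%_. h)" for h by (rule jp_cong[OF D1]) simp
 obtain B where B: "B \<ge> 0" "\<And>v. (\<forall>n\<in>{0}. v n \<in> Xs) ==> \<bar>D 1 \<alpha> (up \<alpha>) v\<bar> \<le> B * (\<Prod>n\<in>{0}. nrm (v n))"
  using jp_bounded[OF D1 L(1) G(2,3)[OF a]] by blast
 have "functional_has_derivative Xs nrm W (%mu. T mu (up mu) (%_. undefined)) (%h. D 1 \<alpha> (up \<alpha>) (%_. h)) \<alpha>"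
  unfolding functional_has_derivative_def
 proof (intro conjI allI ballI impI)
  fix s t v w assume vw: "v \<in> Xs" "w \<in> Xs"
  show "D 1 \<alpha> (up \<alpha>) (%_ q. s *\<^sub>R v q + t *\<^sub>R w q) = s * D 1 \<alpha> (up \<alpha>) (%_. v) + t * D 1 \<alpha> (up \<alpha>) (%_. w)"
   using jp_linear[OF D1 L(2) G(3)[OF a] _ vw, of 0 \<alpha> "%_. undefined" s t] unfolding c0 by simp
 next
  show "\<exists>B. \<forall>v\<in>Xs. \<bar>D 1 \<alpha> (up \<alpha>) (%_. v)\<bar> \<le> B * nrm v"
   using B(2)[of "%_. _"] by (intro exI[of _ B]) simp
 next
  fix eps :: real assume e: "eps > 0"
  from D3[OF T(4) a e] obtain dlt where d0: "dlt > 0 & (\<forall>nu\<in>W. nrm (mdf nu \<alpha>) < dlt --> (\<forall>v. (\<forall>n\<in>{..<0}. v n \<in> Xs) -->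
   \<bar>D 0 nu (up nu) v - D 0 \<alpha> (up \<alpha>) v - D (Suc 0) \<alpha> (up \<alpha>) (case_nat (mdf nu \<alpha>) v)\<bar> \<le> eps * nrm (mdf nu \<alpha>) * (\<Prod>n\<in>{..<0::nat}. nrm (v n))))" ..
  then have d: "dlt > 0" "\<And>nu v. nu \<in> W ==> nrm (mdf nu \<alpha>) < dlt ==>
   \<bar>T nu (up nu) v - T \<alpha> (up \<alpha>) v - D (Suc 0) \<alpha> (up \<alpha>) (case_nat (mdf nu \<alpha>) v)\<bar> \<le> eps * nrm (mdf nu \<alpha>)"
   unfolding D(1) by simp_all
  have "D (Suc 0) \<alpha> (up \<alpha>) (case_nat h v) = D 1 \<alpha> (up \<alpha>) (%_. h)" for h v
   unfolding One_nat_def[symmetric] by (rule jp_cong[OF D1]) simp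
  then show "\<exists>dlt>0. \<forall>nu\<in>W. nrm (mdf nu \<alpha>) < dlt -->
   \<bar>T nu (up nu) (%_. undefined) - T \<alpha> (up \<alpha>) (%_. undefined) - D 1 \<alpha> (up \<alpha>) (%_. mdf nu \<alpha>)\<bar> \<le> eps * nrm (mdf nu \<alpha>)"
   using d by (intro exI[of _ dlt]) simp
 qed
 then show "\<exists>L. functional_has_derivative Xs nrm W (%mu. T mu (up mu) (%_. undefined)) L \<alpha>" by blast
qed

section \<open>The implicit function theorem for jet expressions\<close>

definition near :: "('m => real^4) => real^2 => real => (('m => real^4) \<times> (real^2)) set" where
 "near \<alpha> u0 e = {(mu, u). mu \<in> Xs & u \<in> U & dst \<alpha> u0 mu u < e}"

lemma near_mono: "e \<le> e' ==> near \<alpha> u0 e \<subseteq> near \<alpha> u0 e'"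
 by (auto simp: near_def)

lemma near_subset: "near \<alpha> u0 e \<subseteq> Xs \<times> U"
 by (auto simp: near_def)

lemma dst_self: "dst \<alpha> u0 \<alpha> u0 = 0"
 by (simp add: dst_def nrm_zero)

lemma jp_near:
 assumes T: "jp (near \<alpha> u0 e0) L {} T" "L \<le> r" "e0 > 0" and \<alpha>: "\<alpha> \<in> Xs" "u0 \<in> U" and e: "eps > 0"
 shows "\<exists>e>0. \<forall>(mu, u)\<in>near \<alpha> u0 e. \<forall>v. \<bar>T mu u v - T \<alpha> u0 v\<bar> \<le> eps"
proof -
 have "(\<alpha>, u0) \<in> near \<alpha> u0 e0" using \<alpha> T(3) by (simp add: near_def dst_self)
 from jp_continuous[OF T(1,2) this \<alpha>] have "at_le \<alpha> u0 0 {} (%nu u' v. T nu u' v - T \<alpha> u0 v) eps"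
  using e unfolding at_small_def by blast
 then show ?thesis unfolding at_le_def near_def by auto
qed

lemma jp_near_value:
 assumes "jp (near \<alpha> u0 e0) L {} T" "L \<le> r" "e0 > 0" "\<alpha> \<in> Xs" "u0 \<in> U" "eps > 0" "T \<alpha> u0 w = x"
 shows "\<exists>e>0. \<forall>mu u. (mu, u) \<in> near \<alpha> u0 e --> \<bar>T mu u w - x\<bar> \<le> eps"
proof -
 from jp_near[OF assms(1-6)] obtain e where "e > 0 & (\<forall>(mu, u)\<in>near \<alpha> u0 e. \<forall>v. \<bar>T mu u v - T \<alpha> u0 v\<bar> \<le> eps)" ..
 then show ?thesis using assms(7) by (intro exI[of _ e]) auto
qed

lemma jp_near_pos:
 assumes T: "jp (near \<alpha> u0 e0) L {} T" "L \<le> r" "e0 > 0" and \<alpha>: "\<alpha> \<in> Xs" "u0 \<in> U" and p: "\<And>v. T \<alpha> u0 v > 0"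
 shows "\<exists>e>0. e \<le> e0 & (\<forall>(mu, u)\<in>near \<alpha> u0 e. \<forall>v. T mu u v > 0)"
proof -
 let ?x = "T \<alpha> u0 (%_. undefined)"
 have x: "T \<alpha> u0 v = ?x" for v by (rule jp_cong[OF T(1)]) simp
 have x0: "?x / 2 > 0" using p by simp
 from jp_near[OF T \<alpha> x0] obtain e where e: "e > 0" "\<forall>(mu, u)\<in>near \<alpha> u0 e. \<forall>v. \<bar>T mu u v - T \<alpha> u0 v\<bar> \<le> ?x / 2" by blast
 show ?thesis
 proof (intro exI[of _ "min e e0"] conjI)
  show "\<forall>(mu, u)\<in>near \<alpha> u0 (min e e0). \<forall>v. T mu u v > 0"
  proof clarify
   fix mu u v assume "(mu, u) \<in> near \<alpha> u0 (min e e0)"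
   then have "(mu, u) \<in> near \<alpha> u0 e" using near_mono[of "min e e0" e] by auto
   then have "\<bar>T mu u v - T \<alpha> u0 v\<bar> \<le> ?x / 2" using e(2) by auto
   then show "T mu u v > 0" using x[of v] x0 by linarith
  qed
 qed (use e T(3) in auto)
qed

lemma at_big_emptyD:
 "at_big mu u 1 {} R ==> \<exists>B dlt. B \<ge> 0 & dlt > 0 & (\<forall>nu\<in>Xs. \<forall>u'\<in>U. dst mu u nu u' < dlt --> (\<forall>v. \<bar>R nu u' v\<bar> \<le> B * dst mu u nu u'))"
 unfolding at_big_def at_le_def by (simp only: ball_empty simp_thms prod.empty mult_1_right power_one_right) blast

lemma at_small_emptyD:
 "at_small mu u 1 {} R ==> eps > 0 ==> \<exists>dlt>0. \<forall>nu\<in>Xs. \<forall>u'\<in>U. dst mu u nu u' < dlt --> (\<forall>v. \<bar>R nu u' v\<bar> \<le> eps * dst mu u nu u')"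
 unfolding at_small_def at_le_def by simp

text \<open>The derivative in u is normalized to be the identity at the base point, so u |-> u -
  h(mu, u) is a contraction for nearby mu, and its fixed points are the zeros of h. The derivative
  of the fixed point is solved for by Cramer's rule and stays a jet expression.\<close>

theorem jet_implicit_function:
 assumes \<alpha>: "\<alpha> \<in> Xs" "u0 \<in> U" and r: "3 \<le> r" and e0: "e0 > 0"
  and h: "jp (near \<alpha> u0 e0) 2 {} h1" "jp (near \<alpha> u0 e0) 2 {} h2"
  and z: "h1 \<alpha> u0 w = 0" "h2 \<alpha> u0 w = 0"
  and der: "((%u. h1 \<alpha> u w) has_derivative (%k. k $ 1)) (at u0)" "((%u. h2 \<alpha> u w) has_derivative (%k. k $ 2)) (at u0)"
 shows "\<exists>e>0. e \<le> e0 & (\<exists>rho>0. \<exists>d>0. \<exists>up U1 U2. ball u0 rho \<subseteq> U &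
  moving_point (near \<alpha> u0 e) {mu\<in>Xs. nrm (mdf mu \<alpha>) < d} up U1 U2 &
  (\<forall>mu\<in>Xs. nrm (mdf mu \<alpha>) < d --> (\<forall>u\<in>ball u0 rho. (mu, u) \<in> near \<alpha> u0 e) & up mu \<in> ball u0 rho &
   (\<forall>u\<in>ball u0 rho. h1 mu u w = 0 & h2 mu u w = 0 \<longleftrightarrow> u = up mu)))"
proof -
 note ns = near_subset[of \<alpha> u0 e0]
 have r2: "2 < r" "2 \<le> r" "3 \<le> r" using r by simp_all
 have aG: "(\<alpha>, u0) \<in> near \<alpha> u0 e0" using \<alpha> e0 by (simp add: near_def dst_self)
 obtain Tv1 T11 T12 where d1: "jp_deriv (near \<alpha> u0 e0) 2 {} h1 Tv1 T11 T12" using jp_differentiable[OF h(1) r2(1) ns] by blast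
 obtain Tv2 T21 T22 where d2: "jp_deriv (near \<alpha> u0 e0) 2 {} h2 Tv2 T21 T22" using jp_differentiable[OF h(2) r2(1) ns] by blast
 have s3: "Suc 2 = 3" by simp
 have j: "jp (near \<alpha> u0 e0) 3 {0} Tv1" "jp (near \<alpha> u0 e0) 3 {} T11" "jp (near \<alpha> u0 e0) 3 {} T12"
  "jp (near \<alpha> u0 e0) 3 {0} Tv2" "jp (near \<alpha> u0 e0) 3 {} T21" "jp (near \<alpha> u0 e0) 3 {} T22"
  using d1 d2 unfolding jp_deriv_def s3 by simp_all
 have t: "T11 \<alpha> u0 w = 1" "T12 \<alpha> u0 w = 0" "T21 \<alpha> u0 w = 0" "T22 \<alpha> u0 w = 1"
 proof -
  have "(%k::real^2. k $ 1) = (%k. T11 \<alpha> u0 w * k $ 1 + T12 \<alpha> u0 w * k $ 2)"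
   by (rule has_derivative_unique[OF der(1) jp_deriv_has_derivative[OF d1 aG \<alpha> r2(1)]])
  from fun_cong[OF this, of "axis 1 1"] fun_cong[OF this, of "axis 2 1"] show "T11 \<alpha> u0 w = 1" "T12 \<alpha> u0 w = 0" by (simp_all add: axis_def)
  have "(%k::real^2. k $ 2) = (%k. T21 \<alpha> u0 w * k $ 1 + T22 \<alpha> u0 w * k $ 2)"
   by (rule has_derivative_unique[OF der(2) jp_deriv_has_derivative[OF d2 aG \<alpha> r2(1)]])
  from fun_cong[OF this, of "axis 1 1"] fun_cong[OF this, of "axis 2 1"] show "T21 \<alpha> u0 w = 0" "T22 \<alpha> u0 w = 1" by (simp_all add: axis_def)
 qed
 \<comment> \<open>If all entries of the derivative are within 1/8 of the identity matrix, each
   component of the contraction has Lipschitz constant 1/4, and the sum of both components gives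
   1/2.\<close>
 have e8: "(1/8::real) > 0" by simp
 obtain c1 where c1: "c1 > 0 & (\<forall>mu u. (mu, u) \<in> near \<alpha> u0 c1 --> \<bar>T11 mu u w - 1\<bar> \<le> 1/8)"
  using jp_near_value[OF j(2) r2(3) e0 \<alpha> e8 t(1)] ..
 obtain c2 where c2: "c2 > 0 & (\<forall>mu u. (mu, u) \<in> near \<alpha> u0 c2 --> \<bar>T12 mu u w - 0\<bar> \<le> 1/8)"
  using jp_near_value[OF j(3) r2(3) e0 \<alpha> e8 t(2)] ..
 obtain c3 where c3: "c3 > 0 & (\<forall>mu u. (mu, u) \<in> near \<alpha> u0 c3 --> \<bar>T21 mu u w - 0\<bar> \<le> 1/8)"
  using jp_near_value[OF j(5) r2(3) e0 \<alpha> e8 t(3)] ..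
 obtain c4 where c4: "c4 > 0 & (\<forall>mu u. (mu, u) \<in> near \<alpha> u0 c4 --> \<bar>T22 mu u w - 1\<bar> \<le> 1/8)"
  using jp_near_value[OF j(6) r2(3) e0 \<alpha> e8 t(4)] ..
 define e where "e = min e0 (min (min c1 c2) (min c3 c4))"
 have e: "e > 0" "e \<le> e0" "e \<le> c1" "e \<le> c2" "e \<le> c3" "e \<le> c4" using e0 c1 c2 c3 c4 unfolding e_def by auto
 have T8: "\<bar>T11 mu u w - 1\<bar> \<le> 1/8" "\<bar>T12 mu u w\<bar> \<le> 1/8" "\<bar>T21 mu u w\<bar> \<le> 1/8" "\<bar>T22 mu u w - 1\<bar> \<le> 1/8" if "(mu, u) \<in> near \<alpha> u0 e" for mu u
  using c1 c2 c3 c4 near_mono[OF e(3), of \<alpha> u0] near_mono[OF e(4), of \<alpha> u0] near_mono[OF e(5), of \<alpha> u0] near_mono[OF e(6), of \<alpha> u0] that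
  by (simp_all add: subset_iff)
 obtain dlt0 where d0: "dlt0 > 0" "ball u0 dlt0 \<subseteq> U" using ball_in_U[OF \<alpha>(2)] by blast
 define rho where "rho = min (e / 4) (dlt0 / 2)"
 have rho: "rho > 0" "rho \<le> e / 4" "rho < dlt0" using e(1) d0(1) unfolding rho_def by auto
 have cU: "cball u0 rho \<subseteq> U" using rho(3) d0(2) by auto
 \<comment> \<open>The two components of h displace the centre by at most rho / 4 in all. Then rho /
   2 + rho / 4 < rho, so the closed ball is mapped into itself, and the fixed point lies at distance
   at most rho / 2, inside the open ball.\<close>
 have r8: "rho / 8 > 0" using rho by simp
 obtain b1 where b1': "b1 > 0 & (\<forall>mu u. (mu, u) \<in> near \<alpha> u0 b1 --> \<bar>h1 mu u w - 0\<bar> \<le> rho / 8)"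
  using jp_near_value[OF h(1) r2(2) e0 \<alpha> r8 z(1)] ..
 have b1: "b1 > 0" "\<And>mu u. (mu, u) \<in> near \<alpha> u0 b1 ==> \<bar>h1 mu u w\<bar> \<le> rho / 8" using b1' by simp_all
 obtain b2 where b2': "b2 > 0 & (\<forall>mu u. (mu, u) \<in> near \<alpha> u0 b2 --> \<bar>h2 mu u w - 0\<bar> \<le> rho / 8)"
  using jp_near_value[OF h(2) r2(2) e0 \<alpha> r8 z(2)] ..
 have b2: "b2 > 0" "\<And>mu u. (mu, u) \<in> near \<alpha> u0 b2 ==> \<bar>h2 mu u w\<bar> \<le> rho / 8" using b2' by simp_all
 define d where "d = min (e / 2) (min b1 b2)"
 have d: "d > 0" "d \<le> e / 2" "d \<le> b1" "d \<le> b2" using e(1) b1(1) b2(1) unfolding d_def by auto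
 define W where "W = {mu\<in>Xs. nrm (mdf mu \<alpha>) < d}"
 have nE: "(mu, u) \<in> near \<alpha> u0 e" if "mu \<in> W" "u \<in> cball u0 rho" for mu u
 proof -
  have "norm (u - u0) \<le> rho" using that(2) by (simp add: dist_norm norm_minus_commute)
  then have "dst \<alpha> u0 mu u < e" using that(1) d(2) rho(1,2) e(1) unfolding W_def dst_def by simp
  then show ?thesis using that cU by (auto simp: near_def W_def)
 qed
 have nE0: "(mu, u) \<in> near \<alpha> u0 e0" if "mu \<in> W" "u \<in> cball u0 rho" for mu u
  using nE[OF that] near_mono[OF e(2)] by blast
 have h0: "\<bar>h1 mu u0 w\<bar> \<le> rho / 8" "\<bar>h2 mu u0 w\<bar> \<le> rho / 8" if "mu \<in> W" for mu
  using that d(3,4) \<alpha>(2) b1(2)[of mu u0] b2(2)[of mu u0] by (auto simp: near_def dst_def W_def)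
 define \<Psi> :: "('m => real^4) => real^2 => real^2" where "\<Psi> mu u = (\<chi> i. u $ i - (if i = 1 then h1 mu u w else h2 mu u w))" for mu u
 have \<Psi>n: "\<Psi> mu u $ 1 = u $ 1 - h1 mu u w" "\<Psi> mu u $ 2 = u $ 2 - h2 mu u w" for mu u by (simp_all add: \<Psi>_def)
 have nl: "norm x \<le> \<bar>x $ 1\<bar> + \<bar>x $ 2\<bar>" for x :: "real^2" using norm_le_l1_cart[of x] by (simp add: sum_2)
 have der': "((%u. h1 mu u w) has_derivative (%k. T11 mu u w * k $ 1 + T12 mu u w * k $ 2)) (at u)"
  "((%u. h2 mu u w) has_derivative (%k. T21 mu u w * k $ 1 + T22 mu u w * k $ 2)) (at u)"
  if "mu \<in> W" "u \<in> cball u0 rho" for mu u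
 proof -
  have "mu \<in> Xs" "u \<in> U" using that cU by (auto simp: W_def)
  then show "((%u. h1 mu u w) has_derivative (%k. T11 mu u w * k $ 1 + T12 mu u w * k $ 2)) (at u)"
   "((%u. h2 mu u w) has_derivative (%k. T21 mu u w * k $ 1 + T22 mu u w * k $ 2)) (at u)"
   using jp_deriv_has_derivative[OF d1 nE0[OF that] _ _ r2(1)] jp_deriv_has_derivative[OF d2 nE0[OF that] _ _ r2(1)] by simp_all
 qed
 have on: "onorm (%k::real^2. k $ i - (x * k $ 1 + y * k $ 2)) \<le> 1/4"
  if xy: "i = 1 & \<bar>x - 1\<bar> \<le> 1/8 & \<bar>y\<bar> \<le> 1/8 \<or> i = 2 & \<bar>x\<bar> \<le> 1/8 & \<bar>y - 1\<bar> \<le> 1/8" for x y :: real and i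
 proof (rule onorm_le)
  fix k :: "real^2"
  obtain p q where pq: "k $ i - (x * k $ 1 + y * k $ 2) = p * k $ 1 + q * k $ 2" "\<bar>p\<bar> \<le> 1/8" "\<bar>q\<bar> \<le> 1/8"
  proof (cases "i = 1")
   case True
   then show thesis using xy by (intro that[of "1 - x" "- y"]) (auto simp: algebra_simps abs_minus_commute)
  next
   case False
   then show thesis using xy by (intro that[of "- x" "1 - y"]) (auto simp: algebra_simps abs_minus_commute)
  qed
  have "\<bar>p * k $ 1 + q * k $ 2\<bar> \<le> \<bar>p\<bar> * \<bar>k $ 1\<bar> + \<bar>q\<bar> * \<bar>k $ 2\<bar>" unfolding abs_mult[symmetric] by (rule abs_triangle_ineq)
  also have "\<dots> \<le> 1/8 * norm k + 1/8 * norm k" by (intro add_mono mult_mono pq component_le_norm_cart) auto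
  finally show "norm (k $ i - (x * k $ 1 + y * k $ 2)) \<le> 1/4 * norm k" unfolding pq(1) by simp
 qed
 have con: "dist (\<Psi> mu u) (\<Psi> mu u') \<le> 1/2 * dist u u'" if mu: "mu \<in> W" and u: "u \<in> cball u0 rho" "u' \<in> cball u0 rho" for mu u u'
 proof -
  have "norm ((u $ 1 - h1 mu u w) - (u' $ 1 - h1 mu u' w)) \<le> 1/4 * norm (u - u')"
  proof (rule differentiable_bound[OF convex_cball _ _ u])
   fix y assume y: "y \<in> cball u0 rho"
   show "((%u. u $ 1 - h1 mu u w) has_derivative (%k. k $ 1 - (T11 mu y w * k $ 1 + T12 mu y w * k $ 2))) (at y within cball u0 rho)"
    by (rule has_derivative_diff[OF bounded_linear_imp_has_derivative[OF bounded_linear_vec_nth] has_derivative_at_withinI[OF der'(1)[OF mu y]]])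
   show "onorm (%k::real^2. k $ 1 - (T11 mu y w * k $ 1 + T12 mu y w * k $ 2)) \<le> 1/4" by (rule on) (use T8[OF nE[OF mu y]] in simp)
  qed
  moreover have "norm ((u $ 2 - h2 mu u w) - (u' $ 2 - h2 mu u' w)) \<le> 1/4 * norm (u - u')"
  proof (rule differentiable_bound[OF convex_cball _ _ u])
   fix y assume y: "y \<in> cball u0 rho"
   show "((%u. u $ 2 - h2 mu u w) has_derivative (%k. k $ 2 - (T21 mu y w * k $ 1 + T22 mu y w * k $ 2))) (at y within cball u0 rho)"
    by (rule has_derivative_diff[OF bounded_linear_imp_has_derivative[OF bounded_linear_vec_nth] has_derivative_at_withinI[OF der'(2)[OF mu y]]])
   show "onorm (%k::real^2. k $ 2 - (T21 mu y w * k $ 1 + T22 mu y w * k $ 2)) \<le> 1/4" by (rule on) (use T8[OF nE[OF mu y]] in simp)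
  qed
  ultimately have "\<bar>(\<Psi> mu u - \<Psi> mu u') $ 1\<bar> + \<bar>(\<Psi> mu u - \<Psi> mu u') $ 2\<bar> \<le> 1/4 * norm (u - u') + 1/4 * norm (u - u')"
   unfolding vector_minus_component \<Psi>n real_norm_def by (rule add_mono)
  then show ?thesis using nl[of "\<Psi> mu u - \<Psi> mu u'"] unfolding dist_norm by linarith
 qed
 have u0c: "u0 \<in> cball u0 rho" using rho(1) by simp
 have \<Psi>0: "dist (\<Psi> mu u0) u0 \<le> rho / 4" if "mu \<in> W" for mu
  using nl[of "\<Psi> mu u0 - u0"] h0[OF that] unfolding dist_norm vector_minus_component \<Psi>n by linarith
 have dc: "dist (\<Psi> mu u) u0 \<le> 1/2 * dist u u0 + rho / 4" if "mu \<in> W" "u \<in> cball u0 rho" for mu u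
  using dist_triangle[of "\<Psi> mu u" u0 "\<Psi> mu u0"] con[OF that u0c] \<Psi>0[OF that(1)] by linarith
 have fx: "\<exists>!u\<in>cball u0 rho. \<Psi> mu u = u" if mu: "mu \<in> W" for mu
 proof (rule Banach_fix)
  show "complete (cball u0 rho)" by (rule compact_imp_complete[OF compact_cball])
  show "cball u0 rho \<noteq> {}" using u0c by blast
  show "(0::real) \<le> 1/2" "1/2 < (1::real)" by simp_all
  show "\<Psi> mu ` cball u0 rho \<subseteq> cball u0 rho"
  proof (rule image_subsetI)
   fix u assume u: "u \<in> cball u0 rho"
   then have "dist u u0 \<le> rho" by (simp add: dist_commute)
   then have "dist (\<Psi> mu u) u0 \<le> rho" using dc[OF mu u] rho(1) by linarith
   then show "\<Psi> mu u \<in> cball u0 rho" by (simp add: dist_commute)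
  qed
 qed (rule con[OF mu])
 have fxz: "\<Psi> mu u = u \<longleftrightarrow> h1 mu u w = 0 & h2 mu u w = 0" for mu u
  unfolding vec_eq_iff forall_2 \<Psi>n by simp
 define up where "up mu = (THE u. u \<in> cball u0 rho & \<Psi> mu u = u)" for mu
 have up: "up mu \<in> cball u0 rho" "\<Psi> mu (up mu) = up mu" if "mu \<in> W" for mu
  using theI'[OF fx[OF that]] unfolding up_def by auto
 have upu: "u = up mu" if "mu \<in> W" "u \<in> cball u0 rho" "\<Psi> mu u = u" for mu u
  using fx[OF that(1)] up[OF that(1)] that by blast
 have upb: "up mu \<in> ball u0 rho" if "mu \<in> W" for mu
 proof -
  have "dist (up mu) u0 \<le> 1/2 * dist (up mu) u0 + rho / 4" using dc[OF that up(1)[OF that]] unfolding up(2)[OF that] .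
  then have "dist (up mu) u0 < rho" using rho(1) by linarith
  then show ?thesis by (simp add: dist_commute)
 qed
 have uz: "h1 mu (up mu) w = 0" "h2 mu (up mu) w = 0" if "mu \<in> W" for mu using up(2)[OF that] unfolding fxz by auto
 have WX: "mu \<in> Xs" if "mu \<in> W" for mu using that by (simp add: W_def)
 have upU: "up mu \<in> U" if "mu \<in> W" for mu using up(1)[OF that] cU by blast
 \<comment> \<open>The usual estimate for fixed points: the map for nu moves \<open>up mu\<close> by
   the vector h(nu, up mu), which is O of the norm of nu - mu because h(mu, up mu) = 0; the
   contraction constant 1/2 doubles this.\<close>
 have lip: "\<exists>M\<ge>0. \<exists>dlt>0. \<forall>nu\<in>W. nrm (mdf nu mu) < dlt --> norm (up nu - up mu) \<le> M * nrm (mdf nu mu)" if mu: "mu \<in> W" for mu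
 proof -
  note G = nE0[OF mu up(1)[OF mu]]
  have "at_big mu (up mu) 1 {} (%nu u' v. h1 nu u' v - h1 mu (up mu) v)" by (rule jp_deriv_at_big[OF d1 r2(1) G WX[OF mu] upU[OF mu]]) simp
  from at_big_emptyD[OF this] obtain B1 dlt1 where b1: "B1 \<ge> 0 & dlt1 > 0 & (\<forall>nu\<in>Xs. \<forall>u'\<in>U. dst mu (up mu) nu u' < dlt1 --> (\<forall>v. \<bar>h1 nu u' v - h1 mu (up mu) v\<bar> \<le> B1 * dst mu (up mu) nu u'))"
   by (elim exE)
  note B1 = conjunct1[OF b1] conjunct1[OF conjunct2[OF b1]] conjunct2[OF conjunct2[OF b1], rule_format, where v = w]
  have "at_big mu (up mu) 1 {} (%nu u' v. h2 nu u' v - h2 mu (up mu) v)" by (rule jp_deriv_at_big[OF d2 r2(1) G WX[OF mu] upU[OF mu]]) simp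
  from at_big_emptyD[OF this] obtain B2 dlt2 where b2: "B2 \<ge> 0 & dlt2 > 0 & (\<forall>nu\<in>Xs. \<forall>u'\<in>U. dst mu (up mu) nu u' < dlt2 --> (\<forall>v. \<bar>h2 nu u' v - h2 mu (up mu) v\<bar> \<le> B2 * dst mu (up mu) nu u'))"
   by (elim exE)
  note B2 = conjunct1[OF b2] conjunct1[OF conjunct2[OF b2]] conjunct2[OF conjunct2[OF b2], rule_format, where v = w]
  show ?thesis
  proof (rule exI[of _ "2 * (B1 + B2)"], intro conjI exI[of _ "min dlt1 dlt2"] ballI impI)
   fix nu assume n: "nu \<in> W" "nrm (mdf nu mu) < min dlt1 dlt2"
   have ds: "dst mu (up mu) nu (up mu) = nrm (mdf nu mu)" by (simp add: dst_def)
   have b: "\<bar>h1 nu (up mu) w\<bar> \<le> B1 * nrm (mdf nu mu)" "\<bar>h2 nu (up mu) w\<bar> \<le> B2 * nrm (mdf nu mu)"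
    using B1(3)[OF WX[OF n(1)] upU[OF mu]] B2(3)[OF WX[OF n(1)] upU[OF mu]] n(2) unfolding ds uz[OF mu] by simp_all
   have "dist (\<Psi> nu (up mu)) (up mu) \<le> (B1 + B2) * nrm (mdf nu mu)"
    using nl[of "\<Psi> nu (up mu) - up mu"] b unfolding dist_norm vector_minus_component \<Psi>n distrib_right by linarith
   moreover have "dist (up nu) (\<Psi> nu (up mu)) \<le> 1/2 * dist (up nu) (up mu)"
    using con[OF n(1) up(1)[OF n(1)] up(1)[OF mu]] unfolding up(2)[OF n(1)] .
   ultimately have "dist (up nu) (up mu) \<le> 2 * ((B1 + B2) * nrm (mdf nu mu))"
    using dist_triangle[of "up nu" "up mu" "\<Psi> nu (up mu)"] by linarith
   then show "norm (up nu - up mu) \<le> 2 * (B1 + B2) * nrm (mdf nu mu)" by (simp only: dist_norm mult.assoc)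
  qed (use B1 B2 in auto)
 qed
 define dt where "dt mu u v = T11 mu u v * T22 mu u v - T12 mu u v * T21 mu u v" for mu u v
 have jdt: "jp (near \<alpha> u0 e0) 3 {} dt" unfolding dt_def[abs_def] by (intro jp_diff jp_cmult j)
 have cg: "dt mu u v = dt mu u w" "T11 mu u v = T11 mu u w" "T12 mu u v = T12 mu u w" "T21 mu u v = T21 mu u w" "T22 mu u v = T22 mu u w" for mu u v
  by (rule jp_cong[OF jdt], simp) (rule jp_cong[OF j(2)], simp, rule jp_cong[OF j(3)], simp, rule jp_cong[OF j(5)], simp, rule jp_cong[OF j(6)], simp)
 \<comment> \<open>7/8 * 7/8 - 1/8 * 1/8 = 3/4, and a lower bound of 1/2 is all that is
   used.\<close>
 have dtp: "dt mu u v \<ge> 1/2" if "(mu, u) \<in> near \<alpha> u0 e" for mu u v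
 proof -
  note q = T8[OF that]
  have "T11 mu u w \<ge> 7/8" "T22 mu u w \<ge> 7/8" using q(1,4) by linarith+
  then have "T11 mu u w * T22 mu u w \<ge> 7/8 * (7/8)" by (intro mult_mono) auto
  moreover have "\<bar>T12 mu u w * T21 mu u w\<bar> \<le> 1/8 * (1/8)" unfolding abs_mult using q by (intro mult_mono) auto
  ultimately have "dt mu u w \<ge> 1/2" unfolding dt_def by linarith
  then show ?thesis using cg(1)[of mu u v] by simp
 qed
 \<comment> \<open>Cramer's rule for the linearized equations in the displacement of the zero. The
   reciprocal of the determinant is written as a real power, the form in which \<open>jp\<close>
   provides it for a positive base.\<close>
 define U1 where "U1 mu u v = dt mu u v powr (-1) * (T12 mu u v * Tv2 mu u v - T22 mu u v * Tv1 mu u v)" for mu u v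
 define U2 where "U2 mu u v = dt mu u v powr (-1) * (T21 mu u v * Tv1 mu u v - T11 mu u v * Tv2 mu u v)" for mu u v
 have jm: "jp (near \<alpha> u0 e) 3 S T" if "jp (near \<alpha> u0 e0) 3 S T" for S T
  by (rule jp_mono[OF that order_refl near_mono[OF e(2)]])
 have pw: "jp (near \<alpha> u0 e) 3 {} (%mu u v. dt mu u v powr (-1))"
  by (rule jp.jp_powr[OF jm[OF jdt]]) (use dtp in \<open>fastforce intro: less_le_trans[of 0 "1/2::real"]\<close>)
 have jU: "jp (near \<alpha> u0 e) 3 {0} U1" "jp (near \<alpha> u0 e) 3 {0} U2"
  unfolding U1_def[abs_def] U2_def[abs_def] by (intro jp_diff jp_cmult[OF pw] jp_cmult jm j)+
 have dif: "\<exists>dlt>0. \<forall>nu\<in>W. nrm (mdf nu mu) < dlt -->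
   \<bar>(up nu - up mu) $ 1 - U1 mu (up mu) (%_. mdf nu mu)\<bar> \<le> eps * nrm (mdf nu mu) &
   \<bar>(up nu - up mu) $ 2 - U2 mu (up mu) (%_. mdf nu mu)\<bar> \<le> eps * nrm (mdf nu mu)"
  if mu: "mu \<in> W" and eps: "eps > 0" for mu eps
 proof -
  note G = nE0[OF mu up(1)[OF mu]]
  from lip[OF mu] obtain M where M': "M \<ge> 0 & (\<exists>dlt>0. \<forall>nu\<in>W. nrm (mdf nu mu) < dlt --> norm (up nu - up mu) \<le> M * nrm (mdf nu mu))" ..
  from conjunct2[OF M'] obtain dlt1 where M1: "dlt1 > 0 & (\<forall>nu\<in>W. nrm (mdf nu mu) < dlt1 --> norm (up nu - up mu) \<le> M * nrm (mdf nu mu))" ..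
  note M = conjunct1[OF M'] conjunct1[OF M1] conjunct2[OF M1, rule_format]
  define eps1 where "eps1 = eps / (3 * (1 + M))"
  have "3 * (1 + M) > 0" using M(1) by simp
  then have ep: "eps1 > 0" unfolding eps1_def by (rule divide_pos_pos[OF eps])
  have rem: "\<exists>dlt>0. \<forall>nu\<in>Xs. \<forall>u'\<in>U. dst mu (up mu) nu u' < dlt -->
   \<bar>h nu u' w - h mu (up mu) w - (Tv mu (up mu) (case_nat (mdf nu mu) w) + Ta mu (up mu) w * (u' - up mu) $ 1 + Tb mu (up mu) w * (u' - up mu) $ 2)\<bar>
   \<le> eps1 * dst mu (up mu) nu u'" if "jp_deriv (near \<alpha> u0 e0) 2 {} h Tv Ta Tb" for h Tv Ta Tb
  proof -
   have "at_small mu (up mu) 1 {} (%nu u' v. h nu u' v - h mu (up mu) v -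
    (Tv mu (up mu) (case_nat (mdf nu mu) v) + Ta mu (up mu) v * (u' - up mu) $ 1 + Tb mu (up mu) v * (u' - up mu) $ 2))"
    using that G unfolding jp_deriv_def by auto
   from at_small_emptyD[OF this ep] obtain dlt where dd: "dlt > 0 & (\<forall>nu\<in>Xs. \<forall>u'\<in>U. dst mu (up mu) nu u' < dlt --> (\<forall>v. \<bar>h nu u' v - h mu (up mu) v -
    (Tv mu (up mu) (case_nat (mdf nu mu) v) + Ta mu (up mu) v * (u' - up mu) $ 1 + Tb mu (up mu) v * (u' - up mu) $ 2)\<bar> \<le> eps1 * dst mu (up mu) nu u'))" ..
   show ?thesis by (intro exI[of _ dlt] conjI[OF conjunct1[OF dd]] ballI impI) (rule conjunct2[OF dd, rule_format])
  qed
  obtain dlt3 where D3: "dlt3 > 0 & (\<forall>nu\<in>Xs. \<forall>u'\<in>U. dst mu (up mu) nu u' < dlt3 -->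
   \<bar>h1 nu u' w - h1 mu (up mu) w - (Tv1 mu (up mu) (case_nat (mdf nu mu) w) + T11 mu (up mu) w * (u' - up mu) $ 1 + T12 mu (up mu) w * (u' - up mu) $ 2)\<bar>
   \<le> eps1 * dst mu (up mu) nu u')" using rem[OF d1] ..
  obtain dlt4 where D4: "dlt4 > 0 & (\<forall>nu\<in>Xs. \<forall>u'\<in>U. dst mu (up mu) nu u' < dlt4 -->
   \<bar>h2 nu u' w - h2 mu (up mu) w - (Tv2 mu (up mu) (case_nat (mdf nu mu) w) + T21 mu (up mu) w * (u' - up mu) $ 1 + T22 mu (up mu) w * (u' - up mu) $ 2)\<bar>
   \<le> eps1 * dst mu (up mu) nu u')" using rem[OF d2] ..
  define dlt where "dlt = min dlt1 (min dlt3 dlt4 / (1 + M))"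
  show ?thesis
  proof (intro exI[of _ dlt] conjI ballI impI)
   show "dlt > 0" using M(1,2) D3 D4 unfolding dlt_def by simp
   fix nu assume n: "nu \<in> W" "nrm (mdf nu mu) < dlt"
   let ?n = "nrm (mdf nu mu)" and ?h = "mdf nu mu"
   have l: "?n < dlt1" "?n < min dlt3 dlt4 / (1 + M)" using n(2) unfolding dlt_def by linarith+
   have ds: "dst mu (up mu) nu (up nu) \<le> (1 + M) * ?n" using M(3)[OF n(1) l(1)] by (simp add: dst_def algebra_simps)
   have "(1 + M) * ?n < min dlt3 dlt4" using l(2) M(1) by (simp add: field_simps)
   then have dl: "dst mu (up mu) nu (up nu) < dlt3" "dst mu (up mu) nu (up nu) < dlt4" using ds by linarith+
   have "eps1 * dst mu (up mu) nu (up nu) \<le> eps1 * ((1 + M) * ?n)" using ds ep by (intro mult_left_mono) auto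
   also have "\<dots> = eps / 3 * ?n" using M(1) unfolding eps1_def by (simp add: field_simps)
   finally have eta: "eps1 * dst mu (up mu) nu (up nu) \<le> eps / 3 * ?n" .
   define y1 y2 where "y1 = (up nu - up mu) $ 1" and "y2 = (up nu - up mu) $ 2"
   define a b where "a = Tv1 mu (up mu) (%_. ?h)" and "b = Tv2 mu (up mu) (%_. ?h)"
   define t11 t12 t21 t22 where "t11 = T11 mu (up mu) w" and "t12 = T12 mu (up mu) w" and "t21 = T21 mu (up mu) w" and "t22 = T22 mu (up mu) w"
   note df = y1_def y2_def a_def b_def t11_def t12_def t21_def t22_def
   define D where "D = t11 * t22 - t12 * t21"
   have ab: "Tv1 mu (up mu) (case_nat ?h w) = a" "Tv2 mu (up mu) (case_nat ?h w) = b"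
    unfolding a_def b_def by (rule jp_cong[OF j(1)], simp) (rule jp_cong[OF j(4)], simp)
   have "\<bar>a + t11 * y1 + t12 * y2\<bar> \<le> eps1 * dst mu (up mu) nu (up nu)"
    using conjunct2[OF D3, rule_format, OF WX[OF n(1)] upU[OF n(1)] dl(1)] unfolding uz[OF mu] uz[OF n(1)] ab df[symmetric] by simp
   then have r1: "\<bar>a + t11 * y1 + t12 * y2\<bar> \<le> eps / 3 * ?n" using eta by linarith
   have "\<bar>b + t21 * y1 + t22 * y2\<bar> \<le> eps1 * dst mu (up mu) nu (up nu)"
    using conjunct2[OF D4, rule_format, OF WX[OF n(1)] upU[OF n(1)] dl(2)] unfolding uz[OF mu] uz[OF n(1)] ab df[symmetric] by simp
   then have r2': "\<bar>b + t21 * y1 + t22 * y2\<bar> \<le> eps / 3 * ?n" using eta by linarith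
   have D2: "D \<ge> 1/2" "dt mu (up mu) (%_. ?h) = D"
    using dtp[OF nE[OF mu up(1)[OF mu]], of w] cg(1)[of mu "up mu" "%_. ?h"] unfolding D_def dt_def df by simp_all
   have "D \<noteq> 0" using D2(1) by linarith
   then have dx: "D * (y - x / D) = D * y - x" for y x by (simp add: right_diff_distrib)
   note q = T8[OF nE[OF mu up(1)[OF mu]], folded df]
   have U12: "U1 mu (up mu) (%_. ?h) = (t12 * b - t22 * a) / D" "U2 mu (up mu) (%_. ?h) = (t21 * a - t11 * b) / D"
    using D2(1) unfolding U1_def U2_def D2(2) cg(2-5)[of mu "up mu" "%_. ?h"] df[symmetric] by (simp_all add: powr_minus_divide)
   \<comment> \<open>The entries are at most 9/8 on the diagonal and 1/8 off it, and D >= 1/2, so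
     the error is at most 2 (9/8 + 1/8) = 5/2 times that of the equations. Hence eps / 3 for the
     latter is enough.\<close>
   have fin: "\<bar>y\<bar> \<le> eps * ?n" if "D * y = p * X - p' * Y" "\<bar>p\<bar> \<le> 9/8" "\<bar>p'\<bar> \<le> 1/8" "\<bar>X\<bar> \<le> eps / 3 * ?n" "\<bar>Y\<bar> \<le> eps / 3 * ?n" for y p p' X Y
   proof -
    have "1/2 * \<bar>y\<bar> \<le> D * \<bar>y\<bar>" using D2(1) by (intro mult_right_mono) auto
    also have "\<dots> = \<bar>p * X - p' * Y\<bar>" using D2(1) that(1)[symmetric] by (simp add: abs_mult)
    also have "\<dots> \<le> \<bar>p\<bar> * \<bar>X\<bar> + \<bar>p'\<bar> * \<bar>Y\<bar>" unfolding abs_mult[symmetric] by (rule abs_triangle_ineq4)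
    also have "\<dots> \<le> 9/8 * (eps / 3 * ?n) + 1/8 * (eps / 3 * ?n)" by (intro add_mono mult_mono that) auto
    finally have "\<bar>y\<bar> \<le> 5/2 * (eps / 3 * ?n)" by simp
    moreover have "0 \<le> eps / 3 * ?n" using that(4) abs_ge_zero order_trans by blast
    ultimately show ?thesis by simp
   qed
   have "\<bar>y1 - (t12 * b - t22 * a) / D\<bar> \<le> eps * ?n"
   proof (rule fin[OF _ _ _ r1 r2'])
    show "D * (y1 - (t12 * b - t22 * a) / D) = t22 * (a + t11 * y1 + t12 * y2) - t12 * (b + t21 * y1 + t22 * y2)"
     unfolding dx by (simp add: D_def algebra_simps)
   qed (use q in \<open>linarith+\<close>)
   then show "\<bar>(up nu - up mu) $ 1 - U1 mu (up mu) (%_. ?h)\<bar> \<le> eps * ?n" unfolding U12 y1_def .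
   have "\<bar>y2 - (t21 * a - t11 * b) / D\<bar> \<le> eps * ?n"
   proof (rule fin[OF _ _ _ r2' r1])
    show "D * (y2 - (t21 * a - t11 * b) / D) = t11 * (b + t21 * y1 + t22 * y2) - t21 * (a + t11 * y1 + t12 * y2)"
     unfolding dx by (simp add: D_def algebra_simps)
   qed (use q in \<open>linarith+\<close>)
   then show "\<bar>(up nu - up mu) $ 2 - U2 mu (up mu) (%_. ?h)\<bar> \<le> eps * ?n" unfolding U12 y2_def .
  qed
 qed
 have mp: "moving_point (near \<alpha> u0 e) W up U1 U2"
  unfolding moving_point_def using jU lip dif nE up(1) WX by blast
 show ?thesis
 proof (rule exI[of _ e], rule conjI[OF e(1)], rule conjI[OF e(2)], rule exI[of _ rho], rule conjI[OF rho(1)], rule exI[of _ d], rule conjI[OF d(1)],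
   rule exI[of _ up], rule exI[of _ U1], rule exI[of _ U2], intro conjI ballI impI)
  show "moving_point (near \<alpha> u0 e) {mu\<in>Xs. nrm (mdf mu \<alpha>) < d} up U1 U2" using mp unfolding W_def .
  show "ball u0 rho \<subseteq> U" using cU by auto
  fix mu assume m: "mu \<in> Xs" "nrm (mdf mu \<alpha>) < d"
  then have mu: "mu \<in> W" by (simp add: W_def)
  show "up mu \<in> ball u0 rho" by (rule upb[OF mu])
  fix u assume u: "u \<in> ball u0 rho"
  then have uc: "u \<in> cball u0 rho" by simp
  show "(mu, u) \<in> near \<alpha> u0 e" by (rule nE[OF mu uc])
  show "h1 mu u w = 0 & h2 mu u w = 0 \<longleftrightarrow> u = up mu"
  proof
   assume "h1 mu u w = 0 & h2 mu u w = 0"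
   then show "u = up mu" unfolding fxz[symmetric] by (rule upu[OF mu uc])
  next
   assume "u = up mu"
   then show "h1 mu u w = 0 & h2 mu u w = 0" using uz[OF mu] by simp
  qed
 qed
qed

end

section \<open>Axial curvature lines as jet expressions\<close>

context jet_space begin

text \<open>Agreement with a jet expression is asked for on G only. Inverses and square roots become
  real powers, which \<open>jp\<close> admits where their base is positive.\<close>

definition rep :: "(('m => real^4) \<times> (real^2)) set => nat => (('m => real^4) => real^2 => real) => bool" where
 "rep G L f \<longleftrightarrow> (\<exists>T. jp G L {} T & (\<forall>(mu, u)\<in>G. \<forall>v. T mu u v = f mu u))"

lemma repI: "jp G L {} T ==> (\<And>mu u v. (mu, u) \<in> G ==> T mu u v = f mu u) ==> rep G L f"
 unfolding rep_def by (intro exI[of _ T]) auto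

lemma repE:
 assumes "rep G L f"
 obtains T where "jp G L {} T" "\<And>mu u v. (mu, u) \<in> G ==> T mu u v = f mu u"
proof -
 from assms obtain T where T: "jp G L {} T & (\<forall>(mu, u)\<in>G. \<forall>v. T mu u v = f mu u)" unfolding rep_def ..
 show thesis by (rule that[OF conjunct1[OF T]]) (use T in auto)
qed

lemma rep_cong: "rep G L f ==> (\<And>mu u. (mu, u) \<in> G ==> g mu u = f mu u) ==> rep G L g"
 by (elim repE, rule repI, assumption) simp

lemma rep_mono:
 assumes "rep G L f" "L \<le> L'" "H \<subseteq> G"
 shows "rep H L' f"
proof (rule repE[OF assms(1)])
 fix T assume T: "jp G L {} T" "\<And>mu u v. (mu, u) \<in> G ==> T mu u v = f mu u"
 show ?thesis by (rule repI[OF jp_mono[OF T(1) assms(2,3)]]) (rule T(2)[OF subsetD[OF assms(3)]])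
qed

lemma rep_const: "rep G L (%mu u. c)"
 by (rule repI[OF jp_const]) (rule refl)

lemma rep_add: "rep G L f ==> rep G L g ==> rep G L (%mu u. f mu u + g mu u)"
 by (elim repE, rule repI, rule jp_add, assumption+) simp

lemma rep_mult: "rep G L f ==> rep G L g ==> rep G L (%mu u. f mu u * g mu u)"
 by (elim repE, rule repI, rule jp_cmult, assumption+) simp

lemma rep_diff: "rep G L f ==> rep G L g ==> rep G L (%mu u. f mu u - g mu u)"
 by (elim repE, rule repI, rule jp_diff, assumption+) simp

lemma rep_minus: "rep G L f ==> rep G L (%mu u. - f mu u)"
 by (elim repE, rule repI, rule jp_minus, assumption) simp

lemma rep_power: "rep G L f ==> rep G L (%mu u. f mu u ^ n)"
 by (elim repE, rule repI, rule jp_power, assumption) simp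

lemma rep_divide_const: "rep G L f ==> rep G L (%mu u. f mu u / c)"
 using rep_mult[OF _ rep_const[of G L "inverse c"]] by (simp add: divide_inverse)

lemma rep_powr:
 assumes "rep G L f" "\<And>mu u. (mu, u) \<in> G ==> f mu u > 0"
 shows "rep G L (%mu u. f mu u powr c)"
proof (rule repE[OF assms(1)])
 fix T assume T: "jp G L {} T" "\<And>mu u v. (mu, u) \<in> G ==> T mu u v = f mu u"
 show ?thesis by (rule repI[OF jp.jp_powr[OF T(1)]]) (use T(2) assms(2) in auto)
qed

lemma rep_inverse:
 assumes "rep G L f" "\<And>mu u. (mu, u) \<in> G ==> f mu u > 0"
 shows "rep G L (%mu u. inverse (f mu u))"
proof (rule rep_cong[OF rep_powr[OF assms, of "-1"]])
 fix mu u assume "(mu, u) \<in> G"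
 from assms(2)[OF this] show "inverse (f mu u) = f mu u powr (-1)" by (simp add: powr_minus)
qed

lemma rep_sqrt:
 assumes "rep G L f" "\<And>mu u. (mu, u) \<in> G ==> f mu u > 0"
 shows "rep G L (%mu u. sqrt (f mu u))"
proof (rule rep_cong[OF rep_powr[OF assms, of "1/2"]])
 fix mu u assume "(mu, u) \<in> G"
 then have "f mu u \<ge> 0" using assms(2) less_imp_le by blast
 then show "sqrt (f mu u) = f mu u powr (1/2)" by (rule powr_half_sqrt[symmetric])
qed

lemma rep_sum: "finite B ==> (\<And>b. b \<in> B ==> rep G L (f b)) ==> rep G L (%mu u. \<Sum>b\<in>B. f b mu u)"
 by (induction B rule: finite_induct) (auto intro: rep_const rep_add)

lemma rep_inner:
 assumes "set s \<subseteq> Basis" "length s \<le> L" "set t \<subseteq> Basis" "length t \<le> L"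
 shows "rep G L (%mu u. iter_deriv s (mu \<circ> pc) u \<bullet> iter_deriv t (mu \<circ> pc) u)"
proof -
 have "rep G L (%mu u. jet q b mu u)" if "b \<in> Basis" "set q \<subseteq> Basis" "length q \<le> L" for q b
  by (rule repI[OF jp_jet[OF that(2,3,1)]]) (rule refl)
 then have "rep G L (%mu u. \<Sum>b\<in>Basis. jet s b mu u * jet t b mu u)"
  using assms by (intro rep_sum rep_mult finite_Basis) auto
 then show ?thesis by (rule rep_cong) (unfold jet_def, rule euclidean_inner)
qed

lemma pd_iter: "pdx X = iter_deriv [axis 1 1] X" "pdy X = iter_deriv [axis 2 1] X" "dxx X = iter_deriv [axis 1 1, axis 1 1] X"
 "dxy X = iter_deriv [axis 1 1, axis 2 1] X" "dyy X = iter_deriv [axis 2 1, axis 2 1] X"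
 by (simp_all add: pdx_def[abs_def] pdy_def[abs_def])

lemma rep_first_form:
 assumes "L \<ge> 1"
 shows "rep G L (%mu u. fffE (mu \<circ> pc) u)" "rep G L (%mu u. fffF (mu \<circ> pc) u)" "rep G L (%mu u. fffG (mu \<circ> pc) u)" "rep G L (%mu u. gram (mu \<circ> pc) u)"
proof -
 show *: "rep G L (%mu u. fffE (mu \<circ> pc) u)" "rep G L (%mu u. fffF (mu \<circ> pc) u)" "rep G L (%mu u. fffG (mu \<circ> pc) u)"
  unfolding fffE_def fffF_def fffG_def pd_iter(1,2) using assms by (intro rep_inner; simp add: axis_Basis)+
 show "rep G L (%mu u. gram (mu \<circ> pc) u)" unfolding gram_def by (intro rep_diff rep_mult rep_power *)
qed

lemma rep_axa:
 assumes g: "\<And>mu u. (mu, u) \<in> G ==> gram (mu \<circ> pc) u > 0"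
 shows "rep G 2 (%mu u. axa0 (mu \<circ> pc) u)" "rep G 2 (%mu u. axa1 (mu \<circ> pc) u)"
proof -
 note f = rep_first_form[of 2 G, simplified]
 have i: "rep G 2 (%mu u. inverse (gram (mu \<circ> pc) u))" by (rule rep_inverse[OF f(4) g])
 have n: "rep G 2 (%mu u. nip (mu \<circ> pc) u (iter_deriv s (mu \<circ> pc) u) (iter_deriv t (mu \<circ> pc) u))"
  if "set s \<subseteq> Basis" "length s \<le> 2" "set t \<subseteq> Basis" "length t \<le> 2" for s t
  unfolding nip_def pd_iter(1,2) using that axis_Basis
  by (intro rep_diff rep_add rep_mult i f rep_inner) simp_all
 have n': "rep G 2 (%mu u. nip (mu \<circ> pc) u (iter_deriv [axis i 1, axis j 1] (mu \<circ> pc) u) (iter_deriv [axis k 1, axis l 1] (mu \<circ> pc) u))" for i j k l :: 2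
  using axis_Basis by (intro n) simp_all
 show "rep G 2 (%mu u. axa0 (mu \<circ> pc) u)"
  unfolding axa0_def Let_def pd_iter(3-5) by (intro rep_diff rep_add rep_mult rep_const rep_power f n')
 show "rep G 2 (%mu u. axa1 (mu \<circ> pc) u)"
  unfolding axa1_def Let_def pd_iter(3-5) by (intro rep_diff rep_add rep_mult rep_const rep_power f n')
qed

text \<open>For fixed mu the points u with (mu, u) in \<open>near\<close> form an open set, on which
  f mu coincides with a jet expression. Its partial derivatives are therefore those of the
  expression, of order one higher.\<close>

lemma rep_frechet:
 assumes f: "rep (near \<alpha> u0 e) L f" and L: "L < r"
 shows "rep (near \<alpha> u0 e) (Suc L) (%mu u. fder (f mu) (at u) (axis i 1))"
  and "(mu, u) \<in> near \<alpha> u0 e ==> f mu differentiable (at u)"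
proof -
 obtain T where T: "jp (near \<alpha> u0 e) L {} T" "\<And>mu u v. (mu, u) \<in> near \<alpha> u0 e ==> T mu u v = f mu u" by (rule repE[OF f]) blast
 obtain Tv T1 T2 where d: "jp_deriv (near \<alpha> u0 e) L {} T Tv T1 T2" using jp_differentiable[OF T(1) L near_subset] by blast
 have j: "jp (near \<alpha> u0 e) (Suc L) {} T1" "jp (near \<alpha> u0 e) (Suc L) {} T2" using d unfolding jp_deriv_def by simp_all
 have D: "(f mu has_derivative (%h. T1 mu u v * h $ 1 + T2 mu u v * h $ 2)) (at u)" if n: "(mu, u) \<in> near \<alpha> u0 e" for mu u v
 proof -
  have m: "mu \<in> Xs" "u \<in> U" using n by (simp_all add: near_def)
  let ?S = "U \<inter> ball u0 (e - nrm (mdf mu \<alpha>))"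
  have S: "open ?S" "u \<in> ?S" using open_U n by (auto simp: near_def dst_def dist_norm norm_minus_commute)
  have "T mu x v = f mu x" if "x \<in> ?S" for x
   using that m(1) by (intro T(2)) (auto simp: near_def dst_def dist_norm norm_minus_commute)
  from has_derivative_transform_within_open[OF jp_deriv_has_derivative[OF d n m L] S this] show ?thesis .
 qed
 show "f mu differentiable (at u)" if "(mu, u) \<in> near \<alpha> u0 e"
  using D[OF that, of undefined] by (rule differentiableI)
 have "i = 1 \<or> i = 2" using exhaust_2 by blast
 then show "rep (near \<alpha> u0 e) (Suc L) (%mu u. fder (f mu) (at u) (axis i 1))"
 proof
  assume "i = 1"
  show ?thesis
  proof (rule repI[OF j(1)])
   fix mu u v assume n: "(mu, u) \<in> near \<alpha> u0 e"
   show "T1 mu u v = fder (f mu) (at u) (axis i 1)"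
    unfolding frechet_derivative_eqI[OF D[OF n, of v]] \<open>i = 1\<close> by (simp add: axis_def)
  qed
 next
  assume "i = 2"
  show ?thesis
  proof (rule repI[OF j(2)])
   fix mu u v assume n: "(mu, u) \<in> near \<alpha> u0 e"
   show "T2 mu u v = fder (f mu) (at u) (axis i 1)"
    unfolding frechet_derivative_eqI[OF D[OF n, of v]] \<open>i = 2\<close> by (simp add: axis_def)
  qed
 qed
qed

definition repc :: "(('m => real^4) \<times> (real^2)) set => nat => (('m => real^4) => real^2 => complex) => bool" where
 "repc G L f \<longleftrightarrow> rep G L (%mu u. Re (f mu u)) & rep G L (%mu u. Im (f mu u))"

lemma repc_Complex: "rep G L f ==> rep G L g ==> repc G L (%mu u. Complex (f mu u) (g mu u))"
 by (simp add: repc_def)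

lemma repc_mult: "repc G L f ==> repc G L g ==> repc G L (%mu u. f mu u * g mu u)"
 by (auto simp: repc_def intro!: rep_add rep_diff rep_mult)

lemma repc_power: "repc G L f ==> repc G L (%mu u. f mu u ^ n)"
proof (induction n)
 case 0
 then show ?case by (simp add: repc_def rep_const)
next
 case (Suc n)
 then show ?case by (simp add: repc_mult)
qed

lemma repc_cnj: "repc G L f ==> repc G L (%mu u. cnj (f mu u))"
 by (simp add: repc_def rep_minus)

lemma repc_combination:
 "repc G L f ==> repc G L g ==> repc G L (%mu u. (f mu u - \<i> * g mu u) / 2)"
 "repc G L f ==> repc G L g ==> repc G L (%mu u. (f mu u + \<i> * g mu u) / 2)"
 by (auto simp: repc_def intro!: rep_divide_const rep_add rep_diff rep_minus)

lemma rep_cmod: "repc G L f ==> rep G L (%mu u. (cmod (f mu u))^2)"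
 unfolding cmod_power2 repc_def by (intro rep_add rep_power) simp_all

lemma rep_disc5: "repc G L f ==> repc G L g ==> rep G L (%mu u. disc5 (f mu u) (g mu u))"
proof -
 assume f: "repc G L f" and g: "repc G L g"
 have "rep G L (%mu u. Re (f mu u ^ 3 * cnj (g mu u) ^ 5))"
  using repc_mult[OF repc_power[OF f] repc_power[OF repc_cnj[OF g]]] unfolding repc_def by blast
 then show ?thesis
  unfolding disc5_def quintic_P_def by (intro rep_diff rep_mult rep_power rep_const rep_cmod f g)
qed

text \<open>The derivative of \<open>axc\<close> at a zero, as an expression that is defined everywhere.\<close>

definition axlin :: "(real^2 => real^4) => real^2 => complex => complex" where
 "axlin X u z = (let a = Re (z * zetaX X u); b = Re (z * zetaY X u);
   d0 = a * fder (axa0 X) (at u) (axis 1 1) + b * fder (axa0 X) (at u) (axis 2 1);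
   d1 = a * fder (axa1 X) (at u) (axis 1 1) + b * fder (axa1 X) (at u) (axis 2 1)
  in Complex (fffE X u * d1 / 4 - fffF X u * d0) (sqrt (gram X u) * d0))"

lemma repc_axlin:
 assumes r: "2 < r" and g: "\<And>mu u. (mu, u) \<in> near \<alpha> u0 e ==> gram (mu \<circ> pc) u > 0"
 shows "repc (near \<alpha> u0 e) 3 (%mu u. axlin (mu \<circ> pc) u z)"
proof -
 have s3: "Suc 2 = 3" by simp
 note d = rep_frechet(1)[OF rep_axa(1)[OF g] r, unfolded s3] rep_frechet(1)[OF rep_axa(2)[OF g] r, unfolded s3]
 note f = rep_first_form[of 3 "near \<alpha> u0 e", simplified]
 have w: "rep (near \<alpha> u0 e) 3 (%mu u. sqrt (gram (mu \<circ> pc) u))" by (rule rep_sqrt[OF f(4) g])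
 have z: "rep (near \<alpha> u0 e) 3 (%mu u. Re (z * zetaX (mu \<circ> pc) u))" "rep (near \<alpha> u0 e) 3 (%mu u. Re (z * zetaY (mu \<circ> pc) u))"
  unfolding zetaX_def zetaY_def times_complex.sel complex.sel by (intro rep_diff rep_mult rep_const rep_minus f w)+
 show ?thesis
  unfolding axlin_def Let_def by (intro repc_Complex rep_diff rep_add rep_mult rep_divide_const z d f w)
qed

lemma axlin_axial:
 assumes r: "3 \<le> r" and g: "\<And>mu u. (mu, u) \<in> near \<alpha> u0 e ==> gram (mu \<circ> pc) u > 0" and n: "(mu, u) \<in> near \<alpha> u0 e"
  and 0: "axc (mu \<circ> pc) u = 0"
 shows "axial_alpha (mu \<circ> pc) u = (axlin (mu \<circ> pc) u 1 - \<i> * axlin (mu \<circ> pc) u \<i>) / 2"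
  "axial_beta (mu \<circ> pc) u = (axlin (mu \<circ> pc) u 1 + \<i> * axlin (mu \<circ> pc) u \<i>) / 2"
proof -
 have m: "mu \<in> Xs" "u \<in> U" using n by (simp_all add: near_def)
 have r2: "2 < r" using r by simp
 let ?X = "mu \<circ> pc"
 let ?S = "U \<inter> ball u0 (e - nrm (mdf mu \<alpha>))"
 have S: "open ?S" "u \<in> ?S" using open_U n by (auto simp: near_def dst_def dist_norm norm_minus_commute)
 have gS: "gram ?X x > 0" if "x \<in> ?S" for x
  using that m(1) by (intro g) (auto simp: near_def dst_def dist_norm norm_minus_commute)
 have XC: "Ck_on 3 ?X ?S" by (rule Ck_on_subset[OF Ck_on_mono[OF Ck[OF m(1)] r]]) blast
 have D: "(axc ?X has_derivative (%v. Complex (fffE ?X u * fder (axa1 ?X) (at u) v / 4 - fffF ?X u * fder (axa0 ?X) (at u) v)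
   (sqrt (gram ?X u) * fder (axa0 ?X) (at u) v))) (at u)"
  by (rule axc_has_derivative[OF S XC _ 0]) (rule gS)
 have rax: "rep (near \<alpha> u0 e) 2 (%mu u. axa0 (mu \<circ> pc) u)" "rep (near \<alpha> u0 e) 2 (%mu u. axa1 (mu \<circ> pc) u)"
  by (rule rep_axa, rule g, assumption)+
 have df: "axa0 ?X differentiable (at u)" "axa1 ?X differentiable (at u)"
  using rep_frechet(2)[OF rax(1) r2 n] rep_frechet(2)[OF rax(2) r2 n] by simp_all
 have "fder (axc ?X) (at u) (zvec ?X u z) = axlin ?X u z" for z
  unfolding frechet_derivative_eqI[OF D] has_derivative_plane_expand[OF df(1), of "zvec ?X u z"] has_derivative_plane_expand[OF df(2), of "zvec ?X u z"]
  by (simp add: axlin_def zvec_def Let_def)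
 then show "axial_alpha ?X u = (axlin ?X u 1 - \<i> * axlin ?X u \<i>) / 2" "axial_beta ?X u = (axlin ?X u 1 + \<i> * axlin ?X u \<i>) / 2"
  by (simp_all add: axial_alpha_def axial_beta_def)
qed

text \<open>|alpha|^2 - |beta|^2 is the determinant of the real linear map z |-> alpha z + beta cnj
  z. So different moduli mean that the Jacobian of (\<open>axa0\<close>, \<open>axa1\<close>) is
  nonzero and the zero is simple.\<close>

lemma axlin_determinant:
 assumes g: "gram X u \<ge> 0"
 shows "(cmod ((axlin X u 1 - \<i> * axlin X u \<i>) / 2))^2 - (cmod ((axlin X u 1 + \<i> * axlin X u \<i>) / 2))^2 =
  - (gram X u * (fffE X u)^2 / 4) * (fder (axa0 X) (at u) (axis 1 1) * fder (axa1 X) (at u) (axis 2 1)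
   - fder (axa0 X) (at u) (axis 2 1) * fder (axa1 X) (at u) (axis 1 1))"
proof -
 define w where "w = sqrt (gram X u)"
 have w: "gram X u = w^2" using g by (simp add: w_def)
 have cm: "(cmod ((z - \<i> * z') / 2))^2 - (cmod ((z + \<i> * z') / 2))^2 = Re z * Im z' - Im z * Re z'" for z z'
  unfolding cmod_power2 by (simp add: power2_eq_square field_simps)
 show ?thesis unfolding cm axlin_def Let_def zetaX_def zetaY_def w_def[symmetric] w
  by (simp add: power2_eq_square field_simps)
qed

theorem axial_implicit_function:
 assumes r: "4 \<le> r" and \<alpha>: "\<alpha> \<in> Xs" "u0 \<in> U" and g0: "gram (\<alpha> \<circ> pc) u0 > 0" and z0: "axc (\<alpha> \<circ> pc) u0 = 0"
  and c1: "(cmod (axial_alpha (\<alpha> \<circ> pc) u0))^2 < (cmod (axial_beta (\<alpha> \<circ> pc) u0))^2"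
  and c2: "25 * (cmod (axial_alpha (\<alpha> \<circ> pc) u0))^2 > 9 * (cmod (axial_beta (\<alpha> \<circ> pc) u0))^2"
 shows "\<exists>rho>0. \<exists>d>0. \<exists>up F. ball u0 rho \<subseteq> U & (\<forall>mu\<in>Xs. nrm (mdf mu \<alpha>) < d --> up mu \<in> ball u0 rho &
   (\<forall>u\<in>ball u0 rho. axc (mu \<circ> pc) u = 0 \<longleftrightarrow> u = up mu) &
   (cmod (axial_alpha (mu \<circ> pc) (up mu)))^2 < (cmod (axial_beta (mu \<circ> pc) (up mu)))^2 &
   25 * (cmod (axial_alpha (mu \<circ> pc) (up mu)))^2 > 9 * (cmod (axial_beta (mu \<circ> pc) (up mu)))^2 &
   F mu = disc5 (axial_alpha (mu \<circ> pc) (up mu)) (axial_beta (mu \<circ> pc) (up mu))) &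
  (\<forall>W \<subseteq> {mu\<in>Xs. nrm (mdf mu \<alpha>) < d}. \<alpha> \<in> W -->
   Ck_functional Xs nrm (r - 3) F W & (\<exists>L. functional_has_derivative Xs nrm W F L \<alpha>))"
proof -
 have r': "2 < r" "3 \<le> r" "1 \<le> r" "2 \<le> r" using r by simp_all
 have pos: "\<exists>e>0. e \<le> e0 & (\<forall>mu u. (mu, u) \<in> near \<alpha> u0 e --> f mu u > 0)" if f: "rep (near \<alpha> u0 e0) L f" "L \<le> r" "e0 > 0" "f \<alpha> u0 > 0" for f L e0
 proof -
  obtain T where T: "jp (near \<alpha> u0 e0) L {} T" "\<And>mu u v. (mu, u) \<in> near \<alpha> u0 e0 ==> T mu u v = f mu u" by (rule repE[OF f(1)]) blast
  have "(\<alpha>, u0) \<in> near \<alpha> u0 e0" using \<alpha> f(3) by (simp add: near_def dst_self)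
  then have "T \<alpha> u0 v > 0" for v using T(2) f(4) by simp
  from jp_near_pos[OF T(1) f(2,3) \<alpha> this] obtain e where e: "e > 0 & e \<le> e0 & (\<forall>(mu, u)\<in>near \<alpha> u0 e. \<forall>v. T mu u v > 0)" ..
  have "f mu u > 0" if "(mu, u) \<in> near \<alpha> u0 e" for mu u
  proof -
   have n: "(mu, u) \<in> near \<alpha> u0 e0" using that near_mono[of e e0] e by blast
   from bspec[OF conjunct2[OF conjunct2[OF e]] that] have "T mu u undefined > 0" by simp
   then show ?thesis using T(2)[OF n, of undefined] by simp
  qed
  then show ?thesis using e by (intro exI[of _ e]) blast
 qed
 obtain e1 where e1: "e1 > 0 & e1 \<le> 1 & (\<forall>mu u. (mu, u) \<in> near \<alpha> u0 e1 --> gram (mu \<circ> pc) u > 0)"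
  using pos[OF rep_first_form(4)[OF order_refl] r'(3) zero_less_one g0] ..
 have g: "gram (mu \<circ> pc) u > 0" if "(mu, u) \<in> near \<alpha> u0 e1" for mu u using e1 that by simp
 have aN: "(\<alpha>, u0) \<in> near \<alpha> u0 e" if "e > 0" for e using \<alpha> that by (simp add: near_def dst_self)
 \<comment> \<open>Built from \<open>axlin\<close>, these are jet expressions at every nearby pair
   (mu, u), and they agree with \<open>axial_alpha\<close> and \<open>axial_beta\<close> at the
   zeros of \<open>axc\<close>.\<close>
 define al where "al mu u = (axlin (mu \<circ> pc) u 1 - \<i> * axlin (mu \<circ> pc) u \<i>) / 2" for mu u
 define be where "be mu u = (axlin (mu \<circ> pc) u 1 + \<i> * axlin (mu \<circ> pc) u \<i>) / 2" for mu u
 have rl: "repc (near \<alpha> u0 e1) 3 (%mu u. axlin (mu \<circ> pc) u z)" for z by (rule repc_axlin[OF r'(1)], rule g, assumption)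
 have rax: "rep (near \<alpha> u0 e1) 2 (%mu u. axa0 (mu \<circ> pc) u)" "rep (near \<alpha> u0 e1) 2 (%mu u. axa1 (mu \<circ> pc) u)"
  by (rule rep_axa, rule g, assumption)+
 have ra: "repc (near \<alpha> u0 e1) 3 al" and rb: "repc (near \<alpha> u0 e1) 3 be"
  unfolding al_def[abs_def] be_def[abs_def] by (rule repc_combination(1)[OF rl rl], rule repc_combination(2)[OF rl rl])
 have ax: "axial_alpha (mu \<circ> pc) u = al mu u" "axial_beta (mu \<circ> pc) u = be mu u" if "(mu, u) \<in> near \<alpha> u0 e1" "axc (mu \<circ> pc) u = 0" for mu u
  unfolding al_def be_def by (rule axlin_axial(1)[OF r'(2) _ that], rule g, assumption, rule axlin_axial(2)[OF r'(2) _ that], rule g, assumption)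
 note a0 = ax[OF aN[OF conjunct1[OF e1]] z0]
 have p1: "(cmod (be \<alpha> u0))^2 - (cmod (al \<alpha> u0))^2 > 0" and p2: "25 * (cmod (al \<alpha> u0))^2 - 9 * (cmod (be \<alpha> u0))^2 > 0"
  using c1 c2 unfolding a0 by simp_all
 have rp: "rep (near \<alpha> u0 e1) 3 (%mu u. (cmod (be mu u))^2 - (cmod (al mu u))^2)" "rep (near \<alpha> u0 e1) 3 (%mu u. 25 * (cmod (al mu u))^2 - 9 * (cmod (be mu u))^2)"
  by (intro rep_diff rep_mult rep_const rep_cmod ra rb)+
 obtain e2 where e2: "e2 > 0 & e2 \<le> e1 & (\<forall>mu u. (mu, u) \<in> near \<alpha> u0 e2 --> (cmod (be mu u))^2 - (cmod (al mu u))^2 > 0)"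
  using pos[OF rp(1) r'(2) conjunct1[OF e1] p1] ..
 obtain e3 where e3: "e3 > 0 & e3 \<le> e1 & (\<forall>mu u. (mu, u) \<in> near \<alpha> u0 e3 --> 25 * (cmod (al mu u))^2 - 9 * (cmod (be mu u))^2 > 0)"
  using pos[OF rp(2) r'(2) conjunct1[OF e1] p2] ..
 define e0 where "e0 = min e2 e3"
 have e0: "e0 > 0" "e0 \<le> e1" "e0 \<le> e2" "e0 \<le> e3" using e2 e3 unfolding e0_def by auto
 have n01: "near \<alpha> u0 e0 \<subseteq> near \<alpha> u0 e1" by (rule near_mono[OF e0(2)])
 obtain T0 where T0: "jp (near \<alpha> u0 e0) 2 {} T0" "\<And>mu u v. (mu, u) \<in> near \<alpha> u0 e0 ==> T0 mu u v = axa0 (mu \<circ> pc) u"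
  by (rule repE[OF rep_mono[OF rax(1) order_refl n01]]) blast
 obtain T1 where T1: "jp (near \<alpha> u0 e0) 2 {} T1" "\<And>mu u v. (mu, u) \<in> near \<alpha> u0 e0 ==> T1 mu u v = axa1 (mu \<circ> pc) u"
  by (rule repE[OF rep_mono[OF rax(2) order_refl n01]]) blast
 let ?X = "\<alpha> \<circ> pc"
 define P Q P1 Q1 where PQ: "P = fder (axa0 ?X) (at u0) (axis 1 1)" "Q = fder (axa0 ?X) (at u0) (axis 2 1)"
  "P1 = fder (axa1 ?X) (at u0) (axis 1 1)" "Q1 = fder (axa1 ?X) (at u0) (axis 2 1)"
 define dd where "dd = P * Q1 - Q * P1"
 have dd: "dd \<noteq> 0"
 proof
  assume "dd = 0"
  then have "(cmod (al \<alpha> u0))^2 - (cmod (be \<alpha> u0))^2 = 0"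
   unfolding al_def be_def axlin_determinant[OF less_imp_le[OF g0]] by (simp add: dd_def PQ)
  then show False using p1 by simp
 qed
 define ii where "ii = inverse dd"
 have ii: "ii * (P * Q1 - Q * P1) = 1" using dd unfolding ii_def dd_def[symmetric] by simp
 \<comment> \<open>(h1, h2) is (\<open>axa0\<close>, \<open>axa1\<close>) multiplied by the inverse
   of its Jacobian matrix at the base point. The zeros are the same, and the derivative in u there
   is the identity, as \<open>jet_implicit_function\<close> assumes.\<close>
 define h1 where "h1 mu u v = Q1 * ii * T0 mu u v - Q * ii * T1 mu u v" for mu u v
 define h2 where "h2 mu u v = P * ii * T1 mu u v - P1 * ii * T0 mu u v" for mu u v
 have jh: "jp (near \<alpha> u0 e0) 2 {} h1" "jp (near \<alpha> u0 e0) 2 {} h2"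
  unfolding h1_def[abs_def] h2_def[abs_def] by (intro jp_diff jp_cmult jp_const T0 T1)+
 have hz: "h1 mu u v = 0 & h2 mu u v = 0 \<longleftrightarrow> axc (mu \<circ> pc) u = 0" if n: "(mu, u) \<in> near \<alpha> u0 e0" for mu u v
 proof -
  have "gram (mu \<circ> pc) u > 0" using g n n01 by blast
  note iff = axc_eq_0_iff[OF this]
  have "P * h1 mu u v + Q * h2 mu u v = ii * (P * Q1 - Q * P1) * axa0 (mu \<circ> pc) u"
   "P1 * h1 mu u v + Q1 * h2 mu u v = ii * (P * Q1 - Q * P1) * axa1 (mu \<circ> pc) u"
   unfolding h1_def h2_def T0(2)[OF n] T1(2)[OF n] by algebra+
  then have eq: "axa0 (mu \<circ> pc) u = P * h1 mu u v + Q * h2 mu u v" "axa1 (mu \<circ> pc) u = P1 * h1 mu u v + Q1 * h2 mu u v"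
   unfolding ii by simp_all
  show ?thesis unfolding iff
  proof
   assume "h1 mu u v = 0 & h2 mu u v = 0"
   then show "axa0 (mu \<circ> pc) u = 0 & axa1 (mu \<circ> pc) u = 0" unfolding eq by simp
  next
   assume "axa0 (mu \<circ> pc) u = 0 & axa1 (mu \<circ> pc) u = 0"
   then show "h1 mu u v = 0 & h2 mu u v = 0" unfolding h1_def h2_def T0(2)[OF n] T1(2)[OF n] by simp
  qed
 qed
 define w :: "nat => 'm => real^4" where "w = (%_. undefined)"
 have z: "h1 \<alpha> u0 w = 0" "h2 \<alpha> u0 w = 0" using hz[OF aN[OF e0(1)], of w] z0 by simp_all
 let ?S = "U \<inter> ball u0 e0"
 have S: "open ?S" "u0 \<in> ?S" using open_U \<alpha>(2) e0(1) by auto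
 have nS: "(\<alpha>, x) \<in> near \<alpha> u0 e0" if "x \<in> ?S" for x
  using that \<alpha>(1) by (auto simp: near_def dst_def nrm_zero dist_norm norm_minus_commute)
 have df: "axa0 ?X differentiable (at u0)" "axa1 ?X differentiable (at u0)"
  using rep_frechet(2)[OF rax(1) r'(1) aN[OF conjunct1[OF e1]]] rep_frechet(2)[OF rax(2) r'(1) aN[OF conjunct1[OF e1]]] by simp_all
 have ex: "(f has_derivative (%k. k $ 1 * fder f (at u0) (axis 1 1) + k $ 2 * fder f (at u0) (axis 2 1))) (at u0)"
  if f: "f differentiable (at u0)" for f :: "real^2 => real"
 proof -
  have "fder f (at u0) = (%k. k $ 1 * fder f (at u0) (axis 1 1) + k $ 2 * fder f (at u0) (axis 2 1))"
  proof (rule ext)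
   fix k
   show "fder f (at u0) k = k $ 1 * fder f (at u0) (axis 1 1) + k $ 2 * fder f (at u0) (axis 2 1)"
    using has_derivative_plane_expand[OF f, of k] by simp
  qed
  from subst[OF this, of "%d. (f has_derivative d) (at u0)", OF f[unfolded frechet_derivative_works]] show ?thesis .
 qed
 note dfd = ex[OF df(1), folded PQ] ex[OF df(2), folded PQ]
 have der: "((%u. h1 \<alpha> u w) has_derivative (%k. k $ 1)) (at u0)"
 proof -
  have "((%u. Q1 * ii * axa0 ?X u - Q * ii * axa1 ?X u) has_derivative (%k. Q1 * ii * (k $ 1 * P + k $ 2 * Q) - Q * ii * (k $ 1 * P1 + k $ 2 * Q1))) (at u0)"
   by (intro has_derivative_diff has_derivative_mult_right dfd)
  moreover have "Q1 * ii * (k1 * P + k2 * Q) - Q * ii * (k1 * P1 + k2 * Q1) = ii * (P * Q1 - Q * P1) * k1" for k1 k2 by algebra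
  ultimately have "((%u. Q1 * ii * axa0 ?X u - Q * ii * axa1 ?X u) has_derivative (%k. k $ 1)) (at u0)" by (simp only: ii mult_1_left)
  then show ?thesis by (rule has_derivative_transform_within_open[OF _ S]) (simp add: h1_def T0(2)[OF nS] T1(2)[OF nS])
 qed
 have der': "((%u. h2 \<alpha> u w) has_derivative (%k. k $ 2)) (at u0)"
 proof -
  have "((%u. P * ii * axa1 ?X u - P1 * ii * axa0 ?X u) has_derivative (%k. P * ii * (k $ 1 * P1 + k $ 2 * Q1) - P1 * ii * (k $ 1 * P + k $ 2 * Q))) (at u0)"
   by (intro has_derivative_diff has_derivative_mult_right dfd)
  moreover have "P * ii * (k1 * P1 + k2 * Q1) - P1 * ii * (k1 * P + k2 * Q) = ii * (P * Q1 - Q * P1) * k2" for k1 k2 by algebra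
  ultimately have "((%u. P * ii * axa1 ?X u - P1 * ii * axa0 ?X u) has_derivative (%k. k $ 2)) (at u0)" by (simp only: ii mult_1_left)
  then show ?thesis by (rule has_derivative_transform_within_open[OF _ S]) (simp add: h2_def T0(2)[OF nS] T1(2)[OF nS])
 qed
 obtain e where ee: "e > 0 & e \<le> e0 & (\<exists>rho>0. \<exists>d>0. \<exists>up U1 U2. ball u0 rho \<subseteq> U &
  moving_point (near \<alpha> u0 e) {mu\<in>Xs. nrm (mdf mu \<alpha>) < d} up U1 U2 &
  (\<forall>mu\<in>Xs. nrm (mdf mu \<alpha>) < d --> (\<forall>u\<in>ball u0 rho. (mu, u) \<in> near \<alpha> u0 e) & up mu \<in> ball u0 rho &
   (\<forall>u\<in>ball u0 rho. h1 mu u w = 0 & h2 mu u w = 0 \<longleftrightarrow> u = up mu)))"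
  using jet_implicit_function[OF \<alpha> r'(2) e0(1) jh z der der'] ..
 then obtain rho d up U1 U2 where rho: "rho > 0" "d > 0" "ball u0 rho \<subseteq> U" and mp: "moving_point (near \<alpha> u0 e) {mu\<in>Xs. nrm (mdf mu \<alpha>) < d} up U1 U2"
  and im: "\<forall>mu\<in>Xs. nrm (mdf mu \<alpha>) < d --> (\<forall>u\<in>ball u0 rho. (mu, u) \<in> near \<alpha> u0 e) & up mu \<in> ball u0 rho &
   (\<forall>u\<in>ball u0 rho. h1 mu u w = 0 & h2 mu u w = 0 \<longleftrightarrow> u = up mu)" by (elim conjE exE)
 have n0: "near \<alpha> u0 e \<subseteq> near \<alpha> u0 e0" by (rule near_mono) (use ee in simp)
 obtain T where T: "jp (near \<alpha> u0 e) 3 {} T" "\<And>mu u v. (mu, u) \<in> near \<alpha> u0 e ==> T mu u v = disc5 (al mu u) (be mu u)"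
  by (rule repE[OF rep_mono[OF rep_disc5[OF ra rb] order_refl subset_trans[OF n0 n01]]]) blast
 define F where "F = (%mu. T mu (up mu) (%_. undefined))"
 show ?thesis
 proof (rule exI[of _ rho], rule conjI[OF rho(1)], rule exI[of _ d], rule conjI[OF rho(2)], rule exI[of _ up], rule exI[of _ F], intro conjI rho(3) ballI allI impI)
  fix mu assume mu: "mu \<in> Xs" "nrm (mdf mu \<alpha>) < d"
  have im': "\<forall>u\<in>ball u0 rho. (mu, u) \<in> near \<alpha> u0 e" "up mu \<in> ball u0 rho" "\<forall>u\<in>ball u0 rho. h1 mu u w = 0 & h2 mu u w = 0 \<longleftrightarrow> u = up mu"
   using im mu by simp_all
  show ub: "up mu \<in> ball u0 rho" by (rule im'(2))
  show zz: "axc (mu \<circ> pc) u = 0 \<longleftrightarrow> u = up mu" if "u \<in> ball u0 rho" for u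
   using hz[of mu u w] im'(1,3) that n0 by blast
  have nn: "(mu, up mu) \<in> near \<alpha> u0 e" "(mu, up mu) \<in> near \<alpha> u0 e0" using im'(1) ub n0 by blast+
  have n3: "(mu, up mu) \<in> near \<alpha> u0 e1" "(mu, up mu) \<in> near \<alpha> u0 e2" "(mu, up mu) \<in> near \<alpha> u0 e3"
   using nn(2) near_mono[OF e0(2)] near_mono[OF e0(3)] near_mono[OF e0(4)] by blast+
  have z': "axc (mu \<circ> pc) (up mu) = 0" using zz[OF ub] by simp
  note a = ax[OF n3(1) z']
  show "(cmod (axial_alpha (mu \<circ> pc) (up mu)))^2 < (cmod (axial_beta (mu \<circ> pc) (up mu)))^2" unfolding a using e2 n3(2) by simp
  show "25 * (cmod (axial_alpha (mu \<circ> pc) (up mu)))^2 > 9 * (cmod (axial_beta (mu \<circ> pc) (up mu)))^2" unfolding a using e3 n3(3) by simp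
  show "F mu = disc5 (axial_alpha (mu \<circ> pc) (up mu)) (axial_beta (mu \<circ> pc) (up mu))" unfolding a F_def by (rule T(2)[OF nn(1)])
 next
  \<comment> \<open>Regularity is given for every smaller set W, since the neighbourhood is later
    cut down to one consisting of immersions.\<close>
  fix W assume W: "W \<subseteq> {mu\<in>Xs. nrm (mdf mu \<alpha>) < d}" "\<alpha> \<in> W"
  have k: "(r - 3) + 3 \<le> r" "r - 3 > 0" using r by simp_all
  note C = jp_Ck_functional[OF T(1) near_subset k moving_point_subset[OF mp W(1)] W(2)]
  show "Ck_functional Xs nrm (r - 3) F W" unfolding F_def by (rule C(1))
  show "\<exists>L. functional_has_derivative Xs nrm W F L \<alpha>" unfolding F_def by (rule C(2))
 qed
qed

end

section \<open>The types as signs of the discriminant, and the final assembly\<close>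

lemma types_iff_disc5:
 assumes A: "compact_oriented_surface A" and c0: "c0 \<in> A" "p \<in> dom_of c0" and r: "r \<ge> 4" and mu: "mu \<in> immersions A r"
 defines "a \<equiv> axial_alpha (mu \<circ> param c0) (snd c0 p)" and "b \<equiv> axial_beta (mu \<circ> param c0) (snd c0 p)"
 assumes z: "axc (mu \<circ> param c0) (snd c0 p) = 0" and lt: "(cmod a)^2 < (cmod b)^2" "25 * (cmod a)^2 > 9 * (cmod b)^2"
 shows "disc5 a b < 0 \<longleftrightarrow> type_E3 A r mu p" "disc5 a b > 0 \<longleftrightarrow> type_E4 A r mu p" "disc5 a b = 0 \<longleftrightarrow> type_E34 A r mu p"
proof -
 have r3: "r \<ge> 3" using r by simp
 have ax: "axiumbilic A mu p" using axiumbilic_chart_iff[OF A c0 r3 mu] z by simp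
 \<comment> \<open>The types quantify existentially over normal forms, so the translation is made
   for an arbitrary one. The inequality |alpha| < |beta| becomes x < 0, and the other one makes
   strictly positive the quadratic expression that vanishes at the triple roots.\<close>
 have inv: "\<exists>K>0. disc5 a b = K * ((x + 1)^2 * Delta x y)" "x < 0" "x^2 + y^2 + 17 * x + 16 > 0" if nf: "axial_normal_form A r mu p x y" for x y
 proof -
  note i = normal_form_invariants[OF nf A c0 r3 mu, folded a_def b_def]
  show "\<exists>K>0. disc5 a b = K * ((x + 1)^2 * Delta x y)" by (rule i(2))
  obtain K where K: "K > 0 & (cmod b)^2 - (cmod a)^2 = - (K * x)" using i(3) ..
  then have "K * x < 0" using lt(1) by linarith
  then show "x < 0" using K by (simp add: mult_less_0_iff)
  obtain K' where K': "K' > 0 & 25 * (cmod a)^2 - 9 * (cmod b)^2 = K' * (x^2 + y^2 + 17 * x + 16)" using i(4) ..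
  then have "K' * (x^2 + y^2 + 17 * x + 16) > 0" using lt(2) by linarith
  then show "x^2 + y^2 + 17 * x + 16 > 0" using K' by (simp add: zero_less_mult_iff)
 qed
 have ne: "(cmod a)^2 \<noteq> (cmod b)^2" using lt(1) by (rule less_imp_neq)
 obtain x y where xy: "axial_normal_form A r mu p x y"
  using axial_normal_form_ex[OF A c0 r mu z ne[unfolded a_def b_def]] by blast
 have sgn: "disc5 a b < 0 \<longleftrightarrow> (x + 1)^2 * Delta x y < 0" "disc5 a b > 0 \<longleftrightarrow> (x + 1)^2 * Delta x y > 0" "disc5 a b = 0 \<longleftrightarrow> (x + 1)^2 * Delta x y = 0"
  if nf: "axial_normal_form A r mu p x y" for x y
 proof -
  obtain K where K: "K > 0 & disc5 a b = K * ((x + 1)^2 * Delta x y)" using inv(1)[OF nf] ..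
  then have k: "K > 0" "disc5 a b = K * ((x + 1)^2 * Delta x y)" by simp_all
  show "disc5 a b < 0 \<longleftrightarrow> (x + 1)^2 * Delta x y < 0" "disc5 a b > 0 \<longleftrightarrow> (x + 1)^2 * Delta x y > 0" "disc5 a b = 0 \<longleftrightarrow> (x + 1)^2 * Delta x y = 0"
   unfolding k(2) mult_less_0_iff[of K] zero_less_mult_iff[of K] mult_eq_0_iff[of K] using k(1) by simp_all
 qed
 \<comment> \<open>At x = -1 both sides are false, the right one because \<open>Delta\<close> is
   nonnegative there.\<close>
 have sq: "(x + 1)^2 * Delta x y < 0 \<longleftrightarrow> Delta x y < 0" for x y
 proof (cases "x = -1")
  case True
  then show ?thesis using Delta_minus_one[of y] by simp
 next
  case False
  then have "(x + 1)^2 > 0" by simp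
  then show ?thesis by (simp add: mult_less_0_iff)
 qed
 have sq': "(x + 1)^2 * Delta x y > 0 \<longleftrightarrow> Delta x y > 0 & x \<noteq> -1" for x y
 proof (cases "x = -1")
  case False
  then have "(x + 1)^2 > 0" by simp
  then show ?thesis using False by (simp add: zero_less_mult_iff)
 qed simp
 show "disc5 a b < 0 \<longleftrightarrow> type_E3 A r mu p"
 proof
  assume "disc5 a b < 0"
  then have "Delta x y < 0" unfolding sgn(1)[OF xy] sq .
  with xy ax show "type_E3 A r mu p" unfolding type_E3_def by (intro conjI exI[of _ x] exI[of _ y]) simp_all
 next
  assume "type_E3 A r mu p"
  then obtain x y where n: "axial_normal_form A r mu p x y" "Delta x y < 0" unfolding type_E3_def by (elim conjE exE)
  show "disc5 a b < 0" unfolding sgn(1)[OF n(1)] sq by (rule n(2))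
 qed
 show "disc5 a b > 0 \<longleftrightarrow> type_E4 A r mu p"
 proof
  assume "disc5 a b > 0"
  then have "Delta x y > 0 & x \<noteq> -1" unfolding sgn(2)[OF xy] sq' .
  with xy ax inv(2)[OF xy] show "type_E4 A r mu p" unfolding type_E4_def by (intro conjI exI[of _ x] exI[of _ y]) simp_all
 next
  assume "type_E4 A r mu p"
  then obtain x y where n: "axial_normal_form A r mu p x y" "Delta x y > 0" "x \<noteq> -1" unfolding type_E4_def by (elim conjE exE)
  show "disc5 a b > 0" unfolding sgn(2)[OF n(1)] sq' using n by simp
 qed
 show "disc5 a b = 0 \<longleftrightarrow> type_E34 A r mu p"
 proof
  assume "disc5 a b = 0"
  then have d: "x = -1 \<or> Delta x y = 0" unfolding sgn(3)[OF xy] by auto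
  note q = inv(3)[OF xy]
  have s5: "(5/2 * sqrt 5)^2 = 125/4" by (simp add: power_mult_distrib power_divide)
  \<comment> \<open>All three exceptional points lie on the conic x^2 + y^2 + 17 x + 16 = 0, so the
    strict inequality q keeps (x, y) away from them.\<close>
  have x1: "(x, y) \<noteq> (-1, 0)"
  proof
   assume "(x, y) = (-1, 0)"
   then have "x = -1" "y = 0" by simp_all
   then show False using q by simp
  qed
  have x2: "(x, y) \<noteq> (- 27/2, 5/2 * sqrt 5)"
  proof
   assume "(x, y) = (- 27/2, 5/2 * sqrt 5)"
   note xy' = this[unfolded prod.inject]
   note e = conjunct1[OF xy'] and y = conjunct2[OF xy']
   have e2: "y^2 = 125/4" unfolding y by (rule s5)
   show False using q unfolding e2 unfolding e by (simp add: power2_eq_square)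
  qed
  have x3: "(x, y) \<noteq> (- 27/2, - (5/2 * sqrt 5))"
  proof
   assume "(x, y) = (- 27/2, - (5/2 * sqrt 5))"
   note xy' = this[unfolded prod.inject]
   note e = conjunct1[OF xy'] and y = conjunct2[OF xy']
   have e2: "y^2 = 125/4" unfolding y power2_minus by (rule s5)
   show False using q unfolding e2 unfolding e by (simp add: power2_eq_square)
  qed
  have "x \<noteq> 0 & ((Delta x y = 0 & (x, y) \<noteq> (-1, 0) & (x, y) \<noteq> (- 27/2, 5/2 * sqrt 5) & (x, y) \<noteq> (- 27/2, - (5/2 * sqrt 5))) \<or> (x = -1 & y \<noteq> 0))"
   using inv(2)[OF xy] d x1 x2 x3 by blast
  with xy ax show "type_E34 A r mu p" unfolding type_E34_def by blast
 next
  assume "type_E34 A r mu p"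
  then obtain x y where n: "axial_normal_form A r mu p x y" "Delta x y = 0 \<or> x = -1" unfolding type_E34_def by blast
  show "disc5 a b = 0" unfolding sgn(3)[OF n(1)] using n(2) by auto
 qed
qed

lemma jet_space_chart:
 assumes A: "compact_oriented_surface A" and K: "norming_cover A \<K>" and c0: "c0 \<in> A" and rho: "ball u0 rho \<subseteq> img_of c0" and C: "C \<ge> 0"
  and b: "\<forall>v\<in>Cr_maps A r. \<forall>u\<in>ball u0 rho. \<forall>s. set s \<subseteq> Basis & length s \<le> r --> norm (iter_deriv s (v \<circ> param c0) u) \<le> C * Cr_norm \<K> r v"
 shows "jet_space (Cr_maps A r) (Cr_norm \<K> r) (param c0) (ball u0 rho) r C"
proof
 show "open (ball u0 rho)" by simp
 show "(%q. x *\<^sub>R v q + y *\<^sub>R w q) \<in> Cr_maps A r" if "v \<in> Cr_maps A r" "w \<in> Cr_maps A r" for v w x y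
  by (rule Cr_maps_lincomb[OF A that])
 show "Ck_on r (v \<circ> param c0) (ball u0 rho)" if "v \<in> Cr_maps A r" for v
  by (rule Ck_on_subset[OF _ rho]) (use that c0 in \<open>simp add: Cr_maps_def\<close>)
 show "norm (iter_deriv s (v \<circ> param c0) u) \<le> C * Cr_norm \<K> r v"
  if "v \<in> Cr_maps A r" "u \<in> ball u0 rho" "set s \<subseteq> Basis" "length s \<le> r" for v u s
  by (rule b[rule_format, OF that(1,2) conjI[OF that(3,4)]])
 show "Cr_norm \<K> r v \<ge> 0" if "v \<in> Cr_maps A r" for v by (rule Cr_norm_nonneg[OF A K that])
 have z: "(%q. 0) \<in> Cr_maps A r" by (simp add: Cr_maps_def o_def Ck_on_const)
 have "Cr_norm \<K> r (%q. 0) \<le> 0" using Cr_norm_lincomb[OF A K z z, of 0 0] by simp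
 then show "Cr_norm \<K> r (%q. 0) = 0" using Cr_norm_nonneg[OF A K z] by simp
qed (rule C)

text \<open>It reduces the nonvanishing of dF to a one-variable derivative along a single
  perturbation \<open>\<eta>\<close>.\<close>

lemma functional_derivative_along_line:
 assumes L: "functional_has_derivative X nrm W F L \<alpha>" and \<eta>: "\<eta> \<in> X" and N: "\<And>eps. nrm (%q. eps *\<^sub>R \<eta> q) \<le> \<bar>eps\<bar> * N" "N \<ge> 0"
  and dlt: "dlt > 0" "\<And>eps. \<bar>eps\<bar> < dlt ==> (%q. \<alpha> q + eps *\<^sub>R \<eta> q) \<in> W"
 shows "((%eps. F (%q. \<alpha> q + eps *\<^sub>R \<eta> q)) has_real_derivative L \<eta>) (at 0)"
 unfolding has_field_derivative_def has_derivative_at_alt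
proof (intro conjI allI impI)
 show "bounded_linear ((*) (L \<eta>))" by (rule bounded_linear_mult_right)
 fix e :: real assume e: "e > 0"
 have L': "\<forall>s t. \<forall>v\<in>X. \<forall>w\<in>X. L (%q. s *\<^sub>R v q + t *\<^sub>R w q) = s * L v + t * L w"
  "\<forall>eps>0. \<exists>dlt>0. \<forall>nu\<in>W. nrm (%q. nu q - \<alpha> q) < dlt --> \<bar>F nu - F \<alpha> - L (%q. nu q - \<alpha> q)\<bar> \<le> eps * nrm (%q. nu q - \<alpha> q)"
  using L unfolding functional_has_derivative_def by simp_all
 have lin: "L (%q. y *\<^sub>R \<eta> q) = y * L \<eta>" for y
  using L'(1)[rule_format, OF \<eta> \<eta>, of y 0] by simp
 have e': "e / (N + 1) > 0" using e N(2) by simp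
 obtain d where d: "d > 0 & (\<forall>nu\<in>W. nrm (%q. nu q - \<alpha> q) < d --> \<bar>F nu - F \<alpha> - L (%q. nu q - \<alpha> q)\<bar> \<le> e / (N + 1) * nrm (%q. nu q - \<alpha> q))"
  using L'(2)[rule_format, OF e'] ..
 show "\<exists>d>0. \<forall>y. norm (y - 0) < d --> norm (F (%q. \<alpha> q + y *\<^sub>R \<eta> q) - F (%q. \<alpha> q + 0 *\<^sub>R \<eta> q) - L \<eta> * (y - 0)) \<le> e * norm (y - 0)"
 proof (intro exI[of _ "min dlt (d / (N + 1))"] conjI allI impI)
  show "min dlt (d / (N + 1)) > 0" using dlt(1) d N(2) by simp
  fix y :: real assume y: "norm (y - 0) < min dlt (d / (N + 1))"
  then have y1: "\<bar>y\<bar> < dlt" "\<bar>y\<bar> < d / (N + 1)" by simp_all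
  let ?nu = "%q. \<alpha> q + y *\<^sub>R \<eta> q"
  have m: "(%q. ?nu q - \<alpha> q) = (%q. y *\<^sub>R \<eta> q)" by simp
  have n: "nrm (%q. ?nu q - \<alpha> q) \<le> \<bar>y\<bar> * (N + 1)" unfolding m using N(1)[of y] by (simp add: algebra_simps)
  also have "\<dots> < d" using y1(2) N(2) by (simp add: field_simps)
  finally have lt: "nrm (%q. ?nu q - \<alpha> q) < d" .
  have "\<bar>F ?nu - F \<alpha> - L (%q. ?nu q - \<alpha> q)\<bar> \<le> e / (N + 1) * nrm (%q. ?nu q - \<alpha> q)"
   by (rule conjunct2[OF d, rule_format, OF dlt(2)[OF y1(1)] lt])
  also have "\<dots> \<le> e / (N + 1) * (\<bar>y\<bar> * (N + 1))" by (rule mult_left_mono[OF n less_imp_le[OF e']])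
  also have "\<dots> = e * \<bar>y\<bar>" using N(2) by simp
  finally show "norm (F ?nu - F (%q. \<alpha> q + 0 *\<^sub>R \<eta> q) - L \<eta> * (y - 0)) \<le> e * norm (y - 0)"
   unfolding m lin by (simp add: mult.commute)
 qed
qed

theorem proposition11:
  fixes A :: "'m::t2_space chart set"
    and \<K> :: "('m chart \<times> 'm set) set"
    and r :: nat
    and \<alpha> :: "'m \<Rightarrow> real^4"
    and p :: 'm
  assumes "compact_oriented_surface A"
    and "norming_cover A \<K>"
    and "r \<ge> 5"
    and "\<alpha> \<in> immersions A r"
    and "type_E34 A r \<alpha> p"
  shows "\<exists>V W F.
    open V \<and> p \<in> V \<and>
    open_rel (Cr_maps A r) (Cr_norm \<K> r) W \<and> \<alpha> \<in> W \<and> W \<subseteq> immersions A r \<and>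
    Ck_functional (Cr_maps A r) (Cr_norm \<K> r) (r - 3) F W \<and>
    (\<exists>L. functional_has_derivative (Cr_maps A r) (Cr_norm \<K> r) W F L \<alpha> \<and>
         (\<exists>\<eta>\<in>Cr_maps A r. L \<eta> \<noteq> 0)) \<and>
    (\<forall>\<mu>\<in>W. \<exists>p\<^sub>\<mu>\<in>V.
       axiumbilic A \<mu> p\<^sub>\<mu> \<and> (\<forall>q\<in>V. axiumbilic A \<mu> q \<longrightarrow> q = p\<^sub>\<mu>) \<and>
       (F \<mu> < 0 \<longleftrightarrow> type_E3 A r \<mu> p\<^sub>\<mu>) \<and>
       (F \<mu> > 0 \<longleftrightarrow> type_E4 A r \<mu> p\<^sub>\<mu>) \<and>
       (F \<mu> = 0 \<longleftrightarrow> type_E34 A r \<mu> p\<^sub>\<mu>))"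
proof -
 note A = assms(1) and K = assms(2) and \<alpha> = assms(4)
 have r: "r \<ge> 3" "r \<ge> 4" "r > 0" using assms(3) by simp_all
 let ?X = "Cr_maps A r" and ?n = "Cr_norm \<K> r"
 have "p \<in> (\<Union>c\<in>A. dom_of c)" using A unfolding compact_oriented_surface_def by simp
 then obtain c0 where c0: "c0 \<in> A" "p \<in> dom_of c0" by blast
 note ch = atlas_is_chart[OF A c0(1)]
 have ho: "homeomorphism (dom_of c0) (img_of c0) (snd c0) (param c0)" "open (dom_of c0)" using ch by (simp_all add: is_chart_def)
 define u0 where "u0 = snd c0 p"
 have u0: "u0 \<in> img_of c0" "param c0 u0 = p" unfolding u0_def using c0 is_chart_param(1)[OF ch c0(2)] by blast+
 have \<alpha>X: "\<alpha> \<in> ?X" by (rule immersions_Cr_maps[OF \<alpha>])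
 define a b where ab: "a = axial_alpha (\<alpha> \<circ> param c0) u0" "b = axial_beta (\<alpha> \<circ> param c0) u0"
 obtain x y where xy: "axial_normal_form A r \<alpha> p x y" "x \<noteq> 0"
  "(Delta x y = 0 & (x, y) \<noteq> (-1, 0) & (x, y) \<noteq> (- 27/2, 5/2 * sqrt 5) & (x, y) \<noteq> (- 27/2, - (5/2 * sqrt 5))) \<or> (x = -1 & y \<noteq> 0)"
  using assms(5) unfolding type_E34_def by blast
 note inv = normal_form_invariants[OF xy(1) A c0 r(1) \<alpha>, folded u0_def, folded ab]
 have z0: "axc (\<alpha> \<circ> param c0) u0 = 0" by (rule inv(1))
 \<comment> \<open>Each of the two alternatives of E34 makes one factor of the discriminant of the
   separatrix polynomial vanish.\<close>
 have xD: "(x + 1)^2 * Delta x y = 0" using xy(3) by auto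
 have D0: "disc5 a b = 0" using inv(2) xD by auto
 have ne: "(cmod a)^2 \<noteq> (cmod b)^2" using inv(3) xy(2) by auto
 \<comment> \<open>The conic meets the zero set of the discriminant exactly where a separatrix is
   triple, and those parameters are excluded by the definition of E34.\<close>
 have T0: "x^2 + y^2 + 17 * x + 16 \<noteq> 0"
 proof
  assume "x^2 + y^2 + 17 * x + 16 = 0"
  from triple_root_parameters[OF this xD] xy(3) show False by auto
 qed
 have nT: "25 * (cmod a)^2 \<noteq> 9 * (cmod b)^2" using inv(4) T0 by auto
 note st = disc5_zero_imp_strict[OF D0 ne nT]
 have g0: "gram (\<alpha> \<circ> param c0) u0 > 0" by (rule immersion_gram[OF \<alpha> r(3) c0(1) u0(1)])
 obtain rho0 where "rho0 > 0 & (\<exists>C\<ge>0. ball u0 rho0 \<subseteq> img_of c0 & (\<forall>v\<in>?X. \<forall>u\<in>ball u0 rho0.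
  \<forall>s. set s \<subseteq> Basis & length s \<le> r --> norm (iter_deriv s (v \<circ> param c0) u) \<le> C * ?n v))"
  using local_jet_bound[OF A K c0, of r, folded u0_def] ..
 then obtain C where rho0: "rho0 > 0" "C \<ge> 0" "ball u0 rho0 \<subseteq> img_of c0" and jb: "\<forall>v\<in>?X. \<forall>u\<in>ball u0 rho0.
  \<forall>s. set s \<subseteq> Basis & length s \<le> r --> norm (iter_deriv s (v \<circ> param c0) u) \<le> C * ?n v" by (elim conjE exE)
 interpret J: jet_space ?X ?n "param c0" "ball u0 rho0" r C
  by (rule jet_space_chart[OF A K c0(1) rho0(3,2) jb])
 have uU: "u0 \<in> ball u0 rho0" using rho0(1) by simp
 obtain rho where "rho > 0 & (\<exists>d>0. \<exists>up F. ball u0 rho \<subseteq> ball u0 rho0 & (\<forall>mu\<in>?X. ?n (%q. mu q - \<alpha> q) < d --> up mu \<in> ball u0 rho &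
   (\<forall>u\<in>ball u0 rho. axc (mu \<circ> param c0) u = 0 \<longleftrightarrow> u = up mu) &
   (cmod (axial_alpha (mu \<circ> param c0) (up mu)))^2 < (cmod (axial_beta (mu \<circ> param c0) (up mu)))^2 &
   25 * (cmod (axial_alpha (mu \<circ> param c0) (up mu)))^2 > 9 * (cmod (axial_beta (mu \<circ> param c0) (up mu)))^2 &
   F mu = disc5 (axial_alpha (mu \<circ> param c0) (up mu)) (axial_beta (mu \<circ> param c0) (up mu))) &
  (\<forall>W \<subseteq> {mu\<in>?X. ?n (%q. mu q - \<alpha> q) < d}. \<alpha> \<in> W -->
   Ck_functional ?X ?n (r - 3) F W & (\<exists>L. functional_has_derivative ?X ?n W F L \<alpha>)))"
  using J.axial_implicit_function[OF r(2) \<alpha>X uU g0 z0 st(1,2)[unfolded ab]] ..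
 then obtain d up F where rho: "rho > 0" "d > 0" "ball u0 rho \<subseteq> ball u0 rho0" and im: "\<forall>mu\<in>?X. ?n (%q. mu q - \<alpha> q) < d --> up mu \<in> ball u0 rho &
   (\<forall>u\<in>ball u0 rho. axc (mu \<circ> param c0) u = 0 \<longleftrightarrow> u = up mu) &
   (cmod (axial_alpha (mu \<circ> param c0) (up mu)))^2 < (cmod (axial_beta (mu \<circ> param c0) (up mu)))^2 &
   25 * (cmod (axial_alpha (mu \<circ> param c0) (up mu)))^2 > 9 * (cmod (axial_beta (mu \<circ> param c0) (up mu)))^2 &
   F mu = disc5 (axial_alpha (mu \<circ> param c0) (up mu)) (axial_beta (mu \<circ> param c0) (up mu))"
  and sm: "\<forall>W \<subseteq> {mu\<in>?X. ?n (%q. mu q - \<alpha> q) < d}. \<alpha> \<in> W -->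
   Ck_functional ?X ?n (r - 3) F W & (\<exists>L. functional_has_derivative ?X ?n W F L \<alpha>)" by (elim conjE exE)
 obtain e where e: "e > 0 & (\<forall>mu\<in>?X. ?n (%q. mu q - \<alpha> q) < e --> mu \<in> immersions A r)"
  using immersions_stable[OF A K r(3) \<alpha>] ..
 define d' where "d' = min d e"
 have d': "d' > 0" "d' \<le> d" "d' \<le> e" using rho(2) e unfolding d'_def by simp_all
 \<comment> \<open>The radius serves two purposes: the axiumbilic point can be followed, and every
   map in the ball is an immersion.\<close>
 define W where "W = {mu\<in>?X. ?n (%q. mu q - \<alpha> q) < d'}"
 have WI: "mu \<in> ?X" "mu \<in> immersions A r" "?n (%q. mu q - \<alpha> q) < d" if "mu \<in> W" for mu
 proof -
  show x: "mu \<in> ?X" using that by (simp add: W_def)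
  show "?n (%q. mu q - \<alpha> q) < d" using that d'(2) by (simp add: W_def)
  have "?n (%q. mu q - \<alpha> q) < e" using that d'(3) by (simp add: W_def)
  then show "mu \<in> immersions A r" using e x by simp
 qed
 have imW: "up mu \<in> ball u0 rho" "\<And>u. u \<in> ball u0 rho ==> axc (mu \<circ> param c0) u = 0 \<longleftrightarrow> u = up mu"
   "(cmod (axial_alpha (mu \<circ> param c0) (up mu)))^2 < (cmod (axial_beta (mu \<circ> param c0) (up mu)))^2"
   "25 * (cmod (axial_alpha (mu \<circ> param c0) (up mu)))^2 > 9 * (cmod (axial_beta (mu \<circ> param c0) (up mu)))^2"
   "F mu = disc5 (axial_alpha (mu \<circ> param c0) (up mu)) (axial_beta (mu \<circ> param c0) (up mu))" if "mu \<in> W" for mu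
  using mp[OF bspec[OF im WI(1)[OF that]] WI(3)[OF that]] by simp_all
 have zz: "?n (%q. \<alpha> q - \<alpha> q) = 0" using J.nrm_zero by simp
 have \<alpha>W: "\<alpha> \<in> W" using \<alpha>X d'(1) zz by (simp add: W_def)
 have "W \<subseteq> {mu\<in>?X. ?n (%q. mu q - \<alpha> q) < d}" using WI(1,3) by blast
 from sm[rule_format, OF this \<alpha>W] have Fk: "Ck_functional ?X ?n (r - 3) F W" "\<exists>L. functional_has_derivative ?X ?n W F L \<alpha>" by simp_all
 obtain L where L: "functional_has_derivative ?X ?n W F L \<alpha>" using Fk(2) ..
 have oW: "open_rel ?X ?n W"
  unfolding open_rel_def
 proof (intro conjI ballI)
  show "W \<subseteq> ?X" by (simp add: W_def)
  fix mu assume mu: "mu \<in> W"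
  show "\<exists>eps>0. \<forall>nu\<in>?X. ?n (%q. nu q - mu q) < eps --> nu \<in> W"
  proof (intro exI[of _ "d' - ?n (%q. mu q - \<alpha> q)"] conjI ballI impI)
   show "d' - ?n (%q. mu q - \<alpha> q) > 0" using mu by (simp add: W_def)
   fix nu assume nu: "nu \<in> ?X" "?n (%q. nu q - mu q) < d' - ?n (%q. mu q - \<alpha> q)"
   have "?n (%q. 1 *\<^sub>R (nu q - mu q) + 1 *\<^sub>R (mu q - \<alpha> q)) \<le> \<bar>1\<bar> * ?n (%q. nu q - mu q) + \<bar>1\<bar> * ?n (%q. mu q - \<alpha> q)"
    by (rule Cr_norm_lincomb[OF A K J.mdf_in[OF nu(1) WI(1)[OF mu]] J.mdf_in[OF WI(1)[OF mu] \<alpha>X]])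
   then show "nu \<in> W" using nu by (simp add: W_def)
  qed
 qed
 define V where "V = param c0 ` ball u0 rho"
 have bI: "ball u0 rho \<subseteq> img_of c0" using rho(3) rho0(3) by (rule order_trans)
 have Vq: "param c0 u \<in> dom_of c0" "snd c0 (param c0 u) = u" if "u \<in> ball u0 rho" for u
  using is_chart_param(2,3)[OF ch subsetD[OF bI that]] by simp_all
 have "V = dom_of c0 \<inter> snd c0 -` ball u0 rho"
 proof (intro equalityI subsetI)
  fix q assume "q \<in> V"
  then obtain u where "u \<in> ball u0 rho" "q = param c0 u" unfolding V_def by (elim imageE)
  then show "q \<in> dom_of c0 \<inter> snd c0 -` ball u0 rho" using Vq by simp
 next
  fix q assume q: "q \<in> dom_of c0 \<inter> snd c0 -` ball u0 rho"
  then have "q = param c0 (snd c0 q)" using is_chart_param(1)[OF ch] by simp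
  then show "q \<in> V" unfolding V_def by (rule image_eqI) (use q in simp)
 qed
 then have oV: "open V" using continuous_open_preimage[OF homeomorphism_cont1[OF ho(1)] ho(2) open_ball] by simp
 have pV: "p \<in> V" unfolding V_def using rho(1) u0(2) by (intro image_eqI[of _ _ u0]) simp_all
 have main: "\<exists>q\<in>V. axiumbilic A mu q & (\<forall>q'\<in>V. axiumbilic A mu q' --> q' = q) &
   (F mu < 0 \<longleftrightarrow> type_E3 A r mu q) & (F mu > 0 \<longleftrightarrow> type_E4 A r mu q) & (F mu = 0 \<longleftrightarrow> type_E34 A r mu q)" if mu: "mu \<in> W" for mu
 proof (rule bexI[of _ "param c0 (up mu)"])
  note i = imW[OF mu]
  note q = Vq[OF i(1)]
  have z: "axc (mu \<circ> param c0) (up mu) = 0" using i(2)[OF i(1)] by simp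
  note ty = types_iff_disc5[OF A c0(1) q(1) r(2) WI(2)[OF mu], unfolded q(2), OF z i(3,4)]
  have "axiumbilic A mu (param c0 (up mu))" using axiumbilic_chart_iff[OF A c0(1) q(1) r(1) WI(2)[OF mu]] z unfolding q(2) by simp
  moreover have "q' = param c0 (up mu)" if q': "q' \<in> V" "axiumbilic A mu q'" for q'
  proof -
   obtain u where u: "u \<in> ball u0 rho" "q' = param c0 u" using q'(1) unfolding V_def by (elim imageE)
   have "axc (mu \<circ> param c0) u = 0"
    using axiumbilic_chart_iff[OF A c0(1) Vq(1)[OF u(1)] r(1) WI(2)[OF mu]] q'(2) unfolding u(2) Vq(2)[OF u(1)] by simp
   then show ?thesis using i(2)[OF u(1)] u(2) by simp
  qed
  ultimately show "axiumbilic A mu (param c0 (up mu)) & (\<forall>q'\<in>V. axiumbilic A mu q' --> q' = param c0 (up mu)) &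
   (F mu < 0 \<longleftrightarrow> type_E3 A r mu (param c0 (up mu))) & (F mu > 0 \<longleftrightarrow> type_E4 A r mu (param c0 (up mu))) & (F mu = 0 \<longleftrightarrow> type_E34 A r mu (param c0 (up mu)))"
   unfolding i(5) ty by simp
  show "param c0 (up mu) \<in> V" unfolding V_def by (rule imageI[OF i(1)])
 qed
 have "\<exists>\<eta>\<in>?X. L \<eta> \<noteq> 0"
 proof -
  obtain \<eta> \<Phi> l where \<eta>: "\<eta> \<in> ?X" "(\<Phi> has_real_derivative l) (at 0)" "l \<noteq> 0"
   and pert: "\<forall>eps. (%q. \<alpha> q + eps *\<^sub>R \<eta> q) \<in> immersions A r -->
   axc ((%q. \<alpha> q + eps *\<^sub>R \<eta> q) \<circ> param c0) u0 = 0 &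
   disc5 (axial_alpha ((%q. \<alpha> q + eps *\<^sub>R \<eta> q) \<circ> param c0) u0) (axial_beta ((%q. \<alpha> q + eps *\<^sub>R \<eta> q) \<circ> param c0) u0) = \<Phi> eps"
   using immersion_perturbation[OF xy(1) A c0 r(1) \<alpha>, folded u0_def, OF D0[unfolded ab] ne[unfolded ab] nT[unfolded ab]] by blast
  define N where "N = ?n \<eta>"
  have N: "N \<ge> 0" "\<And>eps. ?n (%q. eps *\<^sub>R \<eta> q) \<le> \<bar>eps\<bar> * N"
   using Cr_norm_nonneg[OF A K \<eta>(1)] Cr_norm_lincomb[OF A K \<eta>(1) \<eta>(1), of _ 0] unfolding N_def by simp_all
  define dlt where "dlt = d' / (N + 1)"
  have dlt: "dlt > 0" using d'(1) N(1) unfolding dlt_def by simp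
  have gW: "(%q. \<alpha> q + eps *\<^sub>R \<eta> q) \<in> W" if "\<bar>eps\<bar> < dlt" for eps
  proof -
   have "\<bar>eps\<bar> * N \<le> \<bar>eps\<bar> * (N + 1)" by (simp add: algebra_simps)
   also have "\<dots> < d'" using that N(1) unfolding dlt_def by (simp add: field_simps)
   finally have "?n (%q. eps *\<^sub>R \<eta> q) < d'" using N(2)[of eps] by linarith
   moreover have "(%q. \<alpha> q + eps *\<^sub>R \<eta> q) \<in> ?X" using Cr_maps_lincomb[OF A \<alpha>X \<eta>(1), of 1 eps] by simp
   ultimately show ?thesis by (simp add: W_def)
  qed
  \<comment> \<open>The perturbed immersions keep the zero of \<open>axc\<close> at u0. By
    uniqueness u0 is their point \<open>up\<close>, so F along this line is the function
    \<open>\<Phi>\<close>, whose slope at 0 is known.\<close>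
  have FP: "F (%q. \<alpha> q + eps *\<^sub>R \<eta> q) = \<Phi> eps" if "\<bar>eps\<bar> < dlt" for eps
  proof -
   note w = gW[OF that]
   note pe = mp[OF spec[OF pert] WI(2)[OF w]]
   have "u0 \<in> ball u0 rho" using rho(1) by simp
   from imW(2)[OF w this] pe have "u0 = up (%q. \<alpha> q + eps *\<^sub>R \<eta> q)" by simp
   then show ?thesis using imW(5)[OF w] pe by simp
  qed
  have "((%eps. F (%q. \<alpha> q + eps *\<^sub>R \<eta> q)) has_real_derivative L \<eta>) (at 0)"
   by (rule functional_derivative_along_line[OF L \<eta>(1) N(2,1) dlt gW])
  then have "(\<Phi> has_real_derivative L \<eta>) (at 0)"
   by (rule has_field_derivative_transform_within_open[of _ _ _ "ball 0 dlt"]) (use dlt FP in \<open>simp_all add: dist_norm\<close>)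
  then have "L \<eta> = l" using DERIV_unique \<eta>(2) by blast
  then show ?thesis using \<eta>(1,3) by blast
 qed
 with L have dF: "\<exists>L. functional_has_derivative ?X ?n W F L \<alpha> & (\<exists>\<eta>\<in>?X. L \<eta> \<noteq> 0)" by blast
 have WI': "W \<subseteq> immersions A r" using WI(2) by blast
 show ?thesis
 proof (rule exI[of _ V], rule exI[of _ W], rule exI[of _ F], intro conjI)
  show "open V" "p \<in> V" "open_rel ?X ?n W" "\<alpha> \<in> W" "W \<subseteq> immersions A r" "Ck_functional ?X ?n (r - 3) F W"
   by (rule oV, rule pV, rule oW, rule \<alpha>W, rule WI', rule Fk(1))
  show "\<exists>L. functional_has_derivative ?X ?n W F L \<alpha> & (\<exists>\<eta>\<in>?X. L \<eta> \<noteq> 0)" by (rule dF)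
  show "\<forall>mu\<in>W. \<exists>q\<in>V. axiumbilic A mu q & (\<forall>q'\<in>V. axiumbilic A mu q' --> q' = q) &
   (F mu < 0 \<longleftrightarrow> type_E3 A r mu q) & (F mu > 0 \<longleftrightarrow> type_E4 A r mu q) & (F mu = 0 \<longleftrightarrow> type_E34 A r mu q)"
   by (rule ballI, rule main)
 qed
qed

end
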